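(* Let $K$ be an algebraically closed field of characteristic zero, let $V_1,V_2$ be $K$-vector spaces with $\dim V_i=n_i+1$, write $\mathbb{P}^{n_i}=\mathbb{P}(V_i)$, let $d_1,d_2$ be positive integers, and let $X=S_{d_1,d_2}(V_1,V_2)=\nu_{d_1,d_2}(\mathbb{P}^{n_1}\times\mathbb{P}^{n_2})$ be the Segre-Veronese variety. Let $[p]\in\tau(X)\setminus X$, let $W_p\subset\mathbb{P}^{n_1}\times\mathbb{P}^{n_2}$ be a zero-dimensional scheme of degree $2$ supported at a single point $[o]$ with $[p]\in\langle\nu_{d_1,d_2}(W_p)\rangle$, and let $I_p\subseteq\{1,2\}$ be the minimal set of factors on which $W_p$ depends. Suppose $I_p=\{1,2\}$ (resp. $I_p=\{1\}$, resp. $I_p=\{2\}$). (i) Let $S\in\mathcal{S}(p)$. Then $[o]\notin S$, and $S$ is contained in one of the curves $G$ of bidegree $(1,1)$ containing $W_p$ (resp. in the unique $\alpha$-line $G$ containing $W_p$, resp. in the unique $\beta$-line $G$ containing $W_p$). If $I_p=\{1,2\}$ and $G$ is not smooth, then $G=L\cup R$ with $L$ a $\beta$-line and $R$ an $\alpha$-line such that $\{[o]\}=L\cap R$, $\sharp(S\cap L)=d_2$ and $\sharp(S\cap R)=d_1$. (ii) Let $G$ be any curve of bidegree $(1,1)$ containing $W_p$ (resp. the unique $\alpha$-line containing $W_p$, resp. the unique $\beta$-line containing $W_p$). Then $r(p)=r_{\nu_{d_1,d_2}(G)}(p)$, and hence $S\in\mathcal{S}(p)$ for every $S\subset G$ with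 $\sharp(S)=r_{\nu_{d_1,d_2}(G)}(p)$ and $[p]\in\langle\nu_{d_1,d_2}(S)\rangle$.
   Context: $\nu_{d_1,d_2}:\mathbb{P}(V_1)\times\mathbb{P}(V_2)\to\mathbb{P}(S^{d_1}V_1\otimes S^{d_2}V_2)$ is the Segre-Veronese embedding given by $|\mathcal{O}(d_1,d_2)|$, i.e. $([v_1],[v_2])\mapsto[v_1^{\otimes d_1}\otimes v_2^{\otimes d_2}]$; $\langle\,\cdot\,\rangle$ denotes linear span. The tangential variety is $\tau(X)=\overline{\bigcup_{[q]\in X}T_{[q]}(X)}$; every $[p]\in\tau(X)\setminus X$ lies in $\langle\nu_{d_1,d_2}(W_p)\rangle$ for some degree $2$ connected zero-dimensional scheme $W_p$ (a tangent vector) as in the claim. $I_p$ is the minimal subset of $\{1,2\}$ such that $W_p$ depends only on the factors in $I_p$, i.e. $i\notin I_p$ if and only if the projection of the scheme $W_p$ to $\mathbb{P}^{n_i}$ is a (reduced) point. The rank $r(p)$ is the minimal $r$ such that $p$ is a linear combination of $r$ tensors $v_1^{\otimes d_1}\otimes v_2^{\otimes d_2}$. $\mathcal{S}(p)$ is the set of all finite $S\subset\mathbb{P}^{n_1}\times\mathbb{P}^{n_2}$ with $[p]\in\langle\nu_{d_1,d_2}(S)\rangle$ and $\sharp(S)=r(p)$. For a curve $G\subset\mathbb{P}^{n_1}\times\mathbb{P}^{n_2}$ with $[p]\in\langle\nu_{d_1,d_2}(G)\rangle$, $r_{\nu_{d_1,d_2}(G)}(p)$ is the minimal $r$ such that $[p]\in\langle[p_1],\dots,[p_r]\rangle$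 with all $[p_i]\in\nu_{d_1,d_2}(G)$. A curve $C\subset\mathbb{P}^{n_1}\times\mathbb{P}^{n_2}$ has bidegree $(a,b)$ if $\deg(\mathcal{O}_C(1,0))=a$ and $\deg(\mathcal{O}_C(0,1))=b$. An $\alpha$-line is a curve $R\times[p_2]$ with $R\subset\mathbb{P}^{n_1}$ a line; a $\beta$-line is a curve $[p_1]\times L$ with $L\subset\mathbb{P}^{n_2}$ a line. *)

theory Defs
  imports
    "HOL-Library.Poly_Mapping"
    "HOL-Library.Function_Algebras"
    "HOL-Library.Extended_Nat"
    "HOL-Computational_Algebra.Computational_Algebra"
begin

section \<open>Coordinate spaces and polynomials\<close>

text \<open>
  The coordinate space \<open>K\<^sup>I\<close> is the type \<open>'i \<Rightarrow> 'k\<close>. Function types are used for all spaces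
  (instead of \<open>'k ^ 'i\<close> for some of them) because the index type of tensors, pairs of lists, is
  infinite; only finitely many coordinates of a tensor of given order are nonzero.
\<close>

definition fscale :: "'k::field \<Rightarrow> ('i \<Rightarrow> 'k) \<Rightarrow> 'i \<Rightarrow> 'k" where
  "fscale c f = (\<lambda>i. c * f i)"

global_interpretation fs: vector_space "fscale :: 'k::field \<Rightarrow> ('i \<Rightarrow> 'k) \<Rightarrow> 'i \<Rightarrow> 'k"
  by unfold_locales (auto simp: fscale_def fun_eq_iff algebra_simps)

type_synonym ('i, 'k) mpoly = "('i \<Rightarrow>\<^sub>0 nat) \<Rightarrow>\<^sub>0 'k"

definition Const :: "'k::zero \<Rightarrow> ('i, 'k) mpoly" where
  "Const c = Poly_Mapping.single 0 c"

definition Var :: "'i \<Rightarrow> ('i, 'k::zero_neq_one) mpoly" where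
  "Var i = Poly_Mapping.single (Poly_Mapping.single i 1) 1"

definition mscale :: "'k::field \<Rightarrow> ('i, 'k) mpoly \<Rightarrow> ('i, 'k) mpoly" where
  "mscale c F = Const c * F"

global_interpretation mp: vector_space "mscale :: 'k::field \<Rightarrow> ('i, 'k) mpoly \<Rightarrow> ('i, 'k) mpoly"
  by unfold_locales
    (auto simp: mscale_def Const_def algebra_simps single_add mult_single mult.assoc [symmetric])

text \<open>Evaluation at a point with coordinates in a ring \<open>'b\<close>, coefficients being mapped by \<open>h\<close>.\<close>

definition meval :: "('k::zero \<Rightarrow> 'b::comm_semiring_1) \<Rightarrow> ('i \<Rightarrow> 'b) \<Rightarrow> ('i, 'k) mpoly \<Rightarrow> 'b" where
  "meval h v F = (\<Sum>m\<in>Poly_Mapping.keys F. h (Poly_Mapping.lookup F m) * (\<Prod>i\<in>Poly_Mapping.keys m. v i ^ Poly_Mapping.lookup m i))"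

abbreviation mvalue :: "('i, 'k::comm_semiring_1) mpoly \<Rightarrow> ('i \<Rightarrow> 'k) \<Rightarrow> 'k" where
  "mvalue F v \<equiv> meval (\<lambda>c. c) v F"

text \<open>The differential of \<open>F\<close> at \<open>v\<close> applied to \<open>u\<close>: the coefficient of \<open>t\<close> in \<open>F (v + t u)\<close>.\<close>

definition mdiff :: "('i, 'k::comm_semiring_1) mpoly \<Rightarrow> ('i \<Rightarrow> 'k) \<Rightarrow> ('i \<Rightarrow> 'k) \<Rightarrow> 'k" where
  "mdiff F v u = coeff (meval (\<lambda>c. [:c:]) (\<lambda>i. [:v i, u i:]) F) 1"

definition vanishing_ideal :: "('i \<Rightarrow> 'k::comm_semiring_1) set \<Rightarrow> ('i, 'k) mpoly set" where
  "vanishing_ideal A = {F. \<forall>v\<in>A. mvalue F v = 0}"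

definition is_ideal :: "'a::comm_ring_1 set \<Rightarrow> bool" where
  "is_ideal J \<longleftrightarrow> 0 \<in> J \<and> (\<forall>F\<in>J. \<forall>G\<in>J. F + G \<in> J) \<and> (\<forall>F\<in>J. \<forall>H. H * F \<in> J)"


section \<open>Projective spaces\<close>

text \<open>
  A point of a projective space is a one-dimensional linear subspace, so that the affine cone over
  a set \<open>A\<close> of points is \<open>\<Union>A\<close>.
\<close>

definition proj_pt :: "('i \<Rightarrow> 'k::field) \<Rightarrow> ('i \<Rightarrow> 'k) set" where
  "proj_pt v = fs.span {v}"

definition proj_space :: "('i \<Rightarrow> 'k::field) set set" where
  "proj_space = {proj_pt v |v. v \<noteq> 0}"

text \<open>The linear span of a set of points is given by its affine cone.\<close>

definition lspan :: "('i \<Rightarrow> 'k::field) set set \<Rightarrow> ('i \<Rightarrow> 'k) set" where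
  "lspan A = fs.span (\<Union>A)"

text \<open>
  The polynomials vanishing on a cone over an infinite field form a homogeneous ideal; hence it is
  not necessary to restrict to homogeneous polynomials here.
\<close>

definition proj_closure :: "('i \<Rightarrow> 'k::field) set set \<Rightarrow> ('i \<Rightarrow> 'k) set set" where
  "proj_closure A = {x \<in> proj_space. \<forall>F\<in>vanishing_ideal (\<Union>A). \<forall>v\<in>x. mvalue F v = 0}"

text \<open>The embedded projective tangent space of \<open>A\<close> at \<open>x\<close>.\<close>

definition proj_tangent :: "('i \<Rightarrow> 'k::field) set set \<Rightarrow> ('i \<Rightarrow> 'k) set \<Rightarrow> ('i \<Rightarrow> 'k) set set" where
  "proj_tangent A x =
     {proj_pt u |u. u \<noteq> 0 \<and> (\<forall>F\<in>vanishing_ideal (\<Union>A). \<forall>v\<in>x - {0}. mdiff F v u = 0)}"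

definition tangential_variety :: "('i \<Rightarrow> 'k::field) set set \<Rightarrow> ('i \<Rightarrow> 'k) set set" where
  "tangential_variety A = proj_closure (\<Union>x\<in>A. proj_tangent A x)"

text \<open>The minimal number of points of \<open>A\<close> whose linear span contains \<open>[p]\<close>.\<close>

definition rank_wrt :: "('i \<Rightarrow> 'k::field) set set \<Rightarrow> ('i \<Rightarrow> 'k) \<Rightarrow> nat" where
  "rank_wrt A p = (LEAST r. \<exists>q. (\<forall>i<r. q i \<in> A) \<and> p \<in> lspan (q ` {..<r}))"


section \<open>Closed subsets and closed subschemes of a product of two projective spaces\<close>

text \<open>
  Polynomials in the coordinates of \<open>V\<^sub>1 \<times> V\<^sub>2\<close> are polynomials with indices in \<open>'n1 + 'n2\<close>.
\<close>

type_synonym ('n1, 'n2, 'k) bipt = "('n1 \<Rightarrow> 'k) set \<times> ('n2 \<Rightarrow> 'k) set"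

type_synonym ('n1, 'n2, 'k) bipoly = "('n1 + 'n2, 'k) mpoly"

definition biproj_space :: "('n1, 'n2, 'k::field) bipt set" where
  "biproj_space = proj_space \<times> proj_space"

definition bicone :: "('n1, 'n2, 'k::field) bipt set \<Rightarrow> ('n1 + 'n2 \<Rightarrow> 'k) set" where
  "bicone G = {case_sum v1 v2 |v1 v2 x1 x2. (x1, x2) \<in> G \<and> v1 \<in> x1 \<and> v2 \<in> x2}"

abbreviation set_ideal :: "('n1, 'n2, 'k::field) bipt set \<Rightarrow> ('n1, 'n2, 'k) bipoly set" where
  "set_ideal G \<equiv> vanishing_ideal (bicone G)"

definition has_bidegree :: "('n1::finite + 'n2::finite \<Rightarrow>\<^sub>0 nat) \<Rightarrow> nat \<Rightarrow> nat \<Rightarrow> bool" where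
  "has_bidegree m s t \<longleftrightarrow>
     (\<Sum>i\<in>UNIV. Poly_Mapping.lookup m (Inl i)) = s \<and> (\<Sum>j\<in>UNIV. Poly_Mapping.lookup m (Inr j)) = t"

definition biforms :: "nat \<Rightarrow> nat \<Rightarrow> ('n1::finite, 'n2::finite, 'k::field) bipoly set" where
  "biforms s t = {F. \<forall>m\<in>Poly_Mapping.keys F. has_bidegree m s t}"

definition bicomponent ::
  "nat \<Rightarrow> nat \<Rightarrow> ('n1::finite, 'n2::finite, 'k::field) bipoly \<Rightarrow> ('n1, 'n2, 'k) bipoly" where
  "bicomponent s t F =
     (\<Sum>m\<in>{m \<in> Poly_Mapping.keys F. has_bidegree m s t}. Poly_Mapping.single m (Poly_Mapping.lookup F m))"

definition zero_locus :: "('n1, 'n2, 'k::field) bipoly set \<Rightarrow> ('n1, 'n2, 'k) bipt set" where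
  "zero_locus J = {x \<in> biproj_space. \<forall>F\<in>J. \<forall>v\<in>bicone {x}. mvalue F v = 0}"

text \<open>
  A closed subscheme is given by its bihomogeneous ideal, saturated with respect to the irrelevant
  ideal \<open>B\<close>, which is generated by the products \<open>X\<^sub>i Y\<^sub>j\<close>. The condition
  \<open>J : B = J\<close> amounts to \<open>J : B\<^sup>\<infinity> = J\<close>. The set of closed points of the scheme is \<open>zero_locus J\<close>.
\<close>

definition closed_subscheme :: "('n1::finite, 'n2::finite, 'k::field) bipoly set \<Rightarrow> bool" where
  "closed_subscheme J \<longleftrightarrow> is_ideal J \<and>
     (\<forall>F\<in>J. \<forall>s t. bicomponent s t F \<in> J) \<and>
     (\<forall>F. (\<forall>i j. Var (Inl i) * Var (Inr j) * F \<in> J) \<longrightarrow> F \<in> J)"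

definition hilbert_function ::
  "('n1::finite, 'n2::finite, 'k::field) bipoly set \<Rightarrow> nat \<Rightarrow> nat \<Rightarrow> nat" where
  "hilbert_function J s t = mp.dim (biforms s t :: ('n1, 'n2, 'k) bipoly set)
     - mp.dim (J \<inter> biforms s t)"

definition zero_dim_scheme :: "('n1::finite, 'n2::finite, 'k::field) bipoly set \<Rightarrow> nat \<Rightarrow> bool" where
  "zero_dim_scheme W n \<longleftrightarrow> closed_subscheme W \<and>
     (\<exists>N. \<forall>s\<ge>N. \<forall>t\<ge>N. hilbert_function W s t = n)"

text \<open>Closed subsets carry the reduced scheme structure.\<close>

definition scheme_in ::
  "('n1, 'n2, 'k::field) bipoly set \<Rightarrow> ('n1, 'n2, 'k) bipt set \<Rightarrow> bool" where
  "scheme_in W G \<longleftrightarrow> set_ideal G \<subseteq> W"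

text \<open>The homogeneous ideals of the scheme-theoretic images under the two projections.\<close>

definition image_ideal1 :: "('n1, 'n2, 'k::field) bipoly set \<Rightarrow> ('n1, 'k) mpoly set" where
  "image_ideal1 W = {F. meval Const (\<lambda>i. Var (Inl i)) F \<in> W}"

definition image_ideal2 :: "('n1, 'n2, 'k::field) bipoly set \<Rightarrow> ('n2, 'k) mpoly set" where
  "image_ideal2 W = {F. meval Const (\<lambda>j. Var (Inr j)) F \<in> W}"

definition reduced_point :: "('i, 'k::field) mpoly set \<Rightarrow> bool" where
  "reduced_point J \<longleftrightarrow> (\<exists>x\<in>proj_space. J = vanishing_ideal x)"

definition dependence_set :: "('n1, 'n2, 'k::field) bipoly set \<Rightarrow> nat set" where
  "dependence_set W =
     {i. i = 1 \<and> \<not> reduced_point (image_ideal1 W) \<or> i = 2 \<and> \<not> reduced_point (image_ideal2 W)}"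


section \<open>Curves\<close>

definition zclosed :: "('n1, 'n2, 'k::field) bipt set \<Rightarrow> bool" where
  "zclosed A \<longleftrightarrow> zero_locus (set_ideal A) = A"

definition zirreducible :: "('n1, 'n2, 'k::field) bipt set \<Rightarrow> bool" where
  "zirreducible A \<longleftrightarrow> zclosed A \<and> A \<noteq> {} \<and>
     (\<forall>B C. zclosed B \<and> zclosed C \<and> A \<subseteq> B \<union> C \<longrightarrow> A \<subseteq> B \<or> A \<subseteq> C)"

definition krull_dim :: "('n1, 'n2, 'k::field) bipt set \<Rightarrow> enat" where
  "krull_dim A = Sup {enat n |n. \<exists>Z. (\<forall>i\<le>n. zirreducible (Z i) \<and> Z i \<subseteq> A) \<and>
     (\<forall>i<n. Z i \<subset> Z (Suc i))}"

definition irr_component :: "('n1, 'n2, 'k::field) bipt set \<Rightarrow> ('n1, 'n2, 'k) bipt set \<Rightarrow> bool" where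
  "irr_component Z A \<longleftrightarrow> zirreducible Z \<and> Z \<subseteq> A \<and>
     (\<forall>Z'. zirreducible Z' \<and> Z \<subseteq> Z' \<and> Z' \<subseteq> A \<longrightarrow> Z' = Z)"

definition curve :: "('n1, 'n2, 'k::field) bipt set \<Rightarrow> bool" where
  "curve G \<longleftrightarrow> zclosed G \<and> G \<noteq> {} \<and> (\<forall>Z. irr_component Z G \<longrightarrow> krull_dim Z = 1)"

text \<open>
  For \<open>s, t\<close> large the Hilbert function of \<open>G\<close> is the Euler characteristic of \<open>\<O>\<^sub>G(s, t)\<close>, which
  for a curve is \<open>s deg \<O>\<^sub>G(1, 0) + t deg \<O>\<^sub>G(0, 1) + \<chi>(\<O>\<^sub>G)\<close>.
\<close>

definition curve_bidegree :: "('n1::finite, 'n2::finite, 'k::field) bipt set \<Rightarrow> int \<Rightarrow> int \<Rightarrow> bool" where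
  "curve_bidegree G a b \<longleftrightarrow> curve G \<and>
     (\<exists>c N. \<forall>s\<ge>N. \<forall>t\<ge>N.
        int (hilbert_function (set_ideal G) s t) = a * int s + b * int t + c)"

text \<open>
  Jacobian criterion in bihomogeneous coordinates: the bicone over a curve, with the pairs
  having a zero entry removed, is locally the product of the curve and a two-dimensional torus.
\<close>

definition smooth_curve :: "('n1, 'n2, 'k::field) bipt set \<Rightarrow> bool" where
  "smooth_curve G \<longleftrightarrow> curve G \<and>
     (\<forall>(x1, x2)\<in>G. \<forall>v1\<in>x1 - {0}. \<forall>v2\<in>x2 - {0}.
        fs.dim {u. \<forall>F\<in>set_ideal G. mdiff F (case_sum v1 v2) u = 0} = 3)"

definition proj_line :: "('i \<Rightarrow> 'k::field) set set \<Rightarrow> bool" where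
  "proj_line R \<longleftrightarrow> (\<exists>U. fs.subspace U \<and> fs.dim U = 2 \<and> R = {x \<in> proj_space. x \<subseteq> U})"

definition alpha_line :: "('n1, 'n2, 'k::field) bipt set \<Rightarrow> bool" where
  "alpha_line G \<longleftrightarrow> (\<exists>R. \<exists>x2\<in>proj_space. proj_line R \<and> G = R \<times> {x2})"

definition beta_line :: "('n1, 'n2, 'k::field) bipt set \<Rightarrow> bool" where
  "beta_line G \<longleftrightarrow> (\<exists>x1\<in>proj_space. \<exists>L. proj_line L \<and> G = {x1} \<times> L)"


section \<open>The Segre-Veronese embedding\<close>

text \<open>
  Tensors in the product of the \<open>d1\<close>-th tensor power of \<open>V\<^sub>1\<close> and the \<open>d2\<close>-th tensor power of
  \<open>V\<^sub>2\<close> are functions of pairs of lists of indices, of lengths \<open>d1\<close> and \<open>d2\<close>, extended by zero.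
  The subspace \<open>S\<^sup>d\<^sup>1V\<^sub>1 \<otimes> S\<^sup>d\<^sup>2V\<^sub>2\<close> consists of those invariant under both symmetric groups.
\<close>

definition sym_tensors :: "nat \<Rightarrow> nat \<Rightarrow> ('n1 list \<times> 'n2 list \<Rightarrow> 'k::field) set" where
  "sym_tensors d1 d2 =
     {p. (\<forall>I J. p (I, J) \<noteq> 0 \<longrightarrow> length I = d1 \<and> length J = d2) \<and>
         (\<forall>I J I' J'. mset I = mset I' \<and> mset J = mset J' \<longrightarrow> p (I, J) = p (I', J'))}"

text \<open>Coordinates of \<open>v1\<^sup>\<otimes>\<^sup>d\<^sup>1 \<otimes> v2\<^sup>\<otimes>\<^sup>d\<^sup>2\<close>, for vectors over any commutative ring.\<close>

definition power_tensor ::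
  "nat \<Rightarrow> nat \<Rightarrow> ('n1 \<Rightarrow> 'b::comm_semiring_1) \<Rightarrow> ('n2 \<Rightarrow> 'b) \<Rightarrow> 'n1 list \<times> 'n2 list \<Rightarrow> 'b" where
  "power_tensor d1 d2 v1 v2 = (\<lambda>(I, J).
     if length I = d1 \<and> length J = d2 then prod_list (map v1 I) * prod_list (map v2 J) else 0)"

definition \<nu> ::
  "nat \<Rightarrow> nat \<Rightarrow> ('n1, 'n2, 'k::field) bipt \<Rightarrow> ('n1 list \<times> 'n2 list \<Rightarrow> 'k) set" where
  "\<nu> d1 d2 = (\<lambda>(x1, x2). fs.span {power_tensor d1 d2 v1 v2 |v1 v2. v1 \<in> x1 \<and> v2 \<in> x2})"

definition segre_veronese :: "nat \<Rightarrow> nat \<Rightarrow> ('n1 list \<times> 'n2 list \<Rightarrow> 'k::field) set set" where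
  "segre_veronese d1 d2 = \<nu> d1 d2 ` biproj_space"

definition linear_form :: "('i, 'k::zero) mpoly \<Rightarrow> bool" where
  "linear_form F \<longleftrightarrow> (\<forall>m\<in>Poly_Mapping.keys F. \<exists>i. m = Poly_Mapping.single i 1)"

text \<open>
  The affine cone over the linear span of the scheme \<open>\<nu>(W)\<close>: the common zeros of the linear forms
  whose pullback along \<open>\<nu>\<close> lies in the ideal of \<open>W\<close>.
\<close>

definition scheme_span ::
  "nat \<Rightarrow> nat \<Rightarrow> ('n1, 'n2, 'k::field) bipoly set \<Rightarrow> ('n1 list \<times> 'n2 list \<Rightarrow> 'k) set" where
  "scheme_span d1 d2 W = {q. \<forall>F. linear_form F \<and>
     meval Const (power_tensor d1 d2 (\<lambda>i. Var (Inl i)) (\<lambda>j. Var (Inr j))) F \<in> W \<longrightarrow>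
     mvalue F q = 0}"

definition tensor_rank :: "nat \<Rightarrow> nat \<Rightarrow> ('n1 list \<times> 'n2 list \<Rightarrow> 'k::field) \<Rightarrow> nat" where
  "tensor_rank d1 d2 p = rank_wrt (segre_veronese d1 d2) p"

definition \<S> ::
  "nat \<Rightarrow> nat \<Rightarrow> ('n1 list \<times> 'n2 list \<Rightarrow> 'k::field) \<Rightarrow> ('n1, 'n2, 'k) bipt set set" where
  "\<S> d1 d2 p = {S. S \<subseteq> biproj_space \<and> finite S \<and> p \<in> lspan (\<nu> d1 d2 ` S) \<and>
     card S = tensor_rank d1 d2 p}"

text \<open>
  The first conjunct ensures that the minimum defining the rank with respect to \<open>\<nu>(G)\<close> exists.
\<close>

definition computes_rank ::
  "nat \<Rightarrow> nat \<Rightarrow> ('n1 list \<times> 'n2 list \<Rightarrow> 'k::field) \<Rightarrow> ('n1, 'n2, 'k) bipt set \<Rightarrow> bool" where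
  "computes_rank d1 d2 p G \<longleftrightarrow>
     p \<in> lspan (\<nu> d1 d2 ` G) \<and>
     tensor_rank d1 d2 p = rank_wrt (\<nu> d1 d2 ` G) p \<and>
     (\<forall>S. S \<subseteq> G \<and> finite S \<and> card S = rank_wrt (\<nu> d1 d2 ` G) p \<and> p \<in> lspan (\<nu> d1 d2 ` S)
        \<longrightarrow> S \<in> \<S> d1 d2 p)"

end

theory Submission
  imports Defs
begin

text \<open>
  A scheme \<open>W\<close> of degree two supported at \<open>([a], [b])\<close> is a tangent vector: its biforms are those with
  \<open>F(a, b) = 0\<close> and \<open>\<partial>\<^bsub>(u, w)\<^esub> F(a, b) = 0\<close>. As a functional on the forms of bidegree \<open>(d1, d2)\<close>, the
  tensor \<open>p\<close> is, up to the choice of \<open>(u, w)\<close>, the map \<open>F \<mapsto> \<partial>\<^bsub>(u, w)\<^esub> F(a, b) + e F(a, b)\<close>, and it lies in the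
  span of a finite set \<open>S\<close> if and only if it kills all forms vanishing on \<open>S\<close>. For a form \<open>H\<close> that
  vanishes at \<open>(a, b)\<close> but not in the tangent direction, such as a linear form or a suitable form of
  bidegree \<open>(1, 1)\<close>, the products of \<open>H\<close> with linear forms through the points of \<open>S\<close> off \<open>H\<close> bound
  the cardinality of \<open>S\<close> from below, and in the case of equality they force \<open>S\<close> to lie in the line, in the
  graph of an isomorphism of two lines, or in the union of two lines. Conversely, divided differences decompose \<open>p\<close>
  along the rational curves obtained. That these are all curves of bidegree \<open>(1, 1)\<close> containing \<open>W\<close>
  follows from the growth of the Hilbert functions of their components.
\<close>

section \<open>Evaluation and differentiation of polynomials\<close>

text \<open>By Euler's identity, differentiating a form along \<open>a\<close> or \<open>b\<close>
  only multiplies its value at the point. So \<open>u\<close> and \<open>w\<close> matter modulo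
  \<open>a\<close> and \<open>b\<close>, at the price of changing \<open>e\<close>. This freedom
  produces the graphs: replacing \<open>w\<close> by \<open>w + c b\<close> keeps W but changes the
  isomorphism of the two lines. The obstacle in the count of points is that no linear form in the
  first variables vanishes at a point over [a] without vanishing at \<open>a\<close>, and likewise
  for [b]. Points of S are therefore sorted by the projections they share with the support. Each
  factor gives one inequality, and with \<open>d1 + d2\<close> points only two distributions satisfy
  both: all points off both fibres, or \<open>d1\<close> and \<open>d2\<close> points on two lines.
  Degrees of components are never defined, since the bidegree of a curve is known only through the
  growth of its Hilbert function. Intersection numbers are replaced by the observation that a form H
  not vanishing on an irreducible set embeds forms modulo its ideal into forms of larger bidegree,
  while forms that do not vanish on the intersection with H give additional classes. Too many
  intersections or components then contradict the growth \<open>s + t\<close> plus a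
  constant.\<close>

definition mono_eval :: "('i \<Rightarrow> 'b::comm_semiring_1) \<Rightarrow> ('i \<Rightarrow>\<^sub>0 nat) \<Rightarrow> 'b" where
  "mono_eval v m = (\<Prod>i\<in>Poly_Mapping.keys m. v i ^ Poly_Mapping.lookup m i)"

lemma mono_eval_superset:
  assumes "finite A" "Poly_Mapping.keys m \<subseteq> A"
  shows "mono_eval v m = (\<Prod>i\<in>A. v i ^ Poly_Mapping.lookup m i)"
  unfolding mono_eval_def using assms
  by (intro prod.mono_neutral_left) (auto simp: in_keys_iff)

lemma mono_eval_0 [simp]: "mono_eval v 0 = 1"
  by (simp add: mono_eval_def)

lemma mono_eval_single [simp]: "mono_eval v (Poly_Mapping.single i n) = v i ^ n"
  by (simp add: mono_eval_superset[of "{i}"])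

lemma mono_eval_add: "mono_eval v (m + m') = mono_eval v m * mono_eval v m'"
proof -
  let ?A = "Poly_Mapping.keys m \<union> Poly_Mapping.keys m'"
  have "Poly_Mapping.keys (m + m') \<subseteq> ?A" by (rule keys_add)
  then show ?thesis
    by (simp add: mono_eval_superset[of ?A] lookup_add power_add prod.distrib)
qed

lemma mpoly_eq_sum_single:
  "(F :: 'a \<Rightarrow>\<^sub>0 'k::comm_monoid_add)
    = (\<Sum>m\<in>Poly_Mapping.keys F. Poly_Mapping.single m (Poly_Mapping.lookup F m))"
proof (rule poly_mapping_eqI)
  fix k
  show "Poly_Mapping.lookup F k
    = Poly_Mapping.lookup (\<Sum>m\<in>Poly_Mapping.keys F. Poly_Mapping.single m (Poly_Mapping.lookup F m)) k"
    by (simp add: lookup_sum lookup_single when_def sum.delta in_keys_iff)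
qed

lemma single_eq_Const_mult: "Poly_Mapping.single m c = Const c * Poly_Mapping.single m 1"
  for c :: "'k::comm_ring_1"
  by (simp add: Const_def mult_single)

lemma Const_0 [simp]: "Const 0 = 0"
  by (simp add: Const_def)

lemma Const_1 [simp]: "Const (1::'k::comm_ring_1) = 1"
  by (simp add: Const_def)

lemma Const_add: "Const (c + d) = Const c + Const (d::'k::comm_ring_1)"
  by (simp add: Const_def single_add)

lemma Const_uminus: "Const (- c) = - Const (c::'k::comm_ring_1)"
  by (simp add: Const_def single_uminus)

lemma Const_mult: "Const (c * d) = Const c * Const (d::'k::comm_ring_1)"
  by (simp add: Const_def mult_single)

text \<open>Splitting one variable off a monomial lowers its total degree, on which the induction
  runs.\<close>

lemma monomial_induct [case_names one Var]:
  assumes "P 0" and "\<And>m i. P m \<Longrightarrow> P (Poly_Mapping.single i 1 + m)"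
  shows "P (m :: 'i \<Rightarrow>\<^sub>0 nat)"
proof (induction "\<Sum>i\<in>Poly_Mapping.keys m. Poly_Mapping.lookup m i" arbitrary: m)
  case 0
  then have "\<forall>i\<in>Poly_Mapping.keys m. Poly_Mapping.lookup m i = 0" by simp
  then have "m = 0"
    by (intro poly_mapping_eqI) (auto simp: in_keys_iff)
  then show ?case using assms(1) by simp
next
  case (Suc n)
  then obtain i where i: "i \<in> Poly_Mapping.keys m"
    by (metis Poly_Mapping.keys_zero card.empty ex_in_conv sum.empty old.nat.distinct(2))
  define m' where "m' = m - Poly_Mapping.single i 1"
  have m: "m = Poly_Mapping.single i 1 + m'"
    using i by (intro poly_mapping_eqI)
      (auto simp: m'_def lookup_add lookup_minus lookup_single when_def in_keys_iff)
  then have m': "Poly_Mapping.lookup m j = Poly_Mapping.lookup (Poly_Mapping.single i 1) j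
      + Poly_Mapping.lookup m' j" for j
    by (metis lookup_add)
  have sub: "Poly_Mapping.keys m' \<subseteq> Poly_Mapping.keys m"
    by (auto simp: in_keys_iff m')
  have "Suc n = (\<Sum>j\<in>Poly_Mapping.keys m. Poly_Mapping.lookup m j)" by (fact Suc.hyps(2))
  also have "\<dots> = (\<Sum>j\<in>Poly_Mapping.keys m. Poly_Mapping.lookup m' j + (if j = i then 1 else 0))"
    by (intro sum.cong refl) (simp add: m' lookup_add lookup_single when_def)
  also have "\<dots> = (\<Sum>j\<in>Poly_Mapping.keys m. Poly_Mapping.lookup m' j) + 1"
    using i by (simp add: sum.distrib sum.delta)
  also have "(\<Sum>j\<in>Poly_Mapping.keys m. Poly_Mapping.lookup m' j)
      = (\<Sum>j\<in>Poly_Mapping.keys m'. Poly_Mapping.lookup m' j)"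
    using sub by (intro sum.mono_neutral_right) (auto simp: in_keys_iff)
  finally show ?case using Suc.hyps(1)[of m'] assms(2)[of m' i] m by simp
qed

lemma single_add_1: "Poly_Mapping.single (Poly_Mapping.single i 1 + m) (1::'k::comm_ring_1)
    = Var i * Poly_Mapping.single m 1"
  by (simp add: Var_def mult_single)

text \<open>Only one variable is multiplied at a time, so multiplicativity of evaluation has to be
  checked for a single variable as factor.\<close>

lemma mpoly_induct [case_names Const add Var]:
  fixes F :: "('i, 'k::comm_ring_1) mpoly"
  assumes "\<And>c. P (Const c)" and "\<And>F G. P F \<Longrightarrow> P G \<Longrightarrow> P (F + G)"
    and "\<And>F i. P F \<Longrightarrow> P (Var i * F)"
  shows "P F"
proof -
  have mono: "P (Poly_Mapping.single m c)" for m c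
  proof (induction m rule: monomial_induct)
    case one
    then show ?case using assms(1) by (simp add: Const_def)
  next
    case (Var m i)
    have "Poly_Mapping.single (Poly_Mapping.single i 1 + m) c = Var i * Poly_Mapping.single m c"
      by (simp add: Var_def mult_single)
    then show ?case using assms(3)[OF Var] by metis
  qed
  have "P (\<Sum>m\<in>A. Poly_Mapping.single m (Poly_Mapping.lookup F m))" if "finite A" for A
    using that
  proof (induction rule: finite_induct)
    case empty
    then show ?case using assms(1)[of 0] by simp
  qed (simp add: assms(2) mono)
  from this[of "Poly_Mapping.keys F"] show ?thesis
    using mpoly_eq_sum_single[of F] by simp
qed

text \<open>One set of evaluation rules serves three coefficient maps: the identity for values,
  \<open>c\<close> to the constant polynomial \<open>[:c:]\<close> for differentials, and
  \<open>Const\<close> for the substitution of polynomials into polynomials.\<close>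

locale coeff_hom =
  fixes h :: "'k::comm_ring_1 \<Rightarrow> 'b::comm_ring_1"
  assumes hom_add: "h (c + d) = h c + h d"
    and hom_mult: "h (c * d) = h c * h d"
    and hom_one: "h 1 = 1"
begin

lemma hom_zero: "h 0 = 0"
  using hom_add[of 0 0] by simp

lemma meval_superset:
  assumes "finite A" "Poly_Mapping.keys F \<subseteq> A"
  shows "meval h v F = (\<Sum>m\<in>A. h (Poly_Mapping.lookup F m) * mono_eval v m)"
  unfolding meval_def mono_eval_def[symmetric] using assms
  by (intro sum.mono_neutral_left) (auto simp: in_keys_iff hom_zero)

lemma meval_add: "meval h v (F + G) = meval h v F + meval h v G"
proof -
  let ?A = "Poly_Mapping.keys F \<union> Poly_Mapping.keys G"
  have "Poly_Mapping.keys (F + G) \<subseteq> ?A" by (rule keys_add)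
  then show ?thesis
    by (simp add: meval_superset[of ?A] lookup_add hom_add algebra_simps sum.distrib)
qed

lemma meval_zero [simp]: "meval h v 0 = 0"
  by (simp add: meval_def)

lemma meval_Const [simp]: "meval h v (Const c) = h c"
  by (simp add: meval_superset[of "{0}"] Const_def hom_zero)

lemma meval_one [simp]: "meval h v 1 = 1"
  using meval_Const[of v 1] by (simp add: hom_one)

lemma meval_uminus: "meval h v (- F) = - meval h v F"
  using meval_add[of v F "- F"] by (simp add: eq_neg_iff_add_eq_0 add.commute)

lemma meval_diff: "meval h v (F - G) = meval h v F - meval h v G"
  using meval_add[of v F "- G"] by (simp add: meval_uminus)

lemma meval_sum: "meval h v (sum F A) = (\<Sum>x\<in>A. meval h v (F x))"
  by (induction A rule: infinite_finite_induct) (simp_all add: meval_add)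

lemma meval_single: "meval h v (Poly_Mapping.single m c) = h c * mono_eval v m"
  by (simp add: meval_superset[of "{m}"])

lemma meval_single_mult:
  "meval h v (Poly_Mapping.single m c * F) = h c * mono_eval v m * meval h v F"
proof -
  have "Poly_Mapping.single m c * F = (\<Sum>n\<in>Poly_Mapping.keys F. Poly_Mapping.single m c *
      Poly_Mapping.single n (Poly_Mapping.lookup F n))"
    by (subst (1) mpoly_eq_sum_single[of F]) (simp add: sum_distrib_left)
  also have "meval h v \<dots> = (\<Sum>n\<in>Poly_Mapping.keys F.
      h c * mono_eval v m * (h (Poly_Mapping.lookup F n) * mono_eval v n))"
    by (simp add: meval_sum mult_single meval_single mono_eval_add hom_mult mult_ac)
  also have "\<dots> = h c * mono_eval v m * meval h v F"
    by (simp add: sum_distrib_left meval_superset[of "Poly_Mapping.keys F"])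
  finally show ?thesis .
qed

lemma meval_Var [simp]: "meval h v (Var i) = v i"
  using meval_single_mult[of v "Poly_Mapping.single i 1" 1 1] by (simp add: Var_def hom_one)

lemma meval_Const_mult: "meval h v (Const c * F) = h c * meval h v F"
  by (simp add: Const_def meval_single_mult)

lemma meval_Var_mult: "meval h v (Var i * F) = v i * meval h v F"
  by (simp add: Var_def meval_single_mult hom_one)

lemma meval_mult: "meval h v (F * G) = meval h v F * meval h v G"
  by (induction F rule: mpoly_induct)
    (simp_all add: meval_Const_mult meval_add meval_Var_mult distrib_right mult.assoc)

lemma meval_power: "meval h v (F ^ n) = meval h v F ^ n"
  by (induction n) (simp_all add: meval_mult)

lemma meval_prod: "meval h v (prod F A) = (\<Prod>x\<in>A. meval h v (F x))"
  by (induction A rule: infinite_finite_induct) (simp_all add: meval_mult)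

lemma meval_prod_list: "meval h v (prod_list (map F xs)) = prod_list (map (\<lambda>x. meval h v (F x)) xs)"
  by (induction xs) (simp_all add: meval_mult)

lemma meval_meval: "meval h v (meval Const q E) = meval h (\<lambda>i. meval h v (q i)) E"
  if "coeff_hom (Const :: 'k \<Rightarrow> ('i, 'k) mpoly)" for q :: "'j \<Rightarrow> ('i, 'k) mpoly"
proof -
  interpret C: coeff_hom "Const :: 'k \<Rightarrow> ('i, 'k) mpoly" by (fact that)
  show ?thesis
    by (induction E rule: mpoly_induct)
      (simp_all add: meval_add meval_mult C.meval_add C.meval_mult)
qed

end

global_interpretation ev: coeff_hom "\<lambda>c :: 'k::comm_ring_1. c"
  by unfold_locales auto

global_interpretation pev: coeff_hom "\<lambda>c :: 'k::comm_ring_1. [:c:]"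
  by unfold_locales (auto simp: pCons_one)

global_interpretation cev: coeff_hom "Const :: 'k::comm_ring_1 \<Rightarrow> ('i, 'k) mpoly"
  by unfold_locales (auto simp: Const_add Const_mult)

lemmas ev_simps = ev.meval_add ev.meval_diff ev.meval_uminus ev.meval_mult ev.meval_power
  ev.meval_sum ev.meval_prod ev.meval_prod_list

lemma poly_meval: "poly (meval (\<lambda>c. [:c:]) V F) z = mvalue F (\<lambda>i. poly (V i) z)"
  for F :: "('i, 'k::comm_ring_1) mpoly"
  by (induction F rule: mpoly_induct)
    (simp_all add: pev.meval_add pev.meval_mult ev_simps)

lemma coeff_0_meval: "coeff (meval (\<lambda>c. [:c:]) (\<lambda>i. [:v i, u i:]) F) 0 = mvalue F v"
  for F :: "('i, 'k::comm_ring_1) mpoly"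
  by (simp add: poly_0_coeff_0[symmetric] poly_meval)

text \<open>This becomes the Leibniz rule: \<open>mdiff\<close> is a coefficient of a polynomial in
  one variable, and the coefficient of index 0 is the value.\<close>

lemma coeff_mult_1: "coeff (p * q) (Suc 0) = coeff p (Suc 0) * coeff q 0 + coeff p 0 * coeff q (Suc 0)"
  for p q :: "'k::comm_ring_1 poly"
  by (simp add: coeff_mult)

section \<open>Rules for differentials\<close>

lemma mdiff_zero [simp]: "mdiff 0 v u = (0::'k::comm_ring_1)"
  by (simp add: mdiff_def)

lemma mdiff_one [simp]: "mdiff 1 v u = (0::'k::comm_ring_1)"
  by (simp add: mdiff_def)

lemma mdiff_Const [simp]: "mdiff (Const c) v u = (0::'k::comm_ring_1)"
  by (simp add: mdiff_def)

lemma mdiff_Var [simp]: "mdiff (Var i) v u = (u i::'k::comm_ring_1)"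
  by (simp add: mdiff_def)

lemma mdiff_add: "mdiff (F + G) v u = mdiff F v u + (mdiff G v u::'k::comm_ring_1)"
  by (simp add: mdiff_def pev.meval_add)

lemma mdiff_diff: "mdiff (F - G) v u = mdiff F v u - (mdiff G v u::'k::comm_ring_1)"
  by (simp add: mdiff_def pev.meval_diff)

lemma mdiff_uminus: "mdiff (- F) v u = - (mdiff F v u::'k::comm_ring_1)"
  by (simp add: mdiff_def pev.meval_uminus)

lemma mdiff_mult: "mdiff (F * G) v u = mdiff F v u * mvalue G v + mvalue F v * (mdiff G v u::'k::comm_ring_1)"
  by (simp add: mdiff_def pev.meval_mult coeff_mult_1 coeff_0_meval)

lemma mdiff_sum: "mdiff (sum F A) v u = (\<Sum>x\<in>A. mdiff (F x) v u::'k::comm_ring_1)"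
  by (induction A rule: infinite_finite_induct) (simp_all add: mdiff_add)

lemmas mdiff_simps = mdiff_add mdiff_diff mdiff_uminus mdiff_mult mdiff_sum

lemma mdiff_direction_add:
  "mdiff F v (\<lambda>i. u i + u' i) = mdiff F v u + (mdiff F v u'::'k::comm_ring_1)"
  by (induction F rule: mpoly_induct) (simp_all add: mdiff_simps algebra_simps)

lemma mdiff_direction_scale: "mdiff F v (\<lambda>i. c * u i) = c * (mdiff F v u::'k::comm_ring_1)"
  by (induction F rule: mpoly_induct) (simp_all add: mdiff_simps algebra_simps)

section \<open>Biforms\<close>

abbreviation bval :: "('n1, 'n2, 'k::field) bipoly \<Rightarrow> ('n1 \<Rightarrow> 'k) \<Rightarrow> ('n2 \<Rightarrow> 'k) \<Rightarrow> 'k" where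
  "bval F a b \<equiv> mvalue F (case_sum a b)"

abbreviation bdiff :: "('n1, 'n2, 'k::field) bipoly \<Rightarrow> ('n1 \<Rightarrow> 'k) \<Rightarrow> ('n2 \<Rightarrow> 'k) \<Rightarrow>
    ('n1 \<Rightarrow> 'k) \<Rightarrow> ('n2 \<Rightarrow> 'k) \<Rightarrow> 'k" where
  "bdiff F a b u w \<equiv> mdiff F (case_sum a b) (case_sum u w)"

abbreviation (input) "X i \<equiv> Var (Inl i)"
abbreviation (input) "Y j \<equiv> Var (Inr j)"

lemma has_bidegree_0 [simp]: "has_bidegree 0 s t \<longleftrightarrow> s = 0 \<and> t = 0"
  by (auto simp: has_bidegree_def)

lemma has_bidegree_add:
  "has_bidegree m s t \<Longrightarrow> has_bidegree m' s' t' \<Longrightarrow> has_bidegree (m + m') (s + s') (t + t')"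
  by (auto simp: has_bidegree_def lookup_add sum.distrib)

lemma has_bidegree_unique: "has_bidegree m s t \<Longrightarrow> has_bidegree m s' t' \<Longrightarrow> s = s' \<and> t = t'"
  by (auto simp: has_bidegree_def)

lemma has_bidegree_X: "has_bidegree (Poly_Mapping.single (Inl i) 1) 1 0"
  by (auto simp: has_bidegree_def lookup_single when_def)

lemma has_bidegree_Y: "has_bidegree (Poly_Mapping.single (Inr i) 1) 0 1"
  by (auto simp: has_bidegree_def lookup_single when_def)

lemma ex_bidegree: "\<exists>s t. has_bidegree m s t"
  by (auto simp: has_bidegree_def)

lemma biforms_zero [simp, intro]: "0 \<in> biforms s t"
  by (simp add: biforms_def)

lemma biforms_add [intro]: "F \<in> biforms s t \<Longrightarrow> G \<in> biforms s t \<Longrightarrow> F + G \<in> biforms s t"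
  using keys_add[of F G] by (auto simp: biforms_def)

lemma biforms_uminus [intro]: "F \<in> biforms s t \<Longrightarrow> - F \<in> biforms s t"
  by (auto simp: biforms_def in_keys_iff)

lemma biforms_diff [intro]: "F \<in> biforms s t \<Longrightarrow> G \<in> biforms s t \<Longrightarrow> F - G \<in> biforms s t"
  using biforms_add[of F s t "- G"] biforms_uminus[of G s t] by simp

lemma biforms_sum [intro]: "(\<And>x. x \<in> A \<Longrightarrow> F x \<in> biforms s t) \<Longrightarrow> sum F A \<in> biforms s t"
  by (induction A rule: infinite_finite_induct) auto

lemma biforms_mult: "F \<in> biforms s t \<Longrightarrow> G \<in> biforms s' t' \<Longrightarrow> F * G \<in> biforms (s + s') (t + t')"
  using keys_mult[of F G] by (fastforce simp: biforms_def intro: has_bidegree_add)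

lemma biforms_mult': "F \<in> biforms s t \<Longrightarrow> G \<in> biforms s' t' \<Longrightarrow> S = s + s' \<Longrightarrow> T = t + t' \<Longrightarrow>
    F * G \<in> biforms S T"
  by (simp add: biforms_mult)

lemma biforms_Const [simp, intro]: "Const c \<in> biforms 0 0"
  by (auto simp: biforms_def Const_def)

lemma biforms_one [simp, intro]: "1 \<in> biforms 0 0"
  by (simp add: biforms_def)

lemma biforms_Const_mult [intro]: "F \<in> biforms s t \<Longrightarrow> Const c * F \<in> biforms s t"
  by (rule biforms_mult'[of "Const c" 0 0]) auto

lemma biforms_X [simp, intro]: "X i \<in> biforms (Suc 0) 0"
  using has_bidegree_X[of i] by (auto simp: biforms_def Var_def)

lemma biforms_Y [simp, intro]: "Y i \<in> biforms 0 (Suc 0)"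
  using has_bidegree_Y[of i] by (auto simp: biforms_def Var_def)

lemma biforms_power: "F \<in> biforms s t \<Longrightarrow> F ^ n \<in> biforms (n * s) (n * t)"
  by (induction n) (auto intro: biforms_mult)

lemma biforms_single: "has_bidegree m s t \<Longrightarrow> Poly_Mapping.single m c \<in> biforms s t"
  by (auto simp: biforms_def)

text \<open>Bidegrees travel with the induction, so that a statement may depend on \<open>s\<close>
  and \<open>t\<close>. The zero form lies in every \<open>biforms s t\<close> and occurs as the
  empty sum of monomials, so \<open>zero\<close> has to cover all bidegrees; constants arise from
  \<open>one\<close> and \<open>scale\<close>.\<close>

lemma biform_induct [consumes 1, case_names zero one add scale X Y]:
  fixes F :: "('n1::finite, 'n2::finite, 'k::field) bipoly"
  assumes "F \<in> biforms s t"
    and zero: "\<And>s t. P s t 0" and one: "P 0 0 1"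
    and add: "\<And>s t F G. F \<in> biforms s t \<Longrightarrow> G \<in> biforms s t \<Longrightarrow> P s t F \<Longrightarrow> P s t G \<Longrightarrow> P s t (F + G)"
    and scale: "\<And>s t F c. F \<in> biforms s t \<Longrightarrow> P s t F \<Longrightarrow> P s t (Const c * F)"
    and X: "\<And>s t F i. F \<in> biforms s t \<Longrightarrow> P s t F \<Longrightarrow> P (Suc s) t (X i * F)"
    and Y: "\<And>s t F j. F \<in> biforms s t \<Longrightarrow> P s t F \<Longrightarrow> P s (Suc t) (Y j * F)"
  shows "P s t F"
proof -
  have mono: "P s t (Poly_Mapping.single m 1)" if "has_bidegree m s t" for s t m
    using that
  proof (induction m arbitrary: s t rule: monomial_induct)
    case one
    then show ?case using assms(3) by simp
  next
    case (Var m i)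
    obtain s' t' where b: "has_bidegree m s' t'" using ex_bidegree by blast
    then have F: "Poly_Mapping.single m 1 \<in> (biforms s' t' :: ('n1, 'n2, 'k) bipoly set)"
      by (rule biforms_single)
    show ?case
    proof (cases i)
      case (Inl k)
      have "s = Suc s' \<and> t = t'"
        using has_bidegree_unique[OF Var.prems has_bidegree_add[OF _ b], of 1 0] has_bidegree_X[of k]
        by (simp add: Inl)
      then show ?thesis using X[OF F Var.IH[OF b], of k] by (simp add: Inl single_add_1 del: One_nat_def)
    next
      case (Inr k)
      have "s = s' \<and> t = Suc t'"
        using has_bidegree_unique[OF Var.prems has_bidegree_add[OF _ b], of 0 1] has_bidegree_Y[of k]
        by (simp add: Inr)
      then show ?thesis using Y[OF F Var.IH[OF b], of k] by (simp add: Inr single_add_1 del: One_nat_def)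
    qed
  qed
  have "(\<Sum>m\<in>A. Poly_Mapping.single m (Poly_Mapping.lookup F m)) \<in> biforms s t \<and>
      P s t (\<Sum>m\<in>A. Poly_Mapping.single m (Poly_Mapping.lookup F m))"
    if "finite A" "A \<subseteq> Poly_Mapping.keys F" for A
    using that
  proof (induction rule: finite_induct)
    case empty
    then show ?case by (simp add: zero)
  next
    case (insert m A)
    then have m: "has_bidegree m s t" using assms(1) by (auto simp: biforms_def)
    have "P s t (Poly_Mapping.single m (Poly_Mapping.lookup F m))"
      using scale[OF biforms_single[OF m] mono[OF m]] by (metis single_eq_Const_mult)
    with insert m show ?case by (auto intro!: add biforms_single)
  qed
  from this[of "Poly_Mapping.keys F"] show ?thesis using mpoly_eq_sum_single[of F] by simp
qed

lemma bval_scale: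
  fixes F :: "('n1::finite, 'n2::finite, 'k::field) bipoly"
  shows "F \<in> biforms s t \<Longrightarrow> bval F (\<lambda>i. c * a i) (\<lambda>j. d * b j) = c ^ s * d ^ t * bval F a b"
  by (induction rule: biform_induct) (simp_all add: ev_simps algebra_simps)

text \<open>Euler's identity in each of the two groups of variables, with independent multipliers.
  It is the reason why tangent directions matter only modulo the vectors \<open>a\<close> and
  \<open>b\<close>.\<close>

lemma bdiff_euler:
  fixes F :: "('n1::finite, 'n2::finite, 'k::field) bipoly"
  shows "F \<in> biforms s t \<Longrightarrow> bdiff F a b (\<lambda>i. c * a i) (\<lambda>j. d * b j)
    = (c * of_nat s + d * of_nat t) * bval F a b"
  by (induction rule: biform_induct) (simp_all add: ev_simps mdiff_simps algebra_simps)

lemma case_sum_plus: "case_sum (\<lambda>i. u i + u' i) (\<lambda>j. w j + w' j)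
    = (\<lambda>x. case_sum u w x + case_sum u' w' x)" for u u' :: "_ \<Rightarrow> 'k::field"
  by (auto simp: fun_eq_iff split: sum.splits)

lemma case_sum_times: "case_sum (\<lambda>i. c * u i) (\<lambda>j. c * w j) = (\<lambda>x. c * case_sum u w x)"
  for u :: "_ \<Rightarrow> 'k::field"
  by (auto simp: fun_eq_iff split: sum.splits)

lemma bdiff_direction_add: "bdiff F a b (\<lambda>i. u i + u' i) (\<lambda>j. w j + w' j)
    = bdiff F a b u w + bdiff F a b u' w'"
  unfolding case_sum_plus by (rule mdiff_direction_add)

lemma bdiff_direction_scale: "bdiff F a b (\<lambda>i. c * u i) (\<lambda>j. c * w j) = c * bdiff F a b u w"
  unfolding case_sum_times by (rule mdiff_direction_scale)

lemma bdiff_euler_shift: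
  fixes F :: "('n1::finite, 'n2::finite, 'k::field) bipoly"
  assumes "F \<in> biforms s t"
  shows "bdiff F a b (\<lambda>i. e * u i + c * a i) (\<lambda>j. e * w j + d * b j)
    = e * bdiff F a b u w + (c * of_nat s + d * of_nat t) * bval F a b"
  by (simp only: bdiff_direction_add bdiff_direction_scale bdiff_euler[OF assms])

definition lin1 :: "('n1::finite \<Rightarrow> 'k::field) \<Rightarrow> ('n1, 'n2::finite, 'k) bipoly" where
  "lin1 f = (\<Sum>i\<in>UNIV. Const (f i) * X i)"

definition lin2 :: "('n2::finite \<Rightarrow> 'k::field) \<Rightarrow> ('n1::finite, 'n2, 'k) bipoly" where
  "lin2 g = (\<Sum>j\<in>UNIV. Const (g j) * Y j)"

definition dot :: "('i::finite \<Rightarrow> 'k::field) \<Rightarrow> ('i \<Rightarrow> 'k) \<Rightarrow> 'k" where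
  "dot f v = (\<Sum>i\<in>UNIV. f i * v i)"

lemma lin1_biform [simp, intro]: "lin1 f \<in> biforms (Suc 0) 0"
  by (auto simp: lin1_def)

lemma lin2_biform [simp, intro]: "lin2 f \<in> biforms 0 (Suc 0)"
  by (auto simp: lin2_def)

lemma bval_lin1 [simp]: "mvalue (lin1 f) v = dot f (\<lambda>i. v (Inl i))"
  by (simp add: lin1_def dot_def ev_simps)

lemma bval_lin2 [simp]: "mvalue (lin2 f) v = dot f (\<lambda>i. v (Inr i))"
  by (simp add: lin2_def dot_def ev_simps)

lemma mdiff_lin1 [simp]: "mdiff (lin1 f) v u = dot f (\<lambda>i. u (Inl i))"
  by (simp add: lin1_def dot_def mdiff_simps)

lemma mdiff_lin2 [simp]: "mdiff (lin2 f) v u = dot f (\<lambda>i. u (Inr i))"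
  by (simp add: lin2_def dot_def mdiff_simps)

lemma dot_add: "dot f (\<lambda>i. u i + v i) = dot f u + dot f v"
  by (simp add: dot_def algebra_simps sum.distrib)

lemma dot_scale: "dot f (\<lambda>i. c * v i) = c * dot f v"
  by (simp add: dot_def algebra_simps sum_distrib_left)

lemma dot_zero [simp]: "dot f 0 = 0" "dot f (\<lambda>i. 0) = 0"
  by (simp_all add: dot_def)

section \<open>Linear algebra and Hilbert functions\<close>

lemma sum_fun_apply: "(\<Sum>x\<in>A. f x) i = (\<Sum>x\<in>A. f x i)" for f :: "_ \<Rightarrow> _ \<Rightarrow> 'b::comm_monoid_add"
  by (induction A rule: infinite_finite_induct) auto

context vector_space
begin

text \<open>Families in place of sets: a repetition \<open>b i = b j\<close> would give the relation
  with coefficients 1 and -1, so injectivity, and with it the size of the image, comes from the same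
  hypothesis.\<close>

lemma independent_family:
  assumes "finite I" and "\<And>c i. (\<Sum>i\<in>I. scale (c i) (b i)) = 0 \<Longrightarrow> i \<in> I \<Longrightarrow> c i = 0"
  shows "inj_on b I" "independent (b ` I)"
proof -
  show inj: "inj_on b I"
  proof (rule inj_onI, rule ccontr)
    fix i j assume ij: "i \<in> I" "j \<in> I" "b i = b j" "i \<noteq> j"
    let ?c = "\<lambda>k. if k = i then 1 else if k = j then -1 else 0"
    have "(\<Sum>k\<in>I. scale (?c k) (b k)) = (\<Sum>k\<in>{i, j}. scale (?c k) (b k))"
      using ij assms(1) by (intro sum.mono_neutral_right) auto
    also have "\<dots> = 0" using ij by simp
    finally have "(\<Sum>k\<in>I. scale (?c k) (b k)) = 0" .
    from assms(2)[OF this ij(1)] show False by simp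
  qed
  show "independent (b ` I)"
  proof (rule independent_if_scalars_zero)
    fix f x assume *: "(\<Sum>x\<in>b ` I. scale (f x) x) = 0" and x: "x \<in> b ` I"
    have "(\<Sum>i\<in>I. scale (f (b i)) (b i)) = 0"
      using * by (simp add: sum.reindex[OF inj] o_def)
    then show "f x = 0" using assms(2)[of "\<lambda>i. f (b i)"] x by auto
  qed (use assms in auto)
qed

text \<open>The space of all polynomials has infinite dimension; a finite set \<open>M\<close> whose
  span contains \<open>V\<close> makes every independent subset of \<open>V\<close> finite, so that
  \<open>dim V\<close> really bounds its size.\<close>

lemma independent_card_le:
  assumes "S \<subseteq> V" "independent S" "V \<subseteq> span M" "finite M"
  shows "finite S" "card S \<le> dim V"
proof -
  obtain B where B: "S \<subseteq> B" "B \<subseteq> V" "independent B" "V \<subseteq> span B"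
    using maximal_independent_subset_extend[OF assms(1,2)] by blast
  then have "finite B"
    using independent_span_bound[OF assms(4)] assms(3) by (meson order_trans)
  then show "finite S" "card S \<le> dim V"
    using B(1) finite_subset card_mono[OF _ B(1)] basis_card_eq_dim[OF B(2,4,3)] by auto
qed

end

text \<open>Linear independence of the classes of the \<open>b i\<close> in the quotient space by
  \<open>J\<close>, without forming the quotient.\<close>

definition indep_mod :: "('i, 'k::field) mpoly set \<Rightarrow> ('a \<Rightarrow> ('i, 'k) mpoly) \<Rightarrow> 'a set \<Rightarrow> bool" where
  "indep_mod J b I \<longleftrightarrow> finite I \<and> (\<forall>c. (\<Sum>i\<in>I. Const (c i) * b i) \<in> J \<longrightarrow> (\<forall>i\<in>I. c i = 0))"

lemma indep_mod_mono: "indep_mod J b I \<Longrightarrow> J' \<subseteq> J \<Longrightarrow> indep_mod J' b I"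
  by (auto simp: indep_mod_def)

lemma ideal_subspace: "is_ideal J \<Longrightarrow> mp.subspace J"
  by (auto simp: is_ideal_def mp.subspace_def mscale_def)

lemma biforms_subspace: "mp.subspace (biforms s t)"
  by (auto simp: mp.subspace_def mscale_def)

lemma finite_bidegree: "finite {m :: 'n1::finite + 'n2::finite \<Rightarrow>\<^sub>0 nat. has_bidegree m s t}"
proof -
  have "Poly_Mapping.lookup ` {m :: 'n1 + 'n2 \<Rightarrow>\<^sub>0 nat. has_bidegree m s t}
      \<subseteq> PiE UNIV (\<lambda>_. {..s + t})"
  proof (rule image_subsetI, rule PiE_I, unfold mem_Collect_eq atMost_iff)
    fix m :: "'n1 + 'n2 \<Rightarrow>\<^sub>0 nat" and x assume m: "has_bidegree m s t"
    show "Poly_Mapping.lookup m x \<le> s + t"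
    proof (cases x)
      case (Inl i)
      have "Poly_Mapping.lookup m (Inl i) \<le> (\<Sum>i\<in>UNIV. Poly_Mapping.lookup m (Inl i))"
        by (rule member_le_sum) auto
      then show ?thesis using m Inl by (simp add: has_bidegree_def)
    next
      case (Inr j)
      have "Poly_Mapping.lookup m (Inr j) \<le> (\<Sum>j\<in>UNIV. Poly_Mapping.lookup m (Inr j))"
        by (rule member_le_sum) auto
      then show ?thesis using m Inr by (simp add: has_bidegree_def)
    qed
  qed auto
  then have "finite (Poly_Mapping.lookup ` {m :: 'n1 + 'n2 \<Rightarrow>\<^sub>0 nat. has_bidegree m s t})"
    by (rule finite_subset) (intro finite_PiE, auto)
  then show ?thesis
    by (rule finite_imageD) (simp add: inj_on_def poly_mapping.lookup_inject)
qed

lemma biforms_finite_span: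
  "\<exists>M. finite M \<and> (biforms s t :: ('n1::finite, 'n2::finite, 'k::field) bipoly set) \<subseteq> mp.span M"
proof -
  let ?M = "(\<lambda>m. Poly_Mapping.single m 1) ` {m. has_bidegree m s t} :: ('n1, 'n2, 'k) bipoly set"
  have "F \<in> mp.span ?M" if F: "F \<in> biforms s t" for F
  proof -
    have "F = (\<Sum>m\<in>Poly_Mapping.keys F. mscale (Poly_Mapping.lookup F m) (Poly_Mapping.single m 1))"
      by (subst mpoly_eq_sum_single[of F]) (simp add: mscale_def single_eq_Const_mult[symmetric])
    also have "\<dots> \<in> mp.span ?M"
      using F by (intro mp.span_sum mp.span_scale mp.span_base) (auto simp: biforms_def)
    finally show ?thesis .
  qed
  then show ?thesis using finite_bidegree[of s t] by blast
qed

text \<open>A basis of the part of \<open>J\<close> of bidegree \<open>(s, t)\<close> stays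
  independent when the family \<open>b\<close> is added, since a relation puts a combination of the
  \<open>b i\<close> into \<open>J\<close>. Counting inside \<open>biforms s t\<close> then leaves
  room for \<open>card I\<close> after the subtraction in \<open>hilbert_function\<close>.\<close>

lemma hilbert_function_ge:
  fixes J :: "('n1::finite, 'n2::finite, 'k::field) bipoly set"
  assumes J: "mp.subspace J" and b: "\<And>i. i \<in> I \<Longrightarrow> b i \<in> biforms s t" and ind: "indep_mod J b I"
  shows "card I \<le> hilbert_function J s t"
proof -
  obtain M where M: "finite M" "(biforms s t :: ('n1, 'n2, 'k) bipoly set) \<subseteq> mp.span M"
    using biforms_finite_span by blast
  obtain B0 where B0: "B0 \<subseteq> J \<inter> biforms s t" "mp.independent B0" "J \<inter> biforms s t \<subseteq> mp.span B0"
    "card B0 = mp.dim (J \<inter> biforms s t)"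
    using mp.basis_exists by blast
  have fin: "finite B0"
    by (rule mp.independent_card_le(1)[OF B0(1,2) _ M(1)]) (use M(2) in auto)
  have finI: "finite I" using ind by (simp add: indep_mod_def)
  let ?b = "case_sum (\<lambda>x. x) b"
  have zero: "c k = 0" if c: "(\<Sum>k\<in>B0 <+> I. mscale (c k) (?b k)) = 0" and k: "k \<in> B0 <+> I" for c k
  proof -
    have e: "(\<Sum>x\<in>B0. mscale (c (Inl x)) x) + (\<Sum>i\<in>I. mscale (c (Inr i)) (b i)) = 0"
      using c fin finI by (simp add: sum.Plus)
    have "(\<Sum>x\<in>B0. mscale (c (Inl x)) x) \<in> J"
      using B0(1) by (intro mp.subspace_sum[OF J] mp.subspace_scale[OF J]) auto
    then have "- (\<Sum>x\<in>B0. mscale (c (Inl x)) x) \<in> J" by (rule mp.subspace_neg[OF J])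
    also have "- (\<Sum>x\<in>B0. mscale (c (Inl x)) x) = (\<Sum>i\<in>I. mscale (c (Inr i)) (b i))"
      using e by (simp add: minus_unique)
    finally have I0: "\<forall>i\<in>I. c (Inr i) = 0"
      using ind by (auto simp: indep_mod_def mscale_def dest: spec[of _ "\<lambda>i. c (Inr i)"])
    then have "(\<Sum>x\<in>B0. mscale (c (Inl x)) x) = 0" using e by simp
    then have "\<forall>x\<in>B0. c (Inl x) = 0"
      using B0(2) fin by (auto simp: mp.dependent_finite)
    then show ?thesis using k I0 by auto
  qed
  have fam: "inj_on ?b (B0 <+> I)" "mp.independent (?b ` (B0 <+> I))"
    by (intro mp.independent_family finite_Plus fin finI; erule (1) zero)+
  have "card (?b ` (B0 <+> I)) = card B0 + card I"
    using card_image[OF fam(1)] fin finI by (simp add: card_Plus)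
  moreover have "card (?b ` (B0 <+> I)) \<le> mp.dim (biforms s t :: ('n1, 'n2, 'k) bipoly set)"
    by (rule mp.independent_card_le(2)[OF _ fam(2) M(2,1)]) (use B0(1) b in auto)
  ultimately show ?thesis
    using B0(4) by (simp add: hilbert_function_def)
qed

text \<open>The converse of the preceding bound: a basis of the part in \<open>J\<close> is extended
  to one of all forms, and the added vectors are the family \<open>b\<close>. Upper bounds for a
  Hilbert function are obtained by testing such a family.\<close>

lemma hilbert_function_basis:
  fixes J :: "('n1::finite, 'n2::finite, 'k::field) bipoly set"
  assumes J: "mp.subspace J"
  obtains b :: "nat \<Rightarrow> ('n1, 'n2, 'k) bipoly"
  where "\<And>i. i < hilbert_function J s t \<Longrightarrow> b i \<in> biforms s t"
    "indep_mod J b {..<hilbert_function J s t}"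
proof -
  obtain M where M: "finite M" "(biforms s t :: ('n1, 'n2, 'k) bipoly set) \<subseteq> mp.span M"
    using biforms_finite_span by blast
  obtain B0 where B0: "B0 \<subseteq> J \<inter> biforms s t" "mp.independent B0" "J \<inter> biforms s t \<subseteq> mp.span B0"
    "card B0 = mp.dim (J \<inter> biforms s t)"
    using mp.basis_exists by blast
  obtain B where B: "B0 \<subseteq> B" "B \<subseteq> biforms s t" "mp.independent B" "biforms s t \<subseteq> mp.span B"
    using mp.maximal_independent_subset_extend[of B0 "biforms s t"] B0 by blast
  have fin: "finite B"
    by (rule mp.independent_card_le(1)[OF B(2,3) M(2,1)])
  then have fin0: "finite B0" using B(1) finite_subset by blast
  have "card (B - B0) = hilbert_function J s t"
    using mp.basis_card_eq_dim[OF B(2,4,3)] B0(4) card_Diff_subset[OF fin0 B(1)]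
    by (simp add: hilbert_function_def)
  then obtain b where b: "bij_betw b {..<hilbert_function J s t} (B - B0)"
    using ex_bij_betw_nat_finite[of "B - B0"] fin by (auto simp: lessThan_atLeast0)
  have "indep_mod J b {..<hilbert_function J s t}"
    unfolding indep_mod_def
  proof (intro conjI allI impI ballI)
    fix c i assume c: "(\<Sum>i<hilbert_function J s t. Const (c i) * b i) \<in> J"
      and i: "i \<in> {..<hilbert_function J s t}"
    define g where "g = inv_into {..<hilbert_function J s t} b"
    have eq: "(\<Sum>i<hilbert_function J s t. Const (c i) * b i) = (\<Sum>x\<in>B - B0. mscale (c (g x)) x)"
      by (subst sum.reindex_bij_betw[OF b, symmetric], rule sum.cong)
        (auto simp: mscale_def g_def inv_into_f_f[OF bij_betw_imp_inj_on[OF b]])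
    have "(\<Sum>x\<in>B - B0. mscale (c (g x)) x) \<in> biforms s t"
      using B(2) by (intro mp.subspace_sum[OF biforms_subspace] mp.subspace_scale[OF biforms_subspace]) auto
    then have "(\<Sum>x\<in>B - B0. mscale (c (g x)) x) \<in> mp.span B0"
      using c eq B0(3) by auto
    \<comment> \<open>A combination of the added vectors that lies in \<open>J\<close> is also a
      combination of \<open>B0\<close>; moving it to one side gives a relation on the basis
      \<open>B\<close>, with coefficients \<open>?e\<close>.\<close>
    then obtain d where d: "(\<Sum>x\<in>B - B0. mscale (c (g x)) x) = (\<Sum>x\<in>B0. mscale (d x) x)"
      using mp.span_finite[OF fin0] by auto
    let ?e = "\<lambda>x. if x \<in> B0 then - d x else c (g x)"
    have "(\<Sum>x\<in>B. mscale (?e x) x) = (\<Sum>x\<in>B - B0. mscale (?e x) x) + (\<Sum>x\<in>B0. mscale (?e x) x)"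
      by (rule sum.subset_diff[OF B(1) fin])
    also have "\<dots> = 0" using d by (simp add: sum_negf)
    finally have e0: "(\<Sum>x\<in>B. mscale (?e x) x) = 0" .
    have "\<forall>x\<in>B. ?e x = 0"
    proof (rule ccontr)
      assume "\<not> ?thesis"
      then have "mp.dependent B" unfolding mp.dependent_finite[OF fin] using e0 by (intro exI[of _ ?e]) blast
      then show False using B(3) by simp
    qed
    moreover have "b i \<in> B - B0" using b i by (auto simp: bij_betw_def)
    ultimately have "c (g (b i)) = 0" by (auto split: if_splits)
    then show "c i = 0" using i by (simp add: g_def inv_into_f_f[OF bij_betw_imp_inj_on[OF b]])
  qed auto
  moreover have "b i \<in> biforms s t" if "i < hilbert_function J s t" for i
    using b B(2) that by (auto simp: bij_betw_def)
  ultimately show ?thesis using that by blast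
qed

lemma hilbert_function_antimono:
  fixes J :: "('n1::finite, 'n2::finite, 'k::field) bipoly set"
  assumes "mp.subspace J" "mp.subspace J'" "J \<subseteq> J'"
  shows "hilbert_function J' s t \<le> hilbert_function J s t"
proof -
  obtain b where "\<And>i. i < hilbert_function J' s t \<Longrightarrow> b i \<in> biforms s t"
    "indep_mod J' b {..<hilbert_function J' s t}"
    using hilbert_function_basis[OF assms(2)] by blast
  then show ?thesis
    using hilbert_function_ge[OF assms(1), of "{..<hilbert_function J' s t}" b s t]
      indep_mod_mono[OF _ assms(3)] by auto
qed

text \<open>A family independent modulo \<open>J\<close> has independent vectors of values under the
  functionals \<open>\<phi> i\<close>, because the common kernel of these lies in \<open>J\<close>.
  The vectors live in a space of dimension \<open>card I\<close>.\<close>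

lemma hilbert_function_le:
  fixes J :: "('n1::finite, 'n2::finite, 'k::field) bipoly set" and I :: "'a set"
  assumes J: "mp.subspace J" and I: "finite I"
    and add: "\<And>i F G. \<phi> i (F + G) = \<phi> i F + (\<phi> i G :: 'k)"
    and scale: "\<And>i F c. \<phi> i (Const c * F) = c * \<phi> i F"
    and ker: "\<And>F. F \<in> biforms s t \<Longrightarrow> (\<And>i. i \<in> I \<Longrightarrow> \<phi> i F = 0) \<Longrightarrow> F \<in> J"
  shows "hilbert_function J s t \<le> card I"
proof -
  let ?N = "{..<hilbert_function J s t}"
  obtain b where b: "\<And>i. i < hilbert_function J s t \<Longrightarrow> b i \<in> biforms s t" "indep_mod J b ?N"
    using hilbert_function_basis[OF J] by blast
  define \<Phi> where "\<Phi> = (\<lambda>F i. if i \<in> I then \<phi> i F else 0)"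
  have z: "\<phi> i 0 = 0" for i using scale[of i 0 0] by simp
  have sum: "\<phi> i (\<Sum>n\<in>A. Const (c n) * b n) = (\<Sum>n\<in>A. c n * \<phi> i (b n))" if "finite A" for A i c
    using that by (induction A rule: finite_induct) (simp_all add: z add scale)
  have zero: "c n = 0" if c: "(\<Sum>n\<in>?N. fscale (c n) (\<Phi> (b n))) = 0" and n: "n \<in> ?N" for c n
  proof -
    have "(\<Sum>n\<in>?N. Const (c n) * b n) \<in> J"
    proof (rule ker)
      fix i assume i: "i \<in> I"
      have "\<phi> i (\<Sum>n\<in>?N. Const (c n) * b n) = (\<Sum>n\<in>?N. fscale (c n) (\<Phi> (b n))) i"
        using i by (simp add: sum sum_fun_apply fscale_def \<Phi>_def)
      then show "\<phi> i (\<Sum>n\<in>?N. Const (c n) * b n) = 0" using c by simp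
    qed (use b(1) in auto)
    then show ?thesis using b(2) n by (auto simp: indep_mod_def)
  qed
  have fam: "inj_on (\<lambda>n. \<Phi> (b n)) ?N" "fs.independent ((\<lambda>n. \<Phi> (b n)) ` ?N)"
    by (intro fs.independent_family finite_lessThan; erule (1) zero)+
  define E where "E = (\<lambda>i j. if j = i then 1 else 0 :: 'k) ` I"
  have sub: "(\<lambda>n. \<Phi> (b n)) ` ?N \<subseteq> fs.span E"
  proof clarify
    fix n
    have "\<Phi> (b n) = (\<Sum>i\<in>I. fscale (\<phi> i (b n)) (\<lambda>j. if j = i then 1 else 0))"
      using I by (auto simp: fun_eq_iff sum_fun_apply fscale_def \<Phi>_def sum.delta if_distrib cong: if_cong)
    also have "\<dots> \<in> fs.span E"
      by (intro fs.span_sum fs.span_scale fs.span_base) (auto simp: E_def)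
    finally show "\<Phi> (b n) \<in> fs.span E" .
  qed
  have "card ((\<lambda>n. \<Phi> (b n)) ` ?N) \<le> card E"
    using fs.independent_span_bound[OF _ fam(2) sub] I by (auto simp: E_def)
  also have "\<dots> \<le> card I" unfolding E_def by (rule card_image_le[OF I])
  finally show ?thesis using card_image[OF fam(1)] by simp
qed

text \<open>The substitute for intersection theory. By \<open>colon\<close>, multiplication by
  \<open>H\<close> sends forms independent modulo \<open>J'\<close> to forms independent modulo
  \<open>J\<close>. The products lie in \<open>T\<close>, as do the elements of \<open>J\<close> of
  this bidegree, so forms \<open>e\<close> independent modulo \<open>T\<close> are new. In the
  applications \<open>T\<close> consists of the forms vanishing at given points on \<open>H\<close>,
  along the tangent vector, or on a second component.\<close>

lemma hilbert_function_growth: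
  fixes J J' T :: "('n1::finite, 'n2::finite, 'k::field) bipoly set"
  assumes J: "mp.subspace J" and J': "mp.subspace J'" and T: "mp.subspace T"
    and H: "H \<in> biforms i j"
    and colon: "\<And>F. F \<in> biforms s t \<Longrightarrow> H * F \<in> J \<Longrightarrow> F \<in> J'"
    and JT: "J \<inter> biforms (s + i) (t + j) \<subseteq> T"
    and HT: "\<And>F. F \<in> biforms s t \<Longrightarrow> H * F \<in> T"
    and e: "\<And>k. k \<in> I \<Longrightarrow> e k \<in> biforms (s + i) (t + j)" and ind: "indep_mod T e I"
  shows "hilbert_function J' s t + card I \<le> hilbert_function J (s + i) (t + j)"
proof -
  let ?N = "{..<hilbert_function J' s t}"
  obtain b where b: "\<And>n. n < hilbert_function J' s t \<Longrightarrow> b n \<in> biforms s t" "indep_mod J' b ?N"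
    using hilbert_function_basis[OF J'] by blast
  have finI: "finite I" using ind by (simp add: indep_mod_def)
  let ?b = "case_sum (\<lambda>n. H * b n) e"
  have bif: "?b k \<in> biforms (s + i) (t + j)" if "k \<in> ?N <+> I" for k
    using that b(1) e biforms_mult'[OF H, of _ s t "s + i" "t + j"] by auto
  have "indep_mod J ?b (?N <+> I)"
    unfolding indep_mod_def
  proof (intro conjI allI impI)
    fix c assume c: "(\<Sum>k\<in>?N <+> I. Const (c k) * ?b k) \<in> J"
    define F where "F = (\<Sum>n\<in>?N. Const (c (Inl n)) * b n)"
    define E where "E = (\<Sum>k\<in>I. Const (c (Inr k)) * e k)"
    have F: "F \<in> biforms s t" using b(1) by (auto simp: F_def)
    have eq: "(\<Sum>k\<in>?N <+> I. Const (c k) * ?b k) = H * F + E"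
      using finI by (simp add: sum.Plus F_def E_def sum_distrib_left mult_ac)
    have "(\<Sum>k\<in>?N <+> I. Const (c k) * ?b k) \<in> biforms (s + i) (t + j)"
      using bif by (intro biforms_sum biforms_Const_mult) blast
    then have "H * F + E \<in> T" using c JT eq by auto
    then have "E \<in> T" using mp.subspace_diff[OF T _ HT[OF F], of "H * F + E"] by simp
    then have I0: "\<forall>k\<in>I. c (Inr k) = 0"
      using ind unfolding indep_mod_def E_def by (auto dest: spec[of _ "\<lambda>k. c (Inr k)"])
    then have "E = 0" by (simp add: E_def)
    then have "F \<in> J'" using c eq colon[OF F] by simp
    then have "\<forall>n\<in>?N. c (Inl n) = 0"
      using b(2) unfolding indep_mod_def F_def by (auto dest: spec[of _ "\<lambda>k. c (Inl k)"])
    then show "\<forall>k\<in>?N <+> I. c k = 0" using I0 by auto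
  qed (use finI in auto)
  from hilbert_function_ge[OF J bif this] show ?thesis
    using finI by (simp add: card_Plus)
qed

text \<open>A basis of the span of \<open>A\<close> is extended by \<open>x\<close> and a functional
  is prescribed on it. With finitely many coordinates a functional is \<open>dot\<close> with the
  vector of its values on the unit vectors.\<close>

lemma separating_form:
  fixes x :: "'i::finite \<Rightarrow> 'k::field"
  assumes "x \<notin> fs.span A"
  obtains f where "\<And>v. v \<in> A \<Longrightarrow> dot f v = 0" "dot f x = 1"
proof -
  have vs: "vector_space ((*) :: 'k \<Rightarrow> 'k \<Rightarrow> 'k)"
    by (rule vector_space.intro) (simp_all add: distrib_left distrib_right)
  have vp: "vector_space_pair (fscale :: 'k \<Rightarrow> ('i \<Rightarrow> 'k) \<Rightarrow> 'i \<Rightarrow> 'k) ((*) :: 'k \<Rightarrow> 'k \<Rightarrow> 'k)"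
    by (rule vector_space_pair.intro[OF fs.vector_space_axioms vs])
  obtain B where B: "B \<subseteq> A" "fs.independent B" "A \<subseteq> fs.span B"
    by (metis fs.basis_exists)
  have xB: "x \<notin> fs.span B" using assms fs.span_mono[OF B(1)] by (rule contra_subsetD[rotated])
  have ind: "fs.independent (insert x B)" by (rule fs.independent_insertI[OF xB B(2)])
  obtain L where L: "Vector_Spaces.linear fscale (*) L" "\<forall>v\<in>insert x B. L v = (if v = x then 1 else 0)"
    using vector_space_pair.linear_independent_extend[OF vp ind, where f = "\<lambda>v. if v = x then 1 else 0"]
    by metis
  have L_add: "L (v + w) = L v + L w" and L_scale: "L (fscale c v) = c * L v" for v w c
    using L(1) by (simp_all only: Vector_Spaces.linear_iff)
  have L0: "L 0 = 0" using L_scale[of 0 0] by simp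
  have L_sum: "L (\<Sum>i\<in>A. F i) = (\<Sum>i\<in>A. L (F i))" for A :: "'i set" and F
  proof (induction A rule: infinite_finite_induct)
    case (insert i A)
    then show ?case by (metis L_add sum.insert)
  qed (metis L0 sum.infinite, metis L0 sum.empty)
  define e where "e = (\<lambda>(i::'i) j. if j = i then 1 else 0 :: 'k)"
  define f where "f = (\<lambda>i. L (e i))"
  have Lf: "L v = dot f v" for v
  proof -
    have "v = (\<Sum>i\<in>UNIV. fscale (v i) (e i))"
      by (auto simp: fun_eq_iff sum_fun_apply fscale_def e_def sum.delta if_distrib cong: if_cong)
    then have "L v = L (\<Sum>i\<in>UNIV. fscale (v i) (e i))" by simp
    then show ?thesis by (simp add: L_sum L_scale dot_def f_def mult_ac)
  qed
  have "L v = 0" if "v \<in> fs.span B" for v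
    using that
  proof (induction rule: fs.span_induct_alt)
    case (step c y z)
    have "L y = 0" using step(1) L(2) xB fs.span_base[of y B] by auto
    then show ?case using step.IH by (simp only: L_add L_scale) simp
  qed (rule L0)
  then show ?thesis using that[of f] B(3) L(2) by (auto simp: Lf)
qed

lemma in_span_1: "(x :: 'i \<Rightarrow> 'k::field) \<in> fs.span {a} \<longleftrightarrow> (\<exists>c. x = (\<lambda>i. c * a i))"
  by (auto simp: fs.span_singleton fscale_def)

lemma in_span_2: "(x :: 'i \<Rightarrow> 'k::field) \<in> fs.span {a, u} \<longleftrightarrow> (\<exists>c d. x = (\<lambda>i. c * a i + d * u i))"
proof
  assume "x \<in> fs.span {a, u}"
  then obtain k l where "x - fscale k a = fscale l u"
    by (auto simp: fs.span_breakdown_eq fs.span_singleton)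
  then have "x = (\<lambda>i. k * a i + l * u i)"
    by (auto simp: fscale_def fun_eq_iff algebra_simps)
  then show "\<exists>c d. x = (\<lambda>i. c * a i + d * u i)" by blast
next
  assume "\<exists>c d. x = (\<lambda>i. c * a i + d * u i)"
  then obtain c d where "x = fscale c a + fscale d u" by (auto simp: fscale_def fun_eq_iff)
  then show "x \<in> fs.span {a, u}"
    by (auto intro!: fs.span_add fs.span_scale intro: fs.span_base)
qed

text \<open>The two forms are the coordinates dual to \<open>a\<close> and \<open>u\<close> on the
  plane they span: \<open>f\<close> reads off the coefficient of \<open>u\<close> and
  \<open>f0\<close> that of \<open>a\<close>.\<close>

lemma coordinate_forms:
  fixes a u :: "'i::finite \<Rightarrow> 'k::field"
  assumes "a \<noteq> 0" "u \<notin> fs.span {a}"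
  obtains f f0 where "dot f a = 0" "dot f u = 1" "dot f0 a = 1" "dot f0 u = 0"
proof -
  obtain f where f: "dot f a = 0" "dot f u = 1"
    using separating_form[OF assms(2)] by blast
  have "a \<notin> fs.span {u}"
  proof
    assume "a \<in> fs.span {u}"
    then obtain c where c: "a = (\<lambda>i. c * u i)" by (auto simp: in_span_1)
    then have "c = 0" using f by (simp add: dot_scale)
    then show False using c assms(1) by (simp add: fun_eq_iff)
  qed
  then obtain f0 where "dot f0 u = 0" "dot f0 a = 1" using separating_form by blast
  then show ?thesis using that f by blast
qed

lemma nonzero_form:
  assumes "(a :: 'i::finite \<Rightarrow> 'k::field) \<noteq> 0"
  obtains f where "dot f a = 1"
proof -
  have "a \<notin> fs.span {}" using assms by (simp add: fs.span_empty)
  then show ?thesis using separating_form that by blast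
qed

section \<open>Schemes of degree two supported at a point\<close>

lemma bicomponent_biform: "bicomponent s t F \<in> biforms s t"
  unfolding bicomponent_def by (intro biforms_sum biforms_single) auto

definition bidegs :: "('n1::finite, 'n2::finite, 'k::field) bipoly \<Rightarrow> (nat \<times> nat) set" where
  "bidegs F = (\<lambda>m. (\<Sum>i\<in>UNIV. Poly_Mapping.lookup m (Inl i), \<Sum>j\<in>UNIV. Poly_Mapping.lookup m (Inr j)))
    ` Poly_Mapping.keys F"

lemma finite_bidegs [simp]: "finite (bidegs F)"
  by (simp add: bidegs_def)

lemma sum_bicomponents: "F = (\<Sum>(s, t)\<in>bidegs F. bicomponent s t F)"
proof -
  let ?d = "\<lambda>m. (\<Sum>i\<in>UNIV. Poly_Mapping.lookup m (Inl i), \<Sum>j\<in>UNIV. Poly_Mapping.lookup m (Inr j))"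
  have "(\<Sum>(s, t)\<in>bidegs F. bicomponent s t F)
      = (\<Sum>st\<in>?d ` Poly_Mapping.keys F. \<Sum>m\<in>{m \<in> Poly_Mapping.keys F. ?d m = st}.
          Poly_Mapping.single m (Poly_Mapping.lookup F m))"
    by (intro sum.cong) (auto simp: bidegs_def bicomponent_def has_bidegree_def)
  also have "\<dots> = F"
    by (subst sum.image_gen[symmetric]) (simp_all flip: mpoly_eq_sum_single)
  finally show ?thesis by simp
qed

lemma is_idealD:
  assumes "is_ideal J"
  shows "0 \<in> J" "F \<in> J \<Longrightarrow> G \<in> J \<Longrightarrow> F + G \<in> J" "F \<in> J \<Longrightarrow> H * F \<in> J" "F \<in> J \<Longrightarrow> F * H \<in> J"
    "F \<in> J \<Longrightarrow> - F \<in> J" "F \<in> J \<Longrightarrow> G \<in> J \<Longrightarrow> F - G \<in> J"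
proof -
  have mult: "H * F \<in> J" if "F \<in> J" for F H using assms that by (auto simp: is_ideal_def)
  have add: "F + G \<in> J" if "F \<in> J" "G \<in> J" for F G using assms that by (auto simp: is_ideal_def)
  have neg: "- F \<in> J" if "F \<in> J" for F using mult[OF that, of "-1"] by simp
  show "0 \<in> J" "F \<in> J \<Longrightarrow> G \<in> J \<Longrightarrow> F + G \<in> J" "F \<in> J \<Longrightarrow> H * F \<in> J" "F \<in> J \<Longrightarrow> F * H \<in> J"
    "F \<in> J \<Longrightarrow> - F \<in> J" "F \<in> J \<Longrightarrow> G \<in> J \<Longrightarrow> F - G \<in> J"
    using assms mult neg add[of F G] add[of F "- G"] by (auto simp: is_ideal_def mult.commute)
qed

lemma is_ideal_sum: "is_ideal J \<Longrightarrow> (\<And>x. x \<in> A \<Longrightarrow> F x \<in> J) \<Longrightarrow> sum F A \<in> J"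
  by (induction A rule: infinite_finite_induct) (auto simp: is_idealD)

text \<open>Allows reductions on the multiples of a fixed \<open>F\<close>: it suffices that the
  equations of a point belong to the ideal of multipliers sending \<open>F\<close> into
  \<open>J\<close>.\<close>

lemma is_ideal_colon: "is_ideal J \<Longrightarrow> is_ideal {H. H * F \<in> J}"
  by (auto simp: is_ideal_def distrib_right mult.assoc)

lemma is_ideal_Const_mult_iff:
  assumes "is_ideal J" "c \<noteq> (0::'k::field)"
  shows "Const c * F \<in> J \<longleftrightarrow> F \<in> J"
proof
  assume "Const c * F \<in> J"
  then have "Const (1 / c) * (Const c * F) \<in> J" by (rule is_idealD(3)[OF assms(1)])
  moreover have "Const (1 / c) * (Const c * F) = F"
    using assms(2) by (simp add: mult.assoc[symmetric] Const_mult[symmetric])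
  ultimately show "F \<in> J" by simp
qed (rule is_idealD(3)[OF assms(1)])

text \<open>Modulo the equations of a point every \<open>X i\<close> becomes \<open>a i\<close>
  times \<open>X k\<close> and every \<open>Y j\<close> becomes \<open>b j\<close> times
  \<open>Y l\<close>, which turns a form into its value at \<open>(a, b)\<close> times the one
  remaining monomial.\<close>

lemma biform_mod_point:
  fixes F :: "('n1::finite, 'n2::finite, 'k::field) bipoly"
  assumes J: "is_ideal J"
    and "\<And>i. X i - Const (a i) * X k \<in> J" "\<And>j. Y j - Const (b j) * Y l \<in> J"
    and "F \<in> biforms s t"
  shows "F - Const (bval F a b) * (X k ^ s * Y l ^ t) \<in> J"
  using assms(4)
proof (induction rule: biform_induct)
  case (add s t F G)
  then show ?case using is_idealD(2)[OF J add(3,4)]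
    by (simp add: ev_simps Const_add algebra_simps)
next
  case (scale s t F c)
  then show ?case using is_idealD(3)[OF J scale(2), of "Const c"]
    by (simp add: ev_simps Const_mult algebra_simps)
next
  case (X s t F i)
  have "X i * F - Const (bval (X i * F) a b) * (X k ^ Suc s * Y l ^ t)
    = X i * (F - Const (bval F a b) * (X k ^ s * Y l ^ t))
      + Const (bval F a b) * (X k ^ s * Y l ^ t) * (X i - Const (a i) * X k)"
    by (simp add: ev_simps Const_mult algebra_simps)
  also have "\<dots> \<in> J" using is_idealD(2,3)[OF J] X(2) assms(2) by metis
  finally show ?case .
next
  case (Y s t F j)
  have "Y j * F - Const (bval (Y j * F) a b) * (X k ^ s * Y l ^ Suc t)
    = Y j * (F - Const (bval F a b) * (X k ^ s * Y l ^ t))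
      + Const (bval F a b) * (X k ^ s * Y l ^ t) * (Y j - Const (b j) * Y l)"
    by (simp add: ev_simps Const_mult algebra_simps)
  also have "\<dots> \<in> J" using is_idealD(2,3)[OF J] Y(2) assms(3) by metis
  finally show ?case .
qed (use J is_idealD(1)[OF J] in \<open>simp_all\<close>)

section \<open>Points of a projective space\<close>

lemma proj_space_iff: "proj_pt a \<in> proj_space \<longleftrightarrow> a \<noteq> 0"
proof
  assume "proj_pt a \<in> proj_space"
  then obtain v where v: "v \<noteq> 0" "proj_pt a = proj_pt v" by (auto simp: proj_space_def)
  then have "v \<in> fs.span {a}" using fs.span_base[of v "{v}"] by (simp add: proj_pt_def)
  then show "a \<noteq> 0" using v(1) by auto
qed (auto simp: proj_space_def)

lemma mem_proj_pt: "x \<in> proj_pt a \<longleftrightarrow> (\<exists>c. x = (\<lambda>i. c * a i))"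
  by (simp add: proj_pt_def in_span_1)

lemma self_mem_proj_pt [simp, intro]: "a \<in> proj_pt a"
  by (simp add: proj_pt_def fs.span_base)

lemma proj_pt_scale: "c \<noteq> 0 \<Longrightarrow> proj_pt (\<lambda>i. c * a i) = proj_pt a"
proof -
  assume c: "c \<noteq> 0"
  have "x \<in> proj_pt (\<lambda>i. c * a i) \<longleftrightarrow> x \<in> proj_pt a" for x
  proof
    assume "x \<in> proj_pt a"
    then obtain d where "x = (\<lambda>i. d * a i)" by (auto simp: mem_proj_pt)
    then have "x = (\<lambda>i. (d / c) * (c * a i))" using c by (auto simp: fun_eq_iff)
    then show "x \<in> proj_pt (\<lambda>i. c * a i)" unfolding mem_proj_pt by blast
  next
    assume "x \<in> proj_pt (\<lambda>i. c * a i)"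
    then obtain d where "x = (\<lambda>i. d * (c * a i))" by (auto simp: mem_proj_pt)
    then have "x = (\<lambda>i. (d * c) * a i)" by (simp add: mult.assoc)
    then show "x \<in> proj_pt a" unfolding mem_proj_pt by blast
  qed
  then show ?thesis by blast
qed

lemma proj_pt_eq_iff:
  assumes "a \<noteq> 0"
  shows "proj_pt a = proj_pt b \<longleftrightarrow> (\<exists>c. c \<noteq> 0 \<and> b = (\<lambda>i. c * a i))"
    and "b \<noteq> 0 \<Longrightarrow> proj_pt a = proj_pt b \<longleftrightarrow> b \<in> fs.span {a}"
proof -
  show 1: "proj_pt a = proj_pt b \<longleftrightarrow> (\<exists>c. c \<noteq> 0 \<and> b = (\<lambda>i. c * a i))"
  proof
    assume "proj_pt a = proj_pt b"
    then have "b \<in> proj_pt a" "a \<in> proj_pt b" by auto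
    then obtain c where c: "b = (\<lambda>i. c * a i)" by (auto simp: mem_proj_pt)
    obtain d where d: "a = (\<lambda>i. d * b i)" using \<open>a \<in> proj_pt b\<close> by (auto simp: mem_proj_pt)
    obtain i where "a i \<noteq> 0" using assms by (auto simp: fun_eq_iff)
    then have "c \<noteq> 0" using fun_cong[OF c, of i] fun_cong[OF d, of i]
      by (metis mult_zero_left mult_zero_right)
    then show "\<exists>c. c \<noteq> 0 \<and> b = (\<lambda>i. c * a i)" using c by blast
  qed (auto simp: proj_pt_scale)
  assume b: "b \<noteq> 0"
  have "c \<noteq> 0" if "b = (\<lambda>i. c * a i)" for c
  proof
    assume "c = 0"
    then have "b = (\<lambda>i. 0)" using that by simp
    then show False using b by (simp add: zero_fun_def)
  qed
  then show "proj_pt a = proj_pt b \<longleftrightarrow> b \<in> fs.span {a}"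
    unfolding 1 in_span_1 by blast
qed

lemma mvalue_bicone_point:
  fixes F :: "('n1::finite, 'n2::finite, 'k::field) bipoly"
  assumes "\<And>s t. bval (bicomponent s t F) a b = 0" "v \<in> bicone {(proj_pt a, proj_pt b)}"
  shows "mvalue F v = 0"
proof -
  obtain c d where v: "v = case_sum (\<lambda>i. c * a i) (\<lambda>j. d * b j)"
    using assms(2) by (auto simp: bicone_def mem_proj_pt)
  have "mvalue F v = (\<Sum>(s, t)\<in>bidegs F. mvalue (bicomponent s t F) v)"
    by (subst (1) sum_bicomponents[of F]) (simp add: ev_simps case_prod_beta)
  also have "\<dots> = 0"
    by (intro sum.neutral) (simp add: v case_prod_beta bval_scale[OF bicomponent_biform] assms(1))
  finally show ?thesis .
qed

lemma ex_biform_nonzero: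
  fixes a :: "'n1::finite \<Rightarrow> 'k::field" and b :: "'n2::finite \<Rightarrow> 'k"
  assumes "a \<noteq> 0" "b \<noteq> 0"
  obtains E where "E \<in> biforms s t" "bval E a b = 1"
proof -
  obtain f g where "dot f a = 1" "dot g b = 1" using nonzero_form assms by metis
  moreover have "(lin1 f ^ s * lin2 g ^ t :: ('n1, 'n2, 'k) bipoly) \<in> biforms s t"
    using biforms_power[OF lin1_biform[of f], of s] biforms_power[OF lin2_biform[of g], of t]
    by (intro biforms_mult'[where s = s and t = 0 and s' = 0 and t' = t]) auto
  ultimately show ?thesis using that[of "lin1 f ^ s * lin2 g ^ t"] by (simp add: ev_simps)
qed

section \<open>Saturated ideals\<close>

lemma closed_subschemeD:
  assumes "closed_subscheme W"
  shows "is_ideal W" "F \<in> W \<Longrightarrow> bicomponent s t F \<in> W"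
    "(\<And>i. X i * F \<in> W) \<Longrightarrow> F \<in> W" "(\<And>j. Y j * F \<in> W) \<Longrightarrow> F \<in> W"
    "(\<And>i j. X i * Y j * F \<in> W) \<Longrightarrow> F \<in> W"
proof -
  show J: "is_ideal W" and "F \<in> W \<Longrightarrow> bicomponent s t F \<in> W"
    and sat: "(\<And>i j. X i * Y j * F \<in> W) \<Longrightarrow> F \<in> W"
    using assms by (auto simp: closed_subscheme_def)
  show "F \<in> W" if "\<And>i. X i * F \<in> W"
  proof (rule sat)
    fix i j
    have "Y j * (X i * F) \<in> W" by (rule is_idealD(3)[OF J that])
    then show "X i * Y j * F \<in> W" by (simp add: mult_ac)
  qed
  show "F \<in> W" if "\<And>j. Y j * F \<in> W"
  proof (rule sat)
    fix i j
    have "X i * (Y j * F) \<in> W" by (rule is_idealD(3)[OF J that])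
    then show "X i * Y j * F \<in> W" by (simp add: mult_ac)
  qed
qed

text \<open>The saturation condition removes one variable at a time, the factor being moved from
  \<open>M\<close> onto \<open>F\<close>.\<close>

lemma closed_subscheme_saturated:
  fixes W :: "('n1::finite, 'n2::finite, 'k::field) bipoly set"
  assumes "closed_subscheme W" "\<And>M. M \<in> biforms s t \<Longrightarrow> M * F \<in> W"
  shows "F \<in> W"
  using assms(2)
proof (induction s arbitrary: F)
  case 0
  then show ?case
  proof (induction t arbitrary: F)
    case 0
    then show ?case using biforms_one by (metis mult_1)
  next
    case (Suc t)
    show ?case
    proof (rule closed_subschemeD(4)[OF assms(1)], rule Suc.IH)
      fix j and M :: "('n1, 'n2, 'k) bipoly" assume "M \<in> biforms 0 t"
      then have "M * Y j \<in> biforms 0 (Suc t)" using biforms_mult[OF _ biforms_Y, of M 0 t] by simp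
      from Suc.prems[OF this] show "M * (Y j * F) \<in> W" by (simp add: mult_ac)
    qed
  qed
next
  case (Suc s)
  show ?case
  proof (rule closed_subschemeD(3)[OF assms(1)], rule Suc.IH)
    fix i and M :: "('n1, 'n2, 'k) bipoly" assume "M \<in> biforms s t"
    then have "M * X i \<in> biforms (Suc s) t" using biforms_mult[OF _ biforms_X, of M s t] by simp
    from Suc.prems[OF this] show "M * (X i * F) \<in> W" by (simp add: mult_ac)
  qed
qed

text \<open>The hypotheses on \<open>H\<close> make \<open>X i * Y j\<close> act on it modulo
  \<open>W\<close> as the scalar \<open>a i * b j\<close> times \<open>X k * Y l\<close>. So a
  single product of variables decides about saturation, and its powers are removed by
  induction.\<close>

lemma colon_point_saturated:
  assumes W: "closed_subscheme W"
    and H: "\<And>i. (X i - Const (a i) * X k) * H \<in> W" "\<And>j. (Y j - Const (b j) * Y l) * H \<in> W"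
    and "X k ^ s * Y l ^ t * H \<in> W"
  shows "H \<in> W"
proof -
  note J = closed_subschemeD(1)[OF W]
  have step: "H \<in> W" if "\<And>i. (X i - Const (a i) * X k) * H \<in> W"
    "\<And>j. (Y j - Const (b j) * Y l) * H \<in> W" "X k * Y l * H \<in> W" for H
  proof (rule closed_subschemeD(5)[OF W])
    fix i j
    have "X i * Y j * H = Y j * ((X i - Const (a i) * X k) * H)
        + (Const (a i) * X k) * ((Y j - Const (b j) * Y l) * H) + Const (a i) * Const (b j) * (X k * Y l * H)"
      by (simp add: algebra_simps)
    also have "\<dots> \<in> W" by (intro is_idealD(2,3)[OF J] that)
    finally show "X i * Y j * H \<in> W" .
  qed
  have pow: "H \<in> W" if "\<And>i. (X i - Const (a i) * X k) * H \<in> W"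
    "\<And>j. (Y j - Const (b j) * Y l) * H \<in> W" "(X k * Y l) ^ n * H \<in> W" for n H
    using that
  proof (induction n arbitrary: H)
    case (Suc n)
    have "X k * Y l * H \<in> W"
    proof (rule Suc.IH)
      show "(X i - Const (a i) * X k) * (X k * Y l * H) \<in> W" for i
        using is_idealD(3)[OF J Suc.prems(1), of "X k * Y l"] by (simp add: mult_ac)
      show "(Y i - Const (b i) * Y l) * (X k * Y l * H) \<in> W" for i
        using is_idealD(3)[OF J Suc.prems(2), of "X k * Y l"] by (simp add: mult_ac)
      show "(X k * Y l) ^ n * (X k * Y l * H) \<in> W" using Suc.prems(3) by (simp add: mult_ac)
    qed
    then show ?case using step Suc.prems by blast
  qed simp
  \<comment> \<open>The exponents are equalised so that a power of the product
    \<open>X k * Y l\<close> appears.\<close>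
  have "X k ^ t * Y l ^ s * (X k ^ s * Y l ^ t * H) \<in> W" by (rule is_idealD(3)[OF J assms(4)])
  then have "(X k * Y l) ^ (s + t) * H \<in> W"
    by (simp add: power_mult_distrib power_add mult_ac)
  then show ?thesis using pow H by blast
qed

text \<open>
  In large bidegrees the forms vanishing at the support of \<open>W\<close> are one-dimensional modulo \<open>W\<close>.
  Multiplication by the variables on a generator \<open>F0\<close> of this space therefore picks out a common
  zero of \<open>W\<close>, which has to be the support; so the ideal of the support kills \<open>F0\<close>.
  Hence the square of that ideal is contained in \<open>W\<close>, and first order Taylor expansion describes \<open>W\<close>.
\<close>

lemma degree_two_scheme:
  fixes W :: "('n1::finite, 'n2::finite, 'k::field) bipoly set"
  assumes W2: "zero_dim_scheme W 2" and pt: "zero_locus W = {pt}"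
  obtains a b u w where "a \<noteq> 0" "b \<noteq> 0" "pt = (proj_pt a, proj_pt b)"
    "\<not> (u \<in> fs.span {a} \<and> w \<in> fs.span {b})"
    "\<And>F s t. F \<in> biforms s t \<Longrightarrow> F \<in> W \<longleftrightarrow> bval F a b = 0 \<and> bdiff F a b u w = 0"
proof -
  have W: "closed_subscheme W" using W2 by (simp add: zero_dim_scheme_def)
  note J = closed_subschemeD(1)[OF W]
  note Jadd = is_idealD(2)[OF J] and Jmul = is_idealD(3)[OF J] and Jdiff = is_idealD(6)[OF J]
  obtain N0 where N0: "\<And>s t. s \<ge> N0 \<Longrightarrow> t \<ge> N0 \<Longrightarrow> hilbert_function W s t = 2"
    using W2 by (auto simp: zero_dim_scheme_def)
  \<comment> \<open>One more than the bound for the Hilbert function, so that a linear factor can be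
    split off in bidegree \<open>(N, N)\<close>.\<close>
  define N where "N = Suc N0"
  have HF: "hilbert_function W s t = 2" if "s \<ge> N" "t \<ge> N" for s t
    using N0 that by (simp add: N_def)
  have "pt \<in> biproj_space" using pt by (auto simp: zero_locus_def)
  then obtain a0 b0 where a0: "a0 \<noteq> 0" "b0 \<noteq> 0" "pt = (proj_pt a0, proj_pt b0)"
    by (auto simp: biproj_space_def proj_space_def)
  have W0: "bval F a0 b0 = 0" if "F \<in> W" for F
  proof -
    have "case_sum a0 b0 \<in> bicone {pt}" unfolding bicone_def a0 by blast
    moreover have "pt \<in> zero_locus W" using pt by simp
    ultimately show ?thesis using that by (auto simp: zero_locus_def)
  qed
  \<comment> \<open>A form with value 1 at the support together with \<open>F\<close> and
    \<open>G\<close> would be three forms independent modulo \<open>W\<close>, while the Hilbert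
    function is 2.\<close>
  have one_dim: "\<exists>c. G - Const c * F \<in> W" if FG: "F \<in> biforms s t" "G \<in> biforms s t"
    "bval F a0 b0 = 0" "bval G a0 b0 = 0" "F \<notin> W" and st: "s \<ge> N" "t \<ge> N" for F G s t
  proof (rule ccontr)
    assume no: "\<not> ?thesis"
    obtain E where E: "E \<in> biforms s t" "bval E a0 b0 = 1"
      using ex_biform_nonzero a0 by blast
    define e where "e = (\<lambda>n::nat. if n = 0 then E else if n = 1 then F else G)"
    have "indep_mod W e {..<3}"
      unfolding indep_mod_def
    proof (intro conjI allI impI)
      fix c assume "(\<Sum>i<3. Const (c i) * e i) \<in> W"
      then have *: "Const (c 0) * E + Const (c 1) * F + Const (c 2) * G \<in> W"
        by (simp add: e_def numeral_3_eq_3 numeral_2_eq_2)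
      have "bval (Const (c 0) * E + Const (c 1) * F + Const (c 2) * G) a0 b0 = 0" by (rule W0[OF *])
      then have c0: "c 0 = 0" using E FG by (simp add: ev_simps)
      have c2: "c 2 = 0"
      proof (rule ccontr)
        assume c2: "c 2 \<noteq> 0"
        have "Const (1 / c 2) * (Const (c 0) * E + Const (c 1) * F + Const (c 2) * G) \<in> W" by (rule Jmul[OF *])
        also have "Const (1 / c 2) * (Const (c 0) * E + Const (c 1) * F + Const (c 2) * G)
            = (Const (1 / c 2) * Const (c 2)) * G + Const (1 / c 2) * Const (c 1) * F"
          by (simp add: c0 algebra_simps)
        also have "\<dots> = G - Const (- (c 1 / c 2)) * F"
          using c2 by (simp add: Const_mult[symmetric] Const_uminus)
        finally show False using no by blast
      qed
      have "c 1 = 0" using * c0 c2 is_ideal_Const_mult_iff[OF J, of "c 1" F] FG(5) by auto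
      then show "\<forall>i\<in>{..<3}. c i = 0" using c0 c2 by (auto simp: numeral_3_eq_3 numeral_2_eq_2 less_Suc_eq)
    qed simp
    then have "card {..<3::nat} \<le> hilbert_function W s t"
      by (rule hilbert_function_ge[OF ideal_subspace[OF J], rotated]) (use E FG in \<open>auto simp: e_def\<close>)
    then show False using HF[OF st] by simp
  qed
  \<comment> \<open>Otherwise the value at the support would be the only functional needed, and the
    Hilbert function would be at most 1.\<close>
  have nontriv: "\<exists>F. F \<in> biforms s t \<and> bval F a0 b0 = 0 \<and> F \<notin> W" if "s \<ge> N" "t \<ge> N" for s t
  proof (rule ccontr)
    assume no: "\<not> ?thesis"
    have "hilbert_function W s t \<le> card {()}"
      by (rule hilbert_function_le[OF ideal_subspace[OF J], where \<phi> = "\<lambda>_ F. bval F a0 b0"])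
        (use no in \<open>auto simp: ev_simps\<close>)
    then show False using HF[OF that] by simp
  qed
  obtain F0 where F0: "F0 \<in> biforms N N" "bval F0 a0 b0 = 0" "F0 \<notin> W" using nontriv by blast
  obtain F1 where F1: "F1 \<in> biforms (Suc N) N" "bval F1 a0 b0 = 0" "F1 \<notin> W"
    using nontriv[of "Suc N" N] by auto
  obtain F2 where F2: "F2 \<in> biforms N (Suc N)" "bval F2 a0 b0 = 0" "F2 \<notin> W"
    using nontriv[of N "Suc N"] by auto
  have "\<exists>c. X i * F0 - Const c * F1 \<in> W" for i
    using F0 F1 biforms_mult'[OF biforms_X F0(1)] by (intro one_dim) (auto simp: ev_simps)
  \<comment> \<open>\<open>x\<close> collects the factors of the \<open>X i * F0\<close> with
    respect to the generator \<open>F1\<close> of the next bidegree. Saturation forbids that all of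
    them vanish, and likewise for \<open>y\<close>.\<close>
  then obtain x where x: "\<And>i. X i * F0 - Const (x i) * F1 \<in> W" by metis
  have "\<exists>c. Y j * F0 - Const c * F2 \<in> W" for j
    using F0 F2 biforms_mult'[OF biforms_Y F0(1)] by (intro one_dim) (auto simp: ev_simps)
  then obtain y where y: "\<And>j. Y j * F0 - Const (y j) * F2 \<in> W" by metis
  obtain k where k: "x k \<noteq> 0"
  proof (rule ccontr)
    assume "\<not> thesis"
    then have "\<And>i. x i = 0" using that by auto
    then have "\<And>i. X i * F0 \<in> W" using x by (metis Const_0 diff_zero mult_zero_left)
    then show False using closed_subschemeD(3)[OF W] F0(3) by blast
  qed
  obtain l where l: "y l \<noteq> 0"
  proof (rule ccontr)
    assume "\<not> thesis"
    then have "\<And>i. y i = 0" using that by auto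
    then have "\<And>i. Y i * F0 \<in> W" using y by (metis Const_0 diff_zero mult_zero_left)
    then show False using closed_subschemeD(4)[OF W] F0(3) by blast
  qed
  define a where "a = (\<lambda>i. x i / x k)"
  define b where "b = (\<lambda>j. y j / y l)"
  have ak: "a k = 1" and bl: "b l = 1" using k l by (auto simp: a_def b_def)
  define f where "f = (\<lambda>i. X i - Const (a i) * X k :: ('n1, 'n2, 'k) bipoly)"
  define g where "g = (\<lambda>j. Y j - Const (b j) * Y l :: ('n1, 'n2, 'k) bipoly)"
  \<comment> \<open>\<open>f i\<close> and \<open>g j\<close> are the equations of the point with
    coordinates \<open>a\<close>, \<open>b\<close>; by the choice of \<open>x\<close> and
    \<open>y\<close> they annihilate \<open>F0\<close> modulo \<open>W\<close>.\<close>
  have fF0: "f i * F0 \<in> W" for i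
  proof -
    have "f i * F0 = (X i * F0 - Const (x i) * F1) - Const (a i) * (X k * F0 - Const (x k) * F1)
        + (Const (x i) - Const (a i) * Const (x k)) * F1"
      by (simp add: f_def algebra_simps)
    also have "Const (x i) - Const (a i) * Const (x k) = (0 :: ('n1, 'n2, 'k) bipoly)"
      using k by (simp add: a_def Const_mult[symmetric])
    also have "(X i * F0 - Const (x i) * F1) - Const (a i) * (X k * F0 - Const (x k) * F1) + 0 * F1 \<in> W"
      using Jdiff[OF x[of i] Jmul[OF x[of k], of "Const (a i)"]] by simp
    finally show ?thesis .
  qed
  have gF0: "g j * F0 \<in> W" for j
  proof -
    have "g j * F0 = (Y j * F0 - Const (y j) * F2) - Const (b j) * (Y l * F0 - Const (y l) * F2)
        + (Const (y j) - Const (b j) * Const (y l)) * F2"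
      by (simp add: g_def algebra_simps)
    also have "Const (y j) - Const (b j) * Const (y l) = (0 :: ('n1, 'n2, 'k) bipoly)"
      using l by (simp add: b_def Const_mult[symmetric])
    also have "(Y j * F0 - Const (y j) * F2) - Const (b j) * (Y l * F0 - Const (y l) * F2) + 0 * F2 \<in> W"
      using Jdiff[OF y[of j] Jmul[OF y[of l], of "Const (b j)"]] by simp
    finally show ?thesis .
  qed
  have kill: "H \<in> W" if "\<And>i. f i * H \<in> W" "\<And>j. g j * H \<in> W" "X k ^ s * Y l ^ t * H \<in> W" for H s t
    using colon_point_saturated[OF W, of a k H b l s t] that by (simp add: f_def g_def)
  have modpt: "F - Const (bval F a b) * (X k ^ s * Y l ^ t) \<in> I"
    if "is_ideal I" "\<And>i. f i \<in> I" "\<And>j. g j \<in> I" "F \<in> biforms s t" for I F s t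
    using biform_mod_point[of I a k b l F s t] that by (simp add: f_def g_def)
  \<comment> \<open>Reducing \<open>F\<close> on multiples of \<open>F0\<close> leaves its value at
    \<open>(a, b)\<close> times a monomial; a nonzero value would force \<open>F0\<close> into
    \<open>W\<close> by saturation.\<close>
  have Wab: "bval F a b = 0" if F: "F \<in> W" "F \<in> biforms s t" for F s t
  proof (rule ccontr)
    assume ne: "bval F a b \<noteq> 0"
    have "F - Const (bval F a b) * (X k ^ s * Y l ^ t) \<in> {H. H * F0 \<in> W}"
      by (rule modpt[OF is_ideal_colon[OF J]]) (use fF0 gF0 F in auto)
    then have "(F - Const (bval F a b) * (X k ^ s * Y l ^ t)) * F0 \<in> W" by simp
    from Jdiff[OF Jmul[OF F(1), of F0] this] have "Const (bval F a b) * (X k ^ s * Y l ^ t * F0) \<in> W"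
      by (simp add: algebra_simps)
    then have "X k ^ s * Y l ^ t * F0 \<in> W" using is_ideal_Const_mult_iff[OF J ne] by blast
    then show False using kill[OF fF0 gF0] F0(3) by blast
  qed
  have a_nz: "a \<noteq> 0" "b \<noteq> 0" using ak bl by auto
  have "(proj_pt a, proj_pt b) \<in> zero_locus W"
    unfolding zero_locus_def
  proof (intro CollectI conjI ballI)
    show "(proj_pt a, proj_pt b) \<in> biproj_space"
      using a_nz by (simp add: biproj_space_def proj_space_iff)
    show "mvalue F v = 0" if "F \<in> W" "v \<in> bicone {(proj_pt a, proj_pt b)}" for F v
      using Wab[OF closed_subschemeD(2)[OF W that(1)] bicomponent_biform] that(2)
      by (rule mvalue_bicone_point)
  qed
  then have pt_ab: "pt = (proj_pt a, proj_pt b)" using pt by simp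
  obtain c d where cd: "c \<noteq> 0" "d \<noteq> 0" "a0 = (\<lambda>i. c * a i)" "b0 = (\<lambda>j. d * b j)"
    using a0(3) pt_ab proj_pt_eq_iff(1)[OF a_nz(1)] proj_pt_eq_iff(1)[OF a_nz(2)] by auto
  have v0: "bval F a0 b0 = 0 \<longleftrightarrow> bval F a b = 0" if "F \<in> biforms s t" for F s t
    using bval_scale[OF that, of c a d b] cd by simp
  have f_bif: "f i \<in> biforms (Suc 0) 0" for i unfolding f_def by auto
  have g_bif: "g j \<in> biforms 0 (Suc 0)" for j unfolding g_def by auto
  have fv: "bval (f i) a b = 0" for i by (simp add: f_def ev_simps ak)
  have gv: "bval (g j) a b = 0" for j by (simp add: g_def ev_simps bl)
  have genF0: "\<exists>c. H - Const c * F0 \<in> W" if "H \<in> biforms N N" "bval H a b = 0" for H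
    using one_dim[OF F0(1) that(1) F0(2) _ F0(3)] v0[OF that(1)] that(2) by simp
  have fN: "f i * H \<in> W" and gN: "g j * H \<in> W" if H: "H \<in> biforms N N" "bval H a b = 0" for H i j
  proof -
    obtain c where c: "H - Const c * F0 \<in> W" using genF0[OF H] by blast
    have "f i * (H - Const c * F0) + Const c * (f i * F0) \<in> W" by (rule Jadd[OF Jmul[OF c] Jmul[OF fF0]])
    then show "f i * H \<in> W" by (simp add: algebra_simps)
    have "g j * (H - Const c * F0) + Const c * (g j * F0) \<in> W" by (rule Jadd[OF Jmul[OF c] Jmul[OF gF0]])
    then show "g j * H \<in> W" by (simp add: algebra_simps)
  qed
  \<comment> \<open>After multiplication by \<open>M\<close> the second factor becomes a form of
    bidegree \<open>(N, N)\<close> vanishing at the point, which the first factor carries into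
    \<open>W\<close>; saturation removes \<open>M\<close> again.\<close>
  have sq_f: "f i * f i' \<in> W" "g j * f i' \<in> W" for i i' j
  proof -
    have "f i' * M \<in> biforms N N" if "M \<in> biforms N0 N" for M
      using that by (intro biforms_mult'[OF f_bif]) (auto simp: N_def)
    then have "f i * (f i' * M) \<in> W" "g j * (f i' * M) \<in> W" if "M \<in> biforms N0 N" for M
      using that by (auto intro!: fN gN simp: ev_simps fv)
    then have "M * (f i * f i') \<in> W" "M * (g j * f i') \<in> W" if "M \<in> biforms N0 N" for M
      using that by (auto simp: mult_ac)
    then show "f i * f i' \<in> W" "g j * f i' \<in> W"
      using closed_subscheme_saturated[OF W] by blast+
  qed
  have sq_g: "g j * g j' \<in> W" for j j'
  proof -
    have "g j' * M \<in> biforms N N" if "M \<in> biforms N N0" for M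
      using that by (intro biforms_mult'[OF g_bif]) (auto simp: N_def)
    then have "g j * (g j' * M) \<in> W" if "M \<in> biforms N N0" for M
      using that by (auto intro!: gN simp: ev_simps gv)
    then have "M * (g j * g j') \<in> W" if "M \<in> biforms N N0" for M
      using that by (auto simp: mult_ac)
    then show "g j * g j' \<in> W" using closed_subscheme_saturated[OF W] by blast
  qed
  have sq_fg: "f i * g j \<in> W" for i j using sq_f(2)[of j i] by (simp add: mult.commute)
  have killed: "f i * F \<in> W" "g j * F \<in> W" if F: "F \<in> biforms s t" "bval F a b = 0" for F s t i j
  proof -
    have "F - Const (bval F a b) * (X k ^ s * Y l ^ t) \<in> {H. H * f i \<in> W}"
      by (rule modpt[OF is_ideal_colon[OF J]]) (use sq_f sq_fg F in \<open>auto simp: mult.commute\<close>)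
    then show "f i * F \<in> W" using F(2) by (simp add: mult.commute)
    have "F - Const (bval F a b) * (X k ^ s * Y l ^ t) \<in> {H. H * g j \<in> W}"
      by (rule modpt[OF is_ideal_colon[OF J]]) (use sq_g sq_fg F in \<open>auto simp: mult.commute\<close>)
    then show "g j * F \<in> W" using F(2) by (simp add: mult.commute)
  qed
  have kill': "F \<in> W" if "F \<in> biforms s t" "bval F a b = 0" "X k ^ s' * Y l ^ t' * F \<in> W" for F s t s' t'
    using kill[OF killed(1)[OF that(1,2)] killed(2)[OF that(1,2)] that(3)] .
  have fY_bif: "f i * Y l \<in> biforms 1 1" and gX_bif: "X k * g j \<in> biforms 1 1" for i j
    using biforms_mult[OF f_bif biforms_Y] biforms_mult[OF biforms_X g_bif] by auto
  have fY_v: "bval (f i * Y l) a b = 0" and gX_v: "bval (X k * g j) a b = 0" for i j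
    by (simp_all add: ev_simps fv gv)
  \<comment> \<open>A generator already exists in bidegree (1, 1): if all \<open>f i * Y l\<close>
    and \<open>X k * g j\<close> were in \<open>W\<close>, then all equations of the point would be,
    and with them \<open>F0\<close>, which vanishes there.\<close>
  obtain G0 where G0: "G0 \<in> biforms 1 1" "bval G0 a b = 0" "G0 \<notin> W"
  proof (rule ccontr)
    assume no: "\<not> thesis"
    have fW: "f i \<in> W" for i
    proof -
      have "f i * Y l \<in> W" using no that fY_bif fY_v by blast
      then have "X k * (f i * Y l) \<in> W" by (rule Jmul)
      then have "X k ^ 1 * Y l ^ 1 * f i \<in> W" by (simp add: mult_ac)
      then show ?thesis using kill'[OF f_bif fv] by blast
    qed
    have gW: "g j \<in> W" for j
    proof -
      have "X k * g j \<in> W" using no that gX_bif gX_v by blast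
      then have "Y l * (X k * g j) \<in> W" by (rule Jmul)
      then have "X k ^ 1 * Y l ^ 1 * g j \<in> W" by (simp add: mult_ac)
      then show ?thesis using kill'[OF g_bif gv] by blast
    qed
    have "F0 - Const (bval F0 a b) * (X k ^ N * Y l ^ N) \<in> W"
      by (rule modpt[OF J fW gW F0(1)])
    then show False using F0(2,3) v0[OF F0(1)] by simp
  qed
  \<comment> \<open>Multiplication by a monomial moves the question to bidegree
    \<open>(N, N)\<close>, where one-dimensionality is known, and saturation brings the relation
    back.\<close>
  have genG0: "\<exists>c. H - Const c * G0 \<in> W" if H: "H \<in> biforms 1 1" "bval H a b = 0" for H
  proof -
    let ?Z = "X k ^ N0 * Y l ^ N0 :: ('n1, 'n2, 'k) bipoly"
    have "?Z \<in> biforms N0 N0"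
      using biforms_mult[OF biforms_power[OF biforms_X, where n = N0] biforms_power[OF biforms_Y, where n = N0]]
      by simp
    then have Z: "?Z * H \<in> biforms N N" "?Z * G0 \<in> biforms N N"
      using biforms_mult[OF _ H(1), of ?Z] biforms_mult[OF _ G0(1), of ?Z] by (auto simp: N_def)
    have "?Z * G0 \<notin> W" using kill'[OF G0(1,2)] G0(3) by blast
    then obtain c where "?Z * H - Const c * (?Z * G0) \<in> W"
      using one_dim[OF Z(2,1)] v0[OF Z(1)] v0[OF Z(2)] H(2) G0(2) by (auto simp: ev_simps)
    then have "?Z * (H - Const c * G0) \<in> W" by (simp add: algebra_simps)
    moreover have "H - Const c * G0 \<in> biforms 1 1" using H(1) G0(1) by auto
    ultimately have "H - Const c * G0 \<in> W"
      using kill'[of "H - Const c * G0" 1 1] H(2) G0(2) by (simp add: ev_simps)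
    then show ?thesis by blast
  qed
  \<comment> \<open>The tangent direction: \<open>u i\<close> and \<open>w j\<close> are the
    coordinates of the linear terms \<open>f i * Y l\<close> and \<open>X k * g j\<close> with
    respect to \<open>G0\<close>.\<close>
  obtain u where u: "\<And>i. f i * Y l - Const (u i) * G0 \<in> W" using genG0[OF fY_bif fY_v] by metis
  obtain w where w: "\<And>j. X k * g j - Const (w j) * G0 \<in> W" using genG0[OF gX_bif gX_v] by metis
  \<comment> \<open>Taylor expansion to first order, multiplied by \<open>X k * Y l\<close> because
    the generator \<open>G0\<close> of the first order terms has bidegree (1, 1). Terms of second
    order are products of an equation of the point with \<open>G0\<close> and lie in
    \<open>W\<close>.\<close>
  have taylor: "X k * Y l * F - Const (bval F a b) * (X k ^ Suc s * Y l ^ Suc t)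
      - Const (bdiff F a b u w) * (X k ^ s * Y l ^ t * G0) \<in> W" if "F \<in> biforms s t" for F s t
    using that
  proof (induction rule: biform_induct)
    case (add s t F G)
    then show ?case using Jadd[OF add(3,4)]
      by (simp add: ev_simps mdiff_simps Const_add algebra_simps)
  next
    case (scale s t F c)
    then show ?case using Jmul[OF scale(2), of "Const c"]
      by (simp add: ev_simps mdiff_simps Const_mult algebra_simps)
  next
    case (X s t F i)
    let ?v = "Const (bval F a b) :: ('n1, 'n2, 'k) bipoly" and ?d = "Const (bdiff F a b u w) :: ('n1, 'n2, 'k) bipoly"
    have "X k * Y l * (X i * F) - Const (bval (X i * F) a b) * (X k ^ Suc (Suc s) * Y l ^ Suc t)
        - Const (bdiff (X i * F) a b u w) * (X k ^ Suc s * Y l ^ t * G0)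
      = X i * (X k * Y l * F - ?v * (X k ^ Suc s * Y l ^ Suc t) - ?d * (X k ^ s * Y l ^ t * G0))
        + ?v * (X k ^ Suc s * Y l ^ t) * (f i * Y l - Const (u i) * G0)
        + ?d * (X k ^ s * Y l ^ t) * (f i * G0)"
      by (simp add: ev_simps mdiff_simps Const_mult Const_add f_def algebra_simps)
    also have "\<dots> \<in> W" by (rule Jadd[OF Jadd[OF Jmul[OF X(2)] Jmul[OF u]] Jmul[OF killed(1)[OF G0(1,2)]]])
    finally show ?case .
  next
    case (Y s t F j)
    let ?v = "Const (bval F a b) :: ('n1, 'n2, 'k) bipoly" and ?d = "Const (bdiff F a b u w) :: ('n1, 'n2, 'k) bipoly"
    have "X k * Y l * (Y j * F) - Const (bval (Y j * F) a b) * (X k ^ Suc s * Y l ^ Suc (Suc t))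
        - Const (bdiff (Y j * F) a b u w) * (X k ^ s * Y l ^ Suc t * G0)
      = Y j * (X k * Y l * F - ?v * (X k ^ Suc s * Y l ^ Suc t) - ?d * (X k ^ s * Y l ^ t * G0))
        + ?v * (X k ^ s * Y l ^ Suc t) * (X k * g j - Const (w j) * G0)
        + ?d * (X k ^ s * Y l ^ t) * (g j * G0)"
      by (simp add: ev_simps mdiff_simps Const_mult Const_add g_def algebra_simps)
    also have "\<dots> \<in> W" by (rule Jadd[OF Jadd[OF Jmul[OF Y(2)] Jmul[OF w]] Jmul[OF killed(2)[OF G0(1,2)]]])
    finally show ?case .
  qed (use is_idealD(1)[OF J] in simp_all)
  have iff: "F \<in> W \<longleftrightarrow> bval F a b = 0 \<and> bdiff F a b u w = 0" if F: "F \<in> biforms s t" for F s t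
  proof
    assume FW: "F \<in> W"
    then have v: "bval F a b = 0" using Wab F by blast
    have "bdiff F a b u w = 0"
    proof (rule ccontr)
      assume ne: "bdiff F a b u w \<noteq> 0"
      have "X k * Y l * F - (X k * Y l * F - Const (bval F a b) * (X k ^ Suc s * Y l ^ Suc t)
        - Const (bdiff F a b u w) * (X k ^ s * Y l ^ t * G0)) \<in> W"
        by (rule Jdiff[OF Jmul[OF FW] taylor[OF F]])
      then have "Const (bdiff F a b u w) * (X k ^ s * Y l ^ t * G0) \<in> W" using v by simp
      then have "X k ^ s * Y l ^ t * G0 \<in> W" using is_ideal_Const_mult_iff[OF J ne] by blast
      then show False using kill'[OF G0(1,2)] G0(3) by blast
    qed
    then show "bval F a b = 0 \<and> bdiff F a b u w = 0" using v by simp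
  next
    assume "bval F a b = 0 \<and> bdiff F a b u w = 0"
    then have "X k ^ 1 * Y l ^ 1 * F \<in> W" using taylor[OF F] by simp
    then show "F \<in> W" using kill'[OF F] \<open>bval F a b = 0 \<and> _\<close> by blast
  qed
  \<comment> \<open>If the direction were trivial, Euler's identity would give \<open>G0\<close> a
    zero derivative, and the criterion would put it into \<open>W\<close>.\<close>
  have "\<not> (u \<in> fs.span {a} \<and> w \<in> fs.span {b})"
  proof
    assume "u \<in> fs.span {a} \<and> w \<in> fs.span {b}"
    then obtain c d where "u = (\<lambda>i. c * a i)" "w = (\<lambda>j. d * b j)" by (auto simp: in_span_1)
    then have "bdiff G0 a b u w = 0" using bdiff_euler[OF G0(1), of a b c d] G0(2) by simp
    then show False using iff[OF G0(1)] G0(2,3) by blast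
  qed
  then show ?thesis using that[OF a_nz pt_ab] iff by blast
qed

section \<open>Tensors as functionals on biforms\<close>

text \<open>The derivative of the power tensor along \<open>(u, w)\<close>, taken as a coefficient
  so that products of linear polynomials can be expanded and reversed.\<close>

definition tangent_tensor :: "nat \<Rightarrow> nat \<Rightarrow> ('n1 \<Rightarrow> 'k::field) \<Rightarrow> ('n2 \<Rightarrow> 'k) \<Rightarrow> ('n1 \<Rightarrow> 'k) \<Rightarrow> ('n2 \<Rightarrow> 'k) \<Rightarrow>
    'n1 list \<times> 'n2 list \<Rightarrow> 'k" where
  "tangent_tensor d1 d2 a b u w =
     (\<lambda>e. coeff (power_tensor d1 d2 (\<lambda>i. [:a i, u i:]) (\<lambda>j. [:b j, w j:]) e) 1)"

definition list_monomial :: "'n1 list \<times> 'n2 list \<Rightarrow> ('n1 + 'n2 \<Rightarrow>\<^sub>0 nat)" where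
  "list_monomial = (\<lambda>(I, J). sum_list (map (\<lambda>i. Poly_Mapping.single (Inl i) 1) I)
     + sum_list (map (\<lambda>j. Poly_Mapping.single (Inr j) 1) J))"

lemma mono_eval_list_monomial:
  "mono_eval (case_sum v1 v2) (list_monomial (I, J)) = prod_list (map v1 I) * prod_list (map v2 J)"
proof -
  have "mono_eval (case_sum v1 v2) (sum_list (map (\<lambda>i. Poly_Mapping.single (Inl i) 1) I)) = prod_list (map v1 I)"
    by (induction I) (simp_all add: mono_eval_add)
  moreover have "mono_eval (case_sum v1 v2) (sum_list (map (\<lambda>i. Poly_Mapping.single (Inr i) 1) J)) = prod_list (map v2 J)"
    by (induction J) (simp_all add: mono_eval_add)
  ultimately show ?thesis by (simp add: list_monomial_def mono_eval_add)
qed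

text \<open>Makes \<open>inv list_monomial\<close> a genuine right inverse.\<close>

lemma list_monomial_surj: "\<exists>e. list_monomial e = m"
proof (induction m rule: monomial_induct)
  case one
  show ?case by (rule exI[of _ "([], [])"]) (simp add: list_monomial_def)
next
  case (Var m k)
  then obtain I J where e: "list_monomial (I, J) = m" by force
  show ?case
  proof (cases k)
    case (Inl i)
    then have "list_monomial (i # I, J) = Poly_Mapping.single k 1 + m"
      using e by (auto simp: list_monomial_def add.assoc)
    then show ?thesis by blast
  next
    case (Inr j)
    then have "list_monomial (I, j # J) = Poly_Mapping.single k 1 + m"
      using e by (auto simp: list_monomial_def add_ac)
    then show ?thesis by blast
  qed
qed

lemma has_bidegree_list_monomial:
  "has_bidegree (list_monomial (I, J)) s t \<longleftrightarrow> length I = s \<and> length J = t"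
proof -
  have "has_bidegree (sum_list (map (\<lambda>i. Poly_Mapping.single (Inl i :: 'a + 'b) 1) I)) (length I) 0"
    by (induction I) (auto dest: has_bidegree_add[OF has_bidegree_X])
  moreover have "has_bidegree (sum_list (map (\<lambda>i. Poly_Mapping.single (Inr i :: 'a + 'b) 1) J)) 0 (length J)"
    by (induction J) (auto dest: has_bidegree_add[OF has_bidegree_Y])
  ultimately have "has_bidegree (list_monomial (I, J)) (length I) (length J)"
    using has_bidegree_add by (fastforce simp: list_monomial_def)
  then show ?thesis using has_bidegree_unique by blast
qed

text \<open>A tensor acts on forms through its coordinate at one chosen position for each monomial.
  On power tensors this is evaluation, and no multinomial coefficients enter.\<close>

definition biform_functional ::
  "('n1::finite, 'n2::finite, 'k::field) bipoly \<Rightarrow> ('n1 list \<times> 'n2 list \<Rightarrow> 'k) \<Rightarrow> 'k" where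
  "biform_functional F q = (\<Sum>m\<in>Poly_Mapping.keys F. Poly_Mapping.lookup F m * q (inv list_monomial m))"

lemma biform_functional_add: "biform_functional F (p + q) = biform_functional F p + biform_functional F q"
  by (simp add: biform_functional_def algebra_simps sum.distrib)

lemma biform_functional_scale: "biform_functional F (fscale c q) = c * biform_functional F q"
  by (simp add: biform_functional_def fscale_def algebra_simps sum_distrib_left)

lemma power_tensor_list_monomial:
  assumes "F \<in> biforms d1 d2" "m \<in> Poly_Mapping.keys F"
  shows "power_tensor d1 d2 v1 v2 (inv list_monomial m) = mono_eval (case_sum v1 v2) m"
proof -
  obtain I J where e: "inv list_monomial m = (I, J)" by force
  then have m: "list_monomial (I, J) = m"
    using list_monomial_surj[of m] by (metis f_inv_into_f rangeI)
  then have "length I = d1 \<and> length J = d2"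
    using assms has_bidegree_list_monomial[of I J d1 d2] by (auto simp: biforms_def)
  then show ?thesis
    using mono_eval_list_monomial[of v1 v2 I J] by (simp add: e m power_tensor_def)
qed

lemma biform_functional_power_tensor:
  "F \<in> biforms d1 d2 \<Longrightarrow> biform_functional F (power_tensor d1 d2 v1 v2) = bval F v1 v2"
  by (simp add: biform_functional_def power_tensor_list_monomial
      ev.meval_superset[of "Poly_Mapping.keys F"] cong: sum.cong)

lemma case_sum_poly: "(\<lambda>i. [:case_sum a b i, case_sum u w i:])
    = case_sum (\<lambda>i. [:a i, u i:]) (\<lambda>j. [:b j, w j:])"
  by (auto simp: fun_eq_iff split: sum.splits)

lemma biform_functional_tangent_tensor:
  assumes "F \<in> biforms d1 d2"
  shows "biform_functional F (tangent_tensor d1 d2 a b u w) = bdiff F a b u w"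
proof -
  have "biform_functional F (tangent_tensor d1 d2 a b u w)
    = coeff (\<Sum>m\<in>Poly_Mapping.keys F. [:Poly_Mapping.lookup F m:] *
        power_tensor d1 d2 (\<lambda>i. [:a i, u i:]) (\<lambda>j. [:b j, w j:]) (inv list_monomial m)) 1"
    by (simp add: biform_functional_def tangent_tensor_def coeff_sum)
  also have "(\<Sum>m\<in>Poly_Mapping.keys F. [:Poly_Mapping.lookup F m:] *
        power_tensor d1 d2 (\<lambda>i. [:a i, u i:]) (\<lambda>j. [:b j, w j:]) (inv list_monomial m))
    = meval (\<lambda>c. [:c:]) (case_sum (\<lambda>i. [:a i, u i:]) (\<lambda>j. [:b j, w j:])) F"
    unfolding pev.meval_superset[OF finite_keys order_refl]
    by (intro sum.cong) (simp_all only: power_tensor_list_monomial[OF assms])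
  finally show ?thesis by (simp add: mdiff_def case_sum_poly)
qed

lemma prod_list_scale: "prod_list (map (\<lambda>i. c * f i) I) = c ^ length I * prod_list (map f I)"
  for c :: "'k::comm_monoid_mult"
  by (induction I) (simp_all add: mult_ac)

lemma power_tensor_scale:
  fixes a :: "'n1 \<Rightarrow> 'k::field" and b :: "'n2 \<Rightarrow> 'k"
  shows "power_tensor d1 d2 (\<lambda>i. c * a i) (\<lambda>j. d * b j) = fscale (c ^ d1 * d ^ d2) (power_tensor d1 d2 a b)"
  by (auto simp: power_tensor_def fscale_def fun_eq_iff prod_list_scale mult_ac)

lemma \<nu>_proj_pt: "\<nu> d1 d2 (proj_pt a, proj_pt b) = proj_pt (power_tensor d1 d2 a b)"
proof -
  have "{power_tensor d1 d2 v1 v2 |v1 v2. v1 \<in> proj_pt a \<and> v2 \<in> proj_pt b}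
      \<subseteq> fs.span {power_tensor d1 d2 a b}"
    by (auto simp: mem_proj_pt power_tensor_scale intro!: fs.span_scale[OF fs.span_base])
  moreover have "power_tensor d1 d2 a b \<in> {power_tensor d1 d2 v1 v2 |v1 v2. v1 \<in> proj_pt a \<and> v2 \<in> proj_pt b}"
    by blast
  ultimately show ?thesis
    unfolding \<nu>_def proj_pt_def split
    by (intro equalityI fs.span_minimal fs.subspace_span) (auto intro: fs.span_base)
qed

lemma biform_functional_lspan:
  assumes F: "F \<in> biforms d1 d2"
    and S: "\<And>x1 x2 v1 v2. (x1, x2) \<in> S \<Longrightarrow> v1 \<in> x1 \<Longrightarrow> v2 \<in> x2 \<Longrightarrow> bval F v1 v2 = 0"
    and p: "p \<in> lspan (\<nu> d1 d2 ` S)"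
  shows "biform_functional F p = 0"
proof -
  have zero: "biform_functional F 0 = 0" by (simp add: biform_functional_def)
  have sub: "fs.subspace {q. biform_functional F q = 0}"
    by (auto simp: fs.subspace_def zero biform_functional_add biform_functional_scale)
  have "\<Union> (\<nu> d1 d2 ` S) \<subseteq> {q. biform_functional F q = 0}"
  proof clarify
    fix x1 x2 q assume x: "(x1, x2) \<in> S" "q \<in> \<nu> d1 d2 (x1, x2)"
    have "fs.span {power_tensor d1 d2 v1 v2 |v1 v2. v1 \<in> x1 \<and> v2 \<in> x2} \<subseteq> {q. biform_functional F q = 0}"
      using S[OF x(1)] by (intro fs.span_minimal sub) (auto simp: biform_functional_power_tensor[OF F])
    then show "biform_functional F q = 0" using x(2) by (auto simp: \<nu>_def)
  qed
  then have "fs.span (\<Union> (\<nu> d1 d2 ` S)) \<subseteq> {q. biform_functional F q = 0}"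
    by (rule fs.span_minimal[OF _ sub])
  then show ?thesis using p by (auto simp: lspan_def)
qed

text \<open>With variables as entries each coordinate of the power tensor becomes a form of bidegree
  \<open>(d1, d2)\<close>; identities for forms, such as Euler's, thereby pass to tangent tensors
  coordinatewise.\<close>

lemma power_tensor_Var:
  fixes e :: "'n1::finite list \<times> 'n2::finite list" and d1 d2 :: nat
  defines "T \<equiv> power_tensor d1 d2 (\<lambda>i. Var (Inl i)) (\<lambda>j. Var (Inr j)) e :: ('n1, 'n2, 'k::field) bipoly"
  shows "T \<in> biforms d1 d2" "bval T a b = power_tensor d1 d2 a b e"
    "bdiff T a b u w = tangent_tensor d1 d2 a b u w e"
proof -
  obtain I J where e: "e = (I, J)" by force
  have "prod_list (map (\<lambda>i. Var (Inl i)) I) \<in> (biforms (length I) 0 :: ('n1, 'n2, 'k) bipoly set)"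
    by (induction I) (auto intro: biforms_mult'[OF biforms_X])
  moreover have "prod_list (map (\<lambda>i. Var (Inr i)) J) \<in> (biforms 0 (length J) :: ('n1, 'n2, 'k) bipoly set)"
    by (induction J) (auto intro: biforms_mult'[OF biforms_Y])
  ultimately show "T \<in> biforms d1 d2"
    by (auto simp: T_def e power_tensor_def intro: biforms_mult')
  show "bval T a b = power_tensor d1 d2 a b e"
    by (simp add: T_def e power_tensor_def ev_simps)
  show "bdiff T a b u w = tangent_tensor d1 d2 a b u w e"
    by (simp add: T_def e power_tensor_def mdiff_def tangent_tensor_def case_sum_poly pev.meval_mult
        pev.meval_prod_list)
qed

lemma tangent_tensor_shift:
  fixes a :: "'n1::finite \<Rightarrow> 'k::field" and b :: "'n2::finite \<Rightarrow> 'k"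
  shows "tangent_tensor d1 d2 a b (\<lambda>i. r * u i + c * a i) (\<lambda>j. r * w j + d * b j) e
    = r * tangent_tensor d1 d2 a b u w e + (c * of_nat d1 + d * of_nat d2) * power_tensor d1 d2 a b e"
  using bdiff_euler_shift[OF power_tensor_Var(1)[of d1 d2 e], of a b r u c w d]
  by (simp only: power_tensor_Var)

lemma tangent_tensor_add:
  fixes a :: "'n1::finite \<Rightarrow> 'k::field" and b :: "'n2::finite \<Rightarrow> 'k"
  shows "tangent_tensor d1 d2 a b (\<lambda>i. u i + u' i) (\<lambda>j. w j + w' j) e
    = tangent_tensor d1 d2 a b u w e + tangent_tensor d1 d2 a b u' w' e"
  using bdiff_direction_add[of "power_tensor d1 d2 (\<lambda>i. Var (Inl i)) (\<lambda>j. Var (Inr j)) e" a b u u' w w']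
  by (simp only: power_tensor_Var)

text \<open>Cramer's rule: if \<open>P\<close> and \<open>Q\<close> are independent, there are two
  arguments \<open>x0\<close> and \<open>x1\<close> with nonzero determinant, and the coefficients
  are read off from a relation between the values at \<open>x\<close>, \<open>x0\<close> and
  \<open>x1\<close>. Hence the three terms in \<open>rel\<close>.\<close>

lemma linear_combination_of_two:
  fixes P Q p :: "'x \<Rightarrow> 'k::field"
  assumes P: "P x0 \<noteq> 0"
    and rel: "\<And>\<alpha> \<beta> \<gamma> x y z. \<alpha> * P x + \<beta> * P y + \<gamma> * P z = 0 \<Longrightarrow> \<alpha> * Q x + \<beta> * Q y + \<gamma> * Q z = 0 \<Longrightarrow>
      \<alpha> * p x + \<beta> * p y + \<gamma> * p z = 0"
  obtains c0 c1 where "\<And>x. p x = c1 * Q x + c0 * P x"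
proof (cases "\<forall>x. Q x * P x0 = Q x0 * P x")
  case True
  have "p x = 0 * Q x + (p x0 / P x0) * P x" for x
    using rel[of "P x0" x "- P x" x0 0 x0] True P by (auto simp: field_simps)
  then show ?thesis using that by blast
next
  case False
  then obtain x1 where D: "P x0 * Q x1 - Q x0 * P x1 \<noteq> 0" by (auto simp: mult.commute)
  let ?D = "P x0 * Q x1 - Q x0 * P x1"
  have "p x = ((P x0 * p x1 - P x1 * p x0) / ?D) * Q x + ((Q x1 * p x0 - Q x0 * p x1) / ?D) * P x" for x
  proof -
    have "?D * p x + (- (P x * Q x1 - Q x * P x1)) * p x0 + (- (P x0 * Q x - Q x0 * P x)) * p x1 = 0"
      by (rule rel) (simp_all add: algebra_simps)
    then have "?D * p x = (P x0 * p x1 - P x1 * p x0) * Q x + (Q x1 * p x0 - Q x0 * p x1) * P x"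
      by (simp add: algebra_simps)
    then show ?thesis using D by (simp add: divide_simps mult_ac)
  qed
  then show ?thesis using that by blast
qed

text \<open>A relation between three coordinates that holds for the power tensor and for the tangent
  tensor is a linear form whose pullback lies in \<open>W\<close>, so it also vanishes on
  \<open>p\<close>.\<close>

lemma scheme_span_tangent:
  fixes W :: "('n1::finite, 'n2::finite, 'k::field) bipoly set"
  assumes "a \<noteq> 0" "b \<noteq> 0"
    and W: "\<And>F s t. F \<in> biforms s t \<Longrightarrow> F \<in> W \<longleftrightarrow> bval F a b = 0 \<and> bdiff F a b u w = 0"
    and p: "p \<in> scheme_span d1 d2 W"
  obtains c0 c1 where "\<And>x. p x = c1 * tangent_tensor d1 d2 a b u w x + c0 * power_tensor d1 d2 a b x"
proof -
  obtain i j where ij: "a i \<noteq> 0" "b j \<noteq> 0" using assms(1,2) by (auto simp: fun_eq_iff)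
  define T where "T = (power_tensor d1 d2 (\<lambda>i. Var (Inl i)) (\<lambda>j. Var (Inr j)) ::
    'n1 list \<times> 'n2 list \<Rightarrow> ('n1, 'n2, 'k) bipoly)"
  have T: "T x \<in> biforms d1 d2" "bval (T x) a b = power_tensor d1 d2 a b x"
    "bdiff (T x) a b u w = tangent_tensor d1 d2 a b u w x" for x
    unfolding T_def by (rule power_tensor_Var)+
  have nz: "power_tensor d1 d2 a b (replicate d1 i, replicate d2 j) \<noteq> 0"
    using ij by (simp add: power_tensor_def prod_list_replicate)
  have rel: "\<alpha> * p x + \<beta> * p y + \<gamma> * p z = 0"
    if 0: "\<alpha> * power_tensor d1 d2 a b x + \<beta> * power_tensor d1 d2 a b y + \<gamma> * power_tensor d1 d2 a b z = 0"
      "\<alpha> * tangent_tensor d1 d2 a b u w x + \<beta> * tangent_tensor d1 d2 a b u w y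
        + \<gamma> * tangent_tensor d1 d2 a b u w z = 0" for \<alpha> \<beta> \<gamma> x y z
  proof -
    let ?E = "Const \<alpha> * Var x + Const \<beta> * Var y + Const \<gamma> * Var z"
    have single: "Const c * Var x = Poly_Mapping.single (Poly_Mapping.single x 1) c" for c :: 'k and x :: "'n1 list \<times> 'n2 list"
      by (simp add: Const_def Var_def mult_single)
    have "Poly_Mapping.keys ?E \<subseteq> {Poly_Mapping.single x 1, Poly_Mapping.single y 1, Poly_Mapping.single z 1}"
      unfolding single by (rule order_trans[OF keys_add Un_mono[OF keys_add order_refl], THEN order_trans])
        (auto split: if_splits)
    then have "linear_form ?E" unfolding linear_form_def by blast
    moreover have "meval Const T ?E \<in> W"
    proof -
      have eq: "meval Const T ?E = Const \<alpha> * T x + Const \<beta> * T y + Const \<gamma> * T z"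
        by (simp add: cev.meval_add cev.meval_mult)
      have "Const \<alpha> * T x + Const \<beta> * T y + Const \<gamma> * T z \<in> biforms d1 d2"
        by (intro biforms_add biforms_Const_mult T(1))
      from W[OF this] show ?thesis using 0 by (simp add: eq ev_simps mdiff_simps T)
    qed
    ultimately have "mvalue ?E p = 0" using p by (simp add: scheme_span_def T_def)
    then show ?thesis by (simp add: ev_simps)
  qed
  show ?thesis by (rule linear_combination_of_two[where P = "power_tensor d1 d2 a b" and
        Q = "tangent_tensor d1 d2 a b u w" and p = p, OF nz rel that])
qed

section \<open>Explicit decompositions\<close>

text \<open>
  A tangent tensor plus a multiple of the power tensor consists of the two leading coefficients of a
  polynomial curve of power tensors. For nodes with prescribed sum, a divided difference writes it
  as a combination of as many points of the curve as the degree of the curve.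
\<close>

lemma divided_difference:
  fixes A :: "'k::field set"
  assumes "finite A" "A \<noteq> {}"
  shows "\<exists>c. \<forall>\<phi>. degree \<phi> \<le> card A \<longrightarrow>
    (\<Sum>s\<in>A. c s * poly \<phi> s) = coeff \<phi> (card A - 1) + \<Sum>A * coeff \<phi> (card A)"
  using assms
proof (induction rule: finite_ne_induct)
  case (singleton r)
  have "poly \<phi> r = coeff \<phi> 0 + r * coeff \<phi> 1" if "degree \<phi> \<le> 1" for \<phi>
    using that by (simp add: poly_altdef atMost_Suc mult.commute)
      (auto simp: le_Suc_eq poly_altdef coeff_eq_0 mult.commute)
  then show ?case by (intro exI[of _ "\<lambda>_. 1"]) simp
next
  case (insert r A)
  then obtain c where c: "\<And>\<phi>. degree \<phi> \<le> card A \<Longrightarrow>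
    (\<Sum>s\<in>A. c s * poly \<phi> s) = coeff \<phi> (card A - 1) + \<Sum>A * coeff \<phi> (card A)" by blast
  \<comment> \<open>At the old nodes the weights are those for the quotient \<open>\<psi>\<close> of
    \<open>\<phi>\<close> by the linear factor of \<open>r\<close>, divided by \<open>s - r\<close>;
    the weight at \<open>r\<close> collects the terms with the constant
    \<open>poly \<phi> r\<close>.\<close>
  define d where "d = (\<lambda>s. if s = r then - (\<Sum>s\<in>A. c s / (s - r)) else c s / (s - r))"
  obtain n where n: "card A = Suc n" using insert.hyps by (metis card_eq_0_iff not0_implies_Suc)
  have "(\<Sum>s\<in>insert r A. d s * poly \<phi> s) = coeff \<phi> (card A) + \<Sum>(insert r A) * coeff \<phi> (Suc (card A))"
    if deg: "degree \<phi> \<le> Suc (card A)" for \<phi>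
  proof -
    define \<psi> where "\<psi> = synthetic_div \<phi> r"
    have \<phi>: "\<phi> = [:poly \<phi> r:] + [:- r, 1:] * \<psi>"
      using synthetic_div_correct'[of r \<phi>] by (simp add: \<psi>_def add.commute)
    have deg\<psi>: "degree \<psi> \<le> card A" using deg by (simp add: \<psi>_def degree_synthetic_div)
    have val: "poly \<psi> s = (poly \<phi> s - poly \<phi> r) / (s - r)" if "s \<in> A" for s
    proof -
      have "s - r \<noteq> 0" using that insert.hyps by auto
      moreover have "poly \<phi> s = poly \<phi> r + (s - r) * poly \<psi> s" by (subst \<phi>) (simp add: algebra_simps)
      ultimately show ?thesis by (simp add: field_simps)
    qed
    have top: "coeff \<psi> (Suc (card A)) = 0" using deg\<psi> by (simp add: coeff_eq_0)
    have c1: "coeff \<phi> (Suc (card A)) = coeff \<psi> (card A)"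
      by (subst \<phi>) (simp add: top)
    have c2: "coeff \<phi> (card A) = coeff \<psi> (card A - 1) - r * coeff \<psi> (card A)"
      by (subst \<phi>) (simp add: n)
    have "(\<Sum>s\<in>insert r A. d s * poly \<phi> s) = d r * poly \<phi> r + (\<Sum>s\<in>A. d s * poly \<phi> s)"
      using insert.hyps by simp
    also have "(\<Sum>s\<in>A. d s * poly \<phi> s) = (\<Sum>s\<in>A. c s / (s - r) * poly \<phi> s)"
      using insert.hyps by (intro sum.cong) (auto simp: d_def)
    also have "d r * poly \<phi> r + \<dots> = (\<Sum>s\<in>A. c s * poly \<psi> s)"
      by (simp add: d_def val sum_distrib_right diff_divide_distrib right_diff_distrib sum_subtractf
          cong: sum.cong)
    also have "\<dots> = coeff \<psi> (card A - 1) + \<Sum>A * coeff \<psi> (card A)" by (rule c[OF deg\<psi>])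
    also have "\<dots> = coeff \<phi> (card A) + \<Sum>(insert r A) * coeff \<phi> (Suc (card A))"
      using insert.hyps by (simp add: c1 c2 algebra_simps)
    finally show ?thesis .
  qed
  then show ?case using insert.hyps by (intro exI[of _ d]) simp
qed

text \<open>Integers translated by a common \<open>t\<close>; characteristic zero makes them
  distinct and allows the division by \<open>n\<close>.\<close>

lemma ex_set_with_sum:
  assumes "n > 0"
  obtains A :: "'k::field_char_0 set" where "finite A" "card A = n" "\<Sum>A = e"
proof -
  define t where "t = (e - (\<Sum>i<n. of_nat i)) / (of_nat n :: 'k)"
  have inj: "inj_on (\<lambda>i. of_nat i + t) {..<n}" by (auto simp: inj_on_def)
  have "\<Sum>((\<lambda>i. of_nat i + t) ` {..<n}) = (\<Sum>i<n. of_nat i + t)"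
    by (simp add: sum.reindex[OF inj])
  also have "\<dots> = e" using assms by (simp add: sum.distrib t_def)
  finally show ?thesis using that[of "(\<lambda>i. of_nat i + t) ` {..<n}"] card_image[OF inj] by simp
qed

text \<open>Reversing every linear factor reverses the coefficients of the product, so the two
  lowest coefficients of \<open>A\<close> are the two highest of \<open>B\<close>.
  \<open>pCons 0 B\<close> shifts the index in place of subtracting 1 from \<open>length L\<close>,
  and gives the correct value 0 for the empty list.\<close>

lemma reversed_product:
  fixes L :: "('k::field \<times> 'k) list"
  defines "A \<equiv> prod_list (map (\<lambda>(x, y). [:x, y:]) L)" and "B \<equiv> prod_list (map (\<lambda>(x, y). [:y, x:]) L)"
  shows "degree B \<le> length L" "coeff B (length L) = coeff A 0" "coeff (pCons 0 B) (length L) = coeff A 1"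
  unfolding A_def B_def
proof (induction L)
  case (Cons xy L)
  obtain x y where xy: "xy = (x, y)" by force
  let ?B = "prod_list (map (\<lambda>(x, y). [:y, x:]) L)"
  have "degree ([:y, x:] * ?B) \<le> degree [:y, x:] + degree ?B" by (rule degree_mult_le)
  also have "\<dots> \<le> Suc (length L)" using Cons.IH(1) by (simp add: degree_pCons_eq_if)
  finally have deg: "degree ([:y, x:] * ?B) \<le> Suc (length L)" .
  then show "degree (prod_list (map (\<lambda>(x, y). [:y, x:]) (xy # L))) \<le> length (xy # L)"
    by (simp add: xy)
  have top: "coeff ?B (Suc (length L)) = 0" using Cons.IH(1) by (simp add: coeff_eq_0)
  show "coeff (prod_list (map (\<lambda>(x, y). [:y, x:]) (xy # L))) (length (xy # L))
    = coeff (prod_list (map (\<lambda>(x, y). [:x, y:]) (xy # L))) 0"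
    using Cons.IH(2) top by (simp add: xy)
  show "coeff (pCons 0 (prod_list (map (\<lambda>(x, y). [:y, x:]) (xy # L)))) (length (xy # L))
    = coeff (prod_list (map (\<lambda>(x, y). [:x, y:]) (xy # L))) 1"
    using Cons.IH(2,3) by (cases L) (auto simp: xy coeff_pCons split: nat.splits)
qed simp_all

text \<open>Nodes with sum \<open>e\<close> make the divided difference combine the two leading
  coefficients exactly as in \<open>p\<close>.\<close>

lemma decomposition_from_polys:
  fixes p :: "'n1::finite list \<times> 'n2::finite list \<Rightarrow> 'k::field_char_0"
  assumes "D > 0"
    and "\<And>x. degree (\<phi> x) \<le> D"
    and "\<And>x. p x = coeff (\<phi> x) (D - 1) + e * coeff (\<phi> x) D"
    and "\<And>x z. poly (\<phi> x) z = power_tensor d1 d2 (\<lambda>i. xp z i) (\<lambda>j. yp z j) x"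
  obtains A where "finite A" "card A = D" "p \<in> lspan (\<nu> d1 d2 ` ((\<lambda>z. (proj_pt (xp z), proj_pt (yp z))) ` A))"
proof -
  obtain A :: "'k set" where A: "finite A" "card A = D" "\<Sum>A = e" using ex_set_with_sum[OF assms(1)] .
  then have "A \<noteq> {}" using assms(1) by auto
  then obtain c where c: "\<And>\<phi>. degree \<phi> \<le> D \<Longrightarrow>
    (\<Sum>s\<in>A. c s * poly \<phi> s) = coeff \<phi> (D - 1) + e * coeff \<phi> D"
    using divided_difference[OF A(1)] A by auto
  have "p x = (\<Sum>s\<in>A. c s * power_tensor d1 d2 (xp s) (yp s) x)" for x
    using c[OF assms(2)[of x]] assms(3)[of x] by (simp add: assms(4))
  then have "p = (\<Sum>s\<in>A. fscale (c s) (power_tensor d1 d2 (xp s) (yp s)))"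
    by (auto simp: fun_eq_iff sum_fun_apply fscale_def)
  also have "\<dots> \<in> lspan (\<nu> d1 d2 ` ((\<lambda>z. (proj_pt (xp z), proj_pt (yp z))) ` A))"
    unfolding lspan_def
  proof (intro fs.span_sum fs.span_scale fs.span_base)
    fix s assume "s \<in> A"
    then show "power_tensor d1 d2 (xp s) (yp s) \<in> \<Union> (\<nu> d1 d2 ` (\<lambda>z. (proj_pt (xp z), proj_pt (yp z))) ` A)"
      by (auto simp: \<nu>_proj_pt intro!: bexI[of _ s])
  qed
  finally show ?thesis using that A by blast
qed

section \<open>Parametrisations with the support at infinity\<close>

lemma poly_prod_list_map: "poly (prod_list (map f I)) z = prod_list (map (\<lambda>i. poly (f i) z) I)"
  by (induction I) simp_all

lemma poly_power_tensor:
  fixes V1 :: "'n1 \<Rightarrow> 'k::field poly" and V2 :: "'n2 \<Rightarrow> 'k poly"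
  shows "poly (power_tensor d1 d2 V1 V2 x) z
    = power_tensor d1 d2 (\<lambda>i. poly (V1 i) z) (\<lambda>j. poly (V2 j) z) x"
  by (cases x) (simp add: power_tensor_def poly_prod_list_map)

text \<open>Passing from \<open>a + t u\<close> to \<open>u + z a\<close> puts the support at
  infinity; the power tensor and the tangent tensor there become the two leading
  coefficients.\<close>

lemma power_tensor_reversed:
  fixes a u :: "'n1 \<Rightarrow> 'k::field" and b w :: "'n2 \<Rightarrow> 'k" and d1 d2 :: nat
  defines "B \<equiv> power_tensor d1 d2 (\<lambda>i. [:u i, a i:]) (\<lambda>j. [:w j, b j:])"
  shows "degree (B x) \<le> d1 + d2" "coeff (B x) (d1 + d2) = power_tensor d1 d2 a b x"
    "coeff (pCons 0 (B x)) (d1 + d2) = tangent_tensor d1 d2 a b u w x"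
proof -
  obtain I J where x: "x = (I, J)" by force
  define A where "A = power_tensor d1 d2 (\<lambda>i. [:a i, u i:]) (\<lambda>j. [:b j, w j:])"
  have A0: "coeff (A x) 0 = power_tensor d1 d2 a b x"
    by (simp add: A_def poly_0_coeff_0[symmetric] poly_power_tensor)
  have A1: "coeff (A x) 1 = tangent_tensor d1 d2 a b u w x"
    by (simp add: A_def tangent_tensor_def)
  show "degree (B x) \<le> d1 + d2" "coeff (B x) (d1 + d2) = power_tensor d1 d2 a b x"
    "coeff (pCons 0 (B x)) (d1 + d2) = tangent_tensor d1 d2 a b u w x"
    unfolding A0[symmetric] A1[symmetric]
    using reversed_product[of "map (\<lambda>i. (a i, u i)) I @ map (\<lambda>j. (b j, w j)) J"]
    by (auto simp: A_def B_def x power_tensor_def o_def)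
qed

lemma prod_list_const_poly: "prod_list (map (\<lambda>j. [:b j:]) J) = [:prod_list (map b J):]"
  for b :: "_ \<Rightarrow> 'k::field"
  by (induction J) (simp_all add: pCons_one)

text \<open>Only the first vector moves; the constant factors of the second do not contribute to the
  degree, which is why \<open>d1\<close> points suffice on an \<alpha>-line.\<close>

lemma power_tensor_reversed1:
  fixes a u :: "'n1 \<Rightarrow> 'k::field" and b :: "'n2 \<Rightarrow> 'k" and d1 d2 :: nat
  defines "B \<equiv> power_tensor d1 d2 (\<lambda>i. [:u i, a i:]) (\<lambda>j. [:b j:])"
  shows "degree (B x) \<le> d1" "coeff (B x) d1 = power_tensor d1 d2 a b x"
    "coeff (pCons 0 (B x)) d1 = tangent_tensor d1 d2 a b u (\<lambda>_. 0) x"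
proof -
  obtain I J where x: "x = (I, J)" by force
  define A where "A = power_tensor d1 d2 (\<lambda>i. [:a i, u i:]) (\<lambda>j. [:b j:])"
  have A0: "coeff (A x) 0 = power_tensor d1 d2 a b x"
    by (simp add: A_def poly_0_coeff_0[symmetric] poly_power_tensor)
  have A1: "coeff (A x) 1 = tangent_tensor d1 d2 a b u (\<lambda>_. 0) x"
    by (simp add: A_def tangent_tensor_def)
  show "degree (B x) \<le> d1" "coeff (B x) d1 = power_tensor d1 d2 a b x"
    "coeff (pCons 0 (B x)) d1 = tangent_tensor d1 d2 a b u (\<lambda>_. 0) x"
    unfolding A0[symmetric] A1[symmetric]
    using reversed_product[of "map (\<lambda>i. (a i, u i)) I"]
    by (auto simp: A_def B_def x power_tensor_def o_def prod_list_const_poly coeff_pCons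
        intro: order_trans[OF degree_smult_le] split: nat.splits)
qed

lemma power_tensor_reversed2:
  fixes a :: "'n1 \<Rightarrow> 'k::field" and b w :: "'n2 \<Rightarrow> 'k" and d1 d2 :: nat
  defines "B \<equiv> power_tensor d1 d2 (\<lambda>i. [:a i:]) (\<lambda>j. [:w j, b j:])"
  shows "degree (B x) \<le> d2" "coeff (B x) d2 = power_tensor d1 d2 a b x"
    "coeff (pCons 0 (B x)) d2 = tangent_tensor d1 d2 a b (\<lambda>_. 0) w x"
proof -
  obtain I J where x: "x = (I, J)" by force
  define A where "A = power_tensor d1 d2 (\<lambda>i. [:a i:]) (\<lambda>j. [:b j, w j:])"
  have A0: "coeff (A x) 0 = power_tensor d1 d2 a b x"
    by (simp add: A_def poly_0_coeff_0[symmetric] poly_power_tensor)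
  have A1: "coeff (A x) 1 = tangent_tensor d1 d2 a b (\<lambda>_. 0) w x"
    by (simp add: A_def tangent_tensor_def)
  show "degree (B x) \<le> d2" "coeff (B x) d2 = power_tensor d1 d2 a b x"
    "coeff (pCons 0 (B x)) d2 = tangent_tensor d1 d2 a b (\<lambda>_. 0) w x"
    unfolding A0[symmetric] A1[symmetric]
    using reversed_product[of "map (\<lambda>i. (b i, w i)) J"]
    by (auto simp: A_def B_def x power_tensor_def o_def prod_list_const_poly coeff_pCons
        intro: order_trans[OF degree_smult_le] split: nat.splits)
qed

text \<open>A vector \<open>u + z a\<close> of a line, in coordinates in which \<open>a\<close> is the point at infinity.\<close>

definition line_point :: "('i \<Rightarrow> 'k::field) \<Rightarrow> ('i \<Rightarrow> 'k) \<Rightarrow> 'k \<Rightarrow> 'i \<Rightarrow> 'k" where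
  "line_point a u z = (\<lambda>i. u i + z * a i)"

lemma decomposition_graph:
  fixes p :: "'n1::finite list \<times> 'n2::finite list \<Rightarrow> 'k::field_char_0"
  assumes "d1 > 0"
    and "\<And>x. p x = tangent_tensor d1 d2 a b u w x + e * power_tensor d1 d2 a b x"
  obtains A where "finite A" "card A = d1 + d2"
    "p \<in> lspan (\<nu> d1 d2 ` ((\<lambda>z. (proj_pt (line_point a u z), proj_pt (line_point b w z))) ` A))"
proof (rule decomposition_from_polys[where D = "d1 + d2" and p = p and e = e and
      \<phi> = "power_tensor d1 d2 (\<lambda>i. [:u i, a i:]) (\<lambda>j. [:w j, b j:])" and
      xp = "line_point a u" and yp = "line_point b w"])
  fix x
  \<comment> \<open>\<open>d1 > 0\<close> makes \<open>d1 + d2 - 1\<close> the true predecessor of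
    \<open>d1 + d2\<close>.\<close>
  have "coeff (pCons 0 (power_tensor d1 d2 (\<lambda>i. [:u i, a i:]) (\<lambda>j. [:w j, b j:]) x)) (d1 + d2)
    = coeff (power_tensor d1 d2 (\<lambda>i. [:u i, a i:]) (\<lambda>j. [:w j, b j:]) x) (d1 + d2 - 1)"
    using assms(1) by (simp add: coeff_pCons split: nat.splits)
  then show "p x = coeff (power_tensor d1 d2 (\<lambda>i. [:u i, a i:]) (\<lambda>j. [:w j, b j:]) x) (d1 + d2 - 1)
    + e * coeff (power_tensor d1 d2 (\<lambda>i. [:u i, a i:]) (\<lambda>j. [:w j, b j:]) x) (d1 + d2)"
    by (simp only: assms(2) power_tensor_reversed)
qed (use assms(1) that in \<open>auto simp: power_tensor_reversed poly_power_tensor line_point_def\<close>)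

lemma decomposition_line1:
  fixes p :: "'n1::finite list \<times> 'n2::finite list \<Rightarrow> 'k::field_char_0"
  assumes "d1 > 0"
    and "\<And>x. p x = tangent_tensor d1 d2 a b u (\<lambda>_. 0) x + e * power_tensor d1 d2 a b x"
  obtains A where "finite A" "card A = d1"
    "p \<in> lspan (\<nu> d1 d2 ` ((\<lambda>z. (proj_pt (line_point a u z), proj_pt b)) ` A))"
proof (rule decomposition_from_polys[where D = d1 and p = p and e = e and
      \<phi> = "power_tensor d1 d2 (\<lambda>i. [:u i, a i:]) (\<lambda>j. [:b j:])" and
      xp = "line_point a u" and yp = "\<lambda>_. b"])
  fix x
  have "coeff (pCons 0 (power_tensor d1 d2 (\<lambda>i. [:u i, a i:]) (\<lambda>j. [:b j:]) x)) d1
    = coeff (power_tensor d1 d2 (\<lambda>i. [:u i, a i:]) (\<lambda>j. [:b j:]) x) (d1 - 1)"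
    using assms(1) by (simp add: coeff_pCons split: nat.splits)
  then show "p x = coeff (power_tensor d1 d2 (\<lambda>i. [:u i, a i:]) (\<lambda>j. [:b j:]) x) (d1 - 1)
    + e * coeff (power_tensor d1 d2 (\<lambda>i. [:u i, a i:]) (\<lambda>j. [:b j:]) x) d1"
    by (simp only: assms(2) power_tensor_reversed1)
qed (use assms(1) that in \<open>auto simp: power_tensor_reversed1 poly_power_tensor line_point_def\<close>)

lemma decomposition_line2:
  fixes p :: "'n1::finite list \<times> 'n2::finite list \<Rightarrow> 'k::field_char_0"
  assumes "d2 > 0"
    and "\<And>x. p x = tangent_tensor d1 d2 a b (\<lambda>_. 0) w x + e * power_tensor d1 d2 a b x"
  obtains A where "finite A" "card A = d2"
    "p \<in> lspan (\<nu> d1 d2 ` ((\<lambda>z. (proj_pt a, proj_pt (line_point b w z))) ` A))"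
proof (rule decomposition_from_polys[where D = d2 and p = p and e = e and
      \<phi> = "power_tensor d1 d2 (\<lambda>i. [:a i:]) (\<lambda>j. [:w j, b j:])" and
      xp = "\<lambda>_. a" and yp = "line_point b w"])
  fix x
  have "coeff (pCons 0 (power_tensor d1 d2 (\<lambda>i. [:a i:]) (\<lambda>j. [:w j, b j:]) x)) d2
    = coeff (power_tensor d1 d2 (\<lambda>i. [:a i:]) (\<lambda>j. [:w j, b j:]) x) (d2 - 1)"
    using assms(1) by (simp add: coeff_pCons split: nat.splits)
  then show "p x = coeff (power_tensor d1 d2 (\<lambda>i. [:a i:]) (\<lambda>j. [:w j, b j:]) x) (d2 - 1)
    + e * coeff (power_tensor d1 d2 (\<lambda>i. [:a i:]) (\<lambda>j. [:w j, b j:]) x) d2"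
    by (simp only: assms(2) power_tensor_reversed2)
qed (use assms(1) that in \<open>auto simp: power_tensor_reversed2 poly_power_tensor line_point_def\<close>)

section \<open>Sets of points whose span contains a tangent tensor\<close>

definition vanishes :: "('n1, 'n2, 'k::field) bipoly \<Rightarrow> ('n1, 'n2, 'k) bipt \<Rightarrow> bool" where
  "vanishes F z \<longleftrightarrow> (\<forall>v1\<in>fst z. \<forall>v2\<in>snd z. bval F v1 v2 = 0)"

lemma vanishes_iff:
  fixes F :: "('n1::finite, 'n2::finite, 'k::field) bipoly"
  assumes "F \<in> biforms s t"
  shows "vanishes F (proj_pt a, proj_pt b) \<longleftrightarrow> bval F a b = 0"
proof
  assume "vanishes F (proj_pt a, proj_pt b)"
  then show "bval F a b = 0" unfolding vanishes_def fst_conv snd_conv by blast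
next
  assume "bval F a b = 0"
  then show "vanishes F (proj_pt a, proj_pt b)"
    unfolding vanishes_def fst_conv snd_conv mem_proj_pt
    by (elim bexE exE | intro ballI)+ (auto simp: mem_proj_pt bval_scale[OF assms])
qed

lemma vanishes_mult: "vanishes F z \<or> vanishes G z \<Longrightarrow> vanishes (F * G) z"
  by (auto simp: vanishes_def ev_simps)

lemma biproj_space_cases:
  assumes "z \<in> biproj_space"
  obtains x y where "z = (proj_pt x, proj_pt y)" "x \<noteq> 0" "y \<noteq> 0"
proof -
  obtain x1 x2 where z: "z = (x1, x2)" "x1 \<in> proj_space" "x2 \<in> proj_space"
    using assms by (cases z) (simp add: biproj_space_def)
  obtain x where "x1 = proj_pt x" "x \<noteq> 0" using z(2) unfolding proj_space_def by blast
  moreover obtain y where "x2 = proj_pt y" "y \<noteq> 0" using z(3) unfolding proj_space_def by blast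
  ultimately show ?thesis using that z(1) by simp
qed

lemma biforms_prod:
  assumes "finite A" "\<And>z. z \<in> A \<Longrightarrow> F z \<in> biforms s t"
  shows "prod F A \<in> biforms (card A * s) (card A * t)"
  using assms
proof (induction rule: finite_induct)
  case (insert z A)
  then have "F z * prod F A \<in> biforms (s + card A * s) (t + card A * t)"
    by (intro biforms_mult) auto
  then show ?case using insert.hyps by simp
qed simp

lemma vanishing_product:
  fixes a :: "'n1::finite \<Rightarrow> 'k::field" and b :: "'n2::finite \<Rightarrow> 'k"
  assumes T: "finite T"
    and ex: "\<And>z. z \<in> T \<Longrightarrow> \<exists>F\<in>biforms s t. bval F a b = 1 \<and> vanishes F z"
  obtains F where "F \<in> biforms (card T * s) (card T * t)" "bval F a b = 1" "\<And>z. z \<in> T \<Longrightarrow> vanishes F z"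
proof -
  obtain G where G: "\<And>z. z \<in> T \<Longrightarrow> G z \<in> biforms s t" "\<And>z. z \<in> T \<Longrightarrow> bval (G z) a b = 1"
    "\<And>z. z \<in> T \<Longrightarrow> vanishes (G z) z"
    using ex by metis
  have van: "vanishes (prod G T) z" if "z \<in> T" for z
    using vanishes_mult[of "G z" z "prod G (T - {z})"] G(3)[OF that] prod.remove[OF T that, of G] by simp
  have "bval (prod G T) a b = 1" by (simp add: ev_simps G(2))
  from that[OF biforms_prod[OF T G(1)] this van] show ?thesis by simp
qed

lemma separating_lin1:
  fixes a :: "'n1::finite \<Rightarrow> 'k::field" and b :: "'n2::finite \<Rightarrow> 'k"
  assumes "z \<in> biproj_space" "fst z \<noteq> proj_pt a" "a \<noteq> 0"
  shows "\<exists>F\<in>biforms 1 0. bval F a b = 1 \<and> vanishes F z"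
proof -
  obtain x y where z: "z = (proj_pt x, proj_pt y)" "x \<noteq> 0" "y \<noteq> 0" using assms(1) by (rule biproj_space_cases)
  have "a \<notin> fs.span {x}" using assms(2,3) proj_pt_eq_iff(2)[OF z(2) assms(3)] z(1) by auto
  then obtain f where "dot f x = 0" "dot f a = 1" using separating_form by blast
  then show ?thesis
    by (intro bexI[of _ "lin1 f"]) (simp_all add: z(1) vanishes_iff[OF lin1_biform])
qed

lemma separating_lin2:
  fixes a :: "'n1::finite \<Rightarrow> 'k::field" and b :: "'n2::finite \<Rightarrow> 'k"
  assumes "z \<in> biproj_space" "snd z \<noteq> proj_pt b" "b \<noteq> 0"
  shows "\<exists>F\<in>biforms 0 1. bval F a b = 1 \<and> vanishes F z"
proof -
  obtain x y where z: "z = (proj_pt x, proj_pt y)" "x \<noteq> 0" "y \<noteq> 0" using assms(1) by (rule biproj_space_cases)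
  have "b \<notin> fs.span {y}" using assms(2,3) proj_pt_eq_iff(2)[OF z(3) assms(3)] z(1) by auto
  then obtain f where "dot f y = 0" "dot f b = 1" using separating_form by blast
  then show ?thesis
    by (intro bexI[of _ "lin2 f"]) (simp_all add: z(1) vanishes_iff[OF lin2_biform])
qed

text \<open>
  A point can be killed by a linear form in the first variables unless its first projection is \<open>[a]\<close>,
  and by a linear form in the second variables unless its second projection is \<open>[b]\<close>.
\<close>

lemma killing_form:
  fixes a :: "'n1::finite \<Rightarrow> 'k::field" and b :: "'n2::finite \<Rightarrow> 'k"
  assumes ab: "a \<noteq> 0" "b \<noteq> 0" and T: "finite T" "T \<subseteq> biproj_space" "(proj_pt a, proj_pt b) \<notin> T"
    and n: "card {z \<in> T. snd z = proj_pt b} \<le> n" and m: "card {z \<in> T. fst z = proj_pt a} \<le> m"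
    and nm: "card T \<le> n + m"
  obtains F where "F \<in> biforms n m" "bval F a b = 1" "\<And>z. z \<in> T \<Longrightarrow> vanishes F z"
proof -
  let ?C = "{z \<in> T. snd z = proj_pt b}" and ?B = "{z \<in> T. fst z = proj_pt a}"
  have sub: "?C \<subseteq> T - ?B" using T(3) by auto
  have fin: "finite ?C" "finite ?B" using T(1) by auto
  \<comment> \<open>\<open>T1\<close> receives the linear forms in the first variables: it must
    contain the points over [b], must avoid those over [a], and is taken as large as the degree
    \<open>n\<close> permits.\<close>
  have "\<exists>T1. ?C \<subseteq> T1 \<and> T1 \<subseteq> T - ?B \<and> card T1 = min n (card (T - ?B))"
  proof (rule exists_subset_between)
    show "card ?C \<le> min n (card (T - ?B))" using n card_mono[OF _ sub] T(1) by simp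
  qed (use sub T(1) in auto)
  then obtain T1 where T1: "?C \<subseteq> T1" "T1 \<subseteq> T - ?B" "card T1 = min n (card (T - ?B))" by blast
  have fin1: "finite T1" using T1(2) T(1) finite_subset by blast
  define T2 where "T2 = T - T1"
  have cT2: "card T2 = card T - card T1"
    using T1(2) fin1 by (auto simp: T2_def intro!: card_Diff_subset)
  have "card (T - ?B) = card T - card ?B" using fin by (intro card_Diff_subset) auto
  \<comment> \<open>Either \<open>T1\<close> exhausts everything off the points over [a], and these
    number at most \<open>m\<close>, or it has \<open>n\<close> elements and the total count
    applies.\<close>
  then have m2: "card T2 \<le> m" using cT2 T1(3) nm m card_mono[OF T(1), of ?B] by (simp add: min_def split: if_splits)
  have fin2: "finite T2" using T(1) by (simp add: T2_def)
  have ex1: "\<exists>F\<in>biforms 1 0. bval F a b = 1 \<and> vanishes F z" if "z \<in> T1" for z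
    using that T1(2) T(2) ab(1) by (intro separating_lin1) auto
  have ex2: "\<exists>F\<in>biforms 0 1. bval F a b = 1 \<and> vanishes F z" if "z \<in> T2" for z
    using that T1(1) T(2) ab(2) by (intro separating_lin2) (auto simp: T2_def)
  obtain F1 where F1: "F1 \<in> biforms (card T1 * 1) (card T1 * 0)" "bval F1 a b = 1" "\<And>z. z \<in> T1 \<Longrightarrow> vanishes F1 z"
    by (rule vanishing_product[OF fin1 ex1]) (assumption | rule that)+
  obtain F2 where F2: "F2 \<in> biforms (card T2 * 0) (card T2 * 1)" "bval F2 a b = 1" "\<And>z. z \<in> T2 \<Longrightarrow> vanishes F2 z"
    by (rule vanishing_product[OF fin2 ex2]) (assumption | rule that)+
  \<comment> \<open>Fills up the bidegree when fewer than \<open>n + m\<close> points have to be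
    killed.\<close>
  obtain E where E: "E \<in> biforms (n - card T1) (m - card T2)" "bval E a b = 1"
    using ex_biform_nonzero[OF ab] .
  show ?thesis
  proof (rule that[of "F1 * F2 * E"])
    have "F1 * F2 \<in> biforms (card T1) (card T2)" using biforms_mult[OF F1(1) F2(1)] by simp
    then show "F1 * F2 * E \<in> biforms n m"
      using T1(3) m2 by (intro biforms_mult'[OF _ E(1)]) auto
    show "bval (F1 * F2 * E) a b = 1" using F1(2) F2(2) E(2) by (simp add: ev_simps)
    show "vanishes (F1 * F2 * E) z" if "z \<in> T" for z
      using that F1(3)[of z] F2(3)[of z] by (auto simp: T2_def intro!: vanishes_mult)
  qed
qed

text \<open>The dual form of the condition that the tangent tensor plus \<open>e\<close> times the
  power tensor lies in the span of the images of the points of \<open>S\<close>.\<close>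

definition tangent_spanned :: "nat \<Rightarrow> nat \<Rightarrow> ('n1::finite \<Rightarrow> 'k::field) \<Rightarrow> ('n2::finite \<Rightarrow> 'k) \<Rightarrow> ('n1 \<Rightarrow> 'k) \<Rightarrow> ('n2 \<Rightarrow> 'k) \<Rightarrow>
    'k \<Rightarrow> ('n1, 'n2, 'k) bipt set \<Rightarrow> bool" where
  "tangent_spanned d1 d2 a b u w e S \<longleftrightarrow> finite S \<and> S \<subseteq> biproj_space \<and>
     (\<forall>F\<in>biforms d1 d2. (\<forall>z\<in>S. vanishes F z) \<longrightarrow> bdiff F a b u w + e * bval F a b = 0)"

lemma tangent_spannedI:
  fixes p :: "'n1::finite list \<times> 'n2::finite list \<Rightarrow> 'k::field"
  assumes p: "\<And>x. p x = tangent_tensor d1 d2 a b u w x + e * power_tensor d1 d2 a b x"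
    and S: "finite S" "S \<subseteq> biproj_space" "p \<in> lspan (\<nu> d1 d2 ` S)"
  shows "tangent_spanned d1 d2 a b u w e S"
  unfolding tangent_spanned_def
proof (intro conjI ballI impI S(1,2))
  fix F :: "('n1, 'n2, 'k) bipoly" assume F: "F \<in> biforms d1 d2" and van: "\<forall>z\<in>S. vanishes F z"
  have "p = tangent_tensor d1 d2 a b u w + fscale e (power_tensor d1 d2 a b)"
    by (auto simp: fun_eq_iff p fscale_def)
  then have "biform_functional F p = bdiff F a b u w + e * bval F a b"
    by (simp only: biform_functional_add biform_functional_scale biform_functional_power_tensor[OF F]
        biform_functional_tangent_tensor[OF F])
  moreover have "biform_functional F p = 0"
    using van by (intro biform_functional_lspan[OF F _ S(3)]) (auto simp: vanishes_def)
  ultimately show "bdiff F a b u w + e * bval F a b = 0" by simp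
qed

text \<open>
  The product of \<open>H\<close> with linear forms killing \<open>T\<close>, but not \<open>(a, b)\<close>, would vanish on \<open>S\<close> and not in
  the tangent direction.
\<close>

lemma tangent_spanned_residual:
  fixes a :: "'n1::finite \<Rightarrow> 'k::field" and b :: "'n2::finite \<Rightarrow> 'k"
  assumes S: "tangent_spanned d1 d2 a b u w e S" and ab: "a \<noteq> 0" "b \<noteq> 0"
    and H: "H \<in> biforms i j" "i \<le> d1" "j \<le> d2" "bval H a b = 0" "bdiff H a b u w \<noteq> 0"
    and T: "T \<subseteq> S" "\<And>z. z \<in> S \<Longrightarrow> z \<notin> T \<Longrightarrow> vanishes H z"
    and cards: "card {z \<in> T. snd z = proj_pt b} \<le> d1 - i" "card {z \<in> T. fst z = proj_pt a} \<le> d2 - j"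
      "card T \<le> (d1 - i) + (d2 - j)"
  shows False
proof -
  \<comment> \<open>The support cannot be killed by a form with value 1 there, but it needs no
    factor, as \<open>H\<close> vanishes at it.\<close>
  define U where "U = T - {(proj_pt a, proj_pt b)}"
  have finS: "finite S" "S \<subseteq> biproj_space" using S by (auto simp: tangent_spanned_def)
  then have finT: "finite T" using T(1) finite_subset by blast
  have "card {z \<in> U. snd z = proj_pt b} \<le> card {z \<in> T. snd z = proj_pt b}"
    "card {z \<in> U. fst z = proj_pt a} \<le> card {z \<in> T. fst z = proj_pt a}" "card U \<le> card T"
    using finT by (auto intro!: card_mono simp: U_def)
  then have cU: "card {z \<in> U. snd z = proj_pt b} \<le> d1 - i" "card {z \<in> U. fst z = proj_pt a} \<le> d2 - j"
      "card U \<le> (d1 - i) + (d2 - j)"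
    using cards by linarith+
  have U: "finite U" "U \<subseteq> biproj_space" "(proj_pt a, proj_pt b) \<notin> U"
    using finT T(1) finS by (auto simp: U_def)
  obtain F where F: "F \<in> biforms (d1 - i) (d2 - j)" "bval F a b = 1" "\<And>z. z \<in> U \<Longrightarrow> vanishes F z"
    using killing_form[OF ab U cU] by blast
  have FH: "F * H \<in> biforms d1 d2"
    using H(2,3) by (intro biforms_mult'[OF F(1) H(1)]) auto
  have "vanishes (F * H) z" if "z \<in> S" for z
  proof -
    have "vanishes H (proj_pt a, proj_pt b)" using vanishes_iff[OF H(1)] H(4) by blast
    then have "vanishes F z \<or> vanishes H z"
      using F(3)[of z] T(2)[OF that] by (auto simp: U_def)
    then show ?thesis by (rule vanishes_mult)
  qed
  then have "bdiff (F * H) a b u w + e * bval (F * H) a b = 0"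
    using S FH by (auto simp: tangent_spanned_def)
  then show False using F(2) H(4,5) by (simp add: ev_simps mdiff_simps)
qed

text \<open>By exchange, \<open>u\<close> in the span of \<open>x\<close> and \<open>a\<close> would
  put \<open>x\<close> into the plane of \<open>a\<close> and \<open>u\<close>; so \<open>u\<close>
  can be separated from both.\<close>

lemma line_form:
  fixes a u x :: "'i::finite \<Rightarrow> 'k::field"
  assumes u: "u \<notin> fs.span {a}" and x: "x \<notin> fs.span {a, u}"
  obtains f where "dot f a = 0" "dot f x = 0" "dot f u = 1"
proof -
  have "u \<notin> fs.span {x, a}"
  proof
    assume "u \<in> fs.span {x, a}"
    from fs.in_span_insert[OF this u] have "x \<in> fs.span {u, a}" .
    then show False using x by (simp add: insert_commute)
  qed
  then obtain f where f: "\<And>v. v \<in> {x, a} \<Longrightarrow> dot f v = 0" "dot f u = 1" by (rule separating_form) blast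
  show ?thesis by (rule that[OF f(1) f(1) f(2)]) simp_all
qed

lemma proj_pt_line_point:
  fixes a u x :: "'i \<Rightarrow> 'k::field"
  assumes "x \<in> fs.span {a, u}" "x \<notin> fs.span {a}"
  obtains s where "proj_pt x = proj_pt (line_point a u s)"
proof -
  obtain c d where x: "x = (\<lambda>i. c * a i + d * u i)" using assms(1) by (auto simp: in_span_2)
  have d: "d \<noteq> 0" using assms(2) x by (auto simp: in_span_1)
  have "x = (\<lambda>i. d * line_point a u (c / d) i)"
    using d by (auto simp: x line_point_def fun_eq_iff algebra_simps)
  then have "proj_pt x = proj_pt (line_point a u (c / d))" using proj_pt_scale[OF d] by metis
  then show ?thesis by (rule that)
qed

text \<open>If the first projection of \<open>z\<close> left the line through [a] and [u], one
  linear form would vanish at \<open>a\<close> and at this projection but not at \<open>u\<close>.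
  It takes care of \<open>z\<close> and of all points over [a] at once, leaving few enough points
  for the residual argument.\<close>

lemma tangent_spanned_on_line1:
  fixes a :: "'n1::finite \<Rightarrow> 'k::field" and b :: "'n2::finite \<Rightarrow> 'k"
  assumes S: "tangent_spanned d1 d2 a b u w e S" and ab: "a \<noteq> 0" "b \<noteq> 0" and d1: "d1 > 0"
    and u: "u \<notin> fs.span {a}"
    and z: "z \<in> S" "fst z \<noteq> proj_pt a"
    and cards: "card ({z \<in> S. fst z \<noteq> proj_pt a \<and> snd z = proj_pt b} - {z}) \<le> d1 - 1"
      "card {z \<in> S. fst z \<noteq> proj_pt a} \<le> d1 + d2"
  obtains s where "fst z = proj_pt (line_point a u s)"
proof -
  have finS: "finite S" "S \<subseteq> biproj_space" using S by (auto simp: tangent_spanned_def)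
  obtain x y where xy: "z = (proj_pt x, proj_pt y)" "x \<noteq> 0" "y \<noteq> 0"
    using z(1) finS(2) biproj_space_cases by blast
  have xa: "x \<notin> fs.span {a}" using z(2) xy proj_pt_eq_iff(2)[OF ab(1) xy(2)] by auto
  have "x \<in> fs.span {a, u}"
  proof (rule ccontr)
    assume "x \<notin> fs.span {a, u}"
    then obtain f where f: "dot f a = 0" "dot f x = 0" "dot f u = 1" using line_form[OF u] by blast
    let ?T = "{z \<in> S. fst z \<noteq> proj_pt a} - {z}"
    show False
    proof (rule tangent_spanned_residual[OF S ab lin1_biform[of f], where T = ?T])
      have "{z' \<in> ?T. snd z' = proj_pt b} = {z \<in> S. fst z \<noteq> proj_pt a \<and> snd z = proj_pt b} - {z}" by auto
      then show "card {z' \<in> ?T. snd z' = proj_pt b} \<le> d1 - Suc 0" using cards(1) by simp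
      have "{z' \<in> ?T. fst z' = proj_pt a} = {}" by auto
      then show "card {z' \<in> ?T. fst z' = proj_pt a} \<le> d2 - 0" by (simp only: card.empty)
      have "card ?T = card {z \<in> S. fst z \<noteq> proj_pt a} - 1"
        using z finS by (intro card_Diff_singleton) auto
      then show "card ?T \<le> d1 - Suc 0 + (d2 - 0)" using cards(2) d1 by simp
      fix z' assume z': "z' \<in> S" "z' \<notin> ?T"
      obtain x' y' where xy': "z' = (proj_pt x', proj_pt y')" "x' \<noteq> 0" "y' \<noteq> 0"
        using z'(1) finS(2) biproj_space_cases by blast
      have "dot f x' = 0"
      proof (cases "z' = z")
        case True
        then have "x' \<in> fs.span {x}" using xy xy' proj_pt_eq_iff(2)[OF xy(2) xy'(2)] by auto
        then show ?thesis using f(2) by (auto simp: in_span_1 dot_scale)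
      next
        case False
        then have "x' \<in> fs.span {a}" using z' xy' proj_pt_eq_iff(2)[OF ab(1) xy'(2)] by auto
        then show ?thesis using f(1) by (auto simp: in_span_1 dot_scale)
      qed
      then show "vanishes (lin1 f) z'" by (simp add: xy'(1) vanishes_iff[OF lin1_biform])
    qed (use f d1 in auto)
  qed
  then show ?thesis using proj_pt_line_point[OF _ xa] that xy(1) by auto
qed

lemma tangent_spanned_on_line2:
  fixes a :: "'n1::finite \<Rightarrow> 'k::field" and b :: "'n2::finite \<Rightarrow> 'k"
  assumes S: "tangent_spanned d1 d2 a b u w e S" and ab: "a \<noteq> 0" "b \<noteq> 0" and d2: "d2 > 0"
    and w: "w \<notin> fs.span {b}"
    and z: "z \<in> S" "snd z \<noteq> proj_pt b"
    and cards: "card ({z \<in> S. snd z \<noteq> proj_pt b \<and> fst z = proj_pt a} - {z}) \<le> d2 - 1"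
      "card {z \<in> S. snd z \<noteq> proj_pt b} \<le> d1 + d2"
  obtains s where "snd z = proj_pt (line_point b w s)"
proof -
  have finS: "finite S" "S \<subseteq> biproj_space" using S by (auto simp: tangent_spanned_def)
  obtain x y where xy: "z = (proj_pt x, proj_pt y)" "x \<noteq> 0" "y \<noteq> 0"
    using z(1) finS(2) biproj_space_cases by blast
  have yb: "y \<notin> fs.span {b}" using z(2) xy proj_pt_eq_iff(2)[OF ab(2) xy(3)] by auto
  have "y \<in> fs.span {b, w}"
  proof (rule ccontr)
    assume "y \<notin> fs.span {b, w}"
    then obtain f where f: "dot f b = 0" "dot f y = 0" "dot f w = 1" using line_form[OF w] by blast
    let ?T = "{z \<in> S. snd z \<noteq> proj_pt b} - {z}"
    show False
    proof (rule tangent_spanned_residual[OF S ab lin2_biform[of f], where T = ?T])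
      have "{z' \<in> ?T. fst z' = proj_pt a} = {z \<in> S. snd z \<noteq> proj_pt b \<and> fst z = proj_pt a} - {z}" by auto
      then show "card {z' \<in> ?T. fst z' = proj_pt a} \<le> d2 - Suc 0" using cards(1) by simp
      have "{z' \<in> ?T. snd z' = proj_pt b} = {}" by auto
      then show "card {z' \<in> ?T. snd z' = proj_pt b} \<le> d1 - 0" by (simp only: card.empty)
      have "card ?T = card {z \<in> S. snd z \<noteq> proj_pt b} - 1"
        using z finS by (intro card_Diff_singleton) auto
      then show "card ?T \<le> d1 - 0 + (d2 - Suc 0)" using cards(2) d2 by simp
      fix z' assume z': "z' \<in> S" "z' \<notin> ?T"
      obtain x' y' where xy': "z' = (proj_pt x', proj_pt y')" "x' \<noteq> 0" "y' \<noteq> 0"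
        using z'(1) finS(2) biproj_space_cases by blast
      have "dot f y' = 0"
      proof (cases "z' = z")
        case True
        then have "y' \<in> fs.span {y}" using xy xy' proj_pt_eq_iff(2)[OF xy(3) xy'(3)] by auto
        then show ?thesis using f(2) by (auto simp: in_span_1 dot_scale)
      next
        case False
        then have "y' \<in> fs.span {b}" using z' xy' proj_pt_eq_iff(2)[OF ab(2) xy'(3)] by auto
        then show ?thesis using f(1) by (auto simp: in_span_1 dot_scale)
      qed
      then show "vanishes (lin2 f) z'" by (simp add: xy'(1) vanishes_iff[OF lin2_biform])
    qed (use f d2 in auto)
  qed
  then show ?thesis using proj_pt_line_point[OF _ yb] that xy(1) by auto
qed

text \<open>A linear form that vanishes at \<open>a\<close> but not at \<open>u\<close> covers all
  points over [a]. If both counts were smaller, a form of bidegree \<open>(d1 - 1, d2)\<close> would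
  cover the rest. The first count is limited separately because points over [b] can only be covered
  by linear forms in the first variables.\<close>

lemma tangent_spanned_count1:
  fixes a :: "'n1::finite \<Rightarrow> 'k::field" and b :: "'n2::finite \<Rightarrow> 'k"
  assumes S: "tangent_spanned d1 d2 a b u w e S" and ab: "a \<noteq> 0" "b \<noteq> 0" and d1: "d1 > 0"
    and u: "u \<notin> fs.span {a}"
  shows "card {z \<in> S. fst z \<noteq> proj_pt a \<and> snd z = proj_pt b} \<ge> d1 \<or> card {z \<in> S. fst z \<noteq> proj_pt a} \<ge> d1 + d2"
proof (rule ccontr)
  assume no: "\<not> ?thesis"
  have finS: "finite S" "S \<subseteq> biproj_space" using S by (auto simp: tangent_spanned_def)
  obtain f where f: "dot f a = 0" "dot f u = 1" using separating_form[OF u] by blast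
  let ?T = "{z \<in> S. fst z \<noteq> proj_pt a}"
  show False
  proof (rule tangent_spanned_residual[OF S ab lin1_biform[of f], where T = ?T])
    have "{z' \<in> ?T. snd z' = proj_pt b} = {z \<in> S. fst z \<noteq> proj_pt a \<and> snd z = proj_pt b}" by auto
    then show "card {z' \<in> ?T. snd z' = proj_pt b} \<le> d1 - Suc 0" using no by auto
    have "{z' \<in> ?T. fst z' = proj_pt a} = {}" by auto
    then show "card {z' \<in> ?T. fst z' = proj_pt a} \<le> d2 - 0" by (simp only: card.empty)
    show "card ?T \<le> d1 - Suc 0 + (d2 - 0)" using no d1 by auto
    fix z' assume z': "z' \<in> S" "z' \<notin> ?T"
    obtain x' y' where xy': "z' = (proj_pt x', proj_pt y')" "x' \<noteq> 0" "y' \<noteq> 0"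
      using z'(1) finS(2) biproj_space_cases by blast
    then have "x' \<in> fs.span {a}" using z' xy' proj_pt_eq_iff(2)[OF ab(1) xy'(2)] by auto
    then have "dot f x' = 0" using f(1) by (auto simp: in_span_1 dot_scale)
    then show "vanishes (lin1 f) z'" by (simp add: xy'(1) vanishes_iff[OF lin1_biform])
  qed (use f d1 in auto)
qed

lemma tangent_spanned_count2:
  fixes a :: "'n1::finite \<Rightarrow> 'k::field" and b :: "'n2::finite \<Rightarrow> 'k"
  assumes S: "tangent_spanned d1 d2 a b u w e S" and ab: "a \<noteq> 0" "b \<noteq> 0" and d2: "d2 > 0"
    and w: "w \<notin> fs.span {b}"
  shows "card {z \<in> S. snd z \<noteq> proj_pt b \<and> fst z = proj_pt a} \<ge> d2 \<or> card {z \<in> S. snd z \<noteq> proj_pt b} \<ge> d1 + d2"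
proof (rule ccontr)
  assume no: "\<not> ?thesis"
  have finS: "finite S" "S \<subseteq> biproj_space" using S by (auto simp: tangent_spanned_def)
  obtain f where f: "dot f b = 0" "dot f w = 1" using separating_form[OF w] by blast
  let ?T = "{z \<in> S. snd z \<noteq> proj_pt b}"
  show False
  proof (rule tangent_spanned_residual[OF S ab lin2_biform[of f], where T = ?T])
    have "{z' \<in> ?T. fst z' = proj_pt a} = {z \<in> S. snd z \<noteq> proj_pt b \<and> fst z = proj_pt a}" by auto
    then show "card {z' \<in> ?T. fst z' = proj_pt a} \<le> d2 - Suc 0" using no by auto
    have "{z' \<in> ?T. snd z' = proj_pt b} = {}" by auto
    then show "card {z' \<in> ?T. snd z' = proj_pt b} \<le> d1 - 0" by (simp only: card.empty)
    show "card ?T \<le> d1 - 0 + (d2 - Suc 0)" using no d2 by auto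
    fix z' assume z': "z' \<in> S" "z' \<notin> ?T"
    obtain x' y' where xy': "z' = (proj_pt x', proj_pt y')" "x' \<noteq> 0" "y' \<noteq> 0"
      using z'(1) finS(2) biproj_space_cases by blast
    then have "y' \<in> fs.span {b}" using z' xy' proj_pt_eq_iff(2)[OF ab(2) xy'(3)] by auto
    then have "dot f y' = 0" using f(1) by (auto simp: in_span_1 dot_scale)
    then show "vanishes (lin2 f) z'" by (simp add: xy'(1) vanishes_iff[OF lin2_biform])
  qed (use f d2 in auto)
qed

text \<open>With at most \<open>d1\<close> points the total count \<open>d1 + d2\<close> is out of
  reach since \<open>d2 > 0\<close>, so \<open>d1\<close> points lie over [b], and these are all of
  \<open>S\<close>.\<close>

lemma tangent_spanned_line1:
  fixes a :: "'n1::finite \<Rightarrow> 'k::field" and b :: "'n2::finite \<Rightarrow> 'k"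
  assumes S: "tangent_spanned d1 d2 a b u w e S" and ab: "a \<noteq> 0" "b \<noteq> 0" and d: "d1 > 0" "d2 > 0"
    and u: "u \<notin> fs.span {a}" and card: "card S \<le> d1"
  shows "card S = d1" "\<And>z. z \<in> S \<Longrightarrow> snd z = proj_pt b \<and> fst z \<noteq> proj_pt a \<and> (\<exists>s. fst z = proj_pt (line_point a u s))"
proof -
  have finS: "finite S" "S \<subseteq> biproj_space" using S by (auto simp: tangent_spanned_def)
  let ?C = "{z \<in> S. fst z \<noteq> proj_pt a \<and> snd z = proj_pt b}"
  have "card {z \<in> S. fst z \<noteq> proj_pt a} \<le> card S" using finS by (intro card_mono) auto
  then have cC: "card ?C \<ge> d1" using tangent_spanned_count1[OF S ab d(1) u] card d(2) by linarith
  moreover have "card ?C \<le> card S" using finS by (intro card_mono) auto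
  ultimately show cS: "card S = d1" using card by linarith
  have C: "?C = S" using finS cC card by (intro card_seteq) auto
  fix z assume z: "z \<in> S"
  then have zC: "fst z \<noteq> proj_pt a" "snd z = proj_pt b" using C by blast+
  have "card (?C - {z}) \<le> d1 - 1" using z cS unfolding C by simp
  moreover have "card {z \<in> S. fst z \<noteq> proj_pt a} \<le> d1 + d2"
    using \<open>card {z \<in> S. fst z \<noteq> proj_pt a} \<le> card S\<close> card by linarith
  ultimately obtain s where "fst z = proj_pt (line_point a u s)"
    using tangent_spanned_on_line1[OF S ab d(1) u z zC(1)] by blast
  then show "snd z = proj_pt b \<and> fst z \<noteq> proj_pt a \<and> (\<exists>s. fst z = proj_pt (line_point a u s))"
    using zC by blast
qed

lemma tangent_spanned_line2:
  fixes a :: "'n1::finite \<Rightarrow> 'k::field" and b :: "'n2::finite \<Rightarrow> 'k"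
  assumes S: "tangent_spanned d1 d2 a b u w e S" and ab: "a \<noteq> 0" "b \<noteq> 0" and d: "d1 > 0" "d2 > 0"
    and w: "w \<notin> fs.span {b}" and card: "card S \<le> d2"
  shows "card S = d2" "\<And>z. z \<in> S \<Longrightarrow> fst z = proj_pt a \<and> snd z \<noteq> proj_pt b \<and> (\<exists>s. snd z = proj_pt (line_point b w s))"
proof -
  have finS: "finite S" "S \<subseteq> biproj_space" using S by (auto simp: tangent_spanned_def)
  let ?C = "{z \<in> S. snd z \<noteq> proj_pt b \<and> fst z = proj_pt a}"
  have "card {z \<in> S. snd z \<noteq> proj_pt b} \<le> card S" using finS by (intro card_mono) auto
  then have cC: "card ?C \<ge> d2" using tangent_spanned_count2[OF S ab d(2) w] card d(1) by linarith
  moreover have "card ?C \<le> card S" using finS by (intro card_mono) auto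
  ultimately show cS: "card S = d2" using card by linarith
  have C: "?C = S" using finS cC card by (intro card_seteq) auto
  fix z assume z: "z \<in> S"
  then have zC: "snd z \<noteq> proj_pt b" "fst z = proj_pt a" using C by blast+
  have "card (?C - {z}) \<le> d2 - 1" using z cS unfolding C by simp
  moreover have "card {z \<in> S. snd z \<noteq> proj_pt b} \<le> d1 + d2"
    using \<open>card {z \<in> S. snd z \<noteq> proj_pt b} \<le> card S\<close> card by linarith
  ultimately obtain s where "snd z = proj_pt (line_point b w s)"
    using tangent_spanned_on_line2[OF S ab d(2) w z zC(1)] by blast
  then show "fst z = proj_pt a \<and> snd z \<noteq> proj_pt b \<and> (\<exists>s. snd z = proj_pt (line_point b w s))"
    using zC by blast
qed

lemma tangent_spanned_curve:
  fixes a :: "'n1::finite \<Rightarrow> 'k::field" and b :: "'n2::finite \<Rightarrow> 'k"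
  assumes S: "tangent_spanned d1 d2 a b u w e S" and ab: "a \<noteq> 0" "b \<noteq> 0" and d: "d1 > 0" "d2 > 0"
    and u: "u \<notin> fs.span {a}" and w: "w \<notin> fs.span {b}" and card: "card S \<le> d1 + d2"
  shows "card S = d1 + d2" "(proj_pt a, proj_pt b) \<notin> S"
    and "(\<forall>z\<in>S. fst z \<noteq> proj_pt a \<and> snd z \<noteq> proj_pt b) \<and>
        (\<exists>c. \<forall>z\<in>S. \<exists>s. z = (proj_pt (line_point a u s), proj_pt (line_point b w (s + c))))
      \<or> card {z \<in> S. snd z = proj_pt b} = d1 \<and> card {z \<in> S. fst z = proj_pt a} = d2 \<and>
        (\<forall>z\<in>S. snd z = proj_pt b \<and> (\<exists>s. fst z = proj_pt (line_point a u s)) \<or>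
          fst z = proj_pt a \<and> (\<exists>s. snd z = proj_pt (line_point b w s)))"
proof -
  have finS: "finite S" "S \<subseteq> biproj_space" using S by (auto simp: tangent_spanned_def)
  define A where "A = {z \<in> S. fst z \<noteq> proj_pt a \<and> snd z \<noteq> proj_pt b}"
  define B where "B = {z \<in> S. snd z \<noteq> proj_pt b \<and> fst z = proj_pt a}"
  define C where "C = {z \<in> S. fst z \<noteq> proj_pt a \<and> snd z = proj_pt b}"
  define O' where "O' = {z \<in> S. fst z = proj_pt a \<and> snd z = proj_pt b}"
  have fin: "finite A" "finite B" "finite C" "finite O'"
    using finS by (auto simp: A_def B_def C_def O'_def)
  have AC: "{z \<in> S. fst z \<noteq> proj_pt a} = A \<union> C" and AB: "{z \<in> S. snd z \<noteq> proj_pt b} = A \<union> B"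
    and S_eq: "S = A \<union> B \<union> C \<union> O'"
    by (auto simp: A_def B_def C_def O'_def)
  have cAC: "card (A \<union> C) = card A + card C" and cAB: "card (A \<union> B) = card A + card B"
    using fin by (auto intro!: card_Un_disjoint simp: A_def B_def C_def)
  have "card (A \<union> B \<union> C) = card (A \<union> B) + card C"
    using fin by (intro card_Un_disjoint) (auto simp: A_def B_def C_def)
  moreover have "card (A \<union> B \<union> C \<union> O') = card (A \<union> B \<union> C) + card O'"
    using fin by (intro card_Un_disjoint) (auto simp: A_def B_def C_def O'_def)
  ultimately have cS: "card S = card A + card B + card C + card O'"
    using cAB S_eq by simp
  have 1: "card C \<ge> d1 \<or> card A + card C \<ge> d1 + d2"
    using tangent_spanned_count1[OF S ab d(1) u] unfolding AC cAC C_def[symmetric] .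
  have 2: "card B \<ge> d2 \<or> card A + card B \<ge> d1 + d2"
    using tangent_spanned_count2[OF S ab d(2) w] unfolding AB cAB B_def[symmetric] .
  \<comment> \<open>If both first alternatives hold, the total forces \<open>card A = 0\<close> and
    equality; if both second ones hold, it forces \<open>card B\<close> and \<open>card C\<close> to
    vanish; the mixed cases exceed \<open>d1 + d2\<close>, as both degrees are positive.\<close>
  have cases: "card A = d1 + d2 \<and> card B = 0 \<and> card C = 0 \<or> card A = 0 \<and> card B = d2 \<and> card C = d1"
    and O0: "card O' = 0" and "card S = d1 + d2"
    using 1 2 card d unfolding cS by linarith+
  show "card S = d1 + d2" by fact
  show "(proj_pt a, proj_pt b) \<notin> S" using O0 fin(4) by (auto simp: O'_def)
  have line1: "\<exists>s. fst z = proj_pt (line_point a u s)" if z: "z \<in> S" "fst z \<noteq> proj_pt a" for z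
  proof (rule tangent_spanned_on_line1[OF S ab d(1) u z])
    show "card {z \<in> S. fst z \<noteq> proj_pt a} \<le> d1 + d2" using cases d unfolding AC cAC by auto
    show "card ({z \<in> S. fst z \<noteq> proj_pt a \<and> snd z = proj_pt b} - {z}) \<le> d1 - 1"
    proof (cases "card A = 0")
      case True
      then have "A = {}" using fin by simp
      then have "z \<in> C" using z unfolding A_def C_def by blast
      then show ?thesis using cases d True fin unfolding C_def[symmetric] by auto
    next
      case False
      then have "C = {}" using cases fin by auto
      then show ?thesis unfolding C_def[symmetric] by simp
    qed
  qed blast
  have line2: "\<exists>s. snd z = proj_pt (line_point b w s)" if z: "z \<in> S" "snd z \<noteq> proj_pt b" for z
  proof (rule tangent_spanned_on_line2[OF S ab d(2) w z])
    show "card {z \<in> S. snd z \<noteq> proj_pt b} \<le> d1 + d2" using cases d unfolding AB cAB by auto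
    show "card ({z \<in> S. snd z \<noteq> proj_pt b \<and> fst z = proj_pt a} - {z}) \<le> d2 - 1"
    proof (cases "card A = 0")
      case True
      then have "A = {}" using fin by simp
      then have "z \<in> B" using z unfolding A_def B_def by blast
      then show ?thesis using cases d True fin unfolding B_def[symmetric] by auto
    next
      case False
      then have "B = {}" using cases fin by auto
      then show ?thesis unfolding B_def[symmetric] by simp
    qed
  qed blast
  show "(\<forall>z\<in>S. fst z \<noteq> proj_pt a \<and> snd z \<noteq> proj_pt b) \<and>
        (\<exists>c. \<forall>z\<in>S. \<exists>s. z = (proj_pt (line_point a u s), proj_pt (line_point b w (s + c))))
      \<or> card {z \<in> S. snd z = proj_pt b} = d1 \<and> card {z \<in> S. fst z = proj_pt a} = d2 \<and>
        (\<forall>z\<in>S. snd z = proj_pt b \<and> (\<exists>s. fst z = proj_pt (line_point a u s)) \<or>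
          fst z = proj_pt a \<and> (\<exists>s. snd z = proj_pt (line_point b w s)))"
  proof (cases "card A = 0")
    case True
    then have e: "A = {}" "O' = {}" using fin O0 by auto
    have "{z \<in> S. snd z = proj_pt b} = C" "{z \<in> S. fst z = proj_pt a} = B"
      using e by (auto simp: A_def B_def C_def O'_def)
    then have "card {z \<in> S. snd z = proj_pt b} = d1" "card {z \<in> S. fst z = proj_pt a} = d2"
      using True cases d by auto
    moreover have "snd z = proj_pt b \<and> (\<exists>s. fst z = proj_pt (line_point a u s)) \<or>
          fst z = proj_pt a \<and> (\<exists>s. snd z = proj_pt (line_point b w s))" if z: "z \<in> S" for z
    proof (cases "z \<in> B")
      case True
      then show ?thesis using line2[OF z] unfolding B_def by blast
    next
      case False
      then have "z \<in> C" using z S_eq e by blast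
      then show ?thesis using line1[OF z] unfolding C_def by blast
    qed
    ultimately show ?thesis by blast
  next
    case False
    then have "B = {}" "C = {}" "O' = {}" using fin O0 cases by auto
    then have SA: "S = A" using S_eq by blast
    then have ne: "fst z \<noteq> proj_pt a" "snd z \<noteq> proj_pt b" if "z \<in> S" for z using that by (auto simp: A_def)
    have "\<exists>s t. z = (proj_pt (line_point a u s), proj_pt (line_point b w t))" if "z \<in> S" for z
      using line1[OF that ne(1)[OF that]] line2[OF that ne(2)[OF that]] by (metis prod.collapse)
    then obtain s t where st: "\<And>z. z \<in> S \<Longrightarrow> z = (proj_pt (line_point a u (s z)), proj_pt (line_point b w (t z)))"
      by metis
    obtain f f0 where f: "dot f a = 0" "dot f u = 1" "dot f0 a = 1" "dot f0 u = 0"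
      using coordinate_forms[OF ab(1) u] by blast
    obtain g g0 where g: "dot g b = 0" "dot g w = 1" "dot g0 b = 1" "dot g0 w = 0"
      using coordinate_forms[OF ab(2) w] by blast
    \<comment> \<open>The points are now pairs of parameters, and they lie on a graph
      \<open>t = s + c\<close> as soon as \<open>t - s\<close> is constant.\<close>
    have const: "t z1 - s z1 = t z2 - s z2" if z: "z1 \<in> S" "z2 \<in> S" for z1 z2
    proof (rule ccontr)
      assume neq: "t z1 - s z1 \<noteq> t z2 - s z2"
      \<comment> \<open>In the parameters of the two lines,
        \<open>\<alpha> x + \<beta> y + \<gamma> = 0\<close> is the line through the pairs of
        \<open>z1\<close> and \<open>z2\<close>. The form \<open>Q\<close> of bidegree (1, 1) is its
        homogenisation; it vanishes at the support and has tangent derivative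
        \<open>\<alpha> + \<beta>\<close>. The remaining \<open>d1 + d2 - 2\<close> points meet as
        many linear factors.\<close>
      define \<alpha> where "\<alpha> = t z1 - t z2"
      define \<beta> where "\<beta> = s z2 - s z1"
      define \<gamma> where "\<gamma> = - (\<alpha> * s z1 + \<beta> * t z1)"
      define Q where "Q = Const \<alpha> * (lin1 f0 * lin2 g) + Const \<beta> * (lin1 f * lin2 g0) + Const \<gamma> * (lin1 f * lin2 g)"
      have Q: "Q \<in> biforms 1 1"
        unfolding Q_def by (intro biforms_add biforms_Const_mult biforms_mult'[OF lin1_biform lin2_biform]) auto
      have Qv: "bval Q (line_point a u x) (line_point b w y) = \<alpha> * x + \<beta> * y + \<gamma>" for x y
        using f g by (simp add: Q_def ev_simps line_point_def dot_add dot_scale)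
      show False
      proof (rule tangent_spanned_residual[OF S ab Q, where T = "S - {z1, z2}"])
        show "bval Q a b = 0" using f g by (simp add: Q_def ev_simps)
        have "\<alpha> + \<beta> \<noteq> 0" using neq by (simp add: \<alpha>_def \<beta>_def algebra_simps)
        then show "bdiff Q a b u w \<noteq> 0" using f g by (simp add: Q_def ev_simps mdiff_simps)
        have "{z \<in> S - {z1, z2}. snd z = proj_pt b} = {}" "{z \<in> S - {z1, z2}. fst z = proj_pt a} = {}"
          using ne by auto
        then show "card {z \<in> S - {z1, z2}. snd z = proj_pt b} \<le> d1 - 1"
          "card {z \<in> S - {z1, z2}. fst z = proj_pt a} \<le> d2 - 1" by (simp_all only: card.empty)
        have "z1 \<noteq> z2" using neq by auto
        then have "card (S - {z1, z2}) = d1 + d2 - 2"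
          using z finS \<open>card S = d1 + d2\<close> by (subst card_Diff_subset) auto
        then show "card (S - {z1, z2}) \<le> d1 - 1 + (d2 - 1)" by simp
        fix z assume "z \<in> S" "z \<notin> S - {z1, z2}"
        then have "z = z1 \<or> z = z2" by blast
        moreover have "vanishes Q (proj_pt (line_point a u (s z1)), proj_pt (line_point b w (t z1)))"
          unfolding vanishes_iff[OF Q] Qv by (simp add: \<gamma>_def)
        moreover have "vanishes Q (proj_pt (line_point a u (s z2)), proj_pt (line_point b w (t z2)))"
          unfolding vanishes_iff[OF Q] Qv by (simp add: \<alpha>_def \<beta>_def \<gamma>_def algebra_simps)
        ultimately show "vanishes Q z" using st[OF z(1)] st[OF z(2)] by metis
      qed (use d in auto)
    qed
    have "S \<noteq> {}" using False SA by auto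
    then obtain z0 where z0: "z0 \<in> S" by blast
    have "\<exists>r. z = (proj_pt (line_point a u r), proj_pt (line_point b w (r + (t z0 - s z0))))"
      if "z \<in> S" for z
    proof
      have e: "s z + (t z0 - s z0) = t z" using const[OF z0 that] by (simp add: algebra_simps)
      show "z = (proj_pt (line_point a u (s z)), proj_pt (line_point b w (s z + (t z0 - s z0))))"
        unfolding e by (rule st[OF that])
    qed
    then show ?thesis using ne by blast
  qed
qed

section \<open>Closed and irreducible sets\<close>

lemma set_ideal_is_ideal: "is_ideal (set_ideal G)"
  by (auto simp: is_ideal_def vanishing_ideal_def ev_simps)

lemma set_ideal_subspace: "mp.subspace (set_ideal G)"
  by (rule ideal_subspace[OF set_ideal_is_ideal])

lemma mem_set_ideal: "F \<in> set_ideal G \<longleftrightarrow> (\<forall>z\<in>G. vanishes F z)"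
  unfolding vanishing_ideal_def bicone_def vanishes_def by fastforce

lemma set_ideal_antimono: "A \<subseteq> B \<Longrightarrow> set_ideal B \<subseteq> set_ideal A"
  unfolding subset_iff mem_set_ideal by blast

text \<open>The expression is viewed as a polynomial in \<open>c\<close> and then in
  \<open>d\<close>; in characteristic zero a polynomial with all values zero has zero
  coefficients.\<close>

lemma two_variable_polynomial_zero:
  fixes q :: "nat \<Rightarrow> nat \<Rightarrow> 'k::field_char_0"
  assumes A: "finite A" and zero: "\<And>c d. (\<Sum>(s, t)\<in>A. c ^ s * d ^ t * q s t) = 0" and st: "(s, t) \<in> A"
  shows "q s t = 0"
proof -
  let ?B = "{x \<in> A. fst x = s}"
  have 1: "(\<Sum>x\<in>?B. d ^ snd x * q s (snd x)) = 0" for d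
  proof -
    define P where "P = (\<Sum>x\<in>A. monom (d ^ snd x * q (fst x) (snd x)) (fst x))"
    have "poly P c = 0" for c
      using zero[of c d] by (simp add: P_def poly_sum poly_monom case_prod_beta mult_ac)
    then have "P = 0" using poly_all_0_iff_0 by blast
    then have "0 = coeff P s" by simp
    also have "\<dots> = (\<Sum>x\<in>A. if fst x = s then d ^ snd x * q (fst x) (snd x) else 0)"
      by (simp add: P_def coeff_sum)
    also have "\<dots> = (\<Sum>x\<in>?B. d ^ snd x * q (fst x) (snd x))"
      by (rule sum.inter_filter[OF A, symmetric])
    also have "\<dots> = (\<Sum>x\<in>?B. d ^ snd x * q s (snd x))" by (rule sum.cong) auto
    finally show ?thesis by simp
  qed
  define Q where "Q = (\<Sum>x\<in>?B. monom (q s (snd x)) (snd x))"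
  have "poly Q d = 0" for d using 1[of d] by (simp add: Q_def poly_sum poly_monom mult_ac)
  then have "Q = 0" using poly_all_0_iff_0 by blast
  then have "0 = coeff Q t" by simp
  also have "\<dots> = (\<Sum>x\<in>?B. if x = (s, t) then q s t else 0)"
    unfolding Q_def coeff_sum by (rule sum.cong) auto
  also have "\<dots> = q s t" using A st by (simp add: sum.delta)
  finally show ?thesis by simp
qed

text \<open>Scaling the two vectors of a point independently turns the vanishing of \<open>F\<close>
  into a polynomial identity in the scalars, whose coefficients are the values of the
  components.\<close>

lemma set_ideal_bicomponent:
  fixes G :: "('n1::finite, 'n2::finite, 'k::field_char_0) bipt set"
  assumes G: "G \<subseteq> biproj_space" and F: "F \<in> set_ideal G"
  shows "bicomponent s t F \<in> set_ideal G"
proof (cases "(s, t) \<in> bidegs F")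
  case True
  show ?thesis
    unfolding mem_set_ideal
  proof
    fix z assume z: "z \<in> G"
    then obtain a b where ab: "z = (proj_pt a, proj_pt b)" using G biproj_space_cases by blast
    have "(\<Sum>(s, t)\<in>bidegs F. c ^ s * d ^ t * bval (bicomponent s t F) a b) = 0" for c d
    proof -
      have "vanishes F (proj_pt a, proj_pt b)" using F z ab unfolding mem_set_ideal by blast
      moreover have "(\<lambda>i. c * a i) \<in> proj_pt a" "(\<lambda>j. d * b j) \<in> proj_pt b"
        unfolding mem_proj_pt by blast+
      ultimately have "0 = bval F (\<lambda>i. c * a i) (\<lambda>j. d * b j)"
        unfolding vanishes_def by simp
      also have "\<dots> = (\<Sum>x\<in>bidegs F. bval (bicomponent (fst x) (snd x) F) (\<lambda>i. c * a i) (\<lambda>j. d * b j))"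
        by (subst (1) sum_bicomponents[of F]) (simp add: ev_simps case_prod_beta)
      finally show ?thesis by (simp add: bval_scale[OF bicomponent_biform] case_prod_beta)
    qed
    then have "bval (bicomponent s t F) a b = 0"
      by (rule two_variable_polynomial_zero[where q = "\<lambda>s t. bval (bicomponent s t F) a b", OF finite_bidegs _ True])
    then show "vanishes (bicomponent s t F) z"
      unfolding ab vanishes_iff[OF bicomponent_biform] .
  qed
next
  case False
  then have "{m \<in> Poly_Mapping.keys F. has_bidegree m s t} = {}"
    by (auto simp: bidegs_def has_bidegree_def)
  then have "bicomponent s t F = 0" by (simp only: bicomponent_def sum.empty)
  then show ?thesis by (simp add: is_idealD(1)[OF set_ideal_is_ideal])
qed

lemma zero_locus_subset: "zero_locus J \<subseteq> biproj_space"
  by (auto simp: zero_locus_def)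

lemma mem_zero_locus: "z \<in> zero_locus J \<longleftrightarrow> z \<in> biproj_space \<and> (\<forall>F\<in>J. vanishes F z)"
  unfolding zero_locus_def bicone_def vanishes_def by (cases z) fastforce

text \<open>Every polynomial of the ideal splits into biforms of the ideal, so the closure can be
  tested on biforms, for which vanishing at a point is a single value.\<close>

lemma mem_closure:
  fixes A :: "('n1::finite, 'n2::finite, 'k::field_char_0) bipt set"
  assumes "A \<subseteq> biproj_space"
  shows "z \<in> zero_locus (set_ideal A) \<longleftrightarrow> z \<in> biproj_space \<and>
    (\<forall>s t. \<forall>F\<in>biforms s t. (\<forall>z'\<in>A. vanishes F z') \<longrightarrow> vanishes F z)"
proof
  assume "z \<in> zero_locus (set_ideal A)"
  then show "z \<in> biproj_space \<and> (\<forall>s t. \<forall>F\<in>biforms s t. (\<forall>z'\<in>A. vanishes F z') \<longrightarrow> vanishes F z)"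
    unfolding mem_zero_locus using iffD2[OF mem_set_ideal] by blast
next
  assume *: "z \<in> biproj_space \<and> (\<forall>s t. \<forall>F\<in>biforms s t. (\<forall>z'\<in>A. vanishes F z') \<longrightarrow> vanishes F z)"
  then have "z \<in> biproj_space" by (rule conjunct1)
  then obtain a b where ab: "z = (proj_pt a, proj_pt b)" "a \<noteq> 0" "b \<noteq> 0" by (rule biproj_space_cases)
  have "vanishes F z" if F: "F \<in> set_ideal A" for F
  proof -
    have "vanishes (bicomponent s t F) z" for s t
      using *[THEN conjunct2, rule_format, OF bicomponent_biform] set_ideal_bicomponent[OF assms F, of s t]
      unfolding mem_set_ideal by simp
    then have "bval (bicomponent s t F) a b = 0" for s t
      unfolding ab(1) vanishes_iff[OF bicomponent_biform] by blast
    then have "mvalue F v = 0" if "v \<in> bicone {(proj_pt a, proj_pt b)}" for v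
      using that by (rule mvalue_bicone_point)
    then show ?thesis unfolding ab(1) vanishes_def bicone_def by force
  qed
  then show "z \<in> zero_locus (set_ideal A)" unfolding mem_zero_locus using * by blast
qed

lemma closure_superset: "A \<subseteq> biproj_space \<Longrightarrow> A \<subseteq> zero_locus (set_ideal A)"
  by (auto simp: mem_zero_locus mem_set_ideal)

lemma zclosed_subset: "zclosed A \<Longrightarrow> A \<subseteq> biproj_space"
  using zero_locus_subset[of "set_ideal A"] by (simp add: zclosed_def)

lemma zclosedI:
  fixes A :: "('n1::finite, 'n2::finite, 'k::field_char_0) bipt set"
  assumes A: "A \<subseteq> biproj_space"
    and sep: "\<And>z. z \<in> biproj_space \<Longrightarrow> z \<notin> A \<Longrightarrow> \<exists>s t. \<exists>F\<in>biforms s t. (\<forall>z'\<in>A. vanishes F z') \<and> \<not> vanishes F z"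
  shows "zclosed A"
  unfolding zclosed_def
proof (intro equalityI closure_superset[OF A] subsetI)
  fix z assume z: "z \<in> zero_locus (set_ideal A)"
  show "z \<in> A"
  proof (rule ccontr)
    assume "z \<notin> A"
    moreover have zb: "z \<in> biproj_space" using z zero_locus_subset by (rule rev_subsetD)
    ultimately obtain s t F where "F \<in> biforms s t" "\<forall>z'\<in>A. vanishes F z'" "\<not> vanishes F z"
      using sep by meson
    then show False using z unfolding mem_closure[OF A] by meson
  qed
qed

lemma zclosedE:
  fixes A :: "('n1::finite, 'n2::finite, 'k::field_char_0) bipt set"
  assumes "zclosed A" "z \<in> biproj_space" "z \<notin> A"
  obtains s t F where "F \<in> biforms s t" "\<And>z'. z' \<in> A \<Longrightarrow> vanishes F z'" "\<not> vanishes F z"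
proof -
  have "z \<notin> zero_locus (set_ideal A)" using assms(1,3) by (simp add: zclosed_def)
  then show ?thesis
    using assms(2) that unfolding mem_closure[OF zclosed_subset[OF assms(1)]] by meson
qed

lemma closure_minimal:
  fixes A :: "('n1::finite, 'n2::finite, 'k::field_char_0) bipt set"
  assumes "A \<subseteq> B" "zclosed B"
  shows "zero_locus (set_ideal A) \<subseteq> B"
proof -
  have "zero_locus (set_ideal A) \<subseteq> zero_locus (set_ideal B)"
    using set_ideal_antimono[OF assms(1)] unfolding subset_iff mem_zero_locus by blast
  then show ?thesis using assms(2) by (simp add: zclosed_def)
qed

lemma zclosed_closure:
  fixes A :: "('n1::finite, 'n2::finite, 'k::field_char_0) bipt set"
  assumes "A \<subseteq> biproj_space"
  shows "zclosed (zero_locus (set_ideal A))"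
proof (rule zclosedI[OF zero_locus_subset])
  fix z assume z: "z \<in> biproj_space" "z \<notin> zero_locus (set_ideal A)"
  then obtain s t F where F: "F \<in> biforms s t" "\<forall>z'\<in>A. vanishes F z'" "\<not> vanishes F z"
    using mem_closure[OF assms, of z] by blast
  then have "\<forall>z'\<in>zero_locus (set_ideal A). vanishes F z'"
    using mem_closure[OF assms] by blast
  then show "\<exists>s t. \<exists>F\<in>biforms s t. (\<forall>z'\<in>zero_locus (set_ideal A). vanishes F z') \<and> \<not> vanishes F z"
    using F by blast
qed

lemma not_vanishes_mult:
  fixes F G :: "('n1::finite, 'n2::finite, 'k::field) bipoly"
  assumes "F \<in> biforms s t" "G \<in> biforms s' t'" "z \<in> biproj_space" "\<not> vanishes F z" "\<not> vanishes G z"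
  shows "\<not> vanishes (F * G) z"
proof -
  obtain a b where z: "z = (proj_pt a, proj_pt b)" using assms(3) biproj_space_cases by blast
  show ?thesis
    using assms(4,5) unfolding z vanishes_iff[OF assms(1)] vanishes_iff[OF assms(2)]
      vanishes_iff[OF biforms_mult[OF assms(1,2)]] by (simp add: ev_simps)
qed

lemma zclosed_Un:
  fixes A B :: "('n1::finite, 'n2::finite, 'k::field_char_0) bipt set"
  assumes "zclosed A" "zclosed B"
  shows "zclosed (A \<union> B)"
proof (rule zclosedI)
  show "A \<union> B \<subseteq> biproj_space" using assms zclosed_subset by blast
  fix z assume z: "z \<in> biproj_space" "z \<notin> A \<union> B"
  obtain s t F where F: "F \<in> biforms s t" "\<And>z'. z' \<in> A \<Longrightarrow> vanishes F z'" "\<not> vanishes F z"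
    by (rule zclosedE[OF assms(1) z(1)]) (use z(2) in simp, rule that)
  obtain s' t' G where G: "G \<in> biforms s' t'" "\<And>z'. z' \<in> B \<Longrightarrow> vanishes G z'" "\<not> vanishes G z"
    by (rule zclosedE[OF assms(2) z(1)]) (use z(2) in simp, rule that)
  have "\<forall>z'\<in>A \<union> B. vanishes (F * G) z'" using F(2) G(2) vanishes_mult by blast
  then show "\<exists>s t. \<exists>F\<in>biforms s t. (\<forall>z'\<in>A \<union> B. vanishes F z') \<and> \<not> vanishes F z"
    using not_vanishes_mult[OF F(1) G(1) z(1) F(3) G(3)] biforms_mult[OF F(1) G(1)] by blast
qed

lemma zclosed_hypersurface:
  fixes A :: "('n1::finite, 'n2::finite, 'k::field_char_0) bipt set"
  assumes A: "zclosed A" and F: "F \<in> biforms s t"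
  shows "zclosed {z \<in> A. vanishes F z}"
proof (rule zclosedI)
  show "{z \<in> A. vanishes F z} \<subseteq> biproj_space" using zclosed_subset[OF A] by blast
  fix z assume z: "z \<in> biproj_space" "z \<notin> {z \<in> A. vanishes F z}"
  show "\<exists>s t. \<exists>G\<in>biforms s t. (\<forall>z'\<in>{z \<in> A. vanishes F z}. vanishes G z') \<and> \<not> vanishes G z"
  proof (cases "z \<in> A")
    case True
    then show ?thesis using z F by blast
  next
    case False
    obtain s t G where "G \<in> biforms s t" "\<And>z'. z' \<in> A \<Longrightarrow> vanishes G z'" "\<not> vanishes G z"
      by (rule zclosedE[OF A z(1) False]) (rule that)
    then show ?thesis by blast
  qed
qed

lemma zclosed_singleton:
  fixes z :: "('n1::finite, 'n2::finite, 'k::field_char_0) bipt"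
  assumes "z \<in> biproj_space"
  shows "zclosed {z}"
proof (rule zclosedI)
  fix z' assume z': "z' \<in> biproj_space" "z' \<notin> {z}"
  then obtain a b where ab: "z' = (proj_pt a, proj_pt b)" "a \<noteq> 0" "b \<noteq> 0"
    using biproj_space_cases by blast
  show "\<exists>s t. \<exists>F\<in>biforms s t. (\<forall>z'\<in>{z}. vanishes F z') \<and> \<not> vanishes F z'"
  proof (cases "fst z = proj_pt a")
    case False
    obtain F where F: "F \<in> biforms 1 0" "bval F a b = 1" "vanishes F z"
      using separating_lin1[OF assms False ab(2)] by blast
    then have "\<not> vanishes F z'" unfolding ab(1) vanishes_iff[OF F(1)] by simp
    then show ?thesis using F by blast
  next
    case True
    then have "snd z \<noteq> proj_pt b" using z'(2) ab(1) by (metis prod.collapse singletonI)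
    then obtain F where F: "F \<in> biforms 0 1" "bval F a b = 1" "vanishes F z"
      using separating_lin2[OF assms _ ab(3)] by blast
    then have "\<not> vanishes F z'" unfolding ab(1) vanishes_iff[OF F(1)] by simp
    then show ?thesis using F by blast
  qed
qed (use assms in simp)

lemma zclosed_empty: "zclosed ({} :: ('n1::finite, 'n2::finite, 'k::field_char_0) bipt set)"
proof (rule zclosedI)
  fix z :: "('n1, 'n2, 'k) bipt" assume "z \<in> biproj_space"
  then obtain a b where ab: "z = (proj_pt a, proj_pt b)" using biproj_space_cases by blast
  have "\<not> vanishes 1 z" unfolding ab vanishes_iff[OF biforms_one] by simp
  then show "\<exists>s t. \<exists>F\<in>biforms s t. (\<forall>z'\<in>{}. vanishes F z') \<and> \<not> vanishes F z"
    using biforms_one by blast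
qed simp

lemma zclosed_finite:
  fixes A :: "('n1::finite, 'n2::finite, 'k::field_char_0) bipt set"
  assumes "finite A" "A \<subseteq> biproj_space"
  shows "zclosed A"
  using assms
proof (induction rule: finite_induct)
  case (insert z A)
  then show ?case using zclosed_Un[OF zclosed_singleton[of z], of A] by simp
qed (rule zclosed_empty)

text \<open>The two hypersurface sections are closed and cover \<open>Z\<close>, so one of them is
  all of \<open>Z\<close>.\<close>

lemma zirreducible_prime:
  fixes Z :: "('n1::finite, 'n2::finite, 'k::field_char_0) bipt set"
  assumes Z: "zirreducible Z" and F: "F \<in> biforms s t" and G: "G \<in> biforms s' t'"
    and van: "F * G \<in> set_ideal Z"
  shows "F \<in> set_ideal Z \<or> G \<in> set_ideal Z"
proof -
  have cl: "zclosed Z" using Z by (simp add: zirreducible_def)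
  have "Z \<subseteq> {z \<in> Z. vanishes F z} \<union> {z \<in> Z. vanishes G z}"
    using not_vanishes_mult[OF F G] van zclosed_subset[OF cl] unfolding mem_set_ideal by blast
  then have "Z \<subseteq> {z \<in> Z. vanishes F z} \<or> Z \<subseteq> {z \<in> Z. vanishes G z}"
    using Z zclosed_hypersurface[OF cl F] zclosed_hypersurface[OF cl G] unfolding zirreducible_def by blast
  then show ?thesis unfolding mem_set_ideal by blast
qed

lemma zirreducible_finite:
  fixes Z :: "('n1::finite, 'n2::finite, 'k::field_char_0) bipt set"
  assumes Z: "zirreducible Z" and fin: "finite Z" and z: "z \<in> Z"
  shows "Z = {z}"
proof -
  have sub: "Z \<subseteq> biproj_space" using Z zclosed_subset by (auto simp: zirreducible_def)
  have "zclosed {z}" "zclosed (Z - {z})" using fin sub z by (auto intro: zclosed_finite)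
  moreover have "Z \<subseteq> {z} \<union> (Z - {z})" by blast
  ultimately have "Z \<subseteq> {z} \<or> Z \<subseteq> Z - {z}" using Z unfolding zirreducible_def by blast
  then show ?thesis using z by blast
qed

lemma zirreducible_singleton:
  fixes z :: "('n1::finite, 'n2::finite, 'k::field_char_0) bipt"
  shows "z \<in> biproj_space \<Longrightarrow> zirreducible {z}"
  unfolding zirreducible_def using zclosed_singleton by blast

lemma zirreducible_subset_Un:
  assumes "zirreducible Z" "zclosed A" "zclosed B" "Z \<subseteq> A \<union> B"
  shows "Z \<subseteq> A \<or> Z \<subseteq> B"
  using assms unfolding zirreducible_def by blast

text \<open>The hypothesis makes every closed set that meets \<open>Z\<close> in infinitely many
  points contain \<open>Z\<close>. Two closed sets covering \<open>Z\<close> cannot both meet it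
  finitely, and a chain of irreducible subsets has room only for a point and \<open>Z\<close>
  itself.\<close>

lemma curve_like:
  fixes Z :: "('n1::finite, 'n2::finite, 'k::field_char_0) bipt set"
  assumes inf: "infinite Z" and cl: "zclosed Z"
    and unique: "\<And>s t F. F \<in> biforms s t \<Longrightarrow> infinite {z \<in> Z. vanishes F z} \<Longrightarrow> F \<in> set_ideal Z"
  shows "zirreducible Z" "krull_dim Z = 1"
proof -
  have sub: "Z \<subseteq> biproj_space" using cl by (rule zclosed_subset)
  have inf_sub: "Z \<subseteq> B" if B: "zclosed B" "infinite (Z \<inter> B)" for B
  proof
    fix z assume z: "z \<in> Z"
    show "z \<in> B"
    proof (rule ccontr)
      assume zB: "z \<notin> B"
      have zb: "z \<in> biproj_space" using z sub by blast
      obtain s t F where F: "F \<in> biforms s t" "\<And>z'. z' \<in> B \<Longrightarrow> vanishes F z'" "\<not> vanishes F z"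
        by (rule zclosedE[OF B(1) zb zB]) (rule that)
      have "Z \<inter> B \<subseteq> {z \<in> Z. vanishes F z}" using F(2) by blast
      then have "infinite {z \<in> Z. vanishes F z}" using B(2) finite_subset by blast
      then show False using unique[OF F(1)] F(3) z unfolding mem_set_ideal by blast
    qed
  qed
  show irr: "zirreducible Z"
    unfolding zirreducible_def
  proof (intro conjI allI impI cl)
    show "Z \<noteq> {}" using inf by auto
    fix B C assume BC: "zclosed B \<and> zclosed C \<and> Z \<subseteq> B \<union> C"
    then have "Z = (Z \<inter> B) \<union> (Z \<inter> C)" by blast
    then have "infinite (Z \<inter> B) \<or> infinite (Z \<inter> C)" using inf by (metis finite_UnI)
    then show "Z \<subseteq> B \<or> Z \<subseteq> C" using inf_sub BC by blast
  qed
  have proper: "\<exists>z. Z1 = {z}" if Z1: "zirreducible Z1" "Z1 \<subset> Z" for Z1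
  proof -
    have "zclosed Z1" using Z1 by (simp add: zirreducible_def)
    then have "finite (Z \<inter> Z1)" using inf_sub Z1(2) by blast
    moreover have "Z \<inter> Z1 = Z1" using Z1(2) by blast
    ultimately have "finite Z1" by simp
    then show ?thesis using zirreducible_finite[OF Z1(1)] Z1(1) unfolding zirreducible_def by blast
  qed
  have bound: "n \<le> 1" if ch: "\<forall>i\<le>n. zirreducible (C i) \<and> C i \<subseteq> Z" "\<forall>i<n. C i \<subset> C (Suc i)" for n C
  proof (rule ccontr)
    assume "\<not> n \<le> 1"
    then have n: "0 \<le> n" "0 < n" "1 < n" "1 \<le> n" "2 \<le> n" by auto
    have "C 0 \<subset> C 1" "C 1 \<subset> C 2" using ch(2) n by (auto simp: numeral_2_eq_2)
    moreover have "C 2 \<subseteq> Z" "zirreducible (C 1)" "zirreducible (C 0)" using ch(1) n by auto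
    ultimately obtain z where "C 1 = {z}" using proper[of "C 1"] by blast
    then have "C 0 = {}" using \<open>C 0 \<subset> C 1\<close> by (metis psubset_eq subset_singletonD)
    then show False using \<open>zirreducible (C 0)\<close> by (simp add: zirreducible_def)
  qed
  obtain z where z: "z \<in> Z" using inf by (metis ex_in_conv finite.emptyI)
  let ?S = "{enat n |n. \<exists>C. (\<forall>i\<le>n. zirreducible (C i) \<and> C i \<subseteq> Z) \<and> (\<forall>i<n. C i \<subset> C (Suc i))}"
  have "enat 1 \<in> ?S"
  proof -
    let ?C = "\<lambda>i::nat. if i = 0 then {z} else Z"
    have "{z} \<noteq> Z" using inf by (metis finite.emptyI finite.insertI)
    then have "{z} \<subset> Z" using z by blast
    then have ch: "(\<forall>i\<le>1. zirreducible (?C i) \<and> ?C i \<subseteq> Z) \<and> (\<forall>i<1. ?C i \<subset> ?C (Suc i))"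
      using irr zirreducible_singleton[of z] z sub by auto
    show ?thesis by (rule CollectI, rule exI[of _ 1], rule conjI[OF refl], rule exI[of _ ?C], rule ch)
  qed
  then have "enat 1 \<le> Sup ?S" by (rule Sup_upper)
  moreover have "Sup ?S \<le> enat 1" using bound by (intro Sup_least) auto
  ultimately show "krull_dim Z = 1" unfolding krull_dim_def one_enat_def by (rule antisym[rotated])
qed

text \<open>Irreducible sets are nonempty, so a chain inside a point has length zero.\<close>

lemma krull_dim_singleton: "krull_dim {z} \<noteq> 1"
proof -
  let ?S = "{enat n |n. \<exists>C. (\<forall>i\<le>n. zirreducible (C i) \<and> C i \<subseteq> {z}) \<and> (\<forall>i<n. C i \<subset> C (Suc i))}"
  have "x \<le> 0" if x: "x \<in> ?S" for x
  proof -
    obtain n C where n: "x = enat n" "\<forall>i\<le>n. zirreducible (C i) \<and> C i \<subseteq> {z}" "\<forall>i<n. C i \<subset> C (Suc i)"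
      using x by blast
    have "n = 0"
    proof (rule ccontr)
      assume "n \<noteq> 0"
      then have n0: "0 < n" "Suc 0 \<le> n" "0 \<le> n" by simp_all
      have "C 0 \<subset> C (Suc 0)" by (rule n(3)[rule_format, OF n0(1)])
      moreover have "C (Suc 0) \<subseteq> {z}" using n(2)[rule_format, OF n0(2)] by (rule conjunct2)
      ultimately have "C 0 \<subset> {z}" by (rule psubset_subset_trans)
      have "zirreducible (C 0)" using n(2)[rule_format, OF n0(3)] by (rule conjunct1)
      from \<open>C 0 \<subset> {z}\<close> have "C 0 \<subseteq> {z}" "C 0 \<noteq> {z}" unfolding psubset_eq by simp_all
      then have "C 0 = {}" using subset_singletonD[of "C 0" z] by simp
      then show False using \<open>zirreducible (C 0)\<close> by (simp add: zirreducible_def)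
    qed
    then show ?thesis using n(1) by (simp add: zero_enat_def)
  qed
  then have "krull_dim {z} \<le> 0" unfolding krull_dim_def by (rule Sup_least)
  then show ?thesis by auto
qed

text \<open>Zorn's lemma: the closure of the union of a chain of irreducible sets is irreducible,
  since one member of the chain not contained in \<open>D\<close> forces all of them into
  \<open>B\<close>.\<close>

lemma ex_irr_component:
  fixes G :: "('n1::finite, 'n2::finite, 'k::field_char_0) bipt set"
  assumes G: "zclosed G" and z: "z \<in> G"
  obtains Z where "irr_component Z G" "z \<in> Z"
proof -
  let ?A = "{Z. zirreducible Z \<and> z \<in> Z \<and> Z \<subseteq> G}"
  have zb: "z \<in> biproj_space" using zclosed_subset[OF G] z by blast
  have "\<exists>M\<in>?A. \<forall>Z\<in>?A. M \<subseteq> Z \<longrightarrow> Z = M"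
  proof (rule subset_Zorn)
    fix C assume C: "subset.chain ?A C"
    show "\<exists>U\<in>?A. \<forall>Z\<in>C. Z \<subseteq> U"
    proof (cases "C = {}")
      case True
      then show ?thesis using zirreducible_singleton[OF zb] z by (intro bexI[of _ "{z}"]) auto
    next
      case False
      have CA: "C \<subseteq> ?A" and lin: "\<And>A B. A \<in> C \<Longrightarrow> B \<in> C \<Longrightarrow> A \<subseteq> B \<or> B \<subseteq> A"
        using C unfolding subset.chain_def by auto
      define U where "U = zero_locus (set_ideal (\<Union>C))"
      have UG: "\<Union>C \<subseteq> G" using CA by blast
      then have CU: "\<Union>C \<subseteq> biproj_space" using zclosed_subset[OF G] by blast
      have sup: "\<Union>C \<subseteq> U" unfolding U_def by (rule closure_superset[OF CU])
      have zU: "z \<in> U" using sup False CA by blast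
      have "zirreducible U"
        unfolding zirreducible_def
      proof (intro conjI allI impI)
        show "zclosed U" unfolding U_def by (rule zclosed_closure[OF CU])
        show "U \<noteq> {}" using zU by blast
        fix B D assume BD: "zclosed B \<and> zclosed D \<and> U \<subseteq> B \<union> D"
        have each: "Z \<subseteq> B \<or> Z \<subseteq> D" if "Z \<in> C" for Z
          using BD that sup CA by (intro zirreducible_subset_Un) auto
        have "\<Union>C \<subseteq> B \<or> \<Union>C \<subseteq> D"
        proof (rule disjCI)
          assume "\<not> \<Union>C \<subseteq> D"
          then obtain Z0 where Z0: "Z0 \<in> C" "\<not> Z0 \<subseteq> D" by blast
          have "Z \<subseteq> B" if Z: "Z \<in> C" for Z
          proof (cases "Z \<subseteq> Z0")
            case True
            then show ?thesis using each[OF Z0(1)] Z0(2) by blast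
          next
            case False
            then have "Z0 \<subseteq> Z" using lin[OF Z Z0(1)] by blast
            then show ?thesis using each[OF Z] Z0(2) by blast
          qed
          then show "\<Union>C \<subseteq> B" by blast
        qed
        then show "U \<subseteq> B \<or> U \<subseteq> D"
          unfolding U_def using BD closure_minimal by blast
      qed
      moreover have "U \<subseteq> G" unfolding U_def by (rule closure_minimal[OF UG G])
      ultimately show ?thesis using sup zU by blast
    qed
  qed
  then obtain M where M0: "M \<in> ?A" "\<forall>Z\<in>?A. M \<subseteq> Z \<longrightarrow> Z = M" by (rule bexE)
  have M: "zirreducible M" "z \<in> M" "M \<subseteq> G" using M0(1) by simp_all
  have "irr_component M G" unfolding irr_component_def using M M0(2) by blast
  then show ?thesis using that M(2) by blast
qed

text \<open>A finite irreducible set is a point, which has the wrong dimension; so components of a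
  curve are infinite.\<close>

lemma curve_component:
  fixes G :: "('n1::finite, 'n2::finite, 'k::field_char_0) bipt set"
  assumes G: "curve G" and z: "z \<in> G"
  obtains Z where "zirreducible Z" "infinite Z" "Z \<subseteq> G" "z \<in> Z"
proof -
  have "zclosed G" using G by (simp add: curve_def)
  then obtain Z where Z: "irr_component Z G" "z \<in> Z" using ex_irr_component z by blast
  have irr: "zirreducible Z" "Z \<subseteq> G" using Z(1) by (auto simp: irr_component_def)
  have dim: "krull_dim Z = 1" using G Z(1) by (simp add: curve_def)
  have "infinite Z"
  proof
    assume "finite Z"
    then have "Z = {z}" by (rule zirreducible_finite[OF irr(1) _ Z(2)])
    then show False using dim krull_dim_singleton[of z] by simp
  qed
  then show ?thesis using that irr Z(2) by blast
qed

section \<open>Hilbert functions of irreducible sets\<close>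

lemma bval_zero_subspace: "mp.subspace {F. bval F a b = 0}"
  by (auto simp: mp.subspace_def mscale_def ev_simps)

lemma hilbert_function_pos:
  fixes Z :: "('n1::finite, 'n2::finite, 'k::field) bipt set"
  assumes "z \<in> Z" "z \<in> biproj_space"
  shows "1 \<le> hilbert_function (set_ideal Z) s t"
proof -
  obtain a b where z: "z = (proj_pt a, proj_pt b)" "a \<noteq> 0" "b \<noteq> 0" by (rule biproj_space_cases[OF assms(2)])
  obtain E where E: "E \<in> biforms s t" "bval E a b = 1" using z(2,3) by (rule ex_biform_nonzero)
  have "indep_mod (set_ideal Z) (\<lambda>_. E) {()}"
    unfolding indep_mod_def
  proof (intro conjI allI impI ballI)
    fix c :: "unit \<Rightarrow> 'k" and i
    assume "(\<Sum>i\<in>{()}. Const (c i) * E) \<in> set_ideal Z"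
    then have "vanishes (Const (c ()) * E) z" using assms(1) unfolding mem_set_ideal by simp
    then show "c i = 0" unfolding z(1) vanishes_iff[OF biforms_Const_mult[OF E(1)]] by (simp add: ev_simps E(2))
  qed simp
  from hilbert_function_ge[OF set_ideal_subspace _ this, of s t] E(1) show ?thesis by simp
qed

text \<open>The ideal of an irreducible set is prime with respect to biforms, which is the colon
  condition with \<open>J' = J\<close>.\<close>

lemma hilbert_function_growth_irreducible:
  fixes Z :: "('n1::finite, 'n2::finite, 'k::field_char_0) bipt set"
  assumes Z: "zirreducible Z" and H: "H \<in> biforms i j" "H \<notin> set_ideal Z"
    and T: "mp.subspace T" "set_ideal Z \<inter> biforms (s + i) (t + j) \<subseteq> T" "\<And>F. F \<in> biforms s t \<Longrightarrow> H * F \<in> T"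
    and e: "\<And>k. k \<in> I \<Longrightarrow> e k \<in> biforms (s + i) (t + j)" "indep_mod T e I"
  shows "hilbert_function (set_ideal Z) s t + card I \<le> hilbert_function (set_ideal Z) (s + i) (t + j)"
proof (rule hilbert_function_growth[OF set_ideal_subspace set_ideal_subspace T(1) H(1) _ T(2,3) e])
  fix F assume "F \<in> biforms s t" "H * F \<in> set_ideal Z"
  then show "F \<in> set_ideal Z" using zirreducible_prime[OF Z H(1)] H(2) by blast
qed

text \<open>An intersection number of at least one: all multiples of \<open>H\<close> vanish at
  \<open>z\<close>, while some form of the same bidegree does not.\<close>

lemma growth_point:
  fixes Z :: "('n1::finite, 'n2::finite, 'k::field_char_0) bipt set"
  assumes Z: "zirreducible Z" and H: "H \<in> biforms i j" "H \<notin> set_ideal Z"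
    and z: "z \<in> Z" "vanishes H z"
  shows "hilbert_function (set_ideal Z) s t + 1 \<le> hilbert_function (set_ideal Z) (s + i) (t + j)"
proof -
  have "z \<in> biproj_space" using z(1) Z zclosed_subset unfolding zirreducible_def by blast
  then obtain a b where ab: "z = (proj_pt a, proj_pt b)" "a \<noteq> 0" "b \<noteq> 0" by (rule biproj_space_cases)
  obtain E where E: "E \<in> biforms (s + i) (t + j)" "bval E a b = 1" using ab(2,3) by (rule ex_biform_nonzero)
  have Hab: "bval H a b = 0" using z(2) unfolding ab(1) vanishes_iff[OF H(1)] .
  have "hilbert_function (set_ideal Z) s t + card {()} \<le> hilbert_function (set_ideal Z) (s + i) (t + j)"
  proof (rule hilbert_function_growth_irreducible[OF Z H bval_zero_subspace[of a b], where e = "\<lambda>_. E"])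
    show "set_ideal Z \<inter> biforms (s + i) (t + j) \<subseteq> {F. bval F a b = 0}"
    proof clarify
      fix F assume F: "F \<in> set_ideal Z" "F \<in> biforms (s + i) (t + j)"
      then have "vanishes F z" using z(1) unfolding mem_set_ideal by blast
      then show "bval F a b = 0" unfolding ab(1) vanishes_iff[OF F(2)] .
    qed
    show "indep_mod {F. bval F a b = 0} (\<lambda>_. E) {()}"
      by (simp add: indep_mod_def ev_simps E(2))
  qed (simp_all add: ev_simps Hab E(1))
  then show ?thesis by simp
qed

lemma growth_two_points:
  fixes Z :: "('n1::finite, 'n2::finite, 'k::field_char_0) bipt set"
  assumes Z: "zirreducible Z" and H: "H \<in> biforms i j" "H \<notin> set_ideal Z"
    and z: "(proj_pt a, proj_pt b) \<in> Z" "vanishes H (proj_pt a, proj_pt b)"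
      "(proj_pt a', proj_pt b') \<in> Z" "vanishes H (proj_pt a', proj_pt b')"
    and E: "E \<in> biforms (s + i) (t + j)" "bval E a b = 1" "bval E a' b' = 0"
    and E': "E' \<in> biforms (s + i) (t + j)" "bval E' a' b' = 1" "bval E' a b = 0"
  shows "hilbert_function (set_ideal Z) s t + 2 \<le> hilbert_function (set_ideal Z) (s + i) (t + j)"
proof -
  have Hab: "bval H a b = 0" "bval H a' b' = 0" using z(2,4) unfolding vanishes_iff[OF H(1)] .
  let ?T = "{F :: ('n1, 'n2, 'k) bipoly. bval F a b = 0 \<and> bval F a' b' = 0}"
  have "hilbert_function (set_ideal Z) s t + card (UNIV :: bool set) \<le> hilbert_function (set_ideal Z) (s + i) (t + j)"
  proof (rule hilbert_function_growth_irreducible[OF Z H, where T = ?T and e = "\<lambda>k. if k then E else E'"])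
    show "mp.subspace ?T" by (auto simp: mp.subspace_def mscale_def ev_simps)
    show "set_ideal Z \<inter> biforms (s + i) (t + j) \<subseteq> ?T"
    proof
      fix F assume "F \<in> set_ideal Z \<inter> biforms (s + i) (t + j)"
      then have F: "F \<in> set_ideal Z" "F \<in> biforms (s + i) (t + j)" by simp_all
      have "vanishes F (proj_pt a, proj_pt b)" "vanishes F (proj_pt a', proj_pt b')"
        using F(1) z(1,3) unfolding mem_set_ideal by simp_all
      then show "F \<in> ?T" unfolding vanishes_iff[OF F(2)] by simp
    qed
    show "indep_mod ?T (\<lambda>k. if k then E else E') UNIV"
      by (simp add: indep_mod_def ev_simps E E' UNIV_bool)
  qed (simp_all add: ev_simps Hab E(1) E'(1))
  then show ?thesis by simp
qed

lemma zirreducible_biproj: "zirreducible Z \<Longrightarrow> z \<in> Z \<Longrightarrow> z \<in> biproj_space"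
  using zclosed_subset unfolding zirreducible_def by blast

text \<open>Points with different first projections are separated by a linear form that vanishes at
  one of them and not at the other, so \<open>H\<close> of bidegree (1, 0) meets \<open>Z\<close>
  properly.\<close>

lemma growth_nonconstant1:
  fixes Z :: "('n1::finite, 'n2::finite, 'k::field_char_0) bipt set"
  assumes Z: "zirreducible Z" and z: "z \<in> Z" "z' \<in> Z" "fst z \<noteq> fst z'"
  shows "hilbert_function (set_ideal Z) s t + 1 \<le> hilbert_function (set_ideal Z) (Suc s) t"
proof -
  obtain a b where ab: "z' = (proj_pt a, proj_pt b)" "a \<noteq> 0" "b \<noteq> 0"
    by (rule biproj_space_cases[OF zirreducible_biproj[OF Z z(2)]])
  obtain F where F: "F \<in> biforms 1 0" "bval F a b = 1" "vanishes F z"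
    using separating_lin1[OF zirreducible_biproj[OF Z z(1)] _ ab(2), of b] z(3) ab(1) by auto
  have "\<not> vanishes F z'" unfolding ab(1) vanishes_iff[OF F(1)] using F(2) by simp
  then have "F \<notin> set_ideal Z" using z(2) unfolding mem_set_ideal by blast
  from growth_point[OF Z F(1) this z(1) F(3), of s t] show ?thesis by simp
qed

lemma growth_nonconstant2:
  fixes Z :: "('n1::finite, 'n2::finite, 'k::field_char_0) bipt set"
  assumes Z: "zirreducible Z" and z: "z \<in> Z" "z' \<in> Z" "snd z \<noteq> snd z'"
  shows "hilbert_function (set_ideal Z) s t + 1 \<le> hilbert_function (set_ideal Z) s (Suc t)"
proof -
  obtain a b where ab: "z' = (proj_pt a, proj_pt b)" "a \<noteq> 0" "b \<noteq> 0"
    by (rule biproj_space_cases[OF zirreducible_biproj[OF Z z(2)]])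
  obtain F where F: "F \<in> biforms 0 1" "bval F a b = 1" "vanishes F z"
    using separating_lin2[OF zirreducible_biproj[OF Z z(1)] _ ab(3), of a] z(3) ab(1) by auto
  have "\<not> vanishes F z'" unfolding ab(1) vanishes_iff[OF F(1)] using F(2) by simp
  then have "F \<notin> set_ideal Z" using z(2) unfolding mem_set_ideal by blast
  from growth_point[OF Z F(1) this z(1) F(3), of s t] show ?thesis by simp
qed

lemma hilbert_function_nonconstant1:
  fixes Z :: "('n1::finite, 'n2::finite, 'k::field_char_0) bipt set"
  assumes Z: "zirreducible Z" and z: "z \<in> Z" "z' \<in> Z" "fst z \<noteq> fst z'"
  shows "hilbert_function (set_ideal Z) 0 t + s \<le> hilbert_function (set_ideal Z) s t" "s + 1 \<le> hilbert_function (set_ideal Z) s t"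
proof -
  show 1: "hilbert_function (set_ideal Z) 0 t + s \<le> hilbert_function (set_ideal Z) s t"
  proof (induction s)
    case (Suc s)
    then show ?case using growth_nonconstant1[OF Z z, of s t] by linarith
  qed simp
  show "s + 1 \<le> hilbert_function (set_ideal Z) s t"
    using 1 hilbert_function_pos[OF z(1) zirreducible_biproj[OF Z z(1)], of 0 t] by linarith
qed

lemma hilbert_function_nonconstant2:
  fixes Z :: "('n1::finite, 'n2::finite, 'k::field_char_0) bipt set"
  assumes Z: "zirreducible Z" and z: "z \<in> Z" "z' \<in> Z" "snd z \<noteq> snd z'"
  shows "t + 1 \<le> hilbert_function (set_ideal Z) s t"
proof (induction t)
  case 0
  show ?case using hilbert_function_pos[OF z(1) zirreducible_biproj[OF Z z(1)], of s 0] by linarith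
next
  case (Suc t)
  then show ?case using growth_nonconstant2[OF Z z, of s t] by linarith
qed

text \<open>The increments are added along the path from \<open>(0, 0)\<close> to
  \<open>(0, t)\<close> and on to \<open>(s, t)\<close>.\<close>

lemma hilbert_function_nonconstant:
  fixes Z :: "('n1::finite, 'n2::finite, 'k::field_char_0) bipt set"
  assumes Z: "zirreducible Z" and z1: "z \<in> Z" "z' \<in> Z" "fst z \<noteq> fst z'"
    and z2: "y \<in> Z" "y' \<in> Z" "snd y \<noteq> snd y'"
  shows "s + t + 1 \<le> hilbert_function (set_ideal Z) s t"
  using hilbert_function_nonconstant1(1)[OF Z z1, of t s] hilbert_function_nonconstant2[OF Z z2, of t 0]
  by linarith

text \<open>Additivity over components. Forms independent modulo the ideal of \<open>Z1\<close>,
  multiplied by \<open>H\<close>, land in the ideal of \<open>Z2\<close>, so forms independent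
  modulo that ideal are new. The fixed bidegree \<open>(i, j)\<close> of \<open>H\<close> affects
  only the constant term of the asymptotics.\<close>

lemma hilbert_function_additive:
  fixes G :: "('n1::finite, 'n2::finite, 'k::field_char_0) bipt set"
  assumes Z1: "zirreducible Z1" "Z1 \<subseteq> G" and Z2: "Z2 \<subseteq> G"
    and H: "H \<in> biforms i j" "H \<in> set_ideal Z2" "H \<notin> set_ideal Z1"
  shows "hilbert_function (set_ideal Z1) s t + hilbert_function (set_ideal Z2) (s + i) (t + j)
    \<le> hilbert_function (set_ideal G) (s + i) (t + j)"
proof -
  obtain e where e: "\<And>k. k < hilbert_function (set_ideal Z2) (s + i) (t + j) \<Longrightarrow> e k \<in> biforms (s + i) (t + j)"
    "indep_mod (set_ideal Z2) e {..<hilbert_function (set_ideal Z2) (s + i) (t + j)}"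
    by (rule hilbert_function_basis[OF set_ideal_subspace]) (rule that)
  have "hilbert_function (set_ideal Z1) s t + card {..<hilbert_function (set_ideal Z2) (s + i) (t + j)}
    \<le> hilbert_function (set_ideal G) (s + i) (t + j)"
  proof (rule hilbert_function_growth[OF set_ideal_subspace set_ideal_subspace set_ideal_subspace[of Z2] H(1) _ _ _ _ e(2)])
    fix F assume F: "F \<in> biforms s t" "H * F \<in> set_ideal G"
    then have "H * F \<in> set_ideal Z1" using set_ideal_antimono[OF Z1(2)] by blast
    then show "F \<in> set_ideal Z1" using zirreducible_prime[OF Z1(1) H(1) F(1)] H(3) by blast
  next
    show "set_ideal G \<inter> biforms (s + i) (t + j) \<subseteq> set_ideal Z2" using set_ideal_antimono[OF Z2] by blast
    show "H * F \<in> set_ideal Z2" for F by (rule is_idealD(4)[OF set_ideal_is_ideal H(2)])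
  qed (use e(1) in simp)
  then show ?thesis by simp
qed

section \<open>Rational curves\<close>

lemma coeff_mult_top:
  fixes p q :: "'k::comm_ring_1 poly"
  assumes "degree p \<le> m" "degree q \<le> n"
  shows "coeff (p * q) (m + n) = coeff p m * coeff q n"
proof -
  have "coeff (p * q) (m + n) = (\<Sum>i\<le>m + n. coeff p i * coeff q (m + n - i))" by (rule coeff_mult)
  also have "\<dots> = (\<Sum>i\<in>{m}. coeff p i * coeff q (m + n - i))"
  proof (rule sum.mono_neutral_right)
    show "\<forall>i\<in>{..m + n} - {m}. coeff p i * coeff q (m + n - i) = 0"
    proof
      fix i assume "i \<in> {..m + n} - {m}"
      then have "degree p < i \<or> degree q < m + n - i" using assms by auto
      then show "coeff p i * coeff q (m + n - i) = 0" using coeff_eq_0 by fastforce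
    qed
  qed auto
  finally show ?thesis by simp
qed

text \<open>Restriction of a form to a parametrised curve in an affine parameter; the value at
  infinity is recovered as the coefficient at the formal degree.\<close>

definition pullback :: "('n1 \<Rightarrow> 'k::field poly) \<Rightarrow> ('n2 \<Rightarrow> 'k poly) \<Rightarrow> ('n1, 'n2, 'k) bipoly \<Rightarrow> 'k poly" where
  "pullback xp yp F = meval (\<lambda>c. [:c:]) (case_sum xp yp) F"

lemma poly_pullback: "poly (pullback xp yp F) z = bval F (\<lambda>i. poly (xp i) z) (\<lambda>j. poly (yp j) z)"
proof -
  have "(\<lambda>x. poly (case_sum xp yp x) z) = case_sum (\<lambda>i. poly (xp i) z) (\<lambda>j. poly (yp j) z)"
    by (auto simp: fun_eq_iff split: sum.splits)
  then show ?thesis by (simp add: pullback_def poly_meval)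
qed

lemma pullback_top:
  fixes F :: "('n1::finite, 'n2::finite, 'k::field) bipoly"
  assumes deg: "\<And>i. degree (xp i) \<le> m" "\<And>j. degree (yp j) \<le> n"
  shows "F \<in> biforms s t \<Longrightarrow> degree (pullback xp yp F) \<le> s * m + t * n \<and>
    coeff (pullback xp yp F) (s * m + t * n) = bval F (\<lambda>i. coeff (xp i) m) (\<lambda>j. coeff (yp j) n)"
proof (induction rule: biform_induct)
  case (add s t F G)
  then show ?case by (auto simp: pullback_def pev.meval_add ev_simps intro: degree_add_le)
next
  case (scale s t F c)
  then show ?case by (auto simp: pullback_def pev.meval_mult ev_simps)
next
  case (X s t F i)
  then have "degree (xp i * pullback xp yp F) \<le> m + (s * m + t * n)"
    using degree_mult_le[of "xp i" "pullback xp yp F"] deg(1)[of i] by linarith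
  moreover have "coeff (xp i * pullback xp yp F) (m + (s * m + t * n))
      = coeff (xp i) m * coeff (pullback xp yp F) (s * m + t * n)"
    using X deg(1)[of i] by (intro coeff_mult_top) auto
  ultimately show ?case using X by (simp add: pullback_def pev.meval_mult ev_simps add_ac)
next
  case (Y s t F j)
  then have "degree (yp j * pullback xp yp F) \<le> n + (s * m + t * n)"
    using degree_mult_le[of "yp j" "pullback xp yp F"] deg(2)[of j] by linarith
  moreover have "coeff (yp j * pullback xp yp F) (n + (s * m + t * n))
      = coeff (yp j) n * coeff (pullback xp yp F) (s * m + t * n)"
    using Y deg(2)[of j] by (intro coeff_mult_top) auto
  ultimately show ?case using Y by (simp add: pullback_def pev.meval_mult ev_simps add_ac)
qed (simp_all add: pullback_def)

text \<open>The inserted point is the one at infinity of the parameter line, given by the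
  coefficients at the formal degrees \<open>m\<close> and \<open>n\<close>; individual coordinates
  may have smaller degree.\<close>

definition rational_curve :: "('n1 \<Rightarrow> 'k::field poly) \<Rightarrow> nat \<Rightarrow> ('n2 \<Rightarrow> 'k poly) \<Rightarrow> nat \<Rightarrow> ('n1, 'n2, 'k) bipt set" where
  "rational_curve xp m yp n = insert (proj_pt (\<lambda>i. coeff (xp i) m), proj_pt (\<lambda>j. coeff (yp j) n))
    (range (\<lambda>z. (proj_pt (\<lambda>i. poly (xp i) z), proj_pt (\<lambda>j. poly (yp j) z))))"

lemma set_ideal_rational_curve:
  fixes F :: "('n1::finite, 'n2::finite, 'k::field_char_0) bipoly"
  assumes deg: "\<And>i. degree (xp i) \<le> m" "\<And>j. degree (yp j) \<le> n" and F: "F \<in> biforms s t"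
  shows "F \<in> set_ideal (rational_curve xp m yp n) \<longleftrightarrow> pullback xp yp F = 0"
proof
  assume "F \<in> set_ideal (rational_curve xp m yp n)"
  then have "vanishes F (proj_pt (\<lambda>i. poly (xp i) z), proj_pt (\<lambda>j. poly (yp j) z))" for z
    unfolding mem_set_ideal rational_curve_def by blast
  then have "poly (pullback xp yp F) z = 0" for z
    unfolding vanishes_iff[OF F] poly_pullback .
  then show "pullback xp yp F = 0" using poly_all_0_iff_0 by blast
next
  assume P: "pullback xp yp F = 0"
  have "vanishes F (proj_pt (\<lambda>i. coeff (xp i) m), proj_pt (\<lambda>j. coeff (yp j) n))"
    unfolding vanishes_iff[OF F] using pullback_top[where xp = xp and yp = yp, OF deg F] P by simp
  moreover have "vanishes F (proj_pt (\<lambda>i. poly (xp i) z), proj_pt (\<lambda>j. poly (yp j) z))" for z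
    unfolding vanishes_iff[OF F] poly_pullback[symmetric] P by simp
  ultimately show "F \<in> set_ideal (rational_curve xp m yp n)"
    unfolding mem_set_ideal rational_curve_def by blast
qed

text \<open>A nonzero pullback has finitely many roots, so the form has finitely many zeros on the
  curve, infinity included.\<close>

lemma rational_curve_unique:
  fixes F :: "('n1::finite, 'n2::finite, 'k::field_char_0) bipoly"
  assumes deg: "\<And>i. degree (xp i) \<le> m" "\<And>j. degree (yp j) \<le> n" and F: "F \<in> biforms s t"
    and inf: "infinite {q \<in> rational_curve xp m yp n. vanishes F q}"
  shows "F \<in> set_ideal (rational_curve xp m yp n)"
  unfolding set_ideal_rational_curve[OF deg F]
proof (rule ccontr)
  assume "pullback xp yp F \<noteq> 0"
  then have "finite {z. poly (pullback xp yp F) z = 0}" by (rule poly_roots_finite)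
  moreover have "{q \<in> rational_curve xp m yp n. vanishes F q}
      \<subseteq> insert (proj_pt (\<lambda>i. coeff (xp i) m), proj_pt (\<lambda>j. coeff (yp j) n))
        ((\<lambda>z. (proj_pt (\<lambda>i. poly (xp i) z), proj_pt (\<lambda>j. poly (yp j) z))) ` {z. poly (pullback xp yp F) z = 0})"
    by (auto simp: rational_curve_def vanishes_iff[OF F] poly_pullback)
  ultimately show False using inf by (meson finite.insertI finite_imageI finite_subset)
qed

section \<open>Lines and graphs\<close>

lemma line_point_notin_span:
  fixes a u :: "'i \<Rightarrow> 'k::field"
  assumes "u \<notin> fs.span {a}"
  shows "line_point a u z \<notin> fs.span {a}"
proof
  assume "line_point a u z \<in> fs.span {a}"
  then obtain c where "line_point a u z = (\<lambda>i. c * a i)" unfolding in_span_1 by blast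
  then have "u i = (c - z) * a i" for i
    by (auto simp: line_point_def fun_eq_iff algebra_simps eq_diff_eq)
  then have "u = (\<lambda>i. (c - z) * a i)" by blast
  then show False using assms unfolding in_span_1 by blast
qed

lemma line_point_nonzero:
  fixes a u :: "'i \<Rightarrow> 'k::field"
  assumes "u \<notin> fs.span {a}"
  shows "line_point a u z \<noteq> 0" "proj_pt (line_point a u z) \<noteq> proj_pt a"
proof -
  show nz: "line_point a u z \<noteq> 0" using line_point_notin_span[OF assms, of z] fs.span_zero by metis
  show "proj_pt (line_point a u z) \<noteq> proj_pt a"
    using line_point_notin_span[OF assms, of z] self_mem_proj_pt[of "line_point a u z"]
    unfolding proj_pt_def by blast
qed

lemma line_point_in_span: "line_point a u z \<in> fs.span {a, u}"
  unfolding in_span_2 line_point_def by (rule exI[of _ z], rule exI[of _ 1]) (simp add: add.commute)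

lemma line_point_inj:
  fixes a u :: "'i::finite \<Rightarrow> 'k::field"
  assumes a: "a \<noteq> 0" and u: "u \<notin> fs.span {a}" and eq: "proj_pt (line_point a u z) = proj_pt (line_point a u z')"
  shows "z = z'"
proof -
  obtain f f0 where f: "dot f a = 0" "dot f u = 1" "dot f0 a = 1" "dot f0 u = 0"
    using a u by (rule coordinate_forms)
  obtain c where c: "line_point a u z' = (\<lambda>i. c * line_point a u z i)"
    using eq proj_pt_eq_iff(1)[OF line_point_nonzero(1)[OF u]] by blast
  have "dot f (line_point a u z') = c * dot f (line_point a u z)"
    "dot f0 (line_point a u z') = c * dot f0 (line_point a u z)"
    unfolding c dot_scale by simp_all
  then show ?thesis by (simp add: line_point_def dot_add dot_scale f)
qed

lemma line_cases:
  fixes a u x :: "'i \<Rightarrow> 'k::field"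
  assumes "x \<in> fs.span {a, u}" "x \<noteq> 0" "a \<noteq> 0"
  shows "proj_pt x = proj_pt a \<or> (\<exists>z. proj_pt x = proj_pt (line_point a u z))"
proof (cases "x \<in> fs.span {a}")
  case True
  then show ?thesis using proj_pt_eq_iff(2)[OF assms(3,2)] by simp
next
  case False
  then show ?thesis using proj_pt_line_point[OF assms(1)] by blast
qed

text \<open>The graph of the isomorphism of two lines that matches the parameters \<open>z\<close>.
  It depends on the vectors and not just on the lines: replacing \<open>w\<close> by
  \<open>w + c b\<close> shifts one parameter and gives another graph with the same tangent
  direction at the base point.\<close>

definition graph_curve :: "('n1 \<Rightarrow> 'k::field) \<Rightarrow> ('n1 \<Rightarrow> 'k) \<Rightarrow> ('n2 \<Rightarrow> 'k) \<Rightarrow> ('n2 \<Rightarrow> 'k) \<Rightarrow> ('n1, 'n2, 'k) bipt set" where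
  "graph_curve a u b w = insert (proj_pt a, proj_pt b)
     (range (\<lambda>z. (proj_pt (line_point a u z), proj_pt (line_point b w z))))"

definition alpha_curve :: "('n1 \<Rightarrow> 'k::field) \<Rightarrow> ('n1 \<Rightarrow> 'k) \<Rightarrow> ('n2 \<Rightarrow> 'k) \<Rightarrow> ('n1, 'n2, 'k) bipt set" where
  "alpha_curve a u b = insert (proj_pt a, proj_pt b) (range (\<lambda>z. (proj_pt (line_point a u z), proj_pt b)))"

definition beta_curve :: "('n1 \<Rightarrow> 'k::field) \<Rightarrow> ('n2 \<Rightarrow> 'k) \<Rightarrow> ('n2 \<Rightarrow> 'k) \<Rightarrow> ('n1, 'n2, 'k) bipt set" where
  "beta_curve a b w = insert (proj_pt a, proj_pt b) (range (\<lambda>z. (proj_pt a, proj_pt (line_point b w z))))"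

lemma graph_curve_rational: "graph_curve a u b w = rational_curve (\<lambda>i. [:u i, a i:]) 1 (\<lambda>j. [:w j, b j:]) 1"
  by (simp add: graph_curve_def rational_curve_def line_point_def)

lemma alpha_curve_rational: "alpha_curve a u b = rational_curve (\<lambda>i. [:u i, a i:]) 1 (\<lambda>j. [:b j:]) 0"
  by (simp add: alpha_curve_def rational_curve_def line_point_def)

lemma beta_curve_rational: "beta_curve a b w = rational_curve (\<lambda>i. [:a i:]) 0 (\<lambda>j. [:w j, b j:]) 1"
  by (simp add: beta_curve_def rational_curve_def line_point_def)

lemma mem_alpha_curve:
  fixes a u x :: "'n1 \<Rightarrow> 'k::field"
  assumes "a \<noteq> 0" "x \<noteq> 0" "x \<in> fs.span {a, u}"
  shows "(proj_pt x, proj_pt b) \<in> alpha_curve a u b"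
  using line_cases[OF assms(3,2,1)] unfolding alpha_curve_def by auto

lemma mem_beta_curve:
  fixes b w y :: "'n2 \<Rightarrow> 'k::field"
  assumes "b \<noteq> 0" "y \<noteq> 0" "y \<in> fs.span {b, w}"
  shows "(proj_pt a, proj_pt y) \<in> beta_curve a b w"
  using line_cases[OF assms(3,2,1)] unfolding beta_curve_def by auto

lemma alpha_curve_cases:
  assumes "z \<in> alpha_curve a u b" "a \<noteq> 0" "u \<notin> fs.span {a}"
  obtains x where "z = (proj_pt x, proj_pt b)" "x \<noteq> 0" "x \<in> fs.span {a, u}"
proof -
  have "z = (proj_pt a, proj_pt b) \<or> (\<exists>s. z = (proj_pt (line_point a u s), proj_pt b))"
    using assms(1) unfolding alpha_curve_def by blast
  moreover have "a \<in> fs.span {a, u}" by (rule fs.span_base) simp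
  ultimately show ?thesis
    using that assms(2) line_point_nonzero(1)[OF assms(3)] line_point_in_span by metis
qed

lemma beta_curve_cases:
  assumes "z \<in> beta_curve a b w" "b \<noteq> 0" "w \<notin> fs.span {b}"
  obtains y where "z = (proj_pt a, proj_pt y)" "y \<noteq> 0" "y \<in> fs.span {b, w}"
proof -
  have "z = (proj_pt a, proj_pt b) \<or> (\<exists>s. z = (proj_pt a, proj_pt (line_point b w s)))"
    using assms(1) unfolding beta_curve_def by blast
  moreover have "b \<in> fs.span {b, w}" by (rule fs.span_base) simp
  ultimately show ?thesis
    using that assms(2) line_point_nonzero(1)[OF assms(3)] line_point_in_span by metis
qed

lemma curves_biproj:
  fixes a u :: "'n1 \<Rightarrow> 'k::field" and b w :: "'n2 \<Rightarrow> 'k"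
  assumes "a \<noteq> 0" "b \<noteq> 0"
  shows "u \<notin> fs.span {a} \<Longrightarrow> w \<notin> fs.span {b} \<Longrightarrow> graph_curve a u b w \<subseteq> biproj_space"
    "u \<notin> fs.span {a} \<Longrightarrow> alpha_curve a u b \<subseteq> biproj_space"
    "w \<notin> fs.span {b} \<Longrightarrow> beta_curve a b w \<subseteq> biproj_space"
  using assms line_point_nonzero(1)[of u a] line_point_nonzero(1)[of w b]
  by (auto simp: graph_curve_def alpha_curve_def beta_curve_def biproj_space_def proj_space_iff)

lemma curves_infinite:
  fixes a u :: "'n1::finite \<Rightarrow> 'k::field_char_0" and b w :: "'n2::finite \<Rightarrow> 'k"
  assumes "a \<noteq> 0" "b \<noteq> 0"
  shows "u \<notin> fs.span {a} \<Longrightarrow> infinite (graph_curve a u b w)"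
    "u \<notin> fs.span {a} \<Longrightarrow> infinite (alpha_curve a u b)"
    "w \<notin> fs.span {b} \<Longrightarrow> infinite (beta_curve a b w)"
proof -
  have inf: "infinite (range \<phi>)" if "\<And>z z'. \<phi> z = \<phi> z' \<Longrightarrow> z = z'" for \<phi> :: "'k \<Rightarrow> ('n1, 'n2, 'k) bipt"
  proof
    assume "finite (range \<phi>)"
    moreover have "inj \<phi>" using that by (rule injI)
    ultimately have "finite (UNIV :: 'k set)" by (rule finite_imageD)
    then show False using infinite_UNIV_char_0 by blast
  qed
  show "infinite (graph_curve a u b w)" if u: "u \<notin> fs.span {a}"
  proof -
    have "infinite (range (\<lambda>z. (proj_pt (line_point a u z), proj_pt (line_point b w z))))"
      using line_point_inj[OF assms(1) u] by (intro inf) auto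
    then show ?thesis by (simp add: graph_curve_def)
  qed
  show "infinite (alpha_curve a u b)" if u: "u \<notin> fs.span {a}"
  proof -
    have "infinite (range (\<lambda>z. (proj_pt (line_point a u z), proj_pt b)))"
      using line_point_inj[OF assms(1) u] by (intro inf) auto
    then show ?thesis by (simp add: alpha_curve_def)
  qed
  show "infinite (beta_curve a b w)" if w: "w \<notin> fs.span {b}"
  proof -
    have "infinite (range (\<lambda>z. (proj_pt a, proj_pt (line_point b w z))))"
      using line_point_inj[OF assms(2) w] by (intro inf) auto
    then show ?thesis by (simp add: beta_curve_def)
  qed
qed

section \<open>Equations of the lines and graphs\<close>

lemma vanishes_lin1 [simp]: "vanishes (lin1 f :: ('n1::finite, 'n2::finite, 'k::field) bipoly) (proj_pt x, proj_pt y) \<longleftrightarrow> dot f x = 0"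
  by (simp add: vanishes_iff[OF lin1_biform])

lemma vanishes_lin2 [simp]: "vanishes (lin2 f :: ('n1::finite, 'n2::finite, 'k::field) bipoly) (proj_pt x, proj_pt y) \<longleftrightarrow> dot f y = 0"
  by (simp add: vanishes_iff[OF lin2_biform])

lemma dot_on_span: "x \<in> fs.span A \<Longrightarrow> (\<And>v. v \<in> A \<Longrightarrow> dot f v = 0) \<Longrightarrow> dot f x = 0"
proof (induction rule: fs.span_induct_alt)
  case (step c y z)
  have "fscale c y + z = (\<lambda>i. c * y i + z i)" by (simp add: fscale_def fun_eq_iff)
  then show ?case using step by (simp add: dot_add dot_scale)
qed simp

lemma lin1_on_alpha_curve:
  assumes "dot f a = 0" "dot f u = 0"
  shows "lin1 f \<in> set_ideal (alpha_curve a u b)"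
  using assms by (auto simp: mem_set_ideal alpha_curve_def line_point_def dot_add dot_scale)

lemma lin2_on_beta_curve:
  assumes "dot g b = 0" "dot g w = 0"
  shows "lin2 g \<in> set_ideal (beta_curve a b w)"
  using assms by (auto simp: mem_set_ideal beta_curve_def line_point_def dot_add dot_scale)

lemma zclosed_alpha_curve:
  fixes a u :: "'n1::finite \<Rightarrow> 'k::field_char_0" and b :: "'n2::finite \<Rightarrow> 'k"
  assumes a: "a \<noteq> 0" "u \<notin> fs.span {a}" and b: "b \<noteq> 0"
  shows "zclosed (alpha_curve a u b)"
proof (rule zclosedI[OF curves_biproj(2)[OF a(1) b a(2)]])
  fix z assume z: "z \<in> biproj_space" "z \<notin> alpha_curve a u b"
  obtain x y where xy: "z = (proj_pt x, proj_pt y)" "x \<noteq> 0" "y \<noteq> 0" by (rule biproj_space_cases[OF z(1)])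
  show "\<exists>s t. \<exists>F\<in>biforms s t. (\<forall>z'\<in>alpha_curve a u b. vanishes F z') \<and> \<not> vanishes F z"
  proof (cases "y \<in> fs.span {b}")
    case True
    then have "proj_pt y = proj_pt b" using proj_pt_eq_iff(2)[OF b xy(3)] by simp
    then have "x \<notin> fs.span {a, u}" using z(2) mem_alpha_curve[OF a(1) xy(2)] xy(1) by auto
    then obtain f where f: "\<And>v. v \<in> {a, u} \<Longrightarrow> dot f v = 0" "dot f x = 1" by (rule separating_form) (rule that)
    have "(lin1 f :: ('n1, 'n2, 'k) bipoly) \<in> set_ideal (alpha_curve a u b)"
      by (rule lin1_on_alpha_curve) (simp_all add: f(1))
    moreover have "\<not> vanishes (lin1 f :: ('n1, 'n2, 'k) bipoly) z" unfolding xy(1) vanishes_lin1 f(2) by simp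
    ultimately show ?thesis unfolding mem_set_ideal using lin1_biform by blast
  next
    case False
    then obtain g where g: "\<And>v. v \<in> {b} \<Longrightarrow> dot g v = 0" "dot g y = 1" by (rule separating_form) (rule that)
    have "\<forall>z'\<in>alpha_curve a u b. vanishes (lin2 g :: ('n1, 'n2, 'k) bipoly) z'"
      by (auto simp: alpha_curve_def g(1))
    moreover have "\<not> vanishes (lin2 g :: ('n1, 'n2, 'k) bipoly) z" unfolding xy(1) vanishes_lin2 g(2) by simp
    ultimately show ?thesis using lin2_biform by blast
  qed
qed

lemma zclosed_beta_curve:
  fixes a :: "'n1::finite \<Rightarrow> 'k::field_char_0" and b w :: "'n2::finite \<Rightarrow> 'k"
  assumes a: "a \<noteq> 0" and b: "b \<noteq> 0" "w \<notin> fs.span {b}"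
  shows "zclosed (beta_curve a b w)"
proof (rule zclosedI[OF curves_biproj(3)[OF a b]])
  fix z assume z: "z \<in> biproj_space" "z \<notin> beta_curve a b w"
  obtain x y where xy: "z = (proj_pt x, proj_pt y)" "x \<noteq> 0" "y \<noteq> 0" by (rule biproj_space_cases[OF z(1)])
  show "\<exists>s t. \<exists>F\<in>biforms s t. (\<forall>z'\<in>beta_curve a b w. vanishes F z') \<and> \<not> vanishes F z"
  proof (cases "x \<in> fs.span {a}")
    case True
    then have "proj_pt x = proj_pt a" using proj_pt_eq_iff(2)[OF a xy(2)] by simp
    then have "y \<notin> fs.span {b, w}" using z(2) mem_beta_curve[OF b(1) xy(3)] xy(1) by auto
    then obtain g where g: "\<And>v. v \<in> {b, w} \<Longrightarrow> dot g v = 0" "dot g y = 1" by (rule separating_form) (rule that)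
    have "(lin2 g :: ('n1, 'n2, 'k) bipoly) \<in> set_ideal (beta_curve a b w)"
      by (rule lin2_on_beta_curve) (simp_all add: g(1))
    moreover have "\<not> vanishes (lin2 g :: ('n1, 'n2, 'k) bipoly) z" unfolding xy(1) vanishes_lin2 g(2) by simp
    ultimately show ?thesis unfolding mem_set_ideal using lin2_biform by blast
  next
    case False
    then obtain f where f: "\<And>v. v \<in> {a} \<Longrightarrow> dot f v = 0" "dot f x = 1" by (rule separating_form) (rule that)
    have "\<forall>z'\<in>beta_curve a b w. vanishes (lin1 f :: ('n1, 'n2, 'k) bipoly) z'"
      by (auto simp: beta_curve_def f(1))
    moreover have "\<not> vanishes (lin1 f :: ('n1, 'n2, 'k) bipoly) z" unfolding xy(1) vanishes_lin1 f(2) by simp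
    ultimately show ?thesis using lin1_biform by blast
  qed
qed

text \<open>The determinant of the coordinates of two points with respect to \<open>a\<close>,
  \<open>u\<close> and \<open>b\<close>, \<open>w\<close>, when the forms are the dual coordinates:
  it vanishes if the parameters agree.\<close>

definition graph_form :: "('n1::finite \<Rightarrow> 'k::field) \<Rightarrow> ('n1 \<Rightarrow> 'k) \<Rightarrow> ('n2::finite \<Rightarrow> 'k) \<Rightarrow> ('n2 \<Rightarrow> 'k) \<Rightarrow> ('n1, 'n2, 'k) bipoly" where
  "graph_form f0 f g0 g = lin1 f0 * lin2 g - lin1 f * lin2 g0"

lemma graph_form_biform [simp]: "graph_form f0 f g0 g \<in> biforms (Suc 0) (Suc 0)"
  unfolding graph_form_def by (intro biforms_diff biforms_mult'[OF lin1_biform lin2_biform]) simp_all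

lemma bval_graph_form [simp]: "bval (graph_form f0 f g0 g) x y = dot f0 x * dot g y - dot f x * dot g0 y"
  by (simp add: graph_form_def ev_simps)

lemma vanishes_graph_form: "vanishes (graph_form f0 f g0 g) (proj_pt x, proj_pt y) \<longleftrightarrow>
    dot f0 x * dot g y - dot f x * dot g0 y = 0"
  by (simp add: vanishes_iff[OF graph_form_biform])

lemma graph_form_on_graph_curve:
  assumes "dot f a = 0" "dot f u = 1" "dot f0 a = 1" "dot f0 u = 0"
    and "dot g b = 0" "dot g w = 1" "dot g0 b = 1" "dot g0 w = 0"
  shows "graph_form f0 f g0 g \<in> set_ideal (graph_curve a u b w)"
  using assms by (auto simp: mem_set_ideal graph_curve_def line_point_def dot_add dot_scale vanishes_graph_form)

lemma mem_graph_curve: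
  fixes a u x :: "'n1::finite \<Rightarrow> 'k::field" and b w y :: "'n2::finite \<Rightarrow> 'k"
  assumes f: "dot f a = 0" "dot f u = 1" "dot f0 a = 1" "dot f0 u = 0"
    and g: "dot g b = 0" "dot g w = 1" "dot g0 b = 1" "dot g0 w = 0"
    and x: "x \<noteq> 0" "x \<in> fs.span {a, u}" and y: "y \<noteq> 0" "y \<in> fs.span {b, w}"
    and Q: "dot f0 x * dot g y - dot f x * dot g0 y = 0"
  shows "(proj_pt x, proj_pt y) \<in> graph_curve a u b w"
proof -
  have a: "a \<noteq> 0" and b: "b \<noteq> 0" using f(3) g(3) by auto
  have u: "u \<notin> fs.span {a}" and w: "w \<notin> fs.span {b}"
    using f(1,2) g(1,2) by (auto simp: in_span_1 dot_scale)
  obtain x0 x1 where x01: "x = (\<lambda>i. x0 * a i + x1 * u i)" using x(2) unfolding in_span_2 by blast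
  obtain y0 y1 where y01: "y = (\<lambda>i. y0 * b i + y1 * w i)" using y(2) unfolding in_span_2 by blast
  have Q': "x0 * y1 = x1 * y0" using Q f g by (simp add: x01 y01 dot_add dot_scale)
  show ?thesis
  \<comment> \<open>\<open>x1 = 0\<close> is the parameter at infinity; otherwise the vanishing
    determinant gives both points the same parameter \<open>r\<close>.\<close>
  proof (cases "x1 = 0")
    case True
    then have "x0 \<noteq> 0" using x(1) x01 by (auto simp: fun_eq_iff)
    then have "y1 = 0" using Q' True by simp
    then have "y \<in> fs.span {b}" "x \<in> fs.span {a}" using True x01 y01 unfolding in_span_1 by auto
    then show ?thesis
      using proj_pt_eq_iff(2)[OF a x(1)] proj_pt_eq_iff(2)[OF b y(1)] by (simp add: graph_curve_def)
  next
    case False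
    define r where "r = x0 / x1"
    have y0: "y0 = r * y1" using False Q' by (simp add: r_def field_simps)
    have "y1 \<noteq> 0" using y(1) y0 y01 by (auto simp: fun_eq_iff)
    have "x = (\<lambda>i. x1 * line_point a u r i)"
      using False by (auto simp: x01 r_def line_point_def fun_eq_iff algebra_simps)
    then have "proj_pt x = proj_pt (line_point a u r)" using proj_pt_scale[OF False] by metis
    moreover have "y = (\<lambda>i. y1 * line_point b w r i)"
      by (auto simp: y01 y0 line_point_def fun_eq_iff algebra_simps)
    then have "proj_pt y = proj_pt (line_point b w r)" using proj_pt_scale[OF \<open>y1 \<noteq> 0\<close>] by metis
    ultimately show ?thesis unfolding graph_curve_def by blast
  qed
qed

lemma zclosed_graph_curve:
  fixes a u :: "'n1::finite \<Rightarrow> 'k::field_char_0" and b w :: "'n2::finite \<Rightarrow> 'k"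
  assumes a: "a \<noteq> 0" "u \<notin> fs.span {a}" and b: "b \<noteq> 0" "w \<notin> fs.span {b}"
  shows "zclosed (graph_curve a u b w)"
proof (rule zclosedI[OF curves_biproj(1)[OF a(1) b(1) a(2) b(2)]])
  fix z assume z: "z \<in> biproj_space" "z \<notin> graph_curve a u b w"
  obtain x y where xy: "z = (proj_pt x, proj_pt y)" "x \<noteq> 0" "y \<noteq> 0" by (rule biproj_space_cases[OF z(1)])
  obtain f f0 where f: "dot f a = 0" "dot f u = 1" "dot f0 a = 1" "dot f0 u = 0"
    using a by (rule coordinate_forms)
  obtain g g0 where g: "dot g b = 0" "dot g w = 1" "dot g0 b = 1" "dot g0 w = 0"
    using b by (rule coordinate_forms)
  consider "x \<notin> fs.span {a, u}" | "y \<notin> fs.span {b, w}" | "x \<in> fs.span {a, u}" "y \<in> fs.span {b, w}" by blast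
  then show "\<exists>s t. \<exists>F\<in>biforms s t. (\<forall>z'\<in>graph_curve a u b w. vanishes F z') \<and> \<not> vanishes F z"
  proof cases
    case 1
    then obtain h where h: "\<And>v. v \<in> {a, u} \<Longrightarrow> dot h v = 0" "dot h x = 1" by (rule separating_form) (rule that)
    have "\<forall>z'\<in>graph_curve a u b w. vanishes (lin1 h :: ('n1, 'n2, 'k) bipoly) z'"
      by (auto simp: graph_curve_def line_point_def dot_add dot_scale h(1))
    moreover have "\<not> vanishes (lin1 h :: ('n1, 'n2, 'k) bipoly) z" unfolding xy(1) vanishes_lin1 h(2) by simp
    ultimately show ?thesis using lin1_biform by blast
  next
    case 2
    then obtain h where h: "\<And>v. v \<in> {b, w} \<Longrightarrow> dot h v = 0" "dot h y = 1" by (rule separating_form) (rule that)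
    have "\<forall>z'\<in>graph_curve a u b w. vanishes (lin2 h :: ('n1, 'n2, 'k) bipoly) z'"
      by (auto simp: graph_curve_def line_point_def dot_add dot_scale h(1))
    moreover have "\<not> vanishes (lin2 h :: ('n1, 'n2, 'k) bipoly) z" unfolding xy(1) vanishes_lin2 h(2) by simp
    ultimately show ?thesis using lin2_biform by blast
  next
    case 3
    have "\<not> vanishes (graph_form f0 f g0 g) z"
      using mem_graph_curve[OF f g xy(2) 3(1) xy(3) 3(2)] z(2) unfolding xy(1) vanishes_graph_form by blast
    moreover have "\<forall>z'\<in>graph_curve a u b w. vanishes (graph_form f0 f g0 g) z'"
      using graph_form_on_graph_curve[OF f g] unfolding mem_set_ideal .
    ultimately show ?thesis using graph_form_biform by blast
  qed
qed

section \<open>Irreducibility and bidegree of the curves\<close>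

lemma alpha_curve_irreducible:
  fixes a u :: "'n1::finite \<Rightarrow> 'k::field_char_0" and b :: "'n2::finite \<Rightarrow> 'k"
  assumes a: "a \<noteq> 0" "u \<notin> fs.span {a}" and b: "b \<noteq> 0"
  shows "zirreducible (alpha_curve a u b)" "krull_dim (alpha_curve a u b) = 1"
proof -
  have *: "F \<in> set_ideal (alpha_curve a u b)" if "F \<in> biforms s t" "infinite {z \<in> alpha_curve a u b. vanishes F z}" for s t F
    using that rational_curve_unique[where xp = "\<lambda>i. [:u i, a i:]" and yp = "\<lambda>j. [:b j:]" and m = 1 and n = 0]
    by (simp add: alpha_curve_rational)
  show "zirreducible (alpha_curve a u b)" "krull_dim (alpha_curve a u b) = 1"
    by (rule curve_like[OF curves_infinite(2)[OF a(1) b a(2)] zclosed_alpha_curve[OF a b] *]; assumption)+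
qed

lemma beta_curve_irreducible:
  fixes a :: "'n1::finite \<Rightarrow> 'k::field_char_0" and b w :: "'n2::finite \<Rightarrow> 'k"
  assumes a: "a \<noteq> 0" and b: "b \<noteq> 0" "w \<notin> fs.span {b}"
  shows "zirreducible (beta_curve a b w)" "krull_dim (beta_curve a b w) = 1"
proof -
  have *: "F \<in> set_ideal (beta_curve a b w)" if "F \<in> biforms s t" "infinite {z \<in> beta_curve a b w. vanishes F z}" for s t F
    using that rational_curve_unique[where xp = "\<lambda>i. [:a i:]" and yp = "\<lambda>j. [:w j, b j:]" and m = 0 and n = 1]
    by (simp add: beta_curve_rational)
  show "zirreducible (beta_curve a b w)" "krull_dim (beta_curve a b w) = 1"
    by (rule curve_like[OF curves_infinite(3)[OF a b] zclosed_beta_curve[OF a b] *]; assumption)+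
qed

lemma graph_curve_irreducible:
  fixes a u :: "'n1::finite \<Rightarrow> 'k::field_char_0" and b w :: "'n2::finite \<Rightarrow> 'k"
  assumes a: "a \<noteq> 0" "u \<notin> fs.span {a}" and b: "b \<noteq> 0" "w \<notin> fs.span {b}"
  shows "zirreducible (graph_curve a u b w)" "krull_dim (graph_curve a u b w) = 1"
proof -
  have *: "F \<in> set_ideal (graph_curve a u b w)" if "F \<in> biforms s t" "infinite {z \<in> graph_curve a u b w. vanishes F z}" for s t F
    using that rational_curve_unique[where xp = "\<lambda>i. [:u i, a i:]" and yp = "\<lambda>j. [:w j, b j:]" and m = 1 and n = 1]
    by (simp add: graph_curve_rational)
  show "zirreducible (graph_curve a u b w)" "krull_dim (graph_curve a u b w) = 1"
    by (rule curve_like[OF curves_infinite(1)[OF a(1) b(1) a(2)] zclosed_graph_curve[OF a b] *]; assumption)+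
qed

lemma graph_curve_curve:
  fixes a u :: "'n1::finite \<Rightarrow> 'k::field_char_0" and b w :: "'n2::finite \<Rightarrow> 'k"
  assumes a: "a \<noteq> 0" "u \<notin> fs.span {a}" and b: "b \<noteq> 0" "w \<notin> fs.span {b}"
  shows "curve (graph_curve a u b w)"
  unfolding curve_def
proof (intro conjI allI impI)
  show "zclosed (graph_curve a u b w)" by (rule zclosed_graph_curve[OF a b])
  show "graph_curve a u b w \<noteq> {}" by (simp add: graph_curve_def)
  fix Z assume "irr_component Z (graph_curve a u b w)"
  then have "graph_curve a u b w = Z"
    using graph_curve_irreducible(1)[OF a b] unfolding irr_component_def by blast
  then show "krull_dim Z = 1" using graph_curve_irreducible(2)[OF a b] by simp
qed

lemma cross_curve:
  fixes a u :: "'n1::finite \<Rightarrow> 'k::field_char_0" and b w :: "'n2::finite \<Rightarrow> 'k"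
  assumes a: "a \<noteq> 0" "u \<notin> fs.span {a}" and b: "b \<noteq> 0" "w \<notin> fs.span {b}"
  shows "curve (alpha_curve a u b \<union> beta_curve a b w)"
  unfolding curve_def
proof (intro conjI allI impI)
  let ?A = "alpha_curve a u b" and ?B = "beta_curve a b w"
  have cl: "zclosed ?A" "zclosed ?B" by (rule zclosed_alpha_curve[OF a b(1)], rule zclosed_beta_curve[OF a(1) b])
  show "zclosed (?A \<union> ?B)" by (rule zclosed_Un[OF cl])
  show "?A \<union> ?B \<noteq> {}" by (simp add: alpha_curve_def)
  fix Z assume Z: "irr_component Z (?A \<union> ?B)"
  then have irr: "zirreducible Z" "Z \<subseteq> ?A \<union> ?B" unfolding irr_component_def by blast+
  have "Z \<subseteq> ?A \<or> Z \<subseteq> ?B" by (rule zirreducible_subset_Un[OF irr(1) cl irr(2)])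
  then have "?A = Z \<or> ?B = Z"
    using Z alpha_curve_irreducible(1)[OF a b(1)] beta_curve_irreducible(1)[OF a(1) b]
    unfolding irr_component_def by (metis Un_upper1 Un_upper2)
  then show "krull_dim Z = 1"
    using alpha_curve_irreducible(2)[OF a b(1)] beta_curve_irreducible(2)[OF a(1) b] by auto
qed

lemma pullback_add: "pullback xp yp (F + G) = pullback xp yp F + pullback xp yp G"
  by (simp add: pullback_def pev.meval_add)

lemma pullback_Const_mult: "pullback xp yp (Const c * F) = smult c (pullback xp yp F)"
  by (simp add: pullback_def pev.meval_mult)

text \<open>The \<open>s + t + 1\<close> coefficients of the pullback bound the Hilbert function
  from above; that neither projection is constant bounds it from below.\<close>

lemma graph_curve_bidegree:
  fixes a u :: "'n1::finite \<Rightarrow> 'k::field_char_0" and b w :: "'n2::finite \<Rightarrow> 'k"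
  assumes a: "a \<noteq> 0" "u \<notin> fs.span {a}" and b: "b \<noteq> 0" "w \<notin> fs.span {b}"
  shows "curve_bidegree (graph_curve a u b w) 1 1"
proof -
  let ?G = "graph_curve a u b w" and ?x = "\<lambda>i. [:u i, a i:]" and ?y = "\<lambda>j. [:w j, b j:]"
  have HF: "hilbert_function (set_ideal ?G) s t = s + t + 1" for s t
  proof (rule antisym)
    have "hilbert_function (set_ideal ?G) s t \<le> card {..s + t}"
    proof (rule hilbert_function_le[OF set_ideal_subspace, where \<phi> = "\<lambda>i F. coeff (pullback ?x ?y F) i"])
      fix F :: "('n1, 'n2, 'k) bipoly"
      assume F: "F \<in> biforms s t" and 0: "\<And>i. i \<in> {..s + t} \<Longrightarrow> coeff (pullback ?x ?y F) i = 0"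
      have "degree (pullback ?x ?y F) \<le> s * 1 + t * 1"
        using pullback_top[where xp = ?x and yp = ?y and m = 1 and n = 1, OF _ _ F] by simp
      then have "coeff (pullback ?x ?y F) i = 0" for i
        using 0[of i] coeff_eq_0[of "pullback ?x ?y F" i] by (cases "i \<le> s + t") auto
      then have "pullback ?x ?y F = 0" by (simp add: poly_eq_iff)
      then show "F \<in> set_ideal ?G"
        using set_ideal_rational_curve[where xp = ?x and yp = ?y and m = 1 and n = 1, OF _ _ F]
        by (simp add: graph_curve_rational)
    qed (simp_all add: pullback_add pullback_Const_mult)
    then show "hilbert_function (set_ideal ?G) s t \<le> s + t + 1" by simp
    let ?z = "(proj_pt a, proj_pt b)" and ?z' = "(proj_pt (line_point a u 0), proj_pt (line_point b w 0))"
    have z: "?z \<in> ?G" "?z' \<in> ?G" by (simp_all add: graph_curve_def)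
    have ne: "fst ?z \<noteq> fst ?z'" "snd ?z \<noteq> snd ?z'"
      using line_point_nonzero(2)[OF a(2), of 0] line_point_nonzero(2)[OF b(2), of 0] by auto
    show "s + t + 1 \<le> hilbert_function (set_ideal ?G) s t"
      by (rule hilbert_function_nonconstant[OF graph_curve_irreducible(1)[OF a b] z ne(1) z ne(2)])
  qed
  show ?thesis
    unfolding curve_bidegree_def using graph_curve_curve[OF a b] HF
    by (intro conjI exI[of _ 1] exI[of _ 0]) simp_all
qed

lemma cross_bidegree:
  fixes a u :: "'n1::finite \<Rightarrow> 'k::field_char_0" and b w :: "'n2::finite \<Rightarrow> 'k"
  assumes a: "a \<noteq> 0" "u \<notin> fs.span {a}" and b: "b \<noteq> 0" "w \<notin> fs.span {b}"
  shows "curve_bidegree (alpha_curve a u b \<union> beta_curve a b w) 1 1"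
proof -
  let ?A = "alpha_curve a u b" and ?B = "beta_curve a b w"
  let ?x = "\<lambda>i. [:u i, a i:]" and ?y = "\<lambda>j. [:w j, b j:]" and ?a = "\<lambda>i. [:a i:]" and ?b = "\<lambda>j. [:b j:]"
  have le: "hilbert_function (set_ideal (?A \<union> ?B)) s t \<le> s + t + 1" for s t
  proof -
    \<comment> \<open>The two restrictions have \<open>s + 1\<close> and \<open>t + 1\<close>
      coefficients, but both leading ones are the value at the crossing point; hence the index set
      \<open>{..<t}\<close> for the second line.\<close>
    have "hilbert_function (set_ideal (?A \<union> ?B)) s t \<le> card ({..s} <+> {..<t})"
    proof (rule hilbert_function_le[OF set_ideal_subspace, where
          \<phi> = "\<lambda>k F. case k of Inl i \<Rightarrow> coeff (pullback ?x ?b F) i | Inr i \<Rightarrow> coeff (pullback ?a ?y F) i"])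
      fix F :: "('n1, 'n2, 'k) bipoly"
      assume F: "F \<in> biforms s t" and 0: "\<And>k. k \<in> {..s} <+> {..<t} \<Longrightarrow>
        (case k of Inl i \<Rightarrow> coeff (pullback ?x ?b F) i | Inr i \<Rightarrow> coeff (pullback ?a ?y F) i) = 0"
      have 1: "degree (pullback ?x ?b F) \<le> s" "coeff (pullback ?x ?b F) s = bval F a b"
        using pullback_top[where xp = ?x and yp = ?b and m = 1 and n = 0, OF _ _ F] by simp_all
      have 2: "degree (pullback ?a ?y F) \<le> t" "coeff (pullback ?a ?y F) t = bval F a b"
        using pullback_top[where xp = ?a and yp = ?y and m = 0 and n = 1, OF _ _ F] by simp_all
      have A: "coeff (pullback ?x ?b F) i = 0" for i
        using 0[of "Inl i"] 1(1) coeff_eq_0[of "pullback ?x ?b F" i] by (cases "i \<le> s") auto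
      then have "bval F a b = 0" using 1(2) by simp
      then have B: "coeff (pullback ?a ?y F) i = 0" for i
        using 0[of "Inr i"] 2 coeff_eq_0[of "pullback ?a ?y F" i] by (cases "i < t"; cases "i = t") auto
      have "pullback ?x ?b F = 0" "pullback ?a ?y F = 0" using A B by (simp_all add: poly_eq_iff)
      then have "F \<in> set_ideal ?A" "F \<in> set_ideal ?B"
        using set_ideal_rational_curve[where xp = ?x and yp = ?b and m = 1 and n = 0, OF _ _ F]
          set_ideal_rational_curve[where xp = ?a and yp = ?y and m = 0 and n = 1, OF _ _ F]
        by (simp_all add: alpha_curve_rational beta_curve_rational)
      then show "F \<in> set_ideal (?A \<union> ?B)" unfolding mem_set_ideal by blast
    qed (simp_all add: pullback_add pullback_Const_mult split: sum.splits)
    then show ?thesis by (simp add: card_Plus)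
  qed
  \<comment> \<open>\<open>lin2 g\<close> vanishes on the \<alpha>-line and not on the \<beta>-line.
    It costs one degree in the second variables, so the exact value is obtained for
    \<open>t \<ge> 1\<close>, which is enough asymptotically.\<close>
  have ge: "s + Suc t + 1 \<le> hilbert_function (set_ideal (?A \<union> ?B)) s (Suc t)" for s t
  proof -
    obtain g g0 where g: "dot g b = 0" "dot g w = 1" "dot g0 b = 1" "dot g0 w = 0"
      using b by (rule coordinate_forms)
    have gA: "(lin2 g :: ('n1, 'n2, 'k) bipoly) \<in> set_ideal ?A"
      unfolding mem_set_ideal alpha_curve_def by (auto simp: g)
    have zA: "(proj_pt a, proj_pt b) \<in> ?A" "(proj_pt (line_point a u 0), proj_pt b) \<in> ?A"
      unfolding alpha_curve_def by simp_all
    have zB: "(proj_pt a, proj_pt b) \<in> ?B" "(proj_pt a, proj_pt (line_point b w 0)) \<in> ?B"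
      unfolding beta_curve_def by simp_all
    have "\<not> vanishes (lin2 g :: ('n1, 'n2, 'k) bipoly) (proj_pt a, proj_pt (line_point b w 0))"
      by (simp add: line_point_def g)
    then have gB: "(lin2 g :: ('n1, 'n2, 'k) bipoly) \<notin> set_ideal ?B" using zB(2) unfolding mem_set_ideal by blast
    have "hilbert_function (set_ideal ?B) s t + hilbert_function (set_ideal ?A) (s + 0) (t + Suc 0)
        \<le> hilbert_function (set_ideal (?A \<union> ?B)) (s + 0) (t + Suc 0)"
      by (rule hilbert_function_additive[OF beta_curve_irreducible(1)[OF a(1) b] Un_upper2 Un_upper1 lin2_biform gA gB])
    moreover have "t + 1 \<le> hilbert_function (set_ideal ?B) s t"
      using line_point_nonzero(2)[OF b(2), of 0]
      by (intro hilbert_function_nonconstant2[OF beta_curve_irreducible(1)[OF a(1) b] zB]) auto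
    moreover have "s + 1 \<le> hilbert_function (set_ideal ?A) s (Suc t)"
      using line_point_nonzero(2)[OF a(2), of 0]
      by (intro hilbert_function_nonconstant1(2)[OF alpha_curve_irreducible(1)[OF a b(1)] zA]) auto
    ultimately show ?thesis by simp
  qed
  have "hilbert_function (set_ideal (?A \<union> ?B)) s t = s + t + 1" if "t \<ge> 1" for s t
    using le[of s t] ge[of s "t - 1"] that by simp
  then show ?thesis
    unfolding curve_bidegree_def using cross_curve[OF a b]
    by (intro conjI exI[of _ 1] exI[of _ 1]) simp_all
qed

section \<open>Tangent spaces of the curves\<close>

lemma mdiff_zero_along:
  fixes F :: "('i, 'k::field_char_0) mpoly"
  assumes "\<And>r. mvalue F (\<lambda>i. v i + r * h i) = 0"
  shows "mdiff F v h = 0"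
proof -
  have "poly (meval (\<lambda>c. [:c:]) (\<lambda>i. [:v i, h i:]) F) r = 0" for r
    using assms[of r] by (simp add: poly_meval mult.commute)
  then have "meval (\<lambda>c. [:c:]) (\<lambda>i. [:v i, h i:]) F = 0" using poly_all_0_iff_0 by blast
  then show ?thesis by (simp add: mdiff_def)
qed

text \<open>Homogeneous parameters on a line: in the computation of tangent spaces the point at
  infinity, with parameters (1, 0), is no separate case.\<close>

definition lin_comb :: "('i \<Rightarrow> 'k::field) \<Rightarrow> ('i \<Rightarrow> 'k) \<Rightarrow> 'k \<Rightarrow> 'k \<Rightarrow> 'i \<Rightarrow> 'k" where
  "lin_comb a u s t = (\<lambda>i. s * a i + t * u i)"

lemma dot_lin_comb: "dot f (lin_comb a u s t) = s * dot f a + t * dot f u"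
  by (simp add: lin_comb_def dot_add dot_scale)

lemma lin_comb_simps: "lin_comb x y 1 0 = x" "lin_comb x y s 1 = line_point x y s"
  by (auto simp: lin_comb_def line_point_def fun_eq_iff)

lemma proj_pt_lin_comb: "t \<noteq> 0 \<Longrightarrow> proj_pt (lin_comb x y s t) = proj_pt (line_point x y (s / t))"
proof -
  assume t: "t \<noteq> 0"
  then have "lin_comb x y s t = (\<lambda>i. t * line_point x y (s / t) i)"
    by (auto simp: lin_comb_def line_point_def fun_eq_iff algebra_simps)
  then show ?thesis using proj_pt_scale[OF t] by metis
qed

lemma lin_comb_mem_graph_curve:
  assumes "s \<noteq> 0 \<or> t \<noteq> 0"
  shows "(proj_pt (lin_comb a u s t), proj_pt (lin_comb b w s t)) \<in> graph_curve a u b w"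
proof (cases "t = 0")
  case True
  then have s: "s \<noteq> 0" using assms by simp
  have "proj_pt (lin_comb a u s t) = proj_pt a" "proj_pt (lin_comb b w s t) = proj_pt b"
    using proj_pt_scale[OF s, of a] proj_pt_scale[OF s, of b] True by (simp_all add: lin_comb_def)
  then show ?thesis by (simp add: graph_curve_def)
next
  case False
  have "proj_pt (lin_comb a u s t) = proj_pt (line_point a u (s / t))"
    "proj_pt (lin_comb b w s t) = proj_pt (line_point b w (s / t))"
    by (rule proj_pt_lin_comb[OF False])+
  then show ?thesis unfolding graph_curve_def by blast
qed

lemma graph_curve_lin_comb:
  assumes "z \<in> graph_curve a u b w"
  obtains s t where "s \<noteq> 0 \<or> t \<noteq> 0" "z = (proj_pt (lin_comb a u s t), proj_pt (lin_comb b w s t))"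
proof -
  consider "z = (proj_pt a, proj_pt b)" | s where "z = (proj_pt (line_point a u s), proj_pt (line_point b w s))"
    using assms unfolding graph_curve_def by blast
  then show ?thesis
  proof cases
    case 1
    then show ?thesis using that[of 1 0] by (simp add: lin_comb_simps)
  next
    case (2 s)
    then show ?thesis using that[of s 1] by (simp add: lin_comb_simps)
  qed
qed

lemma bicone_zero:
  assumes "F \<in> set_ideal G" "(x1, x2) \<in> G" "v1 \<in> x1" "v2 \<in> x2"
  shows "bval F v1 v2 = 0"
  using assms unfolding mem_set_ideal vanishes_def by force

text \<open>The tangent space to the bicone is spanned by the two scaling directions and the
  velocity of the parametrisation; there is no more, because the linear equations of the two lines
  and \<open>graph_form\<close> leave only three parameters.\<close>

lemma graph_curve_smooth:
  fixes a u :: "'n1::finite \<Rightarrow> 'k::field_char_0" and b w :: "'n2::finite \<Rightarrow> 'k"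
  assumes a: "a \<noteq> 0" "u \<notin> fs.span {a}" and b: "b \<noteq> 0" "w \<notin> fs.span {b}"
  shows "smooth_curve (graph_curve a u b w)"
proof -
  let ?G = "graph_curve a u b w"
  obtain f f0 where f: "dot f a = 0" "dot f u = 1" "dot f0 a = 1" "dot f0 u = 0"
    using a by (rule coordinate_forms)
  obtain g g0 where g: "dot g b = 0" "dot g w = 1" "dot g0 b = 1" "dot g0 w = 0"
    using b by (rule coordinate_forms)
  have dim3: "fs.dim {h. \<forall>F\<in>set_ideal ?G. mdiff F (case_sum v1 v2) h = 0} = 3"
    if x: "(x1, x2) \<in> ?G" and v: "v1 \<in> x1 - {0}" "v2 \<in> x2 - {0}" for x1 x2 v1 v2
  proof -
    obtain s0 t0 where st0: "x1 = proj_pt (lin_comb a u s0 t0)" "x2 = proj_pt (lin_comb b w s0 t0)"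
      using graph_curve_lin_comb[OF x] by blast
    obtain r1 where r1: "v1 = (\<lambda>i. r1 * lin_comb a u s0 t0 i)" using v(1) st0(1) mem_proj_pt by blast
    obtain r2 where r2: "v2 = (\<lambda>i. r2 * lin_comb b w s0 t0 i)" using v(2) st0(2) mem_proj_pt by blast
    have nz: "r1 \<noteq> 0" "r2 \<noteq> 0" using v r1 r2 by (auto simp: zero_fun_def)
    define s where "s = r1 * s0"
    define t where "t = r1 * t0"
    \<comment> \<open>The vectors over the two factors are scaled independently;
      \<open>\<rho>\<close> is their ratio when both are written with the same parameters
      \<open>s\<close>, \<open>t\<close>.\<close>
    define \<rho> where "\<rho> = r2 / r1"
    have \<rho>: "\<rho> \<noteq> 0" using nz by (simp add: \<rho>_def)
    have v1: "v1 = lin_comb a u s t" by (simp add: r1 s_def t_def lin_comb_def algebra_simps)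
    have v2: "v2 = (\<lambda>j. \<rho> * lin_comb b w s t j)"
      using nz by (simp add: r2 s_def t_def \<rho>_def lin_comb_def algebra_simps)
    have st: "s \<noteq> 0 \<or> t \<noteq> 0" using v(1) v1 by (auto simp: lin_comb_def zero_fun_def)
    \<comment> \<open>Any direction in the parameter plane independent of \<open>(s, t)\<close>
      serves as velocity; \<open>\<delta>\<close> is the determinant of the two.\<close>
    define s' :: 'k where "s' = (if s \<noteq> 0 then 0 else 1)"
    define t' :: 'k where "t' = (if s \<noteq> 0 then 1 else 0)"
    define \<delta> where "\<delta> = s * t' - t * s'"
    have \<delta>: "\<delta> \<noteq> 0" using st by (auto simp: \<delta>_def s'_def t'_def)
    define e1 :: "'n1 + 'n2 \<Rightarrow> 'k" where "e1 = case_sum v1 (\<lambda>_. 0)"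
    define e2 :: "'n1 + 'n2 \<Rightarrow> 'k" where "e2 = case_sum (\<lambda>_. 0) v2"
    define e3 :: "'n1 + 'n2 \<Rightarrow> 'k" where "e3 = case_sum (lin_comb a u s' t') (\<lambda>j. \<rho> * lin_comb b w s' t' j)"
    define T where "T = {h. \<forall>F\<in>set_ideal ?G. mdiff F (case_sum v1 v2) h = 0}"
    have sub: "fs.subspace T"
      using mdiff_direction_scale[of _ "case_sum v1 v2" 0]
      by (auto simp: fs.subspace_def T_def fscale_def plus_fun_def zero_fun_def mdiff_direction_add mdiff_direction_scale)
    have e1T: "e1 \<in> T"
      unfolding T_def
    proof (intro CollectI ballI mdiff_zero_along)
      fix F r assume F: "F \<in> set_ideal ?G"
      have "(\<lambda>i. case_sum v1 v2 i + r * e1 i) = case_sum (\<lambda>i. (1 + r) * v1 i) v2"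
        by (auto simp: e1_def fun_eq_iff algebra_simps split: sum.splits)
      moreover have "(\<lambda>i. (1 + r) * v1 i) \<in> x1" unfolding r1 st0(1) mem_proj_pt
        by (rule exI[of _ "(1 + r) * r1"]) (simp add: mult.assoc)
      ultimately show "mvalue F (\<lambda>i. case_sum v1 v2 i + r * e1 i) = 0"
        using bicone_zero[OF F x, of "\<lambda>i. (1 + r) * v1 i" v2] v(2) by simp
    qed
    have e2T: "e2 \<in> T"
      unfolding T_def
    proof (intro CollectI ballI mdiff_zero_along)
      fix F r assume F: "F \<in> set_ideal ?G"
      have "(\<lambda>i. case_sum v1 v2 i + r * e2 i) = case_sum v1 (\<lambda>i. (1 + r) * v2 i)"
        by (auto simp: e2_def fun_eq_iff algebra_simps split: sum.splits)
      moreover have "(\<lambda>i. (1 + r) * v2 i) \<in> x2" unfolding r2 st0(2) mem_proj_pt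
        by (rule exI[of _ "(1 + r) * r2"]) (simp add: mult.assoc)
      ultimately show "mvalue F (\<lambda>i. case_sum v1 v2 i + r * e2 i) = 0"
        using bicone_zero[OF F x, of v1 "\<lambda>i. (1 + r) * v2 i"] v(1) by simp
    qed
    have e3T: "e3 \<in> T"
      unfolding T_def
    proof (intro CollectI ballI mdiff_zero_along)
      fix F r assume F: "F \<in> set_ideal ?G"
      let ?s = "s + r * s'" and ?t = "t + r * t'"
      have "?s * t' - ?t * s' = \<delta>" by (simp add: \<delta>_def algebra_simps)
      then have "?s \<noteq> 0 \<or> ?t \<noteq> 0" using \<delta> by auto
      from lin_comb_mem_graph_curve[OF this] have mem:
        "(proj_pt (lin_comb a u ?s ?t), proj_pt (lin_comb b w ?s ?t)) \<in> ?G" .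
      have "(\<lambda>i. case_sum v1 v2 i + r * e3 i) = case_sum (lin_comb a u ?s ?t) (\<lambda>j. \<rho> * lin_comb b w ?s ?t j)"
        by (auto simp: v1 v2 e3_def lin_comb_def fun_eq_iff algebra_simps split: sum.splits)
      moreover have "(\<lambda>j. \<rho> * lin_comb b w ?s ?t j) \<in> proj_pt (lin_comb b w ?s ?t)"
        unfolding mem_proj_pt by blast
      ultimately show "mvalue F (\<lambda>i. case_sum v1 v2 i + r * e3 i) = 0"
        using bicone_zero[OF F mem self_mem_proj_pt] by simp
    qed
    have TE: "h \<in> fs.span {e1, e2, e3}" if h: "h \<in> T" for h
    proof -
      define h1 where "h1 = (\<lambda>i. h (Inl i))"
      define h2 where "h2 = (\<lambda>j. h (Inr j))"
      have hF: "mdiff F (case_sum v1 v2) h = 0" if "F \<in> set_ideal ?G" for F using h that by (auto simp: T_def)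
      have "h1 \<in> fs.span {a, u}"
      proof (rule ccontr)
        assume "h1 \<notin> fs.span {a, u}"
        then obtain k where k: "\<And>v. v \<in> {a, u} \<Longrightarrow> dot k v = 0" "dot k h1 = 1" by (rule separating_form) (rule that)
        have "(lin1 k :: ('n1, 'n2, 'k) bipoly) \<in> set_ideal ?G"
          unfolding mem_set_ideal graph_curve_def by (auto simp: line_point_def dot_add dot_scale k(1))
        from hF[OF this] show False using k(2) by (simp add: h1_def)
      qed
      then obtain p0 p1 where p: "h1 = lin_comb a u p0 p1" unfolding in_span_2 lin_comb_def by blast
      have "h2 \<in> fs.span {b, w}"
      proof (rule ccontr)
        assume "h2 \<notin> fs.span {b, w}"
        then obtain k where k: "\<And>v. v \<in> {b, w} \<Longrightarrow> dot k v = 0" "dot k h2 = 1" by (rule separating_form) (rule that)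
        have "(lin2 k :: ('n1, 'n2, 'k) bipoly) \<in> set_ideal ?G"
          unfolding mem_set_ideal graph_curve_def by (auto simp: line_point_def dot_add dot_scale k(1))
        from hF[OF this] show False using k(2) by (simp add: h2_def)
      qed
      then obtain q0 q1 where q: "h2 = lin_comb b w q0 q1" unfolding in_span_2 lin_comb_def by blast
      have "mdiff (graph_form f0 f g0 g) (case_sum v1 v2) h = 0"
        by (rule hF[OF graph_form_on_graph_curve[OF f g]])
      then have Q: "\<rho> * (p0 * t - p1 * s) + (s * q1 - t * q0) = 0"
        unfolding graph_form_def
        by (simp add: mdiff_simps h1_def[symmetric] h2_def[symmetric] p q v1 v2 dot_lin_comb dot_scale f g algebra_simps)
      \<comment> \<open>Cramer's rule for the coordinates of \<open>h\<close> with respect to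
        \<open>e1\<close>, \<open>e2\<close>, \<open>e3\<close>: \<open>A\<close> and
        \<open>B\<close> solve the equations of the first factor, \<open>C\<close> and the same
        \<open>B\<close> those of the second, which are compatible by \<open>Q\<close>.\<close>
      define A where "A = (p0 * t' - p1 * s') / \<delta>"
      define B where "B = (s * p1 - t * p0) / \<delta>"
      define C where "C = (q0 * t' - q1 * s') / (\<rho> * \<delta>)"
      have ABC: "A * \<delta> = p0 * t' - p1 * s'" "B * \<delta> = s * p1 - t * p0" "\<rho> * C * \<delta> = q0 * t' - q1 * s'"
        using \<delta> \<rho> by (simp_all add: A_def B_def C_def)
      have B': "B * \<rho> * \<delta> = s * q1 - t * q0"
      proof -
        have "B * \<rho> * \<delta> = \<rho> * (B * \<delta>)" by simp
        also have "\<dots> = - (\<rho> * (p0 * t - p1 * s))" unfolding ABC by (simp add: algebra_simps)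
        also have "\<dots> = s * q1 - t * q0" using Q by (rule minus_unique)
        finally show ?thesis .
      qed
      have "(A * s + B * s') * \<delta> = (A * \<delta>) * s + (B * \<delta>) * s'" "(A * t + B * t') * \<delta> = (A * \<delta>) * t + (B * \<delta>) * t'"
        by (simp_all add: algebra_simps)
      then have "(A * s + B * s') * \<delta> = p0 * \<delta>" "(A * t + B * t') * \<delta> = p1 * \<delta>"
        unfolding ABC by (simp_all add: \<delta>_def algebra_simps)
      then have c1: "A * s + B * s' = p0" "A * t + B * t' = p1" using \<delta> by simp_all
      have "(\<rho> * (C * s) + B * \<rho> * s') * \<delta> = (\<rho> * C * \<delta>) * s + (B * \<rho> * \<delta>) * s'"
        "(\<rho> * (C * t) + B * \<rho> * t') * \<delta> = (\<rho> * C * \<delta>) * t + (B * \<rho> * \<delta>) * t'"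
        by (simp_all add: algebra_simps)
      then have "(\<rho> * (C * s) + B * \<rho> * s') * \<delta> = q0 * \<delta>" "(\<rho> * (C * t) + B * \<rho> * t') * \<delta> = q1 * \<delta>"
        unfolding ABC B' by (simp_all add: \<delta>_def algebra_simps)
      then have c2: "\<rho> * (C * s) + B * \<rho> * s' = q0" "\<rho> * (C * t) + B * \<rho> * t' = q1" using \<delta> by simp_all
      have "h = fscale A e1 + fscale C e2 + fscale B e3"
      proof
        fix k
        show "h k = (fscale A e1 + fscale C e2 + fscale B e3) k"
        proof (cases k)
          case (Inl i)
          have "h k = p0 * a i + p1 * u i" using fun_cong[OF p, of i] by (simp add: h1_def lin_comb_def Inl)
          then show ?thesis
            unfolding c1[symmetric] by (simp add: Inl fscale_def e1_def e2_def e3_def v1 lin_comb_def algebra_simps)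
        next
          case (Inr j)
          have "h k = q0 * b j + q1 * w j" using fun_cong[OF q, of j] by (simp add: h2_def lin_comb_def Inr)
          then show ?thesis
            unfolding c2[symmetric] by (simp add: Inr fscale_def e1_def e2_def e3_def v2 lin_comb_def algebra_simps)
        qed
      qed
      also have "\<dots> \<in> fs.span {e1, e2, e3}"
        by (intro fs.span_add fs.span_scale fs.span_base) simp_all
      finally show ?thesis .
    qed
    have span: "T = fs.span {e1, e2, e3}"
      using TE fs.span_minimal[OF _ sub, of "{e1, e2, e3}"] e1T e2T e3T by blast
    define e where "e = (\<lambda>n::nat. if n = 0 then e1 else if n = 1 then e2 else e3)"
    have zero: "c i = 0" if c: "(\<Sum>n<3. fscale (c n) (e n)) = 0" and i: "i \<in> {..<3}" for c i
    proof -
      have sum0: "c 0 * e1 k + c 1 * e2 k + c 2 * e3 k = 0" for k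
        using fun_cong[OF c, of k] by (simp add: e_def sum_fun_apply fscale_def numeral_3_eq_3 numeral_2_eq_2)
      have "(\<lambda>i. c 0 * v1 i + c 2 * lin_comb a u s' t' i) = (\<lambda>_. 0)"
        using sum0[of "Inl _"] by (auto simp: e1_def e2_def e3_def)
      then have "dot k (\<lambda>i. c 0 * v1 i + c 2 * lin_comb a u s' t' i) = 0" for k by simp
      from this[of f] this[of f0] have l: "c 0 * t + c 2 * t' = 0" "c 0 * s + c 2 * s' = 0"
        by (simp_all add: dot_add dot_scale v1 dot_lin_comb f)
      have "c 0 * \<delta> = (c 0 * s + c 2 * s') * t' - (c 0 * t + c 2 * t') * s'" "c 2 * \<delta> = (c 0 * t + c 2 * t') * s - (c 0 * s + c 2 * s') * t"
        by (simp_all add: \<delta>_def algebra_simps)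
      then have c02: "c 0 = 0" "c 2 = 0" using \<delta> unfolding l by simp_all
      have "c 1 * v2 j = 0" for j using sum0[of "Inr j"] by (simp add: e1_def e2_def c02)
      moreover obtain j where "v2 j \<noteq> 0" using v(2) by (auto simp: fun_eq_iff)
      ultimately have "c 1 = 0" by (metis mult_eq_0_iff)
      then show ?thesis using i c02 by (auto simp: numeral_3_eq_3 numeral_2_eq_2 less_Suc_eq)
    qed
    have fam: "inj_on e {..<3}" "fs.independent (e ` {..<3})"
      by (intro fs.independent_family finite_lessThan; erule (1) zero)+
    have "e ` {..<3} = {e1, e2, e3}" by (auto simp: e_def numeral_3_eq_3 lessThan_Suc)
    then have "fs.dim T = card (e ` {..<3})"
      using fs.dim_span_eq_card_independent[OF fam(2)] span by simp
    then show ?thesis using card_image[OF fam(1)] by (simp add: T_def)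
  qed
  show ?thesis
    unfolding smooth_curve_def using graph_curve_curve[OF a b] dim3 by blast
qed

section \<open>Curves of bidegree (1,1) through a tangent vector\<close>

lemma case_sum_line: "(\<lambda>i. case_sum a b i + r * case_sum u w i) = case_sum (\<lambda>i. a i + r * u i) (\<lambda>j. b j + r * w j)"
  for a u :: "_ \<Rightarrow> 'k::field"
  by (auto simp: fun_eq_iff split: sum.splits)

lemma graph_curve_tangent:
  fixes a u :: "'n1::finite \<Rightarrow> 'k::field_char_0" and b w :: "'n2::finite \<Rightarrow> 'k"
  assumes F: "F \<in> set_ideal (graph_curve a u b w)"
  shows "bval F a b = 0" "bdiff F a b u w = 0"
proof -
  have 0: "bval F (\<lambda>i. a i + r * u i) (\<lambda>j. b j + r * w j) = 0" for r
    using bicone_zero[OF F lin_comb_mem_graph_curve[of 1 r a u b w] self_mem_proj_pt self_mem_proj_pt]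
    by (simp add: lin_comb_def)
  show "bval F a b = 0" using 0[of 0] by simp
  show "bdiff F a b u w = 0" by (rule mdiff_zero_along) (simp add: case_sum_line 0)
qed

lemma alpha_curve_tangent:
  fixes a u :: "'n1::finite \<Rightarrow> 'k::field_char_0" and b :: "'n2::finite \<Rightarrow> 'k"
  assumes a: "a \<noteq> 0" "u \<notin> fs.span {a}" and F: "F \<in> set_ideal (alpha_curve a u b)"
  shows "bval F a b = 0" "bdiff F a b u (\<lambda>_. 0) = 0"
proof -
  have 0: "bval F (\<lambda>i. a i + r * u i) b = 0" for r
  proof -
    have "(\<lambda>i. a i + r * u i) \<notin> fs.span {u}"
    proof
      obtain f f0 where f: "dot f a = 0" "dot f u = 1" "dot f0 a = 1" "dot f0 u = 0"
        using a by (rule coordinate_forms)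
      assume "(\<lambda>i. a i + r * u i) \<in> fs.span {u}"
      then have "dot f0 (\<lambda>i. a i + r * u i) = 0" by (rule dot_on_span) (simp add: f)
      then show False by (simp add: dot_add dot_scale f)
    qed
    then have nz: "(\<lambda>i. a i + r * u i) \<noteq> 0" using fs.span_zero by metis
    have "(\<lambda>i. a i + r * u i) \<in> fs.span {a, u}"
      unfolding in_span_2 by (rule exI[of _ 1], rule exI[of _ r]) simp
    from mem_alpha_curve[OF a(1) nz this] show ?thesis
      by (rule bicone_zero[OF F _ self_mem_proj_pt self_mem_proj_pt])
  qed
  show "bval F a b = 0" using 0[of 0] by simp
  show "bdiff F a b u (\<lambda>_. 0) = 0" by (rule mdiff_zero_along) (simp add: case_sum_line 0)
qed

lemma beta_curve_tangent:
  fixes a :: "'n1::finite \<Rightarrow> 'k::field_char_0" and b w :: "'n2::finite \<Rightarrow> 'k"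
  assumes b: "b \<noteq> 0" "w \<notin> fs.span {b}" and F: "F \<in> set_ideal (beta_curve a b w)"
  shows "bval F a b = 0" "bdiff F a b (\<lambda>_. 0) w = 0"
proof -
  have 0: "bval F a (\<lambda>i. b i + r * w i) = 0" for r
  proof -
    have "(\<lambda>i. b i + r * w i) \<notin> fs.span {w}"
    proof
      obtain f f0 where f: "dot f b = 0" "dot f w = 1" "dot f0 b = 1" "dot f0 w = 0"
        using b by (rule coordinate_forms)
      assume "(\<lambda>i. b i + r * w i) \<in> fs.span {w}"
      then have "dot f0 (\<lambda>i. b i + r * w i) = 0" by (rule dot_on_span) (simp add: f)
      then show False by (simp add: dot_add dot_scale f)
    qed
    then have nz: "(\<lambda>i. b i + r * w i) \<noteq> 0" using fs.span_zero by metis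
    have "(\<lambda>i. b i + r * w i) \<in> fs.span {b, w}"
      unfolding in_span_2 by (rule exI[of _ 1], rule exI[of _ r]) simp
    from mem_beta_curve[OF b(1) nz this] show ?thesis
      by (rule bicone_zero[OF F _ self_mem_proj_pt self_mem_proj_pt])
  qed
  show "bval F a b = 0" using 0[of 0] by simp
  show "bdiff F a b (\<lambda>_. 0) w = 0" by (rule mdiff_zero_along) (simp add: case_sum_line 0)
qed

lemma scheme_inI:
  fixes W :: "('n1::finite, 'n2::finite, 'k::field_char_0) bipoly set"
  assumes W: "is_ideal W" and G: "G \<subseteq> biproj_space"
    and "\<And>s t F. F \<in> biforms s t \<Longrightarrow> F \<in> set_ideal G \<Longrightarrow> F \<in> W"
  shows "scheme_in W G"
  unfolding scheme_in_def
proof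
  fix F assume F: "F \<in> set_ideal G"
  have "(\<Sum>(s, t)\<in>bidegs F. bicomponent s t F) \<in> W"
    using assms(3)[OF bicomponent_biform set_ideal_bicomponent[OF G F]]
    by (intro is_ideal_sum[OF W]) auto
  then show "F \<in> W" by (simp flip: sum_bicomponents)
qed

text \<open>Every equation of an infinite subset has infinitely many zeros on the curve, hence holds
  on all of it.\<close>

lemma rational_curve_subset:
  fixes A :: "('n1::finite, 'n2::finite, 'k::field_char_0) bipt set"
  assumes deg: "\<And>i. degree (xp i) \<le> m" "\<And>j. degree (yp j) \<le> n"
    and A: "zclosed A" "infinite A" "A \<subseteq> rational_curve xp m yp n" and C: "rational_curve xp m yp n \<subseteq> biproj_space"
  shows "A = rational_curve xp m yp n"
proof (rule antisym[OF A(3)], rule subsetI, rule ccontr)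
  fix z assume z: "z \<in> rational_curve xp m yp n" "z \<notin> A"
  then have zb: "z \<in> biproj_space" using C by blast
  obtain s t F where F: "F \<in> biforms s t" "\<And>z'. z' \<in> A \<Longrightarrow> vanishes F z'" "\<not> vanishes F z"
    by (rule zclosedE[OF A(1) zb z(2)]) (rule that)
  have "A \<subseteq> {q \<in> rational_curve xp m yp n. vanishes F q}" using F(2) A(3) by blast
  then have "infinite {q \<in> rational_curve xp m yp n. vanishes F q}" using A(2) finite_subset by blast
  from rational_curve_unique[where xp = xp and yp = yp, OF deg F(1) this] show False
    using F(3) z(1) unfolding mem_set_ideal by blast
qed

text \<open>
  A curve of bidegree \<open>(1, 1)\<close> is described through its irreducible components. Two different components on which the
  first projection is not constant would make the Hilbert function grow by two in the first degree,
  and likewise for the second projection. So either there is one component on which no projection is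
  constant, or there are an \<open>\<alpha>\<close>-line and a \<open>\<beta>\<close>-line. In the first case the equations are found by
  Bezout type estimates: a form containing more of \<open>W\<close> and the curve than its degree allows has
  to vanish on the curve.
\<close>

locale tangent_curve =
  fixes G :: "('n1::finite, 'n2::finite, 'k::field_char_0) bipt set" and W a b u w
  assumes ab: "a \<noteq> 0" "b \<noteq> 0" and u: "u \<notin> fs.span {a}" and w: "w \<notin> fs.span {b}"
    and W: "is_ideal W" "\<And>F s t. F \<in> biforms s t \<Longrightarrow> F \<in> W \<longleftrightarrow> bval F a b = 0 \<and> bdiff F a b u w = 0"
    and G: "curve_bidegree G 1 1" and WG: "set_ideal G \<subseteq> W"
begin

lemma closedG: "zclosed G" and curveG: "curve G"
  using G by (auto simp: curve_bidegree_def curve_def)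

lemma G_biproj: "G \<subseteq> biproj_space"
  using closedG by (rule zclosed_subset)

text \<open>The form in which the bidegree is used: for large \<open>s\<close> and \<open>t\<close>
  every subset of \<open>G\<close> has Hilbert function at most \<open>s + t\<close> plus a
  constant, hence no more than slope one in each variable.\<close>

lemma irreducible_subset_hilbert:
  obtains K N where "\<And>Z s t. Z \<subseteq> G \<Longrightarrow> s \<ge> N \<Longrightarrow> t \<ge> N \<Longrightarrow> hilbert_function (set_ideal Z) s t \<le> s + t + K"
proof -
  obtain c :: int and N where c: "\<And>s t. s \<ge> N \<Longrightarrow> t \<ge> N \<Longrightarrow> int (hilbert_function (set_ideal G) s t) = int s + int t + c"
    using G by (auto simp: curve_bidegree_def)
  have "hilbert_function (set_ideal Z) s t \<le> s + t + nat c" if Z: "Z \<subseteq> G" "s \<ge> N" "t \<ge> N" for Z s t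
  proof -
    have "hilbert_function (set_ideal Z) s t \<le> hilbert_function (set_ideal G) s t"
      by (rule hilbert_function_antimono[OF set_ideal_subspace set_ideal_subspace set_ideal_antimono[OF Z(1)]])
    then show ?thesis using c[OF Z(2,3)] by linarith
  qed
  then show ?thesis using that by blast
qed

lemma pt_in_G: "(proj_pt a, proj_pt b) \<in> G"
proof (rule ccontr)
  assume no: "(proj_pt a, proj_pt b) \<notin> G"
  have z: "(proj_pt a, proj_pt b) \<in> biproj_space" using ab by (simp add: biproj_space_def proj_space_iff)
  obtain s t F where F: "F \<in> biforms s t" "\<And>z'. z' \<in> G \<Longrightarrow> vanishes F z'" "\<not> vanishes F (proj_pt a, proj_pt b)"
    by (rule zclosedE[OF closedG z no]) (rule that)
  have "F \<in> W" using WG F(2) unfolding subset_iff mem_set_ideal by blast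
  then show False using F(3) W(2)[OF F(1)] unfolding vanishes_iff[OF F(1)] by blast
qed

text \<open>Slope two in \<open>s\<close>, at a fixed large \<open>t\<close>, outgrows the bound
  \<open>s + t + K\<close>; the index is chosen with \<open>2 * k > k + N + K\<close>.\<close>

lemma no_double_growth1:
  assumes "Z \<subseteq> G" "\<And>s t. hilbert_function (set_ideal Z) s t + 2 \<le> hilbert_function (set_ideal Z) (Suc s) t"
  shows False
proof -
  obtain K N where KN: "\<And>Z s t. Z \<subseteq> G \<Longrightarrow> s \<ge> N \<Longrightarrow> t \<ge> N \<Longrightarrow> hilbert_function (set_ideal Z) s t \<le> s + t + K"
    by (rule irreducible_subset_hilbert) (rule that)
  have "2 * k \<le> hilbert_function (set_ideal Z) k N" for k
  proof (induction k)
    case (Suc k)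
    then show ?case using assms(2)[of k N] by simp
  qed simp
  from this[of "N + K + N + 1"] KN[OF assms(1), of "N + K + N + 1" N] show False by simp
qed

lemma no_double_growth2:
  assumes "Z \<subseteq> G" "\<And>s t. hilbert_function (set_ideal Z) s t + 2 \<le> hilbert_function (set_ideal Z) s (Suc t)"
  shows False
proof -
  obtain K N where KN: "\<And>Z s t. Z \<subseteq> G \<Longrightarrow> s \<ge> N \<Longrightarrow> t \<ge> N \<Longrightarrow> hilbert_function (set_ideal Z) s t \<le> s + t + K"
    by (rule irreducible_subset_hilbert) (rule that)
  have "2 * k \<le> hilbert_function (set_ideal Z) N k" for k
  proof (induction k)
    case (Suc k)
    then show ?case using assms(2)[of N k] by simp
  qed simp
  from this[of "N + K + N + 1"] KN[OF assms(1), of N "N + K + N + 1"] show False by simp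
qed

text \<open>Along the diagonal the bound has slope two, so a form of bidegree (1, 1) that does not
  vanish on \<open>Z\<close> cannot meet it three times.\<close>

lemma no_triple_growth:
  assumes "Z \<subseteq> G" "\<And>s t. hilbert_function (set_ideal Z) s t + 3 \<le> hilbert_function (set_ideal Z) (Suc s) (Suc t)"
  shows False
proof -
  obtain K N where KN: "\<And>Z s t. Z \<subseteq> G \<Longrightarrow> s \<ge> N \<Longrightarrow> t \<ge> N \<Longrightarrow> hilbert_function (set_ideal Z) s t \<le> s + t + K"
    by (rule irreducible_subset_hilbert) (rule that)
  have "3 * k \<le> hilbert_function (set_ideal Z) k k" for k
  proof (induction k)
    case (Suc k)
    then show ?case using assms(2)[of k k] by simp
  qed simp
  from this[of "N + K + 1"] KN[OF assms(1), of "N + K + 1" "N + K + 1"] show False by simp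
qed

text \<open>If \<open>Z1\<close> were not contained in \<open>Z2\<close>, the two contributions to
  the Hilbert function of \<open>G\<close> would add up to slope two in \<open>s\<close>.\<close>

lemma component_unique1:
  assumes Z1: "zirreducible Z1" "Z1 \<subseteq> G" "x1 \<in> Z1" "y1 \<in> Z1" "fst x1 \<noteq> fst y1"
    and Z2: "zirreducible Z2" "Z2 \<subseteq> G" "x2 \<in> Z2" "y2 \<in> Z2" "fst x2 \<noteq> fst y2"
  shows "Z1 \<subseteq> Z2"
proof (rule subsetI, rule ccontr)
  fix z assume z: "z \<in> Z1" "z \<notin> Z2"
  have zb: "z \<in> biproj_space" by (rule zirreducible_biproj[OF Z1(1) z(1)])
  have cl: "zclosed Z2" using Z2(1) unfolding zirreducible_def by blast
  obtain i j H where H: "H \<in> biforms i j" "\<And>z'. z' \<in> Z2 \<Longrightarrow> vanishes H z'" "\<not> vanishes H z"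
    by (rule zclosedE[OF cl zb z(2)]) (rule that)
  have H2: "H \<in> set_ideal Z2" and H1: "H \<notin> set_ideal Z1" using H z(1) unfolding mem_set_ideal by blast+
  obtain K N where KN: "\<And>Z s t. Z \<subseteq> G \<Longrightarrow> s \<ge> N \<Longrightarrow> t \<ge> N \<Longrightarrow> hilbert_function (set_ideal Z) s t \<le> s + t + K"
    by (rule irreducible_subset_hilbert) (rule that)
  \<comment> \<open>Large enough for the two lower bounds \<open>s + 1\<close> and
    \<open>s + i + 1\<close> together to exceed the upper bound
    \<open>s + i + (N + j) + K\<close>.\<close>
  define s where "s = N + j + K"
  have "hilbert_function (set_ideal Z1) s N + hilbert_function (set_ideal Z2) (s + i) (N + j)
      \<le> hilbert_function (set_ideal G) (s + i) (N + j)"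
    by (rule hilbert_function_additive[OF Z1(1,2) Z2(2) H(1) H2 H1])
  moreover have "s + 1 \<le> hilbert_function (set_ideal Z1) s N"
    by (rule hilbert_function_nonconstant1(2)[OF Z1(1,3-5)])
  moreover have "s + i + 1 \<le> hilbert_function (set_ideal Z2) (s + i) (N + j)"
    by (rule hilbert_function_nonconstant1(2)[OF Z2(1,3-5)])
  moreover have "hilbert_function (set_ideal G) (s + i) (N + j) \<le> s + i + (N + j) + K"
    by (rule KN) (simp_all add: s_def)
  ultimately show False by (simp add: s_def)
qed

lemma component_unique2:
  assumes Z1: "zirreducible Z1" "Z1 \<subseteq> G" "x1 \<in> Z1" "y1 \<in> Z1" "snd x1 \<noteq> snd y1"
    and Z2: "zirreducible Z2" "Z2 \<subseteq> G" "x2 \<in> Z2" "y2 \<in> Z2" "snd x2 \<noteq> snd y2"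
  shows "Z1 \<subseteq> Z2"
proof (rule subsetI, rule ccontr)
  fix z assume z: "z \<in> Z1" "z \<notin> Z2"
  have zb: "z \<in> biproj_space" by (rule zirreducible_biproj[OF Z1(1) z(1)])
  have cl: "zclosed Z2" using Z2(1) unfolding zirreducible_def by blast
  obtain i j H where H: "H \<in> biforms i j" "\<And>z'. z' \<in> Z2 \<Longrightarrow> vanishes H z'" "\<not> vanishes H z"
    by (rule zclosedE[OF cl zb z(2)]) (rule that)
  have H2: "H \<in> set_ideal Z2" and H1: "H \<notin> set_ideal Z1" using H z(1) unfolding mem_set_ideal by blast+
  obtain K N where KN: "\<And>Z s t. Z \<subseteq> G \<Longrightarrow> s \<ge> N \<Longrightarrow> t \<ge> N \<Longrightarrow> hilbert_function (set_ideal Z) s t \<le> s + t + K"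
    by (rule irreducible_subset_hilbert) (rule that)
  define t where "t = N + i + K"
  have "hilbert_function (set_ideal Z1) N t + hilbert_function (set_ideal Z2) (N + i) (t + j)
      \<le> hilbert_function (set_ideal G) (N + i) (t + j)"
    by (rule hilbert_function_additive[OF Z1(1,2) Z2(2) H(1) H2 H1])
  moreover have "t + 1 \<le> hilbert_function (set_ideal Z1) N t"
    by (rule hilbert_function_nonconstant2[OF Z1(1,3-5)])
  moreover have "t + j + 1 \<le> hilbert_function (set_ideal Z2) (N + i) (t + j)"
    by (rule hilbert_function_nonconstant2[OF Z2(1,3-5)])
  moreover have "hilbert_function (set_ideal G) (N + i) (t + j) \<le> N + i + (t + j) + K"
    by (rule KN) (simp_all add: t_def)
  ultimately show False by (simp add: t_def)
qed

lemma component_cases: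
  assumes "z \<in> G"
  obtains Z where "zirreducible Z" "Z \<subseteq> G" "z \<in> Z" "infinite Z"
    "(\<exists>x\<in>Z. \<exists>y\<in>Z. fst x \<noteq> fst y) \<or> (\<exists>x\<in>Z. \<exists>y\<in>Z. snd x \<noteq> snd y)"
proof -
  obtain Z where Z: "zirreducible Z" "infinite Z" "Z \<subseteq> G" "z \<in> Z"
    by (rule curve_component[OF curveG assms]) (rule that)
  have "Z \<noteq> {z}" using Z(2) by auto
  then obtain z' where "z' \<in> Z" "z' \<noteq> z" using Z(4) by blast
  then have "fst z' \<noteq> fst z \<or> snd z' \<noteq> snd z" by (simp add: prod_eq_iff)
  then show ?thesis using that[OF Z(1,3,4,2)] \<open>z' \<in> Z\<close> Z(4) by blast
qed

text \<open>Were the first projection constant on every component, the second would vary on all of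
  them and they would coincide. Then \<open>G\<close> lies over [a], and a linear form vanishing at
  \<open>a\<close> but not at \<open>u\<close> contradicts
  \<open>set_ideal G \<subseteq> W\<close>.\<close>

lemma nonconstant1_component:
  obtains Z x y where "zirreducible Z" "Z \<subseteq> G" "infinite Z" "x \<in> Z" "y \<in> Z" "fst x \<noteq> fst y"
proof (rule ccontr)
  assume no: "\<not> thesis"
  note goal = that
  have no': "fst x = fst y" if Z: "zirreducible Z" "Z \<subseteq> G" "infinite Z" "x \<in> Z" "y \<in> Z" for Z x y
    using goal[OF Z] no by blast
  obtain Z where Z: "zirreducible Z" "Z \<subseteq> G" "(proj_pt a, proj_pt b) \<in> Z" "infinite Z"
    "(\<exists>x\<in>Z. \<exists>y\<in>Z. fst x \<noteq> fst y) \<or> (\<exists>x\<in>Z. \<exists>y\<in>Z. snd x \<noteq> snd y)"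
    by (rule component_cases[OF pt_in_G]) (rule that)
  then obtain x y where xy: "x \<in> Z" "y \<in> Z" "snd x \<noteq> snd y" using no'[OF Z(1,2,4)] by blast
  have GZ: "G \<subseteq> Z"
  proof
    fix z assume "z \<in> G"
    then obtain Z' where Z': "zirreducible Z'" "Z' \<subseteq> G" "z \<in> Z'" "infinite Z'"
      "(\<exists>x\<in>Z'. \<exists>y\<in>Z'. fst x \<noteq> fst y) \<or> (\<exists>x\<in>Z'. \<exists>y\<in>Z'. snd x \<noteq> snd y)"
      by (rule component_cases) (rule that)
    then obtain x' y' where "x' \<in> Z'" "y' \<in> Z'" "snd x' \<noteq> snd y'" using no'[OF Z'(1,2,4)] by blast
    from component_unique2[OF Z'(1,2) this Z(1,2) xy] show "z \<in> Z" using Z'(3) by blast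
  qed
  obtain f where f: "dot f a = 0" "dot f u = 1" using separating_form[OF u] by blast
  have "(lin1 f :: ('n1, 'n2, 'k) bipoly) \<in> set_ideal G"
    unfolding mem_set_ideal
  proof
    fix z assume z: "z \<in> G"
    then have "z \<in> Z" using GZ by blast
    from no'[OF Z(1,2,4) this Z(3)] have "fst z = proj_pt a" by simp
    then have "z = (proj_pt a, snd z)" by (simp add: prod_eq_iff)
    moreover obtain y where "snd z = proj_pt y" using G_biproj z biproj_space_cases by (metis snd_conv subsetD)
    ultimately show "vanishes (lin1 f :: ('n1, 'n2, 'k) bipoly) z" using f(1) vanishes_lin1 by metis
  qed
  then have "(lin1 f :: ('n1, 'n2, 'k) bipoly) \<in> W" using WG by blast
  then show False using W(2)[OF lin1_biform[of f]] f(2) by simp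
qed

lemma nonconstant2_component:
  obtains Z x y where "zirreducible Z" "Z \<subseteq> G" "infinite Z" "x \<in> Z" "y \<in> Z" "snd x \<noteq> snd y"
proof (rule ccontr)
  assume no: "\<not> thesis"
  note goal = that
  have no': "snd x = snd y" if Z: "zirreducible Z" "Z \<subseteq> G" "infinite Z" "x \<in> Z" "y \<in> Z" for Z x y
    using goal[OF Z] no by blast
  obtain Z where Z: "zirreducible Z" "Z \<subseteq> G" "(proj_pt a, proj_pt b) \<in> Z" "infinite Z"
    "(\<exists>x\<in>Z. \<exists>y\<in>Z. fst x \<noteq> fst y) \<or> (\<exists>x\<in>Z. \<exists>y\<in>Z. snd x \<noteq> snd y)"
    by (rule component_cases[OF pt_in_G]) (rule that)
  then obtain x y where xy: "x \<in> Z" "y \<in> Z" "fst x \<noteq> fst y" using no'[OF Z(1,2,4)] by blast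
  have GZ: "G \<subseteq> Z"
  proof
    fix z assume "z \<in> G"
    then obtain Z' where Z': "zirreducible Z'" "Z' \<subseteq> G" "z \<in> Z'" "infinite Z'"
      "(\<exists>x\<in>Z'. \<exists>y\<in>Z'. fst x \<noteq> fst y) \<or> (\<exists>x\<in>Z'. \<exists>y\<in>Z'. snd x \<noteq> snd y)"
      by (rule component_cases) (rule that)
    then obtain x' y' where "x' \<in> Z'" "y' \<in> Z'" "fst x' \<noteq> fst y'" using no'[OF Z'(1,2,4)] by blast
    from component_unique1[OF Z'(1,2) this Z(1,2) xy] show "z \<in> Z" using Z'(3) by blast
  qed
  obtain g where g: "dot g b = 0" "dot g w = 1" using separating_form[OF w] by blast
  have "(lin2 g :: ('n1, 'n2, 'k) bipoly) \<in> set_ideal G"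
    unfolding mem_set_ideal
  proof
    fix z assume z: "z \<in> G"
    then have "z \<in> Z" using GZ by blast
    from no'[OF Z(1,2,4) this Z(3)] have "snd z = proj_pt b" by simp
    then have "z = (fst z, proj_pt b)" by (simp add: prod_eq_iff)
    moreover obtain x where "fst z = proj_pt x" using G_biproj z biproj_space_cases by (metis fst_conv subsetD)
    ultimately show "vanishes (lin2 g :: ('n1, 'n2, 'k) bipoly) z" using g(1) vanishes_lin2 by metis
  qed
  then have "(lin2 g :: ('n1, 'n2, 'k) bipoly) \<in> W" using WG by blast
  then show False using W(2)[OF lin2_biform[of g]] g(2) by simp
qed

lemma W_subspace: "mp.subspace W"
  by (rule ideal_subspace[OF W(1)])

text \<open>The tangent vector counts as two points: if \<open>H\<close> contains it but not
  \<open>G\<close>, then a form with nonzero value at the support and one with zero value and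
  nonzero derivative are both new.\<close>

lemma growth_tangent:
  assumes irr: "zirreducible G" and H: "H \<in> biforms i j" "H \<in> W" "H \<notin> set_ideal G"
    and E: "E \<in> biforms (s + i) (t + j)" "bval E a b = 0" "bdiff E a b u w \<noteq> 0"
  shows "hilbert_function (set_ideal G) s t + 2 \<le> hilbert_function (set_ideal G) (s + i) (t + j)"
proof -
  obtain E0 where E0: "E0 \<in> biforms (s + i) (t + j)" "bval E0 a b = 1" using ab by (rule ex_biform_nonzero)
  have "indep_mod W (\<lambda>k. if k then E0 else E) UNIV"
    unfolding indep_mod_def
  proof (intro conjI allI impI)
    fix c assume c: "(\<Sum>k\<in>UNIV. Const (c k) * (if k then E0 else E)) \<in> W"
    let ?F = "Const (c True) * E0 + Const (c False) * E"
    have F: "?F \<in> biforms (s + i) (t + j)" using E E0 by blast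
    have "?F \<in> W" using c by (simp add: UNIV_bool add.commute)
    then have 0: "bval ?F a b = 0" "bdiff ?F a b u w = 0" using W(2)[OF F] by blast+
    have "c True = 0" using 0(1) E(2) E0(2) by (simp add: ev_simps)
    moreover from this have "c False = 0" using 0(2) E(3) by (simp add: mdiff_simps)
    ultimately show "\<forall>k\<in>UNIV. c k = 0" by (metis (full_types))
  qed simp
  from hilbert_function_growth_irreducible[OF irr H(1,3) W_subspace _ _ _ this, of s t]
  have "hilbert_function (set_ideal G) s t + card (UNIV :: bool set) \<le> hilbert_function (set_ideal G) (s + i) (t + j)"
    using WG H(2) E(1) E0(1) is_idealD(4)[OF W(1)] by (auto simp: subset_iff)
  then show ?thesis by simp
qed

text \<open>A linear form through the tangent vector meets \<open>G\<close> twice, more than its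
  degree allows, so it vanishes on \<open>G\<close>; hence \<open>G\<close> lies in the product of
  two lines. There a graph through \<open>W\<close> and one further point of \<open>G\<close> meets
  it three times, against degree two.\<close>

lemma mixed_case:
  assumes irr: "zirreducible G"
    and xy1: "x1 \<in> G" "y1 \<in> G" "fst x1 \<noteq> fst y1" and xy2: "x2 \<in> G" "y2 \<in> G" "snd x2 \<noteq> snd y2"
  obtains c where "G = graph_curve a u b (line_point b w c)"
proof -
  obtain f f0 where f: "dot f a = 0" "dot f u = 1" "dot f0 a = 1" "dot f0 u = 0"
    using ab(1) u by (rule coordinate_forms)
  obtain g g0 where g: "dot g b = 0" "dot g w = 1" "dot g0 b = 1" "dot g0 w = 0"
    using ab(2) w by (rule coordinate_forms)
  have l1: "lin1 h \<in> set_ideal G" if h: "dot h a = 0" "dot h u = 0" for h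
  proof (rule ccontr)
    assume no: "lin1 h \<notin> set_ideal G"
    have hW: "lin1 h \<in> W" using W(2)[OF lin1_biform[of h]] h by simp
    show False
    proof (rule no_double_growth1[OF order_refl])
      fix s t
      obtain E where E: "E \<in> biforms s t" "bval E a b = 1" using ab by (rule ex_biform_nonzero)
      have "lin1 f * E \<in> biforms (s + Suc 0) (t + 0)" by (rule biforms_mult'[OF lin1_biform E(1)]) simp_all
      from growth_tangent[OF irr lin1_biform hW no this]
      show "hilbert_function (set_ideal G) s t + 2 \<le> hilbert_function (set_ideal G) (Suc s) t"
        using E(2) f by (simp add: ev_simps mdiff_simps)
    qed
  qed
  have l2: "lin2 h \<in> set_ideal G" if h: "dot h b = 0" "dot h w = 0" for h
  proof (rule ccontr)
    assume no: "lin2 h \<notin> set_ideal G"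
    have hW: "lin2 h \<in> W" using W(2)[OF lin2_biform[of h]] h by simp
    show False
    proof (rule no_double_growth2[OF order_refl])
      fix s t
      obtain E where E: "E \<in> biforms s t" "bval E a b = 1" using ab by (rule ex_biform_nonzero)
      have "lin2 g * E \<in> biforms (s + 0) (t + Suc 0)" by (rule biforms_mult'[OF lin2_biform E(1)]) simp_all
      from growth_tangent[OF irr lin2_biform hW no this]
      show "hilbert_function (set_ideal G) s t + 2 \<le> hilbert_function (set_ideal G) s (Suc t)"
        using E(2) g by (simp add: ev_simps mdiff_simps)
    qed
  qed
  have span: "x \<in> fs.span {a, u}" "y \<in> fs.span {b, w}" if z: "(proj_pt x, proj_pt y) \<in> G" for x y
  proof -
    show "x \<in> fs.span {a, u}"
    proof (rule ccontr)
      assume "x \<notin> fs.span {a, u}"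
      then obtain h where h: "\<And>v. v \<in> {a, u} \<Longrightarrow> dot h v = 0" "dot h x = 1" by (rule separating_form) (rule that)
      have "vanishes (lin1 h :: ('n1, 'n2, 'k) bipoly) (proj_pt x, proj_pt y)"
        using l1[of h] h(1) z unfolding mem_set_ideal by blast
      then show False using h(2) by simp
    qed
    show "y \<in> fs.span {b, w}"
    proof (rule ccontr)
      assume "y \<notin> fs.span {b, w}"
      then obtain h where h: "\<And>v. v \<in> {b, w} \<Longrightarrow> dot h v = 0" "dot h y = 1" by (rule separating_form) (rule that)
      have "vanishes (lin2 h :: ('n1, 'n2, 'k) bipoly) (proj_pt x, proj_pt y)"
        using l2[of h] h(1) z unfolding mem_set_ideal by blast
      then show False using h(2) by simp
    qed
  qed
  have fst_a: "fst z = proj_pt a" if z: "z \<in> G" "vanishes (lin1 f :: ('n1, 'n2, 'k) bipoly) z" for z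
  proof -
    obtain x y where xy: "z = (proj_pt x, proj_pt y)" "x \<noteq> 0" "y \<noteq> 0"
      using biproj_space_cases G_biproj z(1) by blast
    obtain c d where x: "x = (\<lambda>i. c * a i + d * u i)" using span(1)[of x y] z(1) xy(1) unfolding in_span_2 by blast
    have "d = 0" using z(2) unfolding xy(1) vanishes_lin1 by (simp add: x dot_add dot_scale f)
    then have "x \<in> fs.span {a}" using x unfolding in_span_1 by auto
    then show ?thesis using proj_pt_eq_iff(2)[OF ab(1) xy(2)] xy(1) by simp
  qed
  have snd_b: "snd z = proj_pt b" if z: "z \<in> G" "vanishes (lin2 g :: ('n1, 'n2, 'k) bipoly) z" for z
  proof -
    obtain x y where xy: "z = (proj_pt x, proj_pt y)" "x \<noteq> 0" "y \<noteq> 0"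
      using biproj_space_cases G_biproj z(1) by blast
    obtain c d where y: "y = (\<lambda>i. c * b i + d * w i)" using span(2)[of x y] z(1) xy(1) unfolding in_span_2 by blast
    have "d = 0" using z(2) unfolding xy(1) vanishes_lin2 by (simp add: y dot_add dot_scale g)
    then have "y \<in> fs.span {b}" using y unfolding in_span_1 by auto
    then show ?thesis using proj_pt_eq_iff(2)[OF ab(2) xy(3)] xy(1) by simp
  qed
  have f_not: "(lin1 f :: ('n1, 'n2, 'k) bipoly) \<notin> set_ideal G"
    using fst_a xy1 unfolding mem_set_ideal by metis
  have g_not: "(lin2 g :: ('n1, 'n2, 'k) bipoly) \<notin> set_ideal G"
    using snd_b xy2 unfolding mem_set_ideal by metis
  \<comment> \<open>The further point has to lie off both fibres through the support; primality of
    the ideal provides it.\<close>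
  have "(lin1 f * lin2 g :: ('n1, 'n2, 'k) bipoly) \<notin> set_ideal G"
    using zirreducible_prime[OF irr lin1_biform[of f] lin2_biform[of g]] f_not g_not by blast
  then obtain z1 where z1: "z1 \<in> G" "\<not> vanishes (lin1 f * lin2 g :: ('n1, 'n2, 'k) bipoly) z1"
    unfolding mem_set_ideal by blast
  obtain x y where xy: "z1 = (proj_pt x, proj_pt y)" "x \<noteq> 0" "y \<noteq> 0"
    using biproj_space_cases G_biproj z1(1) by blast
  have fg: "dot f x * dot g y \<noteq> 0"
    using z1(2) unfolding xy(1) vanishes_iff[OF biforms_mult[OF lin1_biform lin2_biform]] by (simp add: ev_simps)
  \<comment> \<open>\<open>c\<close> is determined by the requirement that the graph passes through
    \<open>z1\<close>. \<open>w'\<close> is the shifted direction, and \<open>g0'\<close> the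
    coordinate of \<open>b\<close> with respect to \<open>b\<close>, \<open>w'\<close>.\<close>
  define c where "c = (dot f x * dot g0 y - dot f0 x * dot g y) / (dot f x * dot g y)"
  define w' where "w' = line_point b w c"
  define g0' where "g0' = (\<lambda>j. g0 j - c * g j)"
  have g0'_dot: "dot g0' v = dot g0 v - c * dot g v" for v
    by (simp add: g0'_def dot_def algebra_simps sum_subtractf sum_distrib_left)
  have g': "dot g b = 0" "dot g w' = 1" "dot g0' b = 1" "dot g0' w' = 0"
    by (simp_all add: g0'_dot w'_def line_point_def dot_add dot_scale g)
  let ?Q = "graph_form f0 f g0' g"
  have QW: "?Q \<in> W"
    unfolding W(2)[OF graph_form_biform]
    by (simp add: graph_form_def ev_simps mdiff_simps f g g0'_dot)
  have Qz: "bval ?Q x y = 0" using fg by (simp add: g0'_dot c_def field_simps)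
  have QG: "?Q \<in> set_ideal G"
  proof (rule ccontr)
    assume no: "?Q \<notin> set_ideal G"
    show False
    proof (rule no_triple_growth[OF order_refl])
      fix s t
      \<comment> \<open>The three conditions are value and derivative at the support and the value
        at \<open>z1\<close>; the forms \<open>e\<close> chosen below are triangular with respect to
        them.\<close>
      let ?T = "{F \<in> W. bval F x y = 0}"
      obtain E0 where E0: "E0 \<in> biforms (s + Suc 0) (t + Suc 0)" "bval E0 a b = 1" using ab by (rule ex_biform_nonzero)
      obtain E1 where E1: "E1 \<in> biforms s (t + Suc 0)" "bval E1 a b = 1" using ab by (rule ex_biform_nonzero)
      obtain E2 where E2: "E2 \<in> biforms s t" "bval E2 x y = 1" using xy(2,3) by (rule ex_biform_nonzero)
      define e where "e = (\<lambda>k::nat. if k = 0 then E0 else if k = 1 then lin1 f * E1 else lin1 f * lin2 g * E2)"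
      have e_bif: "e 0 \<in> biforms (s + Suc 0) (t + Suc 0)" "e 1 \<in> biforms (s + Suc 0) (t + Suc 0)"
          "e 2 \<in> biforms (s + Suc 0) (t + Suc 0)"
        using E0(1) biforms_mult'[OF lin1_biform E1(1), of "s + Suc 0" "t + Suc 0" f]
          biforms_mult'[OF biforms_mult[OF lin1_biform lin2_biform] E2(1), of "s + Suc 0" "t + Suc 0" f g]
        by (simp_all add: e_def)
      have sub: "mp.subspace ?T"
        using W_subspace by (auto simp: mp.subspace_def mscale_def ev_simps)
      have ind: "indep_mod ?T e {..<3}"
        unfolding indep_mod_def
      proof (intro conjI allI impI)
        fix d assume "(\<Sum>k<3. Const (d k) * e k) \<in> ?T"
        then have *: "Const (d 0) * e 0 + Const (d 1) * e 1 + Const (d 2) * e 2 \<in> ?T" (is "?F \<in> _")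
          by (simp add: numeral_3_eq_3 numeral_2_eq_2)
        have F: "?F \<in> biforms (s + Suc 0) (t + Suc 0)"
          by (intro biforms_add biforms_Const_mult e_bif)
        have 0: "bval ?F a b = 0" "bdiff ?F a b u w = 0" "bval ?F x y = 0" using * W(2)[OF F] by blast+
        have d0: "d 0 = 0" using 0(1) E0(2) f g by (simp add: ev_simps e_def)
        have d1: "d 1 = 0" using 0(2) E1(2) f g by (simp add: mdiff_simps ev_simps e_def d0)
        have "d 2 = 0" using 0(3) E2(2) fg by (simp add: ev_simps e_def d0 d1[simplified])
        then show "\<forall>k\<in>{..<3}. d k = 0" using d0 d1 by (auto simp: numeral_3_eq_3 numeral_2_eq_2 less_Suc_eq)
      qed simp
      have "hilbert_function (set_ideal G) s t + card {..<3::nat}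
          \<le> hilbert_function (set_ideal G) (s + Suc 0) (t + Suc 0)"
      proof (rule hilbert_function_growth_irreducible[OF irr graph_form_biform no sub _ _ _ ind])
        show "set_ideal G \<inter> biforms (s + Suc 0) (t + Suc 0) \<subseteq> ?T"
        proof
          fix F assume "F \<in> set_ideal G \<inter> biforms (s + Suc 0) (t + Suc 0)"
          then have F: "F \<in> set_ideal G" "F \<in> biforms (s + Suc 0) (t + Suc 0)" by simp_all
          have "vanishes F (proj_pt x, proj_pt y)" using F(1) z1(1) xy(1) unfolding mem_set_ideal by blast
          then show "F \<in> ?T" using WG F(1) unfolding vanishes_iff[OF F(2)] by blast
        qed
        show "?Q * F \<in> ?T" for F
          using is_idealD(4)[OF W(1) QW, of F] Qz by (simp add: ev_simps del: bval_graph_form)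
        show "e k \<in> biforms (s + Suc 0) (t + Suc 0)" if "k \<in> {..<3}" for k
          using e_bif that by (auto simp: numeral_3_eq_3 numeral_2_eq_2 less_Suc_eq)
      qed
      then show "hilbert_function (set_ideal G) s t + 3 \<le> hilbert_function (set_ideal G) (Suc s) (Suc t)" by simp
    qed
  qed
  have w'_span: "w' \<notin> fs.span {b}" unfolding w'_def by (rule line_point_notin_span[OF w])
  have "G \<subseteq> graph_curve a u b w'"
  proof
    fix z assume z: "z \<in> G"
    obtain p q where pq: "z = (proj_pt p, proj_pt q)" "p \<noteq> 0" "q \<noteq> 0"
      using biproj_space_cases G_biproj z by blast
    have p: "p \<in> fs.span {a, u}" using span(1)[of p q] z pq(1) by simp
    obtain q0 q1 where q: "q = (\<lambda>j. q0 * b j + q1 * w j)" using span(2)[of p q] z pq(1) unfolding in_span_2 by blast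
    have "q = (\<lambda>j. (q0 - q1 * c) * b j + q1 * w' j)"
      by (auto simp: q w'_def line_point_def fun_eq_iff algebra_simps)
    then have q': "q \<in> fs.span {b, w'}" unfolding in_span_2 by blast
    have "vanishes ?Q z" using QG z unfolding mem_set_ideal by blast
    then have "dot f0 p * dot g q - dot f p * dot g0' q = 0" unfolding pq(1) vanishes_graph_form .
    from mem_graph_curve[OF f g' pq(2) p pq(3) q' this] show "z \<in> graph_curve a u b w'" unfolding pq(1) .
  qed
  moreover have "infinite G"
    using component_cases[OF pt_in_G] finite_subset by metis
  ultimately have "G = graph_curve a u b w'"
    using rational_curve_subset[where xp = "\<lambda>i. [:u i, a i:]" and yp = "\<lambda>j. [:w' j, b j:]" and m = 1 and n = 1,
        OF _ _ closedG] curves_biproj(1)[OF ab u w'_span]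
    by (simp add: graph_curve_rational)
  then show ?thesis using that unfolding w'_def by blast
qed

lemma separating_at_pt:
  assumes "zclosed Z" "(proj_pt a, proj_pt b) \<notin> Z"
  obtains s t F where "F \<in> biforms s t" "F \<in> set_ideal Z" "bval F a b \<noteq> 0"
proof -
  have z: "(proj_pt a, proj_pt b) \<in> biproj_space" using ab by (simp add: biproj_space_def proj_space_iff)
  obtain s t F where F: "F \<in> biforms s t" "\<And>z'. z' \<in> Z \<Longrightarrow> vanishes F z'" "\<not> vanishes F (proj_pt a, proj_pt b)"
    by (rule zclosedE[OF assms(1) z assms(2)]) (rule that)
  show ?thesis
    using that[OF F(1)] F(2,3) unfolding vanishes_iff[OF F(1)] mem_set_ideal by blast
qed

text \<open>Both components pass through the support: if one missed it, a form vanishing on that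
  component but not at the support, times a linear form vanishing on the other, would be an equation
  of \<open>G\<close> with nonzero tangent derivative. The degree bound then makes each component a
  line.\<close>

lemma reducible_case:
  assumes Z1: "zirreducible Z1" "Z1 \<subseteq> G" "infinite Z1" "\<And>x y. x \<in> Z1 \<Longrightarrow> y \<in> Z1 \<Longrightarrow> snd x = snd y"
    and Z2: "zirreducible Z2" "Z2 \<subseteq> G" "infinite Z2" "\<And>x y. x \<in> Z2 \<Longrightarrow> y \<in> Z2 \<Longrightarrow> fst x = fst y"
    and Un: "G = Z1 \<union> Z2"
  shows "G = alpha_curve a u b \<union> beta_curve a b w"
proof -
  let ?o = "(proj_pt a, proj_pt b)"
  have cl: "zclosed Z1" "zclosed Z2" using Z1(1) Z2(1) unfolding zirreducible_def by blast+
  obtain f where f: "dot f a = 0" "dot f u = 1" using separating_form[OF u] by blast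
  obtain g where g: "dot g b = 0" "dot g w = 1" using separating_form[OF w] by blast
  have in_W: "F * H \<in> W" if "F \<in> set_ideal Z1" "H \<in> set_ideal Z2" for F H
  proof -
    have "F * H \<in> set_ideal G"
      unfolding mem_set_ideal Un using that vanishes_mult unfolding mem_set_ideal by blast
    then show ?thesis using WG by blast
  qed
  have lin1_Z2: "(lin1 h :: ('n1, 'n2, 'k) bipoly) \<in> set_ideal Z2" if o: "?o \<in> Z2" and h: "dot h a = 0" for h
    unfolding mem_set_ideal
  proof
    fix z assume z: "z \<in> Z2"
    then have "fst z = proj_pt a" using Z2(4)[OF z o] by simp
    moreover obtain x y where "z = (proj_pt x, proj_pt y)" using biproj_space_cases[OF zirreducible_biproj[OF Z2(1) z]] by blast
    ultimately have "z = (proj_pt a, proj_pt y)" by simp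
    then show "vanishes (lin1 h :: ('n1, 'n2, 'k) bipoly) z" using h by simp
  qed
  have lin2_Z1: "(lin2 h :: ('n1, 'n2, 'k) bipoly) \<in> set_ideal Z1" if o: "?o \<in> Z1" and h: "dot h b = 0" for h
    unfolding mem_set_ideal
  proof
    fix z assume z: "z \<in> Z1"
    then have "snd z = proj_pt b" using Z1(4)[OF z o] by simp
    moreover obtain x y where "z = (proj_pt x, proj_pt y)" using biproj_space_cases[OF zirreducible_biproj[OF Z1(1) z]] by blast
    ultimately have "z = (proj_pt x, proj_pt b)" by simp
    then show "vanishes (lin2 h :: ('n1, 'n2, 'k) bipoly) z" using h by simp
  qed
  have o1: "?o \<in> Z1"
  proof (rule ccontr)
    assume no: "?o \<notin> Z1"
    then have o2: "?o \<in> Z2" using pt_in_G Un by blast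
    obtain s t F where F: "F \<in> biforms s t" "F \<in> set_ideal Z1" "bval F a b \<noteq> 0"
      by (rule separating_at_pt[OF cl(1) no]) (rule that)
    have "F * lin1 f \<in> W" by (rule in_W[OF F(2) lin1_Z2[OF o2 f(1)]])
    then have "bdiff (F * lin1 f) a b u w = 0" using W(2)[OF biforms_mult[OF F(1) lin1_biform[of f]]] by blast
    then show False using F(3) f by (simp add: mdiff_simps)
  qed
  have o2: "?o \<in> Z2"
  proof (rule ccontr)
    assume no: "?o \<notin> Z2"
    obtain s t F where F: "F \<in> biforms s t" "F \<in> set_ideal Z2" "bval F a b \<noteq> 0"
      by (rule separating_at_pt[OF cl(2) no]) (rule that)
    have "lin2 g * F \<in> W" by (rule in_W[OF lin2_Z1[OF o1 g(1)] F(2)])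
    then have "bdiff (lin2 g * F) a b u w = 0" using W(2)[OF biforms_mult[OF lin2_biform[of g] F(1)]] by blast
    then show False using F(3) g by (simp add: mdiff_simps)
  qed
  have "Z1 \<subseteq> alpha_curve a u b"
  proof
    fix z assume z: "z \<in> Z1"
    obtain x y where xy: "z = (proj_pt x, proj_pt y)" "x \<noteq> 0" "y \<noteq> 0"
      by (rule biproj_space_cases[OF zirreducible_biproj[OF Z1(1) z]])
    have zb: "z = (proj_pt x, proj_pt b)" using Z1(4)[OF z o1] xy(1) by simp
    have "x \<in> fs.span {a, u}"
    proof (rule ccontr)
      assume x: "x \<notin> fs.span {a, u}"
      obtain h where h: "dot h a = 0" "dot h x = 0" "dot h u = 1" by (rule line_form[OF u x])
      have xa: "x \<notin> fs.span {a}" using x fs.span_mono[of "{a}" "{a, u}"] by blast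
      obtain k k0 where k: "dot k a = 0" "dot k x = 1" "dot k0 a = 1" "dot k0 x = 0"
        by (rule coordinate_forms[OF ab(1) xa])
      \<comment> \<open>Since \<open>Z2\<close> lies over [a], vanishing on \<open>Z1\<close> would
        make this form an equation of \<open>G\<close>; but its tangent derivative is 1.\<close>
      have no: "(lin1 h :: ('n1, 'n2, 'k) bipoly) \<notin> set_ideal Z1"
      proof
        assume h1: "(lin1 h :: ('n1, 'n2, 'k) bipoly) \<in> set_ideal Z1"
        have "(lin1 h :: ('n1, 'n2, 'k) bipoly) \<in> set_ideal G"
          using h1 lin1_Z2[OF o2 h(1)] unfolding mem_set_ideal Un by blast
        then have "(lin1 h :: ('n1, 'n2, 'k) bipoly) \<in> W" using WG by blast
        then show False using W(2)[OF lin1_biform[of h]] h by simp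
      qed
      \<comment> \<open>\<open>lin1 h\<close> vanishes at two distinct points of \<open>Z1\<close>,
        the support and \<open>z\<close>, which the forms \<open>k0\<close> and \<open>k\<close>
        tell apart.\<close>
      show False
      proof (rule no_double_growth1[OF Z1(2)])
        fix s t
        obtain E where E: "E \<in> biforms s t" "bval E a b = 1" using ab by (rule ex_biform_nonzero)
        obtain E' where E': "E' \<in> biforms s t" "bval E' x b = 1" using xy(2) ab(2) by (rule ex_biform_nonzero)
        have "hilbert_function (set_ideal Z1) s t + 2 \<le> hilbert_function (set_ideal Z1) (s + Suc 0) (t + 0)"
        proof (rule growth_two_points[OF Z1(1) lin1_biform no o1])
          show "(proj_pt x, proj_pt b) \<in> Z1" using z zb by simp
          show "lin1 k0 * E \<in> biforms (s + Suc 0) (t + 0)" by (rule biforms_mult'[OF lin1_biform E(1)]) simp_all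
          show "lin1 k * E' \<in> biforms (s + Suc 0) (t + 0)" by (rule biforms_mult'[OF lin1_biform E'(1)]) simp_all
        qed (use h k E(2) E'(2) in \<open>simp_all add: ev_simps\<close>)
        then show "hilbert_function (set_ideal Z1) s t + 2 \<le> hilbert_function (set_ideal Z1) (Suc s) t" by simp
      qed
    qed
    then show "z \<in> alpha_curve a u b" unfolding zb by (rule mem_alpha_curve[OF ab(1) xy(2)])
  qed
  then have e1: "Z1 = alpha_curve a u b"
    using rational_curve_subset[where xp = "\<lambda>i. [:u i, a i:]" and yp = "\<lambda>j. [:b j:]" and m = 1 and n = 0,
        OF _ _ cl(1) Z1(3)] curves_biproj(2)[OF ab u]
    by (simp add: alpha_curve_rational)
  have "Z2 \<subseteq> beta_curve a b w"
  proof
    fix z assume z: "z \<in> Z2"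
    obtain x y where xy: "z = (proj_pt x, proj_pt y)" "x \<noteq> 0" "y \<noteq> 0"
      by (rule biproj_space_cases[OF zirreducible_biproj[OF Z2(1) z]])
    have za: "z = (proj_pt a, proj_pt y)" using Z2(4)[OF z o2] xy(1) by simp
    have "y \<in> fs.span {b, w}"
    proof (rule ccontr)
      assume y: "y \<notin> fs.span {b, w}"
      obtain h where h: "dot h b = 0" "dot h y = 0" "dot h w = 1" by (rule line_form[OF w y])
      have yb: "y \<notin> fs.span {b}" using y fs.span_mono[of "{b}" "{b, w}"] by blast
      obtain k k0 where k: "dot k b = 0" "dot k y = 1" "dot k0 b = 1" "dot k0 y = 0"
        by (rule coordinate_forms[OF ab(2) yb])
      have no: "(lin2 h :: ('n1, 'n2, 'k) bipoly) \<notin> set_ideal Z2"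
      proof
        assume h1: "(lin2 h :: ('n1, 'n2, 'k) bipoly) \<in> set_ideal Z2"
        have "(lin2 h :: ('n1, 'n2, 'k) bipoly) \<in> set_ideal G"
          using h1 lin2_Z1[OF o1 h(1)] unfolding mem_set_ideal Un by blast
        then have "(lin2 h :: ('n1, 'n2, 'k) bipoly) \<in> W" using WG by blast
        then show False using W(2)[OF lin2_biform[of h]] h by simp
      qed
      show False
      proof (rule no_double_growth2[OF Z2(2)])
        fix s t
        obtain E where E: "E \<in> biforms s t" "bval E a b = 1" using ab by (rule ex_biform_nonzero)
        obtain E' where E': "E' \<in> biforms s t" "bval E' a y = 1" using ab(1) xy(3) by (rule ex_biform_nonzero)
        have "hilbert_function (set_ideal Z2) s t + 2 \<le> hilbert_function (set_ideal Z2) (s + 0) (t + Suc 0)"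
        proof (rule growth_two_points[OF Z2(1) lin2_biform no o2])
          show "(proj_pt a, proj_pt y) \<in> Z2" using z za by simp
          show "lin2 k0 * E \<in> biforms (s + 0) (t + Suc 0)" by (rule biforms_mult'[OF lin2_biform E(1)]) simp_all
          show "lin2 k * E' \<in> biforms (s + 0) (t + Suc 0)" by (rule biforms_mult'[OF lin2_biform E'(1)]) simp_all
        qed (use h k E(2) E'(2) in \<open>simp_all add: ev_simps\<close>)
        then show "hilbert_function (set_ideal Z2) s t + 2 \<le> hilbert_function (set_ideal Z2) s (Suc t)" by simp
      qed
    qed
    then show "z \<in> beta_curve a b w" unfolding za by (rule mem_beta_curve[OF ab(2) xy(3)])
  qed
  then have e2: "Z2 = beta_curve a b w"
    using rational_curve_subset[where xp = "\<lambda>i. [:a i:]" and yp = "\<lambda>j. [:w j, b j:]" and m = 0 and n = 1,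
        OF _ _ cl(2) Z2(3)] curves_biproj(3)[OF ab w]
    by (simp add: beta_curve_rational)
  show ?thesis unfolding Un e1 e2 ..
qed

theorem classification:
  "(\<exists>c. G = graph_curve a u b (line_point b w c)) \<or> G = alpha_curve a u b \<union> beta_curve a b w"
proof -
  obtain Z1 x1 y1 where Z1: "zirreducible Z1" "Z1 \<subseteq> G" "infinite Z1" "x1 \<in> Z1" "y1 \<in> Z1" "fst x1 \<noteq> fst y1"
    by (rule nonconstant1_component) (rule that)
  obtain Z2 x2 y2 where Z2: "zirreducible Z2" "Z2 \<subseteq> G" "infinite Z2" "x2 \<in> Z2" "y2 \<in> Z2" "snd x2 \<noteq> snd y2"
    by (rule nonconstant2_component) (rule that)
  \<comment> \<open>Each point lies on a component on which one of the projections varies, and this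
    component is contained in the one already found for that projection.\<close>
  have Un: "G = Z1 \<union> Z2"
  proof (rule antisym[OF subsetI])
    fix z assume "z \<in> G"
    then obtain Z where Z: "zirreducible Z" "Z \<subseteq> G" "z \<in> Z" "infinite Z"
      "(\<exists>x\<in>Z. \<exists>y\<in>Z. fst x \<noteq> fst y) \<or> (\<exists>x\<in>Z. \<exists>y\<in>Z. snd x \<noteq> snd y)"
      by (rule component_cases) (rule that)
    then show "z \<in> Z1 \<union> Z2"
      using component_unique1[OF Z(1,2) _ _ _ Z1(1,2,4-6)] component_unique2[OF Z(1,2) _ _ _ Z2(1,2,4-6)] by blast
  qed (use Z1(2) Z2(2) in blast)
  show ?thesis
  proof (cases "\<exists>x\<in>Z1. \<exists>y\<in>Z1. snd x \<noteq> snd y")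
    case True
    then obtain x y where xy: "x \<in> Z1" "y \<in> Z1" "snd x \<noteq> snd y" by blast
    have "Z2 \<subseteq> Z1" by (rule component_unique2[OF Z2(1,2,4-6) Z1(1,2) xy])
    then have "G = Z1" using Un by blast
    then show ?thesis using mixed_case[of x1 y1 x y] Z1 xy by blast
  next
    case False
    show ?thesis
    proof (cases "\<exists>x\<in>Z2. \<exists>y\<in>Z2. fst x \<noteq> fst y")
      case True
      then obtain x y where xy: "x \<in> Z2" "y \<in> Z2" "fst x \<noteq> fst y" by blast
      have "Z1 \<subseteq> Z2" by (rule component_unique1[OF Z1(1,2,4-6) Z2(1,2) xy])
      then have "G = Z2" using Un by blast
      then show ?thesis using mixed_case[of x y x2 y2] Z2 xy by blast
    next
      case F2: False
      have "G = alpha_curve a u b \<union> beta_curve a b w"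
        by (rule reducible_case[OF Z1(1-3) _ Z2(1-3) _ Un]) (use False F2 in blast)+
      then show ?thesis ..
    qed
  qed
qed

end

section \<open>The dependence set\<close>

lemma mvalue_lift1: "bval (meval Const (\<lambda>i. Var (Inl i)) F) v1 v2 = mvalue F v1"
  for F :: "('n1::finite, 'k::field) mpoly" and v2 :: "'n2::finite \<Rightarrow> 'k"
  by (simp add: ev.meval_meval[OF cev.coeff_hom_axioms])

lemma mvalue_lift2: "bval (meval Const (\<lambda>j. Var (Inr j)) F) v1 v2 = mvalue F v2"
  for F :: "('n2::finite, 'k::field) mpoly" and v1 :: "'n1::finite \<Rightarrow> 'k"
  by (simp add: ev.meval_meval[OF cev.coeff_hom_axioms])

lemma lift1_linear: "meval Const (\<lambda>i. Var (Inl i)) (\<Sum>i\<in>UNIV. Const (f i) * Var i) = lin1 f"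
  by (simp add: lin1_def cev.meval_sum cev.meval_mult)

lemma lift2_linear: "meval Const (\<lambda>i. Var (Inr i)) (\<Sum>i\<in>UNIV. Const (f i) * Var i) = lin2 f"
  by (simp add: lin2_def cev.meval_sum cev.meval_mult)

text \<open>Vanishing ideals are radical, which fails for the image ideal of a projection that keeps
  the tangent direction.\<close>

lemma radical_vanishing_ideal: "P * P \<in> vanishing_ideal A \<Longrightarrow> P \<in> vanishing_ideal (A :: ('i \<Rightarrow> 'k::field) set)"
  by (auto simp: vanishing_ideal_def ev_simps)

context
  fixes W :: "('n1::finite, 'n2::finite, 'k::field_char_0) bipoly set" and a b u w
  assumes ab: "a \<noteq> 0" "b \<noteq> 0"
    and W: "closed_subscheme W" "\<And>F s t. F \<in> biforms s t \<Longrightarrow> F \<in> W \<longleftrightarrow> bval F a b = 0 \<and> bdiff F a b u w = 0"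
begin

lemma W_vanishes: "F \<in> W \<Longrightarrow> v1 \<in> proj_pt a \<Longrightarrow> v2 \<in> proj_pt b \<Longrightarrow> bval F v1 v2 = 0"
proof -
  assume F: "F \<in> W" and v: "v1 \<in> proj_pt a" "v2 \<in> proj_pt b"
  have "bval (bicomponent s t F) a b = 0" for s t
    using W(2)[OF bicomponent_biform] closed_subschemeD(2)[OF W(1) F] by blast
  moreover have "case_sum v1 v2 \<in> bicone {(proj_pt a, proj_pt b)}" unfolding bicone_def using v by blast
  ultimately show "bval F v1 v2 = 0" by (rule mvalue_bicone_point)
qed

lemma W_from_bicomponents: "(\<And>s t. bicomponent s t F \<in> W) \<Longrightarrow> F \<in> W"
proof -
  assume "\<And>s t. bicomponent s t F \<in> W"
  then have "(\<Sum>(s, t)\<in>bidegs F. bicomponent s t F) \<in> W"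
    by (intro is_ideal_sum[OF closed_subschemeD(1)[OF W(1)]]) auto
  then show "F \<in> W" by (simp flip: sum_bicomponents)
qed

text \<open>If \<open>u\<close> is not a multiple of \<open>a\<close>, a linear form vanishing at
  \<open>a\<close> but not at \<open>u\<close> has its square in the image ideal without being in
  it. Conversely, the lift of a polynomial vanishing at [a] vanishes on the whole fibre over [a], so
  its derivative along \<open>w\<close> is zero, and the one along a multiple of \<open>a\<close> is
  zero by Euler's identity.\<close>

lemma reduced_image1: "reduced_point (image_ideal1 W) \<longleftrightarrow> u \<in> fs.span {a}"
proof
  assume "reduced_point (image_ideal1 W)"
  then obtain x where x: "image_ideal1 W = vanishing_ideal x" by (auto simp: reduced_point_def)
  show "u \<in> fs.span {a}"
  proof (rule ccontr)
    assume "u \<notin> fs.span {a}"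
    then obtain f where f: "dot f a = 0" "dot f u = 1" using separating_form by blast
    let ?P = "\<Sum>i\<in>UNIV. Const (f i) * Var i"
    have "lin1 f * lin1 f \<in> W"
      using W(2)[OF biforms_mult[OF lin1_biform[of f] lin1_biform[of f]]] f by (simp add: ev_simps mdiff_simps)
    then have "?P * ?P \<in> image_ideal1 W"
      by (simp only: image_ideal1_def mem_Collect_eq cev.meval_mult lift1_linear)
    then have "?P \<in> image_ideal1 W" unfolding x by (rule radical_vanishing_ideal)
    then have "lin1 f \<in> W" by (simp only: image_ideal1_def mem_Collect_eq lift1_linear)
    then show False using W(2)[OF lin1_biform[of f]] f by simp
  qed
next
  assume "u \<in> fs.span {a}"
  then obtain c where u: "u = (\<lambda>i. c * a i)" by (auto simp: in_span_1)
  have "image_ideal1 W = vanishing_ideal (proj_pt a)"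
  proof (intro equalityI subsetI)
    fix F assume "F \<in> image_ideal1 W"
    then have "meval Const (\<lambda>i. Var (Inl i)) F \<in> W" by (simp add: image_ideal1_def)
    from W_vanishes[OF this _ self_mem_proj_pt] show "F \<in> vanishing_ideal (proj_pt a)"
      by (simp add: vanishing_ideal_def mvalue_lift1)
  next
    fix F assume F: "F \<in> vanishing_ideal (proj_pt a)"
    have F0: "mvalue F v = 0" if "v \<in> proj_pt a" for v using F that by (simp add: vanishing_ideal_def)
    let ?F = "meval Const (\<lambda>i. Var (Inl i)) F :: ('n1, 'n2, 'k) bipoly"
    \<comment> \<open>Vanishing on the fibre passes to the bihomogeneous components, to which the
      description of \<open>W\<close> applies.\<close>
    let ?A = "{proj_pt a} \<times> proj_space :: ('n1, 'n2, 'k) bipt set"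
    have A: "?A \<subseteq> biproj_space" using ab by (auto simp: biproj_space_def proj_space_iff)
    have "?F \<in> set_ideal ?A"
      unfolding mem_set_ideal vanishes_def using F0 by (auto simp: mvalue_lift1)
    then have comp: "bicomponent s t ?F \<in> set_ideal ?A" for s t by (rule set_ideal_bicomponent[OF A])
    have "bicomponent s t ?F \<in> W" for s t
    proof -
      let ?H = "bicomponent s t ?F"
      have 0: "bval ?H a y = 0" if "y \<noteq> 0" for y
        by (rule bicone_zero[OF comp _ self_mem_proj_pt self_mem_proj_pt]) (simp add: proj_space_iff that)
      have all0: "bval ?H a y = 0" for y
      \<comment> \<open>The zero vector is not a representative of a point of the fibre; it is
        handled as an element of the cone over [b].\<close>
      proof (cases "y = 0")
        case True
        have "y \<in> proj_pt b" unfolding mem_proj_pt by (rule exI[of _ 0]) (simp add: True zero_fun_def)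
        then show ?thesis using ab by (intro bicone_zero[OF comp _ self_mem_proj_pt]) (auto simp: proj_space_iff)
      qed (rule 0)
      have "bdiff ?H a b (\<lambda>_. 0) w = 0" by (rule mdiff_zero_along) (simp add: case_sum_line all0)
      moreover have "bdiff ?H a b u (\<lambda>_. 0) = 0"
        using bdiff_euler[OF bicomponent_biform[of s t ?F], of a b c 0] all0 by (simp add: u)
      ultimately have "bdiff ?H a b u w = 0"
        using bdiff_direction_add[of ?H a b u "\<lambda>_. 0" "\<lambda>_. 0" w] by simp
      then show ?thesis using W(2)[OF bicomponent_biform] all0 by blast
    qed
    then have "?F \<in> W" by (rule W_from_bicomponents)
    then show "F \<in> image_ideal1 W" by (simp add: image_ideal1_def)
  qed
  then show "reduced_point (image_ideal1 W)"
    unfolding reduced_point_def using ab proj_space_iff by blast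
qed

lemma reduced_image2: "reduced_point (image_ideal2 W) \<longleftrightarrow> w \<in> fs.span {b}"
proof
  assume "reduced_point (image_ideal2 W)"
  then obtain x where x: "image_ideal2 W = vanishing_ideal x" by (auto simp: reduced_point_def)
  show "w \<in> fs.span {b}"
  proof (rule ccontr)
    assume "w \<notin> fs.span {b}"
    then obtain f where f: "dot f b = 0" "dot f w = 1" using separating_form by blast
    let ?P = "\<Sum>i\<in>UNIV. Const (f i) * Var i"
    have "lin2 f * lin2 f \<in> W"
      using W(2)[OF biforms_mult[OF lin2_biform[of f] lin2_biform[of f]]] f by (simp add: ev_simps mdiff_simps)
    then have "?P * ?P \<in> image_ideal2 W"
      by (simp only: image_ideal2_def mem_Collect_eq cev.meval_mult lift2_linear)
    then have "?P \<in> image_ideal2 W" unfolding x by (rule radical_vanishing_ideal)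
    then have "lin2 f \<in> W" by (simp only: image_ideal2_def mem_Collect_eq lift2_linear)
    then show False using W(2)[OF lin2_biform[of f]] f by simp
  qed
next
  assume "w \<in> fs.span {b}"
  then obtain c where w: "w = (\<lambda>i. c * b i)" by (auto simp: in_span_1)
  have "image_ideal2 W = vanishing_ideal (proj_pt b)"
  proof (intro equalityI subsetI)
    fix F assume "F \<in> image_ideal2 W"
    then have "meval Const (\<lambda>i. Var (Inr i)) F \<in> W" by (simp add: image_ideal2_def)
    from W_vanishes[OF this self_mem_proj_pt] show "F \<in> vanishing_ideal (proj_pt b)"
      by (simp add: vanishing_ideal_def mvalue_lift2)
  next
    fix F assume F: "F \<in> vanishing_ideal (proj_pt b)"
    have F0: "mvalue F v = 0" if "v \<in> proj_pt b" for v using F that by (simp add: vanishing_ideal_def)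
    let ?F = "meval Const (\<lambda>i. Var (Inr i)) F :: ('n1, 'n2, 'k) bipoly"
    let ?A = "proj_space \<times> {proj_pt b} :: ('n1, 'n2, 'k) bipt set"
    have A: "?A \<subseteq> biproj_space" using ab by (auto simp: biproj_space_def proj_space_iff)
    have "?F \<in> set_ideal ?A"
      unfolding mem_set_ideal vanishes_def using F0 by (auto simp: mvalue_lift2)
    then have comp: "bicomponent s t ?F \<in> set_ideal ?A" for s t by (rule set_ideal_bicomponent[OF A])
    have "bicomponent s t ?F \<in> W" for s t
    proof -
      let ?H = "bicomponent s t ?F"
      have 0: "bval ?H y b = 0" if "y \<noteq> 0" for y
        by (rule bicone_zero[OF comp _ self_mem_proj_pt self_mem_proj_pt]) (simp add: proj_space_iff that)
      have all0: "bval ?H y b = 0" for y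
      proof (cases "y = 0")
        case True
        have "y \<in> proj_pt a" unfolding mem_proj_pt by (rule exI[of _ 0]) (simp add: True zero_fun_def)
        then show ?thesis using ab by (intro bicone_zero[OF comp _ _ self_mem_proj_pt]) (auto simp: proj_space_iff)
      qed (rule 0)
      have "bdiff ?H a b u (\<lambda>_. 0) = 0" by (rule mdiff_zero_along) (simp add: case_sum_line all0)
      moreover have "bdiff ?H a b (\<lambda>_. 0) w = 0"
        using bdiff_euler[OF bicomponent_biform[of s t ?F], of a b 0 c] all0 by (simp add: w)
      ultimately have "bdiff ?H a b u w = 0"
        using bdiff_direction_add[of ?H a b u "\<lambda>_. 0" "\<lambda>_. 0" w] by simp
      then show ?thesis using W(2)[OF bicomponent_biform] all0 by blast
    qed
    then have "?F \<in> W" by (rule W_from_bicomponents)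
    then show "F \<in> image_ideal2 W" by (simp add: image_ideal2_def)
  qed
  then show "reduced_point (image_ideal2 W)"
    unfolding reduced_point_def using ab proj_space_iff by blast
qed

end

section \<open>Lines containing the tangent vector\<close>

lemma fs_plane:
  fixes a u :: "'i \<Rightarrow> 'k::field"
  assumes a: "a \<noteq> 0" and u: "u \<notin> fs.span {a}"
  shows "fs.dim (fs.span {a, u}) = 2"
    and "\<lbrakk>fs.subspace U; fs.dim U = 2; a \<in> U; u \<in> U\<rbrakk> \<Longrightarrow> U = fs.span {a, u}"
proof -
  have ind: "fs.independent {u, a}"
    by (rule fs.independent_insertI[OF u]) (simp add: a fs.dependent_single)
  have ua: "u \<noteq> a" using u fs.span_base[of a "{a}"] by auto
  show "fs.dim (fs.span {a, u}) = 2"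
    using fs.dim_span_eq_card_independent[OF ind] ua by (simp add: insert_commute)
  assume U: "fs.subspace U" "fs.dim U = 2" "a \<in> U" "u \<in> U"
  show "U = fs.span {a, u}"
  proof (intro equalityI subsetI)
    fix x assume x: "x \<in> U"
    show "x \<in> fs.span {a, u}"
    proof (rule ccontr)
      assume nx: "x \<notin> fs.span {a, u}"
      then have ind3: "fs.independent {x, u, a}"
        by (intro fs.independent_insertI ind) (simp add: insert_commute)
      have "x \<noteq> u" "x \<noteq> a" using nx fs.span_base[of _ "{a, u}"] by blast+
      then have card3: "card {x, u, a} = 3" using ua by simp
      obtain B where B: "B \<subseteq> U" "fs.independent B" "U \<subseteq> fs.span B" "card B = fs.dim U"
        by (metis fs.basis_exists)
      have "finite B" using B(4) U(2) by (metis card.infinite zero_neq_numeral)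
      then have "card {x, u, a} \<le> card B"
        using fs.independent_span_bound[OF _ ind3, of B] B(3) x U(3,4) by blast
      then show False using card3 B(4) U(2) by simp
    qed
  next
    fix x assume x: "x \<in> fs.span {a, u}"
    have "fs.span {a, u} \<subseteq> U" using U by (intro fs.span_minimal) auto
    then show "x \<in> U" using x by blast
  qed
qed

lemma proj_pt_subset_iff: "fs.subspace U \<Longrightarrow> proj_pt x \<subseteq> U \<longleftrightarrow> x \<in> U"
proof
  assume U: "fs.subspace U"
  show "proj_pt x \<subseteq> U \<Longrightarrow> x \<in> U" by blast
  show "x \<in> U \<Longrightarrow> proj_pt x \<subseteq> U" unfolding proj_pt_def using U by (intro fs.span_minimal) auto
qed

lemma line_eq:
  "{x \<in> proj_space. x \<subseteq> fs.span A} = {proj_pt x |x. x \<noteq> 0 \<and> x \<in> fs.span (A :: ('i \<Rightarrow> 'k::field) set)}"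
  using proj_pt_subset_iff[OF fs.subspace_span, of _ A] by (auto simp: proj_space_def)

lemma alpha_curve_eq:
  assumes "a \<noteq> 0" "u \<notin> fs.span {a}"
  shows "alpha_curve a u b = {x \<in> proj_space. x \<subseteq> fs.span {a, u}} \<times> {proj_pt b}"
proof (intro equalityI subsetI)
  fix z assume "z \<in> alpha_curve a u b"
  then obtain x where "z = (proj_pt x, proj_pt b)" "x \<noteq> 0" "x \<in> fs.span {a, u}"
    using assms by (rule alpha_curve_cases)
  then show "z \<in> {x \<in> proj_space. x \<subseteq> fs.span {a, u}} \<times> {proj_pt b}" unfolding line_eq by blast
next
  fix z assume "z \<in> {x \<in> proj_space. x \<subseteq> fs.span {a, u}} \<times> {proj_pt b}"
  then obtain x where "z = (proj_pt x, proj_pt b)" "x \<noteq> 0" "x \<in> fs.span {a, u}" unfolding line_eq by blast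
  then show "z \<in> alpha_curve a u b" using mem_alpha_curve[OF assms(1)] by blast
qed

lemma beta_curve_eq:
  assumes "b \<noteq> 0" "w \<notin> fs.span {b}"
  shows "beta_curve a b w = {proj_pt a} \<times> {x \<in> proj_space. x \<subseteq> fs.span {b, w}}"
proof (intro equalityI subsetI)
  fix z assume "z \<in> beta_curve a b w"
  then obtain x where "z = (proj_pt a, proj_pt x)" "x \<noteq> 0" "x \<in> fs.span {b, w}"
    using assms by (rule beta_curve_cases)
  then show "z \<in> {proj_pt a} \<times> {x \<in> proj_space. x \<subseteq> fs.span {b, w}}" unfolding line_eq by blast
next
  fix z assume "z \<in> {proj_pt a} \<times> {x \<in> proj_space. x \<subseteq> fs.span {b, w}}"
  then obtain x where "z = (proj_pt a, proj_pt x)" "x \<noteq> 0" "x \<in> fs.span {b, w}" unfolding line_eq by blast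
  then show "z \<in> beta_curve a b w" using mem_beta_curve[OF assms(1)] by blast
qed

lemma alpha_line_alpha_curve:
  assumes "a \<noteq> 0" "u \<notin> fs.span {a}" "b \<noteq> 0"
  shows "alpha_line (alpha_curve a u b)"
proof -
  have "proj_line {x \<in> proj_space. x \<subseteq> fs.span {a, u}}"
    unfolding proj_line_def
    by (rule exI[of _ "fs.span {a, u}"]) (simp add: fs_plane(1)[OF assms(1,2)] del: fs.dim_span)
  then show ?thesis
    unfolding alpha_line_def using alpha_curve_eq[OF assms(1,2)] assms(3)
    by (intro exI bexI[of _ "proj_pt b"] conjI) (simp_all add: proj_space_iff)
qed

lemma beta_line_beta_curve:
  assumes "a \<noteq> 0" "b \<noteq> 0" "w \<notin> fs.span {b}"
  shows "beta_line (beta_curve a b w)"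
proof -
  have "proj_line {x \<in> proj_space. x \<subseteq> fs.span {b, w}}"
    unfolding proj_line_def
    by (rule exI[of _ "fs.span {b, w}"]) (simp add: fs_plane(1)[OF assms(2,3)] del: fs.dim_span)
  then show ?thesis
    unfolding beta_line_def using beta_curve_eq[OF assms(2,3)] assms(1)
    by (intro bexI[of _ "proj_pt a"] exI conjI) (simp_all add: proj_space_iff)
qed

text \<open>Linear forms vanishing on the line lie in \<open>W\<close>, so they vanish at
  \<open>a\<close>, at \<open>u\<close> and, in the second factor, at \<open>b\<close>. By
  separation the plane of the line contains \<open>a\<close> and \<open>u\<close>.\<close>

lemma alpha_line_unique:
  fixes a u :: "'n1::finite \<Rightarrow> 'k::field_char_0" and b :: "'n2::finite \<Rightarrow> 'k"
  assumes ab: "a \<noteq> 0" "b \<noteq> 0" and u: "u \<notin> fs.span {a}"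
    and W: "\<And>F s t. F \<in> biforms s t \<Longrightarrow> F \<in> W \<Longrightarrow> bval F a b = 0 \<and> bdiff F a b u (\<lambda>_. 0) = 0"
    and G: "alpha_line G" "scheme_in W G"
  shows "G = alpha_curve a u b"
proof -
  have WG: "F \<in> W" if "F \<in> set_ideal G" for F using G(2) that by (auto simp: scheme_in_def)
  obtain R x2 where R: "proj_line R" "x2 \<in> proj_space" "G = R \<times> {x2}" using G(1) unfolding alpha_line_def by blast
  obtain U where U: "fs.subspace U" "fs.dim U = 2" "R = {x \<in> proj_space. x \<subseteq> U}" using R(1) unfolding proj_line_def by blast
  obtain c where c: "x2 = proj_pt c" "c \<noteq> 0" using R(2) unfolding proj_space_def by blast
  have G_elim: "\<exists>x. z = (proj_pt x, proj_pt c) \<and> x \<in> U" if "z \<in> G" for z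
    using that proj_pt_subset_iff[OF U(1)] unfolding R(3) U(3) c(1) proj_space_def by auto
  have l1: "lin1 h \<in> W" if h: "\<And>v. v \<in> U \<Longrightarrow> dot h v = 0" for h
  proof -
    have "vanishes (lin1 h :: ('n1, 'n2, 'k) bipoly) z" if "z \<in> G" for z
      using G_elim[OF that] h by auto
    then show ?thesis using WG unfolding mem_set_ideal by blast
  qed
  have aU: "a \<in> U"
  proof (rule ccontr)
    assume "a \<notin> U"
    then have "a \<notin> fs.span U" using U(1) by (simp add: fs.span_eq_iff[THEN iffD2])
    then obtain h where h: "\<And>v. v \<in> U \<Longrightarrow> dot h v = 0" "dot h a = 1" by (rule separating_form) (rule that)
    then show False using l1[OF h(1)] W[OF lin1_biform[of h]] by simp
  qed
  have uU: "u \<in> U"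
  proof (rule ccontr)
    assume "u \<notin> U"
    then have "u \<notin> fs.span U" using U(1) by (simp add: fs.span_eq_iff[THEN iffD2])
    then obtain h where h: "\<And>v. v \<in> U \<Longrightarrow> dot h v = 0" "dot h u = 1" by (rule separating_form) (rule that)
    then show False using l1[OF h(1)] W[OF lin1_biform[of h]] by simp
  qed
  have "b \<in> fs.span {c}"
  proof (rule ccontr)
    assume "b \<notin> fs.span {c}"
    then obtain g where g: "dot g c = 0" "dot g b = 1" using separating_form by blast
    have "vanishes (lin2 g :: ('n1, 'n2, 'k) bipoly) z" if "z \<in> G" for z
      using G_elim[OF that] g by auto
    then have "(lin2 g :: ('n1, 'n2, 'k) bipoly) \<in> W" using WG unfolding mem_set_ideal by blast
    then show False using W[OF lin2_biform[of g]] g by simp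
  qed
  then have "x2 = proj_pt b" using proj_pt_eq_iff(2)[OF c(2) ab(2)] c(1) by simp
  moreover have "U = fs.span {a, u}" by (rule fs_plane(2)[OF ab(1) u U(1,2) aU uU])
  ultimately show ?thesis unfolding R(3) U(3) alpha_curve_eq[OF ab(1) u] by simp
qed

lemma beta_line_unique:
  fixes a :: "'n1::finite \<Rightarrow> 'k::field_char_0" and b w :: "'n2::finite \<Rightarrow> 'k"
  assumes ab: "a \<noteq> 0" "b \<noteq> 0" and w: "w \<notin> fs.span {b}"
    and W: "\<And>F s t. F \<in> biforms s t \<Longrightarrow> F \<in> W \<Longrightarrow> bval F a b = 0 \<and> bdiff F a b (\<lambda>_. 0) w = 0"
    and G: "beta_line G" "scheme_in W G"
  shows "G = beta_curve a b w"
proof -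
  have WG: "F \<in> W" if "F \<in> set_ideal G" for F using G(2) that by (auto simp: scheme_in_def)
  obtain R x1 where R: "proj_line R" "x1 \<in> proj_space" "G = {x1} \<times> R" using G(1) unfolding beta_line_def by blast
  obtain U where U: "fs.subspace U" "fs.dim U = 2" "R = {x \<in> proj_space. x \<subseteq> U}" using R(1) unfolding proj_line_def by blast
  obtain c where c: "x1 = proj_pt c" "c \<noteq> 0" using R(2) unfolding proj_space_def by blast
  have G_elim: "\<exists>x. z = (proj_pt c, proj_pt x) \<and> x \<in> U" if "z \<in> G" for z
    using that proj_pt_subset_iff[OF U(1)] unfolding R(3) U(3) c(1) proj_space_def by auto
  have l2: "lin2 h \<in> W" if h: "\<And>v. v \<in> U \<Longrightarrow> dot h v = 0" for h
  proof -
    have "vanishes (lin2 h :: ('n1, 'n2, 'k) bipoly) z" if "z \<in> G" for z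
      using G_elim[OF that] h by auto
    then show ?thesis using WG unfolding mem_set_ideal by blast
  qed
  have bU: "b \<in> U"
  proof (rule ccontr)
    assume "b \<notin> U"
    then have "b \<notin> fs.span U" using U(1) by (simp add: fs.span_eq_iff[THEN iffD2])
    then obtain h where h: "\<And>v. v \<in> U \<Longrightarrow> dot h v = 0" "dot h b = 1" by (rule separating_form) (rule that)
    then show False using l2[OF h(1)] W[OF lin2_biform[of h]] by simp
  qed
  have wU: "w \<in> U"
  proof (rule ccontr)
    assume "w \<notin> U"
    then have "w \<notin> fs.span U" using U(1) by (simp add: fs.span_eq_iff[THEN iffD2])
    then obtain h where h: "\<And>v. v \<in> U \<Longrightarrow> dot h v = 0" "dot h w = 1" by (rule separating_form) (rule that)
    then show False using l2[OF h(1)] W[OF lin2_biform[of h]] by simp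
  qed
  have "a \<in> fs.span {c}"
  proof (rule ccontr)
    assume "a \<notin> fs.span {c}"
    then obtain g where g: "dot g c = 0" "dot g a = 1" using separating_form by blast
    have "vanishes (lin1 g :: ('n1, 'n2, 'k) bipoly) z" if "z \<in> G" for z
      using G_elim[OF that] g by auto
    then have "(lin1 g :: ('n1, 'n2, 'k) bipoly) \<in> W" using WG unfolding mem_set_ideal by blast
    then show False using W[OF lin1_biform[of g]] g by simp
  qed
  then have "x1 = proj_pt a" using proj_pt_eq_iff(2)[OF c(2) ab(1)] c(1) by simp
  moreover have "U = fs.span {b, w}" by (rule fs_plane(2)[OF ab(2) w U(1,2) bU wU])
  ultimately show ?thesis unfolding R(3) U(3) beta_curve_eq[OF ab(2) w] by simp
qed

section \<open>Rank with respect to a curve\<close>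

lemma lspan_mono: "A \<subseteq> B \<Longrightarrow> lspan A \<subseteq> lspan B"
  unfolding lspan_def by (intro fs.span_mono) blast

text \<open>The lower bound concerns sets of points, while the rank counts sequences of their
  images; after lifting a sequence along \<open>\<nu>\<close>, repetitions only make the set
  smaller.\<close>

lemma rank_wrt_eq:
  assumes G: "G \<subseteq> biproj_space" and S0: "S0 \<subseteq> G" "finite S0" "card S0 \<le> d" "p \<in> lspan (\<nu> d1 d2 ` S0)"
    and lower: "\<And>S. finite S \<Longrightarrow> S \<subseteq> biproj_space \<Longrightarrow> p \<in> lspan (\<nu> d1 d2 ` S) \<Longrightarrow> d \<le> card S"
  shows "rank_wrt (\<nu> d1 d2 ` G) p = d"
  unfolding rank_wrt_def
proof (rule Least_equality)
  have "card S0 = d" using lower[OF S0(2) _ S0(4)] S0(1,3) G by fastforce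
  then obtain h where h: "bij_betw h {..<d} S0"
    using ex_bij_betw_nat_finite[OF S0(2)] by (auto simp: lessThan_atLeast0)
  then have "h ` {..<d} = S0" by (simp add: bij_betw_def)
  then have "(\<lambda>i. \<nu> d1 d2 (h i)) ` {..<d} = \<nu> d1 d2 ` S0" by (metis image_image)
  then show "\<exists>q. (\<forall>i<d. q i \<in> \<nu> d1 d2 ` G) \<and> p \<in> lspan (q ` {..<d})"
    using S0(1,4) \<open>h ` {..<d} = S0\<close> by (intro exI[of _ "\<lambda>i. \<nu> d1 d2 (h i)"]) auto
next
  fix r :: nat assume "\<exists>q. (\<forall>i<r. q i \<in> \<nu> d1 d2 ` G) \<and> p \<in> lspan (q ` {..<r})"
  then obtain q where q: "\<forall>i<r. q i \<in> \<nu> d1 d2 ` G" "p \<in> lspan (q ` {..<r})" by blast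
  then have "\<forall>i<r. \<exists>z\<in>G. q i = \<nu> d1 d2 z" by blast
  then obtain z where z: "\<And>i. i < r \<Longrightarrow> z i \<in> G" "\<And>i. i < r \<Longrightarrow> q i = \<nu> d1 d2 (z i)" by metis
  have "q ` {..<r} = \<nu> d1 d2 ` (z ` {..<r})" using z(2) by (auto simp: image_image)
  then have "d \<le> card (z ` {..<r})" using q(2) z(1) G by (intro lower finite_imageI finite_lessThan) auto
  also have "\<dots> \<le> r" using card_image_le[of "{..<r}" z] by simp
  finally show "d \<le> r" .
qed

text \<open>The lower bound holds for all finite sets in the product and the decomposition lies on
  \<open>G\<close>, so both ranks equal \<open>d\<close>.\<close>

lemma computes_rankI:
  assumes G: "G \<subseteq> biproj_space" and S0: "S0 \<subseteq> G" "finite S0" "card S0 \<le> d" "p \<in> lspan (\<nu> d1 d2 ` S0)"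
    and lower: "\<And>S. finite S \<Longrightarrow> S \<subseteq> biproj_space \<Longrightarrow> p \<in> lspan (\<nu> d1 d2 ` S) \<Longrightarrow> d \<le> card S"
  shows "computes_rank d1 d2 p G" "tensor_rank d1 d2 p = d"
proof -
  have 1: "rank_wrt (\<nu> d1 d2 ` G) p = d" by (rule rank_wrt_eq[OF G S0 lower])
  have "S0 \<subseteq> biproj_space" using S0(1) G by blast
  then have "rank_wrt (\<nu> d1 d2 ` biproj_space) p = d" by (rule rank_wrt_eq[OF order_refl _ S0(2-4) lower])
  then show 2: "tensor_rank d1 d2 p = d" by (simp add: tensor_rank_def segre_veronese_def)
  have "p \<in> lspan (\<nu> d1 d2 ` G)" using S0(4) lspan_mono[OF image_mono[OF S0(1)]] by blast
  then show "computes_rank d1 d2 p G" using G 1 2 by (auto simp: computes_rank_def \<S>_def)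
qed

section \<open>Ranks and minimal decompositions of tangent tensors\<close>

lemma tangent_normal_form:
  fixes p :: "'n1::finite list \<times> 'n2::finite list \<Rightarrow> 'k::field_char_0"
    and W :: "('n1, 'n2, 'k) bipoly set"
  assumes p: "p \<noteq> 0" "proj_pt p \<notin> segre_veronese d1 d2" "p \<in> scheme_span d1 d2 W"
    and W2: "zero_dim_scheme W 2" and pt: "zero_locus W = {pt}"
  obtains a b u w e where "a \<noteq> 0" "b \<noteq> 0" "pt = (proj_pt a, proj_pt b)"
    "\<not> (u \<in> fs.span {a} \<and> w \<in> fs.span {b})"
    "\<And>F s t. F \<in> biforms s t \<Longrightarrow> F \<in> W \<longleftrightarrow> bval F a b = 0 \<and> bdiff F a b u w = 0"
    "\<And>x. p x = tangent_tensor d1 d2 a b u w x + e * power_tensor d1 d2 a b x"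
proof -
  obtain a b u w where ab: "a \<noteq> 0" "b \<noteq> 0" "pt = (proj_pt a, proj_pt b)"
    and uw: "\<not> (u \<in> fs.span {a} \<and> w \<in> fs.span {b})"
    and W: "\<And>F s t. F \<in> biforms s t \<Longrightarrow> F \<in> W \<longleftrightarrow> bval F a b = 0 \<and> bdiff F a b u w = 0"
    by (rule degree_two_scheme[OF W2 pt]) (rule that)
  obtain c0 c1 where c: "\<And>x. p x = c1 * tangent_tensor d1 d2 a b u w x + c0 * power_tensor d1 d2 a b x"
    by (rule scheme_span_tangent[OF ab(1,2) _ p(3)]) (rule W, assumption, rule that)
  \<comment> \<open>Otherwise \<open>p\<close> would be a multiple of the power tensor, hence a
    point of the Segre-Veronese variety. Afterwards the factor \<open>c1\<close> is absorbed into
    the direction.\<close>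
  have c1: "c1 \<noteq> 0"
  proof
    assume "c1 = 0"
    then have p0: "p = (\<lambda>x. c0 * power_tensor d1 d2 a b x)" using c by (simp add: fun_eq_iff)
    then have "c0 \<noteq> 0" using p(1) by (auto simp: fun_eq_iff)
    then have "proj_pt p = proj_pt (power_tensor d1 d2 a b)" unfolding p0 by (rule proj_pt_scale)
    also have "\<dots> = \<nu> d1 d2 (proj_pt a, proj_pt b)" by (simp add: \<nu>_proj_pt)
    also have "\<dots> \<in> segre_veronese d1 d2"
      unfolding segre_veronese_def using ab by (intro imageI) (simp add: biproj_space_def proj_space_iff)
    finally show False using p(2) by simp
  qed
  have span: "(\<lambda>i. c1 * v i) \<in> fs.span {x} \<longleftrightarrow> v \<in> fs.span {x}" for v x :: "'n1 \<Rightarrow> 'k"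
    using fs.span_scale[of v "{x}" c1] fs.span_scale[of "fscale c1 v" "{x}" "1 / c1"] c1
    by (auto simp: fscale_def)
  have span2: "(\<lambda>i. c1 * v i) \<in> fs.span {x} \<longleftrightarrow> v \<in> fs.span {x}" for v x :: "'n2 \<Rightarrow> 'k"
    using fs.span_scale[of v "{x}" c1] fs.span_scale[of "fscale c1 v" "{x}" "1 / c1"] c1
    by (auto simp: fscale_def)
  show ?thesis
  proof (rule that[OF ab, of "\<lambda>i. c1 * u i" "\<lambda>j. c1 * w j" c0])
    show "\<not> ((\<lambda>i. c1 * u i) \<in> fs.span {a} \<and> (\<lambda>j. c1 * w j) \<in> fs.span {b})"
      using uw by (simp add: span span2)
    show "F \<in> W \<longleftrightarrow> bval F a b = 0 \<and> bdiff F a b (\<lambda>i. c1 * u i) (\<lambda>j. c1 * w j) = 0"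
      if "F \<in> biforms s t" for F s t
      using W[OF that] c1 by (simp add: bdiff_direction_scale)
    show "p x = tangent_tensor d1 d2 a b (\<lambda>i. c1 * u i) (\<lambda>j. c1 * w j) x + c0 * power_tensor d1 d2 a b x" for x
      using tangent_tensor_shift[of d1 d2 a b c1 u 0 w 0 x] c[of x] by simp
  qed
qed

lemma line_case1:
  fixes p :: "'n1::finite list \<times> 'n2::finite list \<Rightarrow> 'k::field_char_0"
    and W :: "('n1, 'n2, 'k) bipoly set"
  assumes d: "d1 > 0" "d2 > 0" and ab: "a \<noteq> 0" "b \<noteq> 0" and u: "u \<notin> fs.span {a}" and w: "w \<in> fs.span {b}"
    and W: "closed_subscheme W" "\<And>F s t. F \<in> biforms s t \<Longrightarrow> F \<in> W \<longleftrightarrow> bval F a b = 0 \<and> bdiff F a b u w = 0"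
    and p: "\<And>x. p x = tangent_tensor d1 d2 a b u w x + e * power_tensor d1 d2 a b x"
  shows "\<exists>!G. alpha_line G \<and> scheme_in W G"
    and "alpha_line G \<Longrightarrow> scheme_in W G \<Longrightarrow>
      (\<forall>S\<in>\<S> d1 d2 p. (proj_pt a, proj_pt b) \<notin> S \<and> S \<subseteq> G) \<and> computes_rank d1 d2 p G"
proof -
  obtain r where r: "w = (\<lambda>j. r * b j)" using w unfolding in_span_1 by blast
  have W': "F \<in> W \<longleftrightarrow> bval F a b = 0 \<and> bdiff F a b u (\<lambda>_. 0) = 0" if "F \<in> biforms s t" for F s t
    using W(2)[OF that] bdiff_euler_shift[OF that, of a b 1 u 0 "\<lambda>_. 0" r] by (auto simp: r)
  have p': "p x = tangent_tensor d1 d2 a b u (\<lambda>_. 0) x + (e + r * of_nat d2) * power_tensor d1 d2 a b x" for x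
    using p[of x] tangent_tensor_shift[of d1 d2 a b 1 u 0 "\<lambda>_. 0" r x] by (simp add: r algebra_simps)
  let ?G = "alpha_curve a u b"
  have G: "alpha_line ?G" by (rule alpha_line_alpha_curve[OF ab(1) u ab(2)])
  have sub: "?G \<subseteq> biproj_space" by (rule curves_biproj(2)[OF ab u])
  have WG: "scheme_in W ?G"
    by (rule scheme_inI[OF closed_subschemeD(1)[OF W(1)] sub]) (simp add: W' alpha_curve_tangent[OF ab(1) u])
  have unique: "G = ?G" if "alpha_line G" "scheme_in W G" for G
    by (rule alpha_line_unique[OF ab u _ that]) (use W' in blast)
  show "\<exists>!G. alpha_line G \<and> scheme_in W G" using G WG unique by blast
  have spanned: "tangent_spanned d1 d2 a b u (\<lambda>_. 0) (e + r * of_nat d2) S"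
    if "finite S" "S \<subseteq> biproj_space" "p \<in> lspan (\<nu> d1 d2 ` S)" for S
    by (rule tangent_spannedI[OF p' that])
  have lower: "d1 \<le> card S" if "finite S" "S \<subseteq> biproj_space" "p \<in> lspan (\<nu> d1 d2 ` S)" for S
    using tangent_spanned_line1(1)[OF spanned[OF that] ab d u] by linarith
  obtain A where A: "finite A" "card A = d1" "p \<in> lspan (\<nu> d1 d2 ` ((\<lambda>z. (proj_pt (line_point a u z), proj_pt b)) ` A))"
    by (rule decomposition_line1[OF d(1) p']) (rule that)
  have S0: "(\<lambda>z. (proj_pt (line_point a u z), proj_pt b)) ` A \<subseteq> ?G"
    "finite ((\<lambda>z. (proj_pt (line_point a u z), proj_pt b)) ` A)"
    "card ((\<lambda>z. (proj_pt (line_point a u z), proj_pt b)) ` A) \<le> d1"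
    using A(1,2) card_image_le[OF A(1)] by (auto simp: alpha_curve_def)
  note rank = computes_rankI[OF sub S0 A(3) lower]
  assume "alpha_line G" "scheme_in W G"
  then have GG: "G = ?G" by (rule unique)
  have "(proj_pt a, proj_pt b) \<notin> S \<and> S \<subseteq> ?G" if S: "S \<in> \<S> d1 d2 p" for S
  proof -
    have S': "finite S" "S \<subseteq> biproj_space" "p \<in> lspan (\<nu> d1 d2 ` S)" "card S \<le> d1"
      using S rank(2) by (auto simp: \<S>_def)
    note z = tangent_spanned_line1(2)[OF spanned[OF S'(1-3)] ab d u S'(4)]
    have "z \<in> ?G" if zS: "z \<in> S" for z
    proof -
      obtain s where "fst z = proj_pt (line_point a u s)" "snd z = proj_pt b" using z[OF zS] by blast
      then have "z = (proj_pt (line_point a u s), proj_pt b)" by (simp add: prod_eq_iff)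
      then show ?thesis unfolding alpha_curve_def by blast
    qed
    then show ?thesis using z[of "(proj_pt a, proj_pt b)"] by auto
  qed
  then show "(\<forall>S\<in>\<S> d1 d2 p. (proj_pt a, proj_pt b) \<notin> S \<and> S \<subseteq> G) \<and> computes_rank d1 d2 p G"
    unfolding GG using rank(1) by blast
qed

lemma line_case2:
  fixes p :: "'n1::finite list \<times> 'n2::finite list \<Rightarrow> 'k::field_char_0"
    and W :: "('n1, 'n2, 'k) bipoly set"
  assumes d: "d1 > 0" "d2 > 0" and ab: "a \<noteq> 0" "b \<noteq> 0" and u: "u \<in> fs.span {a}" and w: "w \<notin> fs.span {b}"
    and W: "closed_subscheme W" "\<And>F s t. F \<in> biforms s t \<Longrightarrow> F \<in> W \<longleftrightarrow> bval F a b = 0 \<and> bdiff F a b u w = 0"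
    and p: "\<And>x. p x = tangent_tensor d1 d2 a b u w x + e * power_tensor d1 d2 a b x"
  shows "\<exists>!G. beta_line G \<and> scheme_in W G"
    and "beta_line G \<Longrightarrow> scheme_in W G \<Longrightarrow>
      (\<forall>S\<in>\<S> d1 d2 p. (proj_pt a, proj_pt b) \<notin> S \<and> S \<subseteq> G) \<and> computes_rank d1 d2 p G"
proof -
  obtain r where r: "u = (\<lambda>j. r * a j)" using u unfolding in_span_1 by blast
  have W': "F \<in> W \<longleftrightarrow> bval F a b = 0 \<and> bdiff F a b (\<lambda>_. 0) w = 0" if "F \<in> biforms s t" for F s t
    using W(2)[OF that] bdiff_euler_shift[OF that, of a b 1 "\<lambda>_. 0" r w 0] by (auto simp: r)
  have p': "p x = tangent_tensor d1 d2 a b (\<lambda>_. 0) w x + (e + r * of_nat d1) * power_tensor d1 d2 a b x" for x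
    using p[of x] tangent_tensor_shift[of d1 d2 a b 1 "\<lambda>_. 0" r w 0 x] by (simp add: r algebra_simps)
  let ?G = "beta_curve a b w"
  have G: "beta_line ?G" by (rule beta_line_beta_curve[OF ab w])
  have sub: "?G \<subseteq> biproj_space" by (rule curves_biproj(3)[OF ab w])
  have WG: "scheme_in W ?G"
    by (rule scheme_inI[OF closed_subschemeD(1)[OF W(1)] sub]) (simp add: W' beta_curve_tangent[OF ab(2) w])
  have unique: "G = ?G" if "beta_line G" "scheme_in W G" for G
    by (rule beta_line_unique[OF ab w _ that]) (use W' in blast)
  show "\<exists>!G. beta_line G \<and> scheme_in W G" using G WG unique by blast
  have spanned: "tangent_spanned d1 d2 a b (\<lambda>_. 0) w (e + r * of_nat d1) S"
    if "finite S" "S \<subseteq> biproj_space" "p \<in> lspan (\<nu> d1 d2 ` S)" for S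
    by (rule tangent_spannedI[OF p' that])
  have lower: "d2 \<le> card S" if "finite S" "S \<subseteq> biproj_space" "p \<in> lspan (\<nu> d1 d2 ` S)" for S
    using tangent_spanned_line2(1)[OF spanned[OF that] ab d w] by linarith
  obtain A where A: "finite A" "card A = d2" "p \<in> lspan (\<nu> d1 d2 ` ((\<lambda>z. (proj_pt a, proj_pt (line_point b w z))) ` A))"
    by (rule decomposition_line2[OF d(2) p']) (rule that)
  have S0: "(\<lambda>z. (proj_pt a, proj_pt (line_point b w z))) ` A \<subseteq> ?G"
    "finite ((\<lambda>z. (proj_pt a, proj_pt (line_point b w z))) ` A)"
    "card ((\<lambda>z. (proj_pt a, proj_pt (line_point b w z))) ` A) \<le> d2"
    using A(1,2) card_image_le[OF A(1)] by (auto simp: beta_curve_def)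
  note rank = computes_rankI[OF sub S0 A(3) lower]
  assume "beta_line G" "scheme_in W G"
  then have GG: "G = ?G" by (rule unique)
  have "(proj_pt a, proj_pt b) \<notin> S \<and> S \<subseteq> ?G" if S: "S \<in> \<S> d1 d2 p" for S
  proof -
    have S': "finite S" "S \<subseteq> biproj_space" "p \<in> lspan (\<nu> d1 d2 ` S)" "card S \<le> d2"
      using S rank(2) by (auto simp: \<S>_def)
    note z = tangent_spanned_line2(2)[OF spanned[OF S'(1-3)] ab d w S'(4)]
    have "z \<in> ?G" if zS: "z \<in> S" for z
    proof -
      obtain s where "snd z = proj_pt (line_point b w s)" "fst z = proj_pt a" using z[OF zS] by blast
      then have "z = (proj_pt a, proj_pt (line_point b w s))" by (simp add: prod_eq_iff)
      then show ?thesis unfolding beta_curve_def by blast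
    qed
    then show ?thesis using z[of "(proj_pt a, proj_pt b)"] by auto
  qed
  then show "(\<forall>S\<in>\<S> d1 d2 p. (proj_pt a, proj_pt b) \<notin> S \<and> S \<subseteq> G) \<and> computes_rank d1 d2 p G"
    unfolding GG using rank(1) by blast
qed

text \<open>The direction may be moved along \<open>b\<close> without changing \<open>W\<close>, so
  every \<open>graph_curve a u b (line_point b w c)\<close> contains it. With the pair of lines
  these are all candidates, and on each of them a decomposition attains the lower bound
  \<open>d1 + d2\<close>.\<close>

lemma conic_case:
  fixes p :: "'n1::finite list \<times> 'n2::finite list \<Rightarrow> 'k::field_char_0"
    and W :: "('n1, 'n2, 'k) bipoly set"
  assumes d: "d1 > 0" "d2 > 0" and ab: "a \<noteq> 0" "b \<noteq> 0" and u: "u \<notin> fs.span {a}" and w: "w \<notin> fs.span {b}"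
    and W: "closed_subscheme W" "\<And>F s t. F \<in> biforms s t \<Longrightarrow> F \<in> W \<longleftrightarrow> bval F a b = 0 \<and> bdiff F a b u w = 0"
    and p: "\<And>x. p x = tangent_tensor d1 d2 a b u w x + e * power_tensor d1 d2 a b x"
  shows "S \<in> \<S> d1 d2 p \<Longrightarrow> (proj_pt a, proj_pt b) \<notin> S \<and>
      (\<exists>G. curve_bidegree G 1 1 \<and> scheme_in W G \<and> S \<subseteq> G) \<and>
      (\<forall>G. curve_bidegree G 1 1 \<and> scheme_in W G \<and> S \<subseteq> G \<and> \<not> smooth_curve G \<longrightarrow>
        (\<exists>L R. beta_line L \<and> alpha_line R \<and> G = L \<union> R \<and> L \<inter> R = {(proj_pt a, proj_pt b)} \<and>
          card (S \<inter> L) = d2 \<and> card (S \<inter> R) = d1))"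
    and "curve_bidegree G 1 1 \<Longrightarrow> scheme_in W G \<Longrightarrow> computes_rank d1 d2 p G"
proof -
  let ?o = "(proj_pt a, proj_pt b)"
  let ?A = "alpha_curve a u b" and ?B = "beta_curve a b w"
  have W_ideal: "is_ideal W" by (rule closed_subschemeD(1)[OF W(1)])
  have w': "line_point b w c \<notin> fs.span {b}" for c by (rule line_point_notin_span[OF w])
  have shift: "bdiff F a b u (line_point b w c) = bdiff F a b u w + c * of_nat t * bval F a b"
    if "F \<in> biforms s t" for F s t c
    using bdiff_euler_shift[OF that, of a b 1 u 0 w c] by (simp add: line_point_def)
  have classification: "(\<exists>c. G = graph_curve a u b (line_point b w c)) \<or> G = ?A \<union> ?B"
    if "curve_bidegree G 1 1" "scheme_in W G" for G
  proof -
    have "tangent_curve G W a b u w"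
    proof
      show "F \<in> W \<longleftrightarrow> bval F a b = 0 \<and> bdiff F a b u w = 0" if "F \<in> biforms s t" for F s t
        using that by (rule W(2))
      show "set_ideal G \<subseteq> W" using that(2) by (simp only: scheme_in_def)
    qed (rule ab u w W_ideal that(1))+
    then show ?thesis by (rule tangent_curve.classification)
  qed
  have cross: "curve_bidegree (?A \<union> ?B) 1 1" by (rule cross_bidegree[OF ab(1) u ab(2) w])
  have subA: "?A \<subseteq> biproj_space" by (rule curves_biproj(2)[OF ab u])
  have subB: "?B \<subseteq> biproj_space" by (rule curves_biproj(3)[OF ab w])
  have W_cross: "scheme_in W (?A \<union> ?B)"
  proof (rule scheme_inI[OF W_ideal])
    show "?A \<union> ?B \<subseteq> biproj_space" using subA subB by blast
    fix s t and F :: "('n1, 'n2, 'k) bipoly" assume F: "F \<in> biforms s t" "F \<in> set_ideal (?A \<union> ?B)"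
    have FA: "F \<in> set_ideal ?A" and FB: "F \<in> set_ideal ?B" using F(2) unfolding mem_set_ideal by blast+
    have "bdiff F a b u w = bdiff F a b u (\<lambda>_. 0) + bdiff F a b (\<lambda>_. 0) w"
      using bdiff_direction_add[of F a b u "\<lambda>_. 0" "\<lambda>_. 0" w] by simp
    then show "F \<in> W"
      using W(2)[OF F(1)] alpha_curve_tangent[OF ab(1) u FA] beta_curve_tangent[OF ab(2) w FB] by simp
  qed
  have W_graph: "scheme_in W (graph_curve a u b (line_point b w c))" for c
  proof (rule scheme_inI[OF W_ideal curves_biproj(1)[OF ab u w']])
    fix s t and F :: "('n1, 'n2, 'k) bipoly"
    assume F: "F \<in> biforms s t" "F \<in> set_ideal (graph_curve a u b (line_point b w c))"
    show "F \<in> W" using W(2)[OF F(1)] graph_curve_tangent[OF F(2)] shift[OF F(1), of c] by simp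
  qed
  have spanned: "tangent_spanned d1 d2 a b u w e S"
    if "finite S" "S \<subseteq> biproj_space" "p \<in> lspan (\<nu> d1 d2 ` S)" for S
    by (rule tangent_spannedI[OF p that])
  have lower: "d1 + d2 \<le> card S" if "finite S" "S \<subseteq> biproj_space" "p \<in> lspan (\<nu> d1 d2 ` S)" for S
    using tangent_spanned_curve(1)[OF spanned[OF that] ab d u w] by linarith
  have rank_cross: "computes_rank d1 d2 p (?A \<union> ?B)" "tensor_rank d1 d2 p = d1 + d2"
  proof -
    \<comment> \<open>Since the derivative is linear in the direction, \<open>p\<close> splits into
      one tangent tensor for each line; the power tensor term is put on the first. The two
      decompositions have \<open>d1\<close> and \<open>d2\<close> points.\<close>
    define p1 where "p1 = (\<lambda>x. tangent_tensor d1 d2 a b u (\<lambda>_. 0) x + e * power_tensor d1 d2 a b x)"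
    define p2 where "p2 = (\<lambda>x. tangent_tensor d1 d2 a b (\<lambda>_. 0) w x + 0 * power_tensor d1 d2 a b x)"
    have p12: "p = p1 + p2"
      using p tangent_tensor_add[of d1 d2 a b u "\<lambda>_. 0" "\<lambda>_. 0" w]
      by (auto simp: fun_eq_iff p1_def p2_def)
    obtain A1 where A1: "finite A1" "card A1 = d1" "p1 \<in> lspan (\<nu> d1 d2 ` ((\<lambda>z. (proj_pt (line_point a u z), proj_pt b)) ` A1))"
      by (rule decomposition_line1[OF d(1), of p1 d2 a b u e]) (simp add: p1_def, rule that)
    obtain A2 where A2: "finite A2" "card A2 = d2" "p2 \<in> lspan (\<nu> d1 d2 ` ((\<lambda>z. (proj_pt a, proj_pt (line_point b w z))) ` A2))"
      by (rule decomposition_line2[OF d(2), of p2 d1 a b w 0]) (simp add: p2_def, rule that)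
    let ?S1 = "(\<lambda>z. (proj_pt (line_point a u z), proj_pt b)) ` A1"
    let ?S2 = "(\<lambda>z. (proj_pt a, proj_pt (line_point b w z))) ` A2"
    have "p1 \<in> lspan (\<nu> d1 d2 ` (?S1 \<union> ?S2))" "p2 \<in> lspan (\<nu> d1 d2 ` (?S1 \<union> ?S2))"
      using A1(3) A2(3) lspan_mono[OF image_mono[of ?S1 "?S1 \<union> ?S2" "\<nu> d1 d2"]]
        lspan_mono[OF image_mono[of ?S2 "?S1 \<union> ?S2" "\<nu> d1 d2"]] by blast+
    then have "p \<in> lspan (\<nu> d1 d2 ` (?S1 \<union> ?S2))" unfolding p12 lspan_def by (rule fs.span_add)
    moreover have "?S1 \<union> ?S2 \<subseteq> ?A \<union> ?B" by (auto simp: alpha_curve_def beta_curve_def)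
    moreover have "card (?S1 \<union> ?S2) \<le> d1 + d2"
      using card_Un_le[of ?S1 ?S2] card_image_le[OF A1(1)] card_image_le[OF A2(1)] A1(2) A2(2)
      by (meson add_mono order_trans)
    moreover have "?A \<union> ?B \<subseteq> biproj_space" using subA subB by blast
    ultimately show "computes_rank d1 d2 p (?A \<union> ?B)" "tensor_rank d1 d2 p = d1 + d2"
      using computes_rankI[of "?A \<union> ?B" "?S1 \<union> ?S2" "d1 + d2" p d1 d2] lower A1(1) A2(1) by blast+
  qed
  have rank_graph: "computes_rank d1 d2 p (graph_curve a u b (line_point b w c))" for c
  proof -
    \<comment> \<open>Moving the direction by \<open>c b\<close> is compensated in the scalar, so
      each graph has its own prescribed sum of nodes.\<close>
    have p': "p x = tangent_tensor d1 d2 a b u (line_point b w c) x + (e - c * of_nat d2) * power_tensor d1 d2 a b x" for x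
      using p[of x] tangent_tensor_shift[of d1 d2 a b 1 u 0 w c x] by (simp add: line_point_def algebra_simps)
    obtain A where A: "finite A" "card A = d1 + d2" "p \<in> lspan (\<nu> d1 d2 ` ((\<lambda>z. (proj_pt (line_point a u z),
        proj_pt (line_point b (line_point b w c) z))) ` A))"
      by (rule decomposition_graph[OF d(1) p']) (rule that)
    let ?S = "(\<lambda>z. (proj_pt (line_point a u z), proj_pt (line_point b (line_point b w c) z))) ` A"
    have S: "?S \<subseteq> graph_curve a u b (line_point b w c)" "finite ?S" "card ?S \<le> d1 + d2"
      using A(1,2) card_image_le[OF A(1)] by (auto simp: graph_curve_def)
    show ?thesis by (rule computes_rankI(1)[OF curves_biproj(1)[OF ab u w'] S A(3) lower])
  qed
  show "computes_rank d1 d2 p G" if "curve_bidegree G 1 1" "scheme_in W G"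
    using classification[OF that] rank_graph rank_cross(1) by blast
  assume "S \<in> \<S> d1 d2 p"
  then have S: "finite S" "S \<subseteq> biproj_space" "p \<in> lspan (\<nu> d1 d2 ` S)" and card: "card S \<le> d1 + d2"
    using rank_cross(2) by (auto simp: \<S>_def)
  note struct = tangent_spanned_curve[OF spanned[OF S] ab d u w card]
  have o: "?o \<notin> S" by (rule struct(2))
  have ne: "S \<noteq> {}" using struct(1) d by auto
  have ex: "\<exists>G. curve_bidegree G 1 1 \<and> scheme_in W G \<and> S \<subseteq> G"
    using struct(3)
  proof (elim disjE conjE)
    assume "\<exists>c. \<forall>z\<in>S. \<exists>s. z = (proj_pt (line_point a u s), proj_pt (line_point b w (s + c)))"
    then obtain c where c: "\<And>z. z \<in> S \<Longrightarrow> \<exists>s. z = (proj_pt (line_point a u s), proj_pt (line_point b w (s + c)))" by blast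
    \<comment> \<open>The constant difference of the parameters is the shift of the direction from
      \<open>w\<close> to \<open>w + c b\<close>.\<close>
    have "line_point b w (s + c) = line_point b (line_point b w c) s" for s
      by (simp add: line_point_def algebra_simps)
    then have "S \<subseteq> graph_curve a u b (line_point b w c)" using c unfolding graph_curve_def by fastforce
    then show ?thesis using W_graph graph_curve_bidegree[OF ab(1) u ab(2) w'] by blast
  next
    assume c: "\<forall>z\<in>S. snd z = proj_pt b \<and> (\<exists>s. fst z = proj_pt (line_point a u s)) \<or>
          fst z = proj_pt a \<and> (\<exists>s. snd z = proj_pt (line_point b w s))"
    have "S \<subseteq> ?A \<union> ?B"
    proof
      fix z assume "z \<in> S"
      then have "(\<exists>s. z = (proj_pt (line_point a u s), proj_pt b)) \<or> (\<exists>s. z = (proj_pt a, proj_pt (line_point b w s)))"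
        using c by (metis prod.collapse)
      then show "z \<in> ?A \<union> ?B" unfolding alpha_curve_def beta_curve_def by blast
    qed
    then show ?thesis using cross W_cross by blast
  qed
  have sing: "\<exists>L R. beta_line L \<and> alpha_line R \<and> G = L \<union> R \<and> L \<inter> R = {?o} \<and> card (S \<inter> L) = d2 \<and> card (S \<inter> R) = d1"
    if G: "curve_bidegree G 1 1" "scheme_in W G" "S \<subseteq> G" "\<not> smooth_curve G" for G
  proof -
    \<comment> \<open>Graphs are smooth, so only the pair of lines remains.\<close>
    have GAB: "G = ?B \<union> ?A"
      using classification[OF G(1,2)] G(4) graph_curve_smooth[OF ab(1) u ab(2) w'] by blast
    have fstB: "fst z = proj_pt a" if "z \<in> ?B" for z using that by (auto simp: beta_curve_def)
    have sndA: "snd z = proj_pt b" if "z \<in> ?A" for z using that by (auto simp: alpha_curve_def)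
    have oAB: "?o \<in> ?A" "?o \<in> ?B" by (simp_all add: alpha_curve_def beta_curve_def)
    have "z = ?o" if "z \<in> ?B" "z \<in> ?A" for z using fstB[OF that(1)] sndA[OF that(2)] by (simp add: prod_eq_iff)
    then have BA: "?B \<inter> ?A = {?o}" using oAB by blast
    \<comment> \<open>Every point of the pair of lines lies over [a] or over [b], and
      \<open>S\<close> is nonempty. This rules out the first alternative for \<open>S\<close> and
      leaves the one with the two cardinalities.\<close>
    have "\<not> (\<forall>z\<in>S. fst z \<noteq> proj_pt a \<and> snd z \<noteq> proj_pt b)"
    proof -
      obtain z where "z \<in> S" using ne by blast
      then show ?thesis using G(3) GAB fstB[of z] sndA[of z] by blast
    qed
    then have cards: "card {z \<in> S. snd z = proj_pt b} = d1" "card {z \<in> S. fst z = proj_pt a} = d2"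
      using struct(3) by blast+
    have no_o: "\<not> (fst z = proj_pt a \<and> snd z = proj_pt b)" if "z \<in> S" for z
      using o that by (metis prod.collapse)
    have "S \<inter> ?B = {z \<in> S. fst z = proj_pt a}" "S \<inter> ?A = {z \<in> S. snd z = proj_pt b}"
      using G(3) GAB fstB sndA no_o by blast+
    then show ?thesis
      using cards BA GAB alpha_line_alpha_curve[OF ab(1) u ab(2)] beta_line_beta_curve[OF ab w]
      by (intro exI[of _ ?B] exI[of _ ?A]) simp
  qed
  show "?o \<notin> S \<and> (\<exists>G. curve_bidegree G 1 1 \<and> scheme_in W G \<and> S \<subseteq> G) \<and>
      (\<forall>G. curve_bidegree G 1 1 \<and> scheme_in W G \<and> S \<subseteq> G \<and> \<not> smooth_curve G \<longrightarrow>
        (\<exists>L R. beta_line L \<and> alpha_line R \<and> G = L \<union> R \<and> L \<inter> R = {?o} \<and> card (S \<inter> L) = d2 \<and> card (S \<inter> R) = d1))"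
    using o ex sing by blast
qed

theorem theorem3p4:
  fixes d1 d2 :: nat
    and p :: "'n1::finite list \<times> 'n2::finite list \<Rightarrow> 'k::{alg_closed_field, field_char_0}"
    and W :: "('n1, 'n2, 'k) bipoly set"
    and pt :: "('n1, 'n2, 'k) bipt"
  assumes "d1 > 0" and "d2 > 0"
    and "p \<in> sym_tensors d1 d2" and "p \<noteq> 0"
    and "proj_pt p \<in> tangential_variety (segre_veronese d1 d2) - segre_veronese d1 d2"
    and "zero_dim_scheme W 2" and "zero_locus W = {pt}"
    and "p \<in> scheme_span d1 d2 W"
  shows
    "(dependence_set W = {1, 2} \<longrightarrow>
       (\<forall>S \<in> \<S> d1 d2 p. pt \<notin> S \<and>
          (\<exists>G. curve_bidegree G 1 1 \<and> scheme_in W G \<and> S \<subseteq> G) \<and>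
          (\<forall>G. curve_bidegree G 1 1 \<and> scheme_in W G \<and> S \<subseteq> G \<and> \<not> smooth_curve G \<longrightarrow>
             (\<exists>L R. beta_line L \<and> alpha_line R \<and> G = L \<union> R \<and> L \<inter> R = {pt} \<and>
                card (S \<inter> L) = d2 \<and> card (S \<inter> R) = d1))) \<and>
       (\<forall>G. curve_bidegree G 1 1 \<and> scheme_in W G \<longrightarrow> computes_rank d1 d2 p G)) \<and>
     (dependence_set W = {1} \<longrightarrow>
       (\<exists>!G. alpha_line G \<and> scheme_in W G) \<and>
       (\<forall>G. alpha_line G \<and> scheme_in W G \<longrightarrow>
          (\<forall>S \<in> \<S> d1 d2 p. pt \<notin> S \<and> S \<subseteq> G) \<and> computes_rank d1 d2 p G)) \<and>
     (dependence_set W = {2} \<longrightarrow>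
       (\<exists>!G. beta_line G \<and> scheme_in W G) \<and>
       (\<forall>G. beta_line G \<and> scheme_in W G \<longrightarrow>
          (\<forall>S \<in> \<S> d1 d2 p. pt \<notin> S \<and> S \<subseteq> G) \<and> computes_rank d1 d2 p G))"
proof -
  have nX: "proj_pt p \<notin> segre_veronese d1 d2" using assms(5) by blast
  obtain a b u w e where ab: "a \<noteq> 0" "b \<noteq> 0" "pt = (proj_pt a, proj_pt b)"
    and uw: "\<not> (u \<in> fs.span {a} \<and> w \<in> fs.span {b})"
    and Wchar: "\<And>F s t. F \<in> biforms s t \<Longrightarrow> F \<in> W \<longleftrightarrow> bval F a b = 0 \<and> bdiff F a b u w = 0"
    and p: "\<And>x. p x = tangent_tensor d1 d2 a b u w x + e * power_tensor d1 d2 a b x"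
    by (rule tangent_normal_form[OF assms(4) nX assms(8,6,7)]) (rule that)
  have W: "closed_subscheme W" using assms(6) by (simp add: zero_dim_scheme_def)
  have red: "reduced_point (image_ideal1 W) \<longleftrightarrow> u \<in> fs.span {a}"
      "reduced_point (image_ideal2 W) \<longleftrightarrow> w \<in> fs.span {b}"
    by (rule reduced_image1[OF ab(1,2) W], rule Wchar, assumption)
      (rule reduced_image2[OF ab(1,2) W], rule Wchar, assumption)
  have dep: "dependence_set W = {i. i = 1 \<and> u \<notin> fs.span {a} \<or> i = 2 \<and> w \<notin> fs.span {b}}"
    unfolding dependence_set_def red ..
  have mem: "1 \<in> dependence_set W \<longleftrightarrow> u \<notin> fs.span {a}" "2 \<in> dependence_set W \<longleftrightarrow> w \<notin> fs.span {b}"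
    unfolding dep by simp_all
  have dep12: "u \<notin> fs.span {a}" "w \<notin> fs.span {b}" if "dependence_set W = {1, 2}"
    using mem unfolding that by simp_all
  have dep1: "u \<notin> fs.span {a}" "w \<in> fs.span {b}" if "dependence_set W = {1}"
    using mem unfolding that by simp_all
  have dep2: "u \<in> fs.span {a}" "w \<notin> fs.span {b}" if "dependence_set W = {2}"
    using mem unfolding that by simp_all
  show ?thesis
    unfolding ab(3)
  proof (intro conjI impI)
    assume "dependence_set W = {1, 2}"
    note conic = conic_case[OF assms(1,2) ab(1,2) dep12[OF this] W _ p]
    show "\<forall>S\<in>\<S> d1 d2 p. (proj_pt a, proj_pt b) \<notin> S \<and>
        (\<exists>G. curve_bidegree G 1 1 \<and> scheme_in W G \<and> S \<subseteq> G) \<and>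
        (\<forall>G. curve_bidegree G 1 1 \<and> scheme_in W G \<and> S \<subseteq> G \<and> \<not> smooth_curve G \<longrightarrow>
          (\<exists>L R. beta_line L \<and> alpha_line R \<and> G = L \<union> R \<and> L \<inter> R = {(proj_pt a, proj_pt b)} \<and>
            card (S \<inter> L) = d2 \<and> card (S \<inter> R) = d1))"
      by (rule ballI, rule conic(1), rule Wchar, assumption+)
    show "\<forall>G. curve_bidegree G 1 1 \<and> scheme_in W G \<longrightarrow> computes_rank d1 d2 p G"
      by (intro allI impI, elim conjE, rule conic(2), rule Wchar, assumption+)
  next
    assume "dependence_set W = {1}"
    note line = line_case1[OF assms(1,2) ab(1,2) dep1[OF this] W _ p]
    show "\<exists>!G. alpha_line G \<and> scheme_in W G" by (rule line(1), rule Wchar, assumption)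
    show "\<forall>G. alpha_line G \<and> scheme_in W G \<longrightarrow>
        (\<forall>S\<in>\<S> d1 d2 p. (proj_pt a, proj_pt b) \<notin> S \<and> S \<subseteq> G) \<and> computes_rank d1 d2 p G"
      by (intro allI impI, elim conjE, rule line(2), rule Wchar, assumption+)
  next
    assume "dependence_set W = {2}"
    note line = line_case2[OF assms(1,2) ab(1,2) dep2[OF this] W _ p]
    show "\<exists>!G. beta_line G \<and> scheme_in W G" by (rule line(1), rule Wchar, assumption)
    show "\<forall>G. beta_line G \<and> scheme_in W G \<longrightarrow>
        (\<forall>S\<in>\<S> d1 d2 p. (proj_pt a, proj_pt b) \<notin> S \<and> S \<subseteq> G) \<and> computes_rank d1 d2 p G"
      by (intro allI impI, elim conjE, rule line(2), rule Wchar, assumption+)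
  qed
qed

end
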